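(* Let $n\in\mathbb{N}\cup\{\infty\}$, $m\ge0$, and let $f\colon(L,\ell)\to(L',\ell')$ be a strict $L_\infty$-epimorphism between Lie $n$-algebras. Then there exist morphisms in $\mathsf{Lie}_n\mathsf{Alg}$ $$r\colon(\tau_{<m+1}L,\tau_{<m+1}\ell)\to(\ker q_{<m+1},\ell^{\ker}),\qquad r'\colon(\tau_{<m+1}L',\tau_{<m+1}\ell')\to(\ker q'_{<m+1},\ell'^{\ker})$$ inducing $L_\infty$-isomorphisms $$(q_{<m+1},r)\colon(\tau_{<m+1}L,\tau_{<m+1}\ell)\xrightarrow{\cong}(\tau_{\le m}L\oplus\ker q_{<m+1},\ \tau_{\le m}\ell\oplus\ell^{\ker}),$$ $$(q'_{<m+1},r')\colon(\tau_{<m+1}L',\tau_{<m+1}\ell')\xrightarrow{\cong}(\tau_{\le m}L'\oplus\ker q'_{<m+1},\ \tau_{\le m}\ell'\oplus\ell'^{\ker})$$ such that the following diagram commutes in $\mathsf{Lie}_n\mathsf{Alg}$: $$\begin{array}{ccc}\tau_{<m+1}L&\xrightarrow{\ (q_{<m+1},r)\ }&\tau_{\le m}L\oplus\ker q_{<m+1}\\ {\scriptstyle\tau_{<m+1}f}\downarrow&&\downarrow{\scriptstyle\tau_{\le m}f\,\oplus\,\tau_{<m+1}f|_{\ker}}\\ \tau_{<m+1}L'&\xrightarrow{\ (q'_{<m+1},r')\ }&\tau_{\le m}L'\oplus\ker q'_{<m+1}\end{array}$$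
   Context: Conventions: $\Bbbk$ is a field of characteristic zero and gradings are homological. For a $\mathbb{Z}$-graded vector space $V$, $\mathbf{s}V$ denotes the suspension, $(\mathbf{s}V)_i = V_{i-1}$, and $\bar S(V)=\bigoplus_{k\ge 1}S^k(V)$ is the reduced symmetric coalgebra, with $\bar\Delta(v_1\vee\cdots\vee v_m)=\sum_{p=1}^{m-1}\sum_{\sigma}\epsilon(\sigma)(v_{\sigma(1)}\vee\cdots\vee v_{\sigma(p)})\otimes(v_{\sigma(p+1)}\vee\cdots\vee v_{\sigma(m)})$, the inner sum over $(p,m-p)$-shuffles and $\epsilon(\sigma)$ the Koszul sign. Coderivations of, and coalgebra morphisms between, such coalgebras are uniquely determined by their components $\bar S(V)\to V$, resp. $\bar S(V)\to V'$. An $L_\infty$-algebra $(L,\ell)$ is a $\mathbb{Z}$-graded vector space $L$ with graded skew-symmetric maps $\ell_k\colon \Lambda^kL\to L$ of degree $k-2$ ($k\ge 1$) such that the degree $-1$ coderivation $\delta$ of $\bar S(\mathbf{s}L)$ with components $\delta^1_k=(-1)^{k(k-1)/2}\,\mathbf{s}\circ\ell_k\circ(\mathbf{s}^{-1})^{\otimes k}$ satisfies $\delta^2=0$. A (weak) $L_\infty$-morphism $f\colon(L,\ell)\to(L',\ell')$ is a collection of graded skew-symmetric maps $f_k\colon\Lambda^kL\to L'$ of degree $k-1$ ($k\ge1$) such that the coalgebra morphism $F\colon\bar S(\mathbf{s}L)\to\bar S(\mathbf{s}L')$ with components $F^1_k=(-1)^{k(k-1)/2}\,\mathbf{s}\circ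 f_k\circ(\mathbf{s}^{-1})^{\otimes k}$ satisfies $F\delta=\delta'F$. Composition is composition of coalgebra morphisms; $f_1$ is always a chain map $(L,\ell_1)\to(L',\ell'_1)$. $f$ is strict if $f_k=0$ for $k\ge2$; an $L_\infty$-isomorphism if $f_1$ is an isomorphism; an $L_\infty$-epimorphism if $f_1$ is surjective in every degree. A Lie $n$-algebra is an $L_\infty$-algebra concentrated in degrees $0,1,\dots,n-1$ (in all degrees $\geq 0$ if $n=\infty$); $\mathsf{Lie}_n\mathsf{Alg}$ is the category of Lie $n$-algebras and weak $L_\infty$-morphisms. It is abelian if $\ell_k=0$ for $k\ge2$, i.e. it is just a chain complex. The categorical product of $(L,\ell)$ and $(L',\ell')$ is $(L\oplus L',\ell\oplus\ell')$ with componentwise brackets; $(q,r)$ denotes the morphism into the product induced by $q$ and $r$. Truncations: write $d=\ell_1$, $d_m\colon L_m\to L_{m-1}$. $\tau_{\le m}L$ is the complex with $L_i$ for $i<m$, $\mathrm{coker}(d_{m+1})$ in degree $m$, $0$ above, with top differential induced by $d_m$. $\tau_{<m}L$ is the complex with $L_i$ for $i<m$, $\mathrm{im}(d_m)$ in degree $m$, $0$ above, with top differential the inclusion $\mathrm{im}(d_m)\hookrightarrow L_{m-1}$. The surjective chain maps $p_{\le m}\colon L\to\tau_{\le m}L$ and $p_{<m}\colon L\to\tau_{<m}L$ are the identity in degrees $<m$, zero in degrees $>m$, and in degree $m$ are the quotient map, resp. $d_m$. The brackets $\tau_{\le m}\ell_k(p_{\le m}x_1,\dots,p_{\le m}x_k)=p_{\le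 m}\ell_k(x_1,\dots,x_k)$ and $\tau_{<m}\ell_k(p_{<m}x_1,\dots,p_{<m}x_k)=p_{<m}\ell_k(x_1,\dots,x_k)$ are well defined and make these Lie $n$-algebras; a morphism $\phi\colon(L,\ell)\to(L',\ell')$ induces $\tau_{\le m}\phi$, $\tau_{<m}\phi$ by $\tau_{\le m}\phi_k(p_{\le m}x_1,\dots)=p'_{\le m}\phi_k(x_1,\dots)$ and likewise for $\tau_{<m}$. The map $q_{<m+1}\colon\tau_{<m+1}L\to\tau_{\le m}L$ is the identity in degrees $<m$, the projection $L_m\to\mathrm{coker}(d_{m+1})$ in degree $m$, and zero in degree $m+1$; it is a strict $L_\infty$-morphism, surjective and a quasi-isomorphism. $\ker q_{<m+1}$ is its kernel, regarded as an abelian Lie $n$-algebra with the restricted differential $\ell^{\ker}$; it is concentrated in degrees $m,m+1$, being a copy of $\mathrm{im}(d_{m+1})$ in each. Primed symbols denote the same constructions for $L'$. Since $\tau_{<m+1}f$ and $\tau_{\le m}f$ are strict and compatible with $q_{<m+1},q'_{<m+1}$, $\tau_{<m+1}f$ restricts to $\tau_{<m+1}f|_{\ker}\colon\ker q_{<m+1}\to\ker q'_{<m+1}$. *)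

theory Defs
  imports
    "HOL-Library.Poly_Mapping"
    "HOL-Library.Extended_Nat"
    "HOL-Algebra.AbelCoset"
    "HOL-Algebra.Module"
    "HOL-Decision_Procs.Algebra_Aux"
begin

section \<open>Graded vector spaces\<close>

text \<open>
  The ground field is a type \<open>'k\<close> of class \<^class>\<open>field_char_0\<close>, turned into a ring record by
  \<^const>\<open>cring_class_ops\<close>.  A graded vector space is a family of vector spaces \<open>V i\<close>; the fields
  \<^const>\<open>mult\<close> and \<^const>\<open>one\<close> of the module records are never used.  A word is a list of homogeneous
  elements, each letter \<open>(i, x)\<close> carrying its degree \<open>i\<close>, with \<open>x\<close> in \<open>V i\<close>.
\<close>

type_synonym ('k, 'v) gspace = "int \<Rightarrow> ('k, 'v) module"
type_synonym 'v word = "(int \<times> 'v) list"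

definition graded_space :: "('k::field_char_0, 'v) gspace \<Rightarrow> bool" where
  "graded_space V \<longleftrightarrow> (\<forall>i. Module.module (cring_class_ops :: 'k ring) (V i))"

definition susp :: "('k, 'v) gspace \<Rightarrow> ('k, 'v) gspace" where
  "susp V = (\<lambda>i. V (i - 1))"

definition words :: "('k, 'v) gspace \<Rightarrow> 'v word set" where
  "words V = {w. w \<noteq> [] \<and> (\<forall>(i, x) \<in> set w. x \<in> carrier (V i))}"

definition wdeg :: "'v word \<Rightarrow> int" where
  "wdeg w = sum_list (map fst w)"

text \<open>The sign \<open>(-1)^(i j)\<close>.\<close>

definition ksgn :: "int \<Rightarrow> int \<Rightarrow> 'k::field_char_0" where
  "ksgn i j = (if odd i \<and> odd j then - 1 else 1)"

text \<open>
  A family of maps \<open>f\<^sub>k\<close>, \<open>k \<ge> 1\<close>, is one function on words, \<open>f\<^sub>k\<close> being its restriction to words of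
  length \<open>k\<close>; \<open>e k\<close> is the degree of \<open>f\<^sub>k\<close>.  Adjacent transpositions generate the symmetric groups,
  so they suffice for graded skew-symmetry.
\<close>

definition skew_maps ::
    "('k::field_char_0, 'v) gspace \<Rightarrow> ('k, 'w) gspace \<Rightarrow> (nat \<Rightarrow> int) \<Rightarrow> ('v word \<Rightarrow> 'w) \<Rightarrow> bool" where
  "skew_maps V V' e f \<longleftrightarrow>
     (\<forall>w \<in> words V. f w \<in> carrier (V' (wdeg w + e (length w)))) \<and>
     (\<forall>u v i x y. u @ (i, x) # v \<in> words V \<and> y \<in> carrier (V i) \<longrightarrow>
        (let M = V' (wdeg (u @ (i, x) # v) + e (length (u @ (i, x) # v))) in
           f (u @ (i, x \<oplus>\<^bsub>V i\<^esub> y) # v) = f (u @ (i, x) # v) \<oplus>\<^bsub>M\<^esub> f (u @ (i, y) # v))) \<and>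
     (\<forall>u v i x c. u @ (i, x) # v \<in> words V \<longrightarrow>
        (let M = V' (wdeg (u @ (i, x) # v) + e (length (u @ (i, x) # v))) in
           f (u @ (i, c \<odot>\<^bsub>V i\<^esub> x) # v) = c \<odot>\<^bsub>M\<^esub> f (u @ (i, x) # v))) \<and>
     (\<forall>u v i x j y. u @ (i, x) # (j, y) # v \<in> words V \<longrightarrow>
        (let M = V' (wdeg (u @ (i, x) # (j, y) # v) + e (length (u @ (i, x) # (j, y) # v))) in
           f (u @ (i, x) # (j, y) # v) = (- ksgn i j) \<odot>\<^bsub>M\<^esub> f (u @ (j, y) # (i, x) # v)))"


section \<open>Free vector spaces\<close>

definition fscale :: "'k::field \<Rightarrow> ('a \<Rightarrow>\<^sub>0 'k) \<Rightarrow> ('a \<Rightarrow>\<^sub>0 'k)" where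
  "fscale c p = Poly_Mapping.map ((*) c) p"

lemma lookup_fscale [simp]: "Poly_Mapping.lookup (fscale c p) a = c * Poly_Mapping.lookup p a"
  by (simp add: fscale_def Poly_Mapping.map.rep_eq when_def)

interpretation free: vector_space "fscale :: 'k::field \<Rightarrow> ('a \<Rightarrow>\<^sub>0 'k) \<Rightarrow> ('a \<Rightarrow>\<^sub>0 'k)"
  by unfold_locales (auto intro!: poly_mapping_eqI simp: lookup_add algebra_simps)

abbreviation gen :: "'a \<Rightarrow> ('a \<Rightarrow>\<^sub>0 'k::field)" where
  "gen a \<equiv> Poly_Mapping.single a 1"

definition lin_ext :: "('a \<Rightarrow> ('b \<Rightarrow>\<^sub>0 'k)) \<Rightarrow> ('a \<Rightarrow>\<^sub>0 'k::field) \<Rightarrow> ('b \<Rightarrow>\<^sub>0 'k)" where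
  "lin_ext g p = (\<Sum>a \<in> Poly_Mapping.keys p. fscale (Poly_Mapping.lookup p a) (g a))"

definition tens :: "('a \<Rightarrow>\<^sub>0 'k::field) \<Rightarrow> ('b \<Rightarrow>\<^sub>0 'k) \<Rightarrow> ('a \<times> 'b \<Rightarrow>\<^sub>0 'k)" where
  "tens p q = (\<Sum>a \<in> Poly_Mapping.keys p. \<Sum>b \<in> Poly_Mapping.keys q.
      Poly_Mapping.single (a, b) (Poly_Mapping.lookup p a * Poly_Mapping.lookup q b))"


section \<open>The reduced symmetric coalgebra\<close>

text \<open>
  The reduced symmetric coalgebra of \<open>V\<close> is the quotient of \<open>sym_free V\<close>, the span of the nonempty
  words in \<open>V\<close>, by \<open>sym_rel V\<close>: the word \<open>[(i\<^sub>1, v\<^sub>1), \<dots>, (i\<^sub>m, v\<^sub>m)]\<close> represents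
  \<open>v\<^sub>1 \<or> \<dots> \<or> v\<^sub>m\<close>.  Its tensor square is the quotient of the span of the pairs of words by
  \<open>tens_rel V\<close>.  Elements of the quotients are given by representatives, equality is congruence
  modulo the relations, and a linear map between quotients is given by a linear map of
  representatives which preserves the relations (over a field every linear map has such a lift).
\<close>

definition sym_free :: "('k::field_char_0, 'v) gspace \<Rightarrow> ('v word \<Rightarrow>\<^sub>0 'k) set" where
  "sym_free V = free.span (gen ` words V)"

definition sym_rel :: "('k::field_char_0, 'v) gspace \<Rightarrow> ('v word \<Rightarrow>\<^sub>0 'k) set" where
  "sym_rel V = free.span (
     {gen (u @ (i, x \<oplus>\<^bsub>V i\<^esub> y) # v) - gen (u @ (i, x) # v) - gen (u @ (i, y) # v) | u v i x y.
        u @ (i, x) # v \<in> words V \<and> y \<in> carrier (V i)} \<union>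
     {gen (u @ (i, c \<odot>\<^bsub>V i\<^esub> x) # v) - fscale c (gen (u @ (i, x) # v)) | u v i x c.
        u @ (i, x) # v \<in> words V} \<union>
     {gen (u @ (i, x) # (j, y) # v) - fscale (ksgn i j) (gen (u @ (j, y) # (i, x) # v)) | u v i x j y.
        u @ (i, x) # (j, y) # v \<in> words V})"

definition tens_rel :: "('k::field_char_0, 'v) gspace \<Rightarrow> ('v word \<times> 'v word \<Rightarrow>\<^sub>0 'k) set" where
  "tens_rel V = free.span ({tens p (gen w) | p w. p \<in> sym_rel V \<and> w \<in> words V} \<union>
                           {tens (gen w) p | p w. p \<in> sym_rel V \<and> w \<in> words V})"

text \<open>
  A \<open>(p, m - p)\<close>-shuffle \<open>\<sigma>\<close> is determined by the set \<open>A = {\<sigma>(1), \<dots>, \<sigma>(p)}\<close> of positions (counted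
  from 0 here), an arbitrary set of cardinality \<open>p\<close>.  Its Koszul sign collects \<open>(-1)^(|v\<^sub>i| |v\<^sub>j|)\<close>
  over the inversions of \<open>\<sigma>\<close>, i.e. over \<open>j < i\<close> with \<open>i \<in> A\<close> and \<open>j \<notin> A\<close>.
\<close>

definition shuffle_sgn :: "'v word \<Rightarrow> nat set \<Rightarrow> 'k::field_char_0" where
  "shuffle_sgn w A = (\<Prod>i\<in>A. \<Prod>j\<in>{..<i} - A. ksgn (fst (w ! i)) (fst (w ! j)))"

definition coprod :: "('v word \<Rightarrow>\<^sub>0 'k::field_char_0) \<Rightarrow> ('v word \<times> 'v word \<Rightarrow>\<^sub>0 'k)" where
  "coprod = lin_ext (\<lambda>w. \<Sum>p = 1..<length w. \<Sum>A | A \<subseteq> {..<length w} \<and> card A = p.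
      fscale (shuffle_sgn w A) (gen (nths w A, nths w (- A))))"

text \<open>The projection onto the summand of words of length one.\<close>

definition proj_one :: "('v word \<Rightarrow>\<^sub>0 'k::field_char_0) \<Rightarrow> ('v word \<Rightarrow>\<^sub>0 'k)" where
  "proj_one = lin_ext (\<lambda>w. if length w = 1 then gen w else 0)"

definition sym_map ::
    "('k::field_char_0, 'v) gspace \<Rightarrow> ('k, 'w) gspace \<Rightarrow> int \<Rightarrow>
     (('v word \<Rightarrow>\<^sub>0 'k) \<Rightarrow> ('w word \<Rightarrow>\<^sub>0 'k)) \<Rightarrow> bool" where
  "sym_map V V' e D \<longleftrightarrow>
     Vector_Spaces.linear fscale fscale D \<and>
     (\<forall>w \<in> words V. D (gen w) \<in> free.span (gen ` {u \<in> words V'. wdeg u = wdeg w + e})) \<and>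
     D ` sym_rel V \<subseteq> sym_rel V'"

text \<open>\<open>tens_map e f g\<close> is the tensor product of \<open>f\<close> and \<open>g\<close>, where \<open>g\<close> has degree \<open>e\<close>.\<close>

definition tens_map ::
    "int \<Rightarrow> (('v word \<Rightarrow>\<^sub>0 'k) \<Rightarrow> ('w word \<Rightarrow>\<^sub>0 'k)) \<Rightarrow> (('v word \<Rightarrow>\<^sub>0 'k) \<Rightarrow> ('w word \<Rightarrow>\<^sub>0 'k)) \<Rightarrow>
     ('v word \<times> 'v word \<Rightarrow>\<^sub>0 'k::field_char_0) \<Rightarrow> ('w word \<times> 'w word \<Rightarrow>\<^sub>0 'k)" where
  "tens_map e f g = lin_ext (\<lambda>(u, v). fscale (ksgn e (wdeg u)) (tens (f (gen u)) (g (gen v))))"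

definition coderivation ::
    "('k::field_char_0, 'v) gspace \<Rightarrow> int \<Rightarrow> (('v word \<Rightarrow>\<^sub>0 'k) \<Rightarrow> ('v word \<Rightarrow>\<^sub>0 'k)) \<Rightarrow> bool" where
  "coderivation V e D \<longleftrightarrow> sym_map V V e D \<and>
     (\<forall>p \<in> sym_free V.
        coprod (D p) - (tens_map 0 D id (coprod p) + tens_map e id D (coprod p)) \<in> tens_rel V)"

definition coalgebra_map ::
    "('k::field_char_0, 'v) gspace \<Rightarrow> ('k, 'w) gspace \<Rightarrow>
     (('v word \<Rightarrow>\<^sub>0 'k) \<Rightarrow> ('w word \<Rightarrow>\<^sub>0 'k)) \<Rightarrow> bool" where
  "coalgebra_map V V' F \<longleftrightarrow> sym_map V V' 0 F \<and>
     (\<forall>p \<in> sym_free V. coprod (F p) - tens_map 0 F F (coprod p) \<in> tens_rel V')"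


section \<open>L-infinity algebras and morphisms\<close>

definition desusp :: "'v word \<Rightarrow> 'v word" where
  "desusp w = map (\<lambda>(i, x). (i - 1, x)) w"

text \<open>
  The sign in \<open>(-1)^(k(k-1)/2) f\<^sub>k \<circ> (s\<^sup>-\<^sup>1)\<^sup>\<otimes>\<^sup>k\<close>.  By the Koszul rule, applying the tensor power
  of the degree \<open>-1\<close> map \<open>s\<^sup>-\<^sup>1\<close> to \<open>v\<^sub>1 \<otimes> \<dots> \<otimes> v\<^sub>k\<close> (degrees in the suspension) produces
  \<open>(-1)^(\<Sum>\<^sub>j (k - j) |v\<^sub>j|)\<close>; positions are counted from 0 below.
\<close>

definition desusp_sgn :: "'v word \<Rightarrow> 'k::field_char_0" where
  "desusp_sgn w =
     (if even (int (length w * (length w - 1) div 2)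
               + (\<Sum>j<length w. int (length w - 1 - j) * fst (w ! j)))
      then 1 else - 1)"

text \<open>
  \<open>D\<close>, a map between the symmetric coalgebras of the suspensions, has components
  \<open>(-1)^(k(k-1)/2) s \<circ> f\<^sub>k \<circ> (s\<^sup>-\<^sup>1)\<^sup>\<otimes>\<^sup>k\<close>, where \<open>f\<^sub>k\<close> has degree \<open>e k\<close>.
\<close>

definition has_components ::
    "('k::field_char_0, 'v) gspace \<Rightarrow> ('k, 'w) gspace \<Rightarrow> (nat \<Rightarrow> int) \<Rightarrow> ('v word \<Rightarrow> 'w) \<Rightarrow>
     (('v word \<Rightarrow>\<^sub>0 'k) \<Rightarrow> ('w word \<Rightarrow>\<^sub>0 'k)) \<Rightarrow> bool" where
  "has_components V V' e f D \<longleftrightarrow>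
     (\<forall>w \<in> words (susp V).
        let i = wdeg (desusp w) + e (length w) in
        proj_one (D (gen w)) - gen [(i + 1, desusp_sgn w \<odot>\<^bsub>V' i\<^esub> f (desusp w))]
          \<in> sym_rel (susp V'))"

abbreviation bracket_deg :: "nat \<Rightarrow> int" where
  "bracket_deg k \<equiv> int k - 2"

abbreviation morphism_deg :: "nat \<Rightarrow> int" where
  "morphism_deg k \<equiv> int k - 1"

record ('k, 'v) linf =
  space :: "('k, 'v) gspace"
  bracket :: "'v word \<Rightarrow> 'v"

definition linf_codiff ::
    "('k::field_char_0, 'v) linf \<Rightarrow> (('v word \<Rightarrow>\<^sub>0 'k) \<Rightarrow> ('v word \<Rightarrow>\<^sub>0 'k)) \<Rightarrow> bool" where
  "linf_codiff L D \<longleftrightarrow> coderivation (susp (space L)) (- 1) D \<and>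
     has_components (space L) (space L) bracket_deg (bracket L) D"

definition linf_algebra :: "('k::field_char_0, 'v) linf \<Rightarrow> bool" where
  "linf_algebra L \<longleftrightarrow> graded_space (space L) \<and>
     skew_maps (space L) (space L) bracket_deg (bracket L) \<and>
     (\<exists>D. linf_codiff L D \<and>
          (\<forall>p \<in> sym_free (susp (space L)). D (D p) \<in> sym_rel (susp (space L))))"

definition linf_coalgebra_map ::
    "('k::field_char_0, 'v) linf \<Rightarrow> ('k, 'w) linf \<Rightarrow> ('v word \<Rightarrow> 'w) \<Rightarrow>
     (('v word \<Rightarrow>\<^sub>0 'k) \<Rightarrow> ('w word \<Rightarrow>\<^sub>0 'k)) \<Rightarrow> bool" where
  "linf_coalgebra_map L L' f F \<longleftrightarrow> coalgebra_map (susp (space L)) (susp (space L')) F \<and>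
     has_components (space L) (space L') morphism_deg f F"

definition linf_morphism ::
    "('k::field_char_0, 'v) linf \<Rightarrow> ('k, 'w) linf \<Rightarrow> ('v word \<Rightarrow> 'w) \<Rightarrow> bool" where
  "linf_morphism L L' f \<longleftrightarrow> linf_algebra L \<and> linf_algebra L' \<and>
     skew_maps (space L) (space L') morphism_deg f \<and>
     (\<exists>F D D'. linf_coalgebra_map L L' f F \<and> linf_codiff L D \<and> linf_codiff L' D' \<and>
        (\<forall>p \<in> sym_free (susp (space L)). F (D p) - D' (F p) \<in> sym_rel (susp (space L'))))"

definition linf_strict :: "('k, 'v) linf \<Rightarrow> ('k, 'w) linf \<Rightarrow> ('v word \<Rightarrow> 'w) \<Rightarrow> bool" where
  "linf_strict L L' f \<longleftrightarrow>
     (\<forall>w \<in> words (space L). length w \<ge> 2 \<longrightarrow>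
        f w = \<zero>\<^bsub>space L' (wdeg w + morphism_deg (length w))\<^esub>)"

definition linf_epi :: "('k::field_char_0, 'v) linf \<Rightarrow> ('k, 'w) linf \<Rightarrow> ('v word \<Rightarrow> 'w) \<Rightarrow> bool" where
  "linf_epi L L' f \<longleftrightarrow> linf_morphism L L' f \<and>
     (\<forall>i. (\<lambda>x. f [(i, x)]) ` carrier (space L i) = carrier (space L' i))"

definition linf_iso :: "('k::field_char_0, 'v) linf \<Rightarrow> ('k, 'w) linf \<Rightarrow> ('v word \<Rightarrow> 'w) \<Rightarrow> bool" where
  "linf_iso L L' f \<longleftrightarrow> linf_morphism L L' f \<and>
     (\<forall>i. bij_betw (\<lambda>x. f [(i, x)]) (carrier (space L i)) (carrier (space L' i)))"

definition lie_n_algebra :: "enat \<Rightarrow> ('k::field_char_0, 'v) linf \<Rightarrow> bool" where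
  "lie_n_algebra n L \<longleftrightarrow> linf_algebra L \<and>
     (\<forall>i. i < 0 \<or> n \<le> enat (nat i) \<longrightarrow> carrier (space L i) = {\<zero>\<^bsub>space L i\<^esub>})"

definition lie_n_morphism ::
    "enat \<Rightarrow> ('k::field_char_0, 'v) linf \<Rightarrow> ('k, 'w) linf \<Rightarrow> ('v word \<Rightarrow> 'w) \<Rightarrow> bool" where
  "lie_n_morphism n L L' f \<longleftrightarrow> lie_n_algebra n L \<and> lie_n_algebra n L' \<and> linf_morphism L L' f"

text \<open>
  Commutativity, in the category of Lie n-algebras, of the square with top \<open>t : A \<rightarrow> B\<close>, left
  \<open>l : A \<rightarrow> C\<close>, right \<open>r : B \<rightarrow> D\<close> and bottom \<open>b : C \<rightarrow> D\<close>.
\<close>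

definition lie_n_square ::
    "enat \<Rightarrow> ('k::field_char_0, 'a) linf \<Rightarrow> ('k, 'b) linf \<Rightarrow> ('k, 'c) linf \<Rightarrow> ('k, 'd) linf \<Rightarrow>
     ('a word \<Rightarrow> 'b) \<Rightarrow> ('a word \<Rightarrow> 'c) \<Rightarrow> ('b word \<Rightarrow> 'd) \<Rightarrow> ('c word \<Rightarrow> 'd) \<Rightarrow> bool" where
  "lie_n_square n A B C D t l r b \<longleftrightarrow>
     lie_n_morphism n A B t \<and> lie_n_morphism n A C l \<and>
     lie_n_morphism n B D r \<and> lie_n_morphism n C D b \<and>
     (\<exists>T U R S. linf_coalgebra_map A B t T \<and> linf_coalgebra_map A C l U \<and>
        linf_coalgebra_map B D r R \<and> linf_coalgebra_map C D b S \<and>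
        (\<forall>p \<in> sym_free (susp (space A)). R (T p) - S (U p) \<in> sym_rel (susp (space D))))"


section \<open>Strict maps and products\<close>

definition strict_of :: "('k, 'w) linf \<Rightarrow> (int \<Rightarrow> 'v \<Rightarrow> 'w) \<Rightarrow> 'v word \<Rightarrow> 'w" where
  "strict_of L' g w =
     (if length w = 1 then g (fst (hd w)) (snd (hd w))
      else \<zero>\<^bsub>space L' (wdeg w + morphism_deg (length w))\<^esub>)"

definition module_prod :: "('k, 'v) module \<Rightarrow> ('k, 'w) module \<Rightarrow> ('k, 'v \<times> 'w) module" where
  "module_prod M N =
     \<lparr>carrier = carrier M \<times> carrier N, mult = undefined, one = undefined,
      zero = (\<zero>\<^bsub>M\<^esub>, \<zero>\<^bsub>N\<^esub>),
      add = (\<lambda>(x, y) (x', y'). (x \<oplus>\<^bsub>M\<^esub> x', y \<oplus>\<^bsub>N\<^esub> y')),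
      smult = (\<lambda>c (x, y). (c \<odot>\<^bsub>M\<^esub> x, c \<odot>\<^bsub>N\<^esub> y))\<rparr>"

definition mor_sum :: "('a word \<Rightarrow> 'c) \<Rightarrow> ('b word \<Rightarrow> 'd) \<Rightarrow> ('a \<times> 'b) word \<Rightarrow> 'c \<times> 'd" where
  "mor_sum f g w = (f (map (\<lambda>(i, x, y). (i, x)) w), g (map (\<lambda>(i, x, y). (i, y)) w))"

definition mor_pair :: "('a word \<Rightarrow> 'b) \<Rightarrow> ('a word \<Rightarrow> 'c) \<Rightarrow> 'a word \<Rightarrow> 'b \<times> 'c" where
  "mor_pair f g w = (f w, g w)"

definition linf_prod :: "('k, 'v) linf \<Rightarrow> ('k, 'w) linf \<Rightarrow> ('k, 'v \<times> 'w) linf" where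
  "linf_prod L L' =
     \<lparr>space = (\<lambda>i. module_prod (space L i) (space L' i)),
      bracket = mor_sum (bracket L) (bracket L')\<rparr>"


section \<open>Truncations\<close>

definition boundaries :: "('k, 'v) linf \<Rightarrow> int \<Rightarrow> 'v set" where
  "boundaries L i = (\<lambda>x. bracket L [(i + 1, x)]) ` carrier (space L (i + 1))"

definition module_quot :: "('k, 'v) module \<Rightarrow> 'v set \<Rightarrow> ('k, 'v set) module" where
  "module_quot M B =
     \<lparr>carrier = a_rcosets\<^bsub>M\<^esub> B, mult = undefined, one = undefined, zero = B,
      add = set_add M,
      smult = (\<lambda>c X. B <+>\<^bsub>M\<^esub> ((\<lambda>x. c \<odot>\<^bsub>M\<^esub> x) ` X))\<rparr>"

text \<open>
  The family of maps induced by \<open>f\<close> along the degreewise surjection \<open>p\<close> from \<open>V\<close> on the sources and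
  \<open>p'\<close> on the target: \<open>f'\<^sub>k (p x\<^sub>1, \<dots>, p x\<^sub>k) = p' (f\<^sub>k (x\<^sub>1, \<dots>, x\<^sub>k))\<close>, evaluated on chosen
  preimages.
\<close>

definition induced ::
    "('k, 'v) gspace \<Rightarrow> (int \<Rightarrow> 'v \<Rightarrow> 'a) \<Rightarrow> (int \<Rightarrow> 'w \<Rightarrow> 'b) \<Rightarrow> (nat \<Rightarrow> int) \<Rightarrow>
     ('v word \<Rightarrow> 'w) \<Rightarrow> 'a word \<Rightarrow> 'b" where
  "induced V p p' e f w =
     p' (wdeg w + e (length w)) (f (map (\<lambda>(i, y). (i, inv_into (carrier (V i)) (p i) y)) w))"

text \<open>
  To have all degrees in one type of cosets, \<open>\<tau>\<^sub>\<le>\<^sub>m L\<close> is written in degree \<open>i\<close> as the quotient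
  of \<open>L\<^sub>i\<close> by \<open>0\<close> if \<open>i < m\<close>, by the image of \<open>d\<close> if \<open>i = m\<close>, and by \<open>L\<^sub>i\<close> if \<open>i > m\<close>.
\<close>

definition tau_le_sub :: "int \<Rightarrow> ('k, 'v) linf \<Rightarrow> int \<Rightarrow> 'v set" where
  "tau_le_sub m L i =
     (if i < m then {\<zero>\<^bsub>space L i\<^esub>} else if i = m then boundaries L m else carrier (space L i))"

definition p_le :: "int \<Rightarrow> ('k, 'v) linf \<Rightarrow> int \<Rightarrow> 'v \<Rightarrow> 'v set" where
  "p_le m L i x = tau_le_sub m L i +>\<^bsub>space L i\<^esub> x"

definition tau_le :: "int \<Rightarrow> ('k, 'v) linf \<Rightarrow> ('k, 'v set) linf" where
  "tau_le m L =
     \<lparr>space = (\<lambda>i. module_quot (space L i) (tau_le_sub m L i)),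
      bracket = induced (space L) (p_le m L) (p_le m L) bracket_deg (bracket L)\<rparr>"

definition tau_le_map ::
    "int \<Rightarrow> ('k, 'v) linf \<Rightarrow> ('k, 'w) linf \<Rightarrow> ('v word \<Rightarrow> 'w) \<Rightarrow> 'v set word \<Rightarrow> 'w set" where
  "tau_le_map m L L' f = induced (space L) (p_le m L) (p_le m L') morphism_deg f"

definition p_lt :: "int \<Rightarrow> ('k, 'v) linf \<Rightarrow> int \<Rightarrow> 'v \<Rightarrow> 'v" where
  "p_lt m L i x =
     (if i < m then x else if i = m then bracket L [(m, x)] else \<zero>\<^bsub>space L i\<^esub>)"

text \<open>In degree \<open>m\<close> the vector space below is the subspace \<open>im d\<^sub>m\<close> of \<open>L\<^sub>m\<^sub>-\<^sub>1\<close>.\<close>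

definition tau_lt :: "int \<Rightarrow> ('k, 'v) linf \<Rightarrow> ('k, 'v) linf" where
  "tau_lt m L =
     \<lparr>space = (\<lambda>i. if i < m then space L i
                   else if i = m then (space L (m - 1))\<lparr>carrier := boundaries L (m - 1)\<rparr>
                   else (space L i)\<lparr>carrier := {\<zero>\<^bsub>space L i\<^esub>}\<rparr>),
      bracket = induced (space L) (p_lt m L) (p_lt m L) bracket_deg (bracket L)\<rparr>"

definition tau_lt_map ::
    "int \<Rightarrow> ('k, 'v) linf \<Rightarrow> ('k, 'w) linf \<Rightarrow> ('v word \<Rightarrow> 'w) \<Rightarrow> 'v word \<Rightarrow> 'w" where
  "tau_lt_map m L L' f = induced (space L) (p_lt m L) (p_lt m L') morphism_deg f"

text \<open>
  The linear part of \<open>q : \<tau>\<^bsub>< m+1\<^esub> L \<rightarrow> \<tau>\<^sub>\<le>\<^sub>m L\<close>.  In degrees \<open>\<le> m\<close> its source is \<open>L\<^sub>i\<close>, and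
  \<open>p_le\<close> is the identity \<open>L\<^sub>i = L\<^sub>i / 0\<close> for \<open>i < m\<close> and the projection to the cokernel for \<open>i = m\<close>.
\<close>

definition q_lin :: "int \<Rightarrow> ('k, 'v) linf \<Rightarrow> int \<Rightarrow> 'v \<Rightarrow> 'v set" where
  "q_lin m L i x = (if i \<le> m then p_le m L i x else \<zero>\<^bsub>space (tau_le m L) i\<^esub>)"

definition q_lt :: "int \<Rightarrow> ('k, 'v) linf \<Rightarrow> 'v word \<Rightarrow> 'v set" where
  "q_lt m L = strict_of (tau_le m L) (q_lin m L)"

definition ker_q :: "int \<Rightarrow> ('k, 'v) linf \<Rightarrow> ('k, 'v) linf" where
  "ker_q m L =
     (let T = tau_lt (m + 1) L in
      \<lparr>space = (\<lambda>i. (space T i)\<lparr>carrier :=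
                  {x \<in> carrier (space T i). q_lin m L i x = \<zero>\<^bsub>space (tau_le m L) i\<^esub>}\<rparr>),
       bracket = (\<lambda>w. if length w = 1 then bracket T w
                      else \<zero>\<^bsub>space T (wdeg w + bracket_deg (length w))\<^esub>)\<rparr>)"

end

(*
  On T = tau_{<m+1} L the kernel K of q is a copy of B = im d_{m+1} in degrees m and m + 1 with the
  identity as differential, so K is a cone and a morphism T -> K is determined by its part into degree m.
  Taking a linear retraction rho : L_m -> B in word length one and zero otherwise, the morphism
  equation forces the part into degree m + 1 to be rho applied to the bracket of T.  The pair (q, r) is
  bijective on linear parts because rho splits L_m, and the square commutes as soon as f rho = rho' f,
  which is achieved by choosing complements of B and f(B) compatibly with ker f.

  On the coalgebra side, coderivations and coalgebra maps are determined by their components because in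
  characteristic zero the kernel of the reduced coproduct is the cogenerators: multiplying the two
  factors of the coproduct of a word of length n gives 2^n - 2 times the word.
*)

theory Submission
  imports Defs
begin

section \<open>Linear maps out of free spaces, determined by their values on generators\<close>

section \<open>Linear maps on free vector spaces\<close>

text \<open>The definitions assert only that some lifts of codifferentials and coalgebra maps exist,
  each fixed up to \<open>sym_rel\<close>. Canonical lifts are therefore built from the components
  by unshuffle sums, and uniqueness reduces every condition to its projection onto single letters,
  an equation in one graded piece. This serves both to verify the definitions and to extract from
  the hypothesis on f that its linear part preserves all brackets.

  Although q and f are strict, r in general is not: a linear splitting of B in L_m need not respect
  the brackets, and the higher components of r record the failure. The morphism equation for r has
  content in two degrees of the kernel. Into degree m it is the forced formula; into degree m + 1 it
  is the generalised Jacobi identity of T followed by rho.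

  Surjectivity of f enters twice: in degree m + 1 it gives f(B) = B', and in degree m it makes B'
  and the image of a complement of B span L'_m. For an arbitrary complement that image may meet B'
  nontrivially, and then no rho' with f rho = rho' f exists.\<close>

interpretation free2: vector_space_pair
  "fscale :: 'k::field \<Rightarrow> ('a \<Rightarrow>\<^sub>0 'k) \<Rightarrow> ('a \<Rightarrow>\<^sub>0 'k)"
  "fscale :: 'k::field \<Rightarrow> ('b \<Rightarrow>\<^sub>0 'k) \<Rightarrow> ('b \<Rightarrow>\<^sub>0 'k)"
  by unfold_locales

abbreviation flin :: "(('a \<Rightarrow>\<^sub>0 'k::field) \<Rightarrow> ('b \<Rightarrow>\<^sub>0 'k)) \<Rightarrow> bool" where
  "flin \<equiv> Vector_Spaces.linear fscale fscale"

lemma flinI: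
  assumes "\<And>p q. h (p + q) = h p + h q" "\<And>c p. h (fscale c p) = fscale c (h p)"
  shows "flin h"
  using assms by (simp add: Vector_Spaces.linear_iff free.vector_space_axioms)

lemmas flin_simps = free2.linear_add free2.linear_scale free2.linear_diff free2.linear_0
  free2.linear_sum

text \<open>Over a common finite superset of the supports additivity becomes termwise; the support
  of a sum alone would be disturbed by cancellation.\<close>

lemma lin_ext_superset:
  assumes "finite S" "Poly_Mapping.keys p \<subseteq> S"
  shows "lin_ext g p = (\<Sum>a\<in>S. fscale (Poly_Mapping.lookup p a) (g a))"
  unfolding lin_ext_def
  by (rule sum.mono_neutral_left) (use assms in \<open>auto simp: in_keys_iff\<close>)

lemma flin_lin_ext [simp, intro]:
  fixes g :: "'a \<Rightarrow> ('b \<Rightarrow>\<^sub>0 'k::field)"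
  shows "flin (lin_ext g)"
proof (rule flinI)
  fix p q :: "'a \<Rightarrow>\<^sub>0 'k::field"
  define S where "S = Poly_Mapping.keys p \<union> Poly_Mapping.keys q"
  have S: "finite S" "Poly_Mapping.keys p \<subseteq> S" "Poly_Mapping.keys q \<subseteq> S"
      "Poly_Mapping.keys (p + q) \<subseteq> S"
    using Poly_Mapping.keys_add[of p q] by (auto simp: S_def)
  show "lin_ext g (p + q) = lin_ext g p + lin_ext g q"
    by (simp add: lin_ext_superset[OF S(1,2)] lin_ext_superset[OF S(1,3)]
        lin_ext_superset[OF S(1,4)] lookup_add free.scale_left_distrib sum.distrib)
next
  fix c and p :: "'a \<Rightarrow>\<^sub>0 'k"
  have "Poly_Mapping.keys (fscale c p) \<subseteq> Poly_Mapping.keys p"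
    by (auto simp: in_keys_iff)
  then show "lin_ext g (fscale c p) = fscale c (lin_ext g p)"
    by (subst (1 2) lin_ext_superset[of "Poly_Mapping.keys p"])
      (auto simp: free.scale_sum_right)
qed

lemma lin_ext_gen [simp]: "lin_ext g (gen a) = g a"
  by (simp add: lin_ext_def)

lemma free_decomp:
  fixes p :: "'a \<Rightarrow>\<^sub>0 'k::field"
  shows "p = (\<Sum>a\<in>Poly_Mapping.keys p. fscale (Poly_Mapping.lookup p a) (gen a))"
proof (rule poly_mapping_eqI)
  fix b
  have "Poly_Mapping.lookup (\<Sum>a\<in>Poly_Mapping.keys p. fscale (Poly_Mapping.lookup p a) (gen a)) b =
      (\<Sum>a\<in>Poly_Mapping.keys p. if b = a then Poly_Mapping.lookup p a else 0)"
    by (auto simp: Poly_Mapping.lookup_sum lookup_single when_def if_distrib[of "(*) _"] cong: if_cong)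
  then show "Poly_Mapping.lookup p b =
      Poly_Mapping.lookup (\<Sum>a\<in>Poly_Mapping.keys p. fscale (Poly_Mapping.lookup p a) (gen a)) b"
    by (auto simp: in_keys_iff)
qed

lemma flin_eq_lin_ext:
  assumes "flin h"
  shows "h p = lin_ext (\<lambda>a. h (gen a)) p"
proof -
  have "h p = h (\<Sum>a\<in>Poly_Mapping.keys p. fscale (Poly_Mapping.lookup p a) (gen a))"
    by (rule arg_cong[OF free_decomp])
  then show ?thesis
    unfolding lin_ext_def free2.linear_sum[OF assms] free2.linear_scale[OF assms] .
qed

lemma flin_eqI:
  assumes "flin h" "flin k" "\<And>a. h (gen a) = k (gen a)"
  shows "h p = k p"
  by (rule trans[OF flin_eq_lin_ext[OF assms(1)] trans[OF _ flin_eq_lin_ext[OF assms(2), symmetric]]])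
    (simp add: assms(3))

lemma flin_comp:
  assumes "flin h" "flin k"
  shows "flin (\<lambda>p. h (k p))"
  by (rule flinI)
    (simp_all add: free2.linear_add[OF assms(1)] free2.linear_add[OF assms(2)]
      free2.linear_scale[OF assms(1)] free2.linear_scale[OF assms(2)])

lemma flin_add:
  assumes "flin h" "flin k"
  shows "flin (\<lambda>p. h p + k p)"
  by (rule flinI)
    (simp_all add: free2.linear_add[OF assms(1)] free2.linear_add[OF assms(2)]
      free2.linear_scale[OF assms(1)] free2.linear_scale[OF assms(2)] free.scale_right_distrib)

lemma flin_diff:
  assumes "flin h" "flin k"
  shows "flin (\<lambda>p. h p - k p)"
  by (rule flinI)
    (simp_all add: free2.linear_add[OF assms(1)] free2.linear_add[OF assms(2)]
      free2.linear_scale[OF assms(1)] free2.linear_scale[OF assms(2)] free.scale_right_diff_distrib)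

lemma flin_fscale:
  assumes "flin h"
  shows "flin (\<lambda>p. fscale c (h p))"
  using flin_comp[OF free.linear_scale_self assms] .

lemma flin_id [simp]: "flin (\<lambda>p. p)" by (rule free.linear_ident)

lemma lin_ext_comp:
  assumes "flin h"
  shows "h (lin_ext g p) = lin_ext (\<lambda>a. h (g a)) p"
  by (rule flin_eqI) (auto intro: flin_comp assms)

lemma lin_ext_add_fun: "lin_ext (\<lambda>a. g a + h a) p = lin_ext g p + lin_ext h p"
  by (rule flin_eqI) (auto intro: flin_add)

lemma lin_ext_scale_fun: "lin_ext (\<lambda>a. fscale c (g a)) p = fscale c (lin_ext g p)"
  by (rule flin_eqI) (auto intro: flin_fscale)

text \<open>Used throughout with \<open>S\<close> a space of relations, to extend a congruence from
  generators to their span.\<close>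

lemma flin_span:
  assumes "flin h" "free.subspace S" "\<And>x. x \<in> X \<Longrightarrow> h x \<in> S" "p \<in> free.span X"
  shows "h p \<in> S"
  using assms(4)
proof (induction p rule: free.span_induct_alt)
  case base
  then show ?case using assms by (simp add: free2.linear_0 free.subspace_0)
next
  case (step c x y)
  then show ?case using assms
    by (auto simp: free2.linear_add free2.linear_scale intro: free.subspace_add free.subspace_scale)
qed

lemma flin_span_eq:
  assumes "flin h" "flin k" "\<And>x. x \<in> X \<Longrightarrow> h x = k x" "p \<in> free.span X"
  shows "h p = k p"
proof -
  have "h p - k p \<in> {0}"
    by (rule flin_span[OF flin_diff[OF assms(1,2)] _ _ assms(4)])
       (use assms(3) in \<open>auto simp: free.subspace_def\<close>)
  then show ?thesis by simp
qed

text \<open>As a nested linear extension the tensor product inherits linearity in each factor from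
  \<open>lin_ext\<close>.\<close>

lemma tens_alt: "tens p q = lin_ext (\<lambda>a. lin_ext (\<lambda>b. gen (a, b)) q) p"
  unfolding tens_def lin_ext_def free.scale_sum_right
  by (intro sum.cong refl) (auto intro!: poly_mapping_eqI simp: lookup_single when_def)

lemma flin_tens_left: "flin (\<lambda>p. tens p q)"
  unfolding tens_alt by simp

lemma flin_tens_right: "flin (tens p)"
  by (rule flinI) (simp_all add: tens_alt flin_simps lin_ext_add_fun lin_ext_scale_fun)

lemma tens_gen [simp]: "tens (gen a) (gen b) = gen (a, b)"
  by (simp add: tens_alt)

lemma tens_zero [simp]: "tens 0 q = 0" "tens p 0 = 0"
  using flin_tens_left[of q] flin_tens_right[of p] by (auto dest: free2.linear_0)

lemmas tens_simps =
  free2.linear_add[OF flin_tens_left] free2.linear_add[OF flin_tens_right]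
  free2.linear_diff[OF flin_tens_left] free2.linear_diff[OF flin_tens_right]
  free2.linear_scale[OF flin_tens_left] free2.linear_scale[OF flin_tens_right]

section \<open>Koszul-signed unshuffle sums and the reduced coproduct\<close>

section \<open>Unshuffles\<close>

lemma ksgn_add_left: "ksgn (i + j) k = ksgn i k * ksgn j k"
  by (auto simp: ksgn_def)

lemma ksgn_add_right: "ksgn k (i + j) = ksgn k i * ksgn k j"
  by (auto simp: ksgn_def)

lemma ksgn_commute: "ksgn i j = ksgn j i"
  by (auto simp: ksgn_def)

lemma ksgn_self [simp]: "ksgn i j * ksgn i j = 1"
  by (auto simp: ksgn_def)

lemma ksgn_zero [simp]: "ksgn 0 j = 1" "ksgn j 0 = 1"
  by (auto simp: ksgn_def)

lemma wdeg_simps [simp]: "wdeg [] = 0" "wdeg (x # w) = fst x + wdeg w" "wdeg (u @ v) = wdeg u + wdeg v"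
  by (auto simp: wdeg_def)

text \<open>The sum of \<open>\<epsilon>(\<sigma>) G u v\<close> over all unshuffles \<open>(u, v)\<close> of \<open>w\<close>, empty words included.\<close>

primrec ush :: "'v word \<Rightarrow> ('v word \<Rightarrow> 'v word \<Rightarrow> ('c \<Rightarrow>\<^sub>0 'k::field_char_0)) \<Rightarrow> ('c \<Rightarrow>\<^sub>0 'k)" where
  "ush [] G = G [] []"
| "ush (x # w) G = ush w (\<lambda>u v. G (x # u) v + fscale (ksgn (fst x) (wdeg u)) (G u (x # v)))"

text \<open>Unshuffling produces only pairs of which \<open>w\<close> is a shuffle. As a congruence
  rule this shows the termination proof of \<open>cmorg\<close> that the second part is shorter when
  the first is nonempty.\<close>

lemma ush_cong [fundef_cong]:
  assumes "w = w'" "\<And>u v. w' \<in> shuffles u v \<Longrightarrow> G u v = G' u v"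
  shows "ush w G = ush w' G'"
  unfolding assms(1) using assms(2)
proof (induction w' arbitrary: G G')
  case (Cons x w)
  show ?case
    unfolding ush.simps
    by (rule Cons.IH) (simp add: Cons.prems Cons_in_shuffles_leftI Cons_in_shuffles_rightI)
qed simp

lemma wdeg_shuffles: "w \<in> shuffles u v \<Longrightarrow> wdeg w = wdeg u + wdeg v"
  by (induction u v arbitrary: w rule: shuffles.induct) auto

lemma ush_add: "ush w (\<lambda>u v. G u v + H u v) = ush w G + ush w H"
proof (induction w arbitrary: G H)
  case (Cons x w)
  show ?case
    by (simp add: Cons.IH[symmetric] free.scale_right_distrib add_ac)
qed simp

lemma ush_linear:
  assumes "flin h"
  shows "h (ush w G) = ush w (\<lambda>u v. h (G u v))"
  by (induction w arbitrary: G) (simp_all add: free2.linear_add[OF assms] free2.linear_scale[OF assms])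

lemma ush_scale: "ush w (\<lambda>u v. fscale c (G u v)) = fscale c (ush w G)"
  by (rule ush_linear[symmetric]) (rule free.linear_scale_self)

lemma ush_zero [simp]: "ush w (\<lambda>u v. 0) = 0"
  by (induction w) simp_all

lemma ush_diff: "ush w (\<lambda>u v. G u v - H u v) = ush w G - ush w H"
  using ush_add[of w G "\<lambda>u v. - H u v"] ush_linear[OF free.linear_uminus, of w H] by simp

lemma ush_in:
  assumes "free.subspace S" "\<And>u v. w \<in> shuffles u v \<Longrightarrow> G u v \<in> S"
  shows "ush w G \<in> S"
  using assms(2)
proof (induction w arbitrary: G)
  case (Cons x w)
  show ?case
    unfolding ush.simps
    by (rule Cons.IH)
      (simp add: Cons.prems Cons_in_shuffles_leftI Cons_in_shuffles_rightI
        assms(1) free.subspace_add free.subspace_scale)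
qed simp

text \<open>An unshuffle of a concatenation is a pair of unshuffles; the sign arises because the
  right part \<open>v\<close> of the first word passes the left part \<open>u'\<close> of the
  second.\<close>

lemma ush_append:
  "ush (a @ b) G =
   ush a (\<lambda>u v. ush b (\<lambda>u' v'. fscale (ksgn (wdeg v) (wdeg u')) (G (u @ u') (v @ v'))))"
proof (induction a arbitrary: G)
  case (Cons x a)
  show ?case
    by (simp add: Cons.IH ush_add ush_scale[symmetric] free.scale_right_distrib ksgn_add_left
        ksgn_add_right ksgn_commute mult_ac)
qed simp

text \<open>Coassociativity: both sides run over the splittings of \<open>w\<close> into three
  parts. The identity is exact on words, without passing to the symmetric quotient.\<close>

lemma ush_assoc:
  "ush w (\<lambda>u v. ush v (\<lambda>a b. G u a b)) = ush w (\<lambda>c b. ush c (\<lambda>u a. G u a b))"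
proof (induction w arbitrary: G)
  case (Cons x w)
  \<comment> \<open>The three summands are the three parts that can receive the first letter
    \<open>x\<close>, with its signs past the parts in front.\<close>
  define G' where "G' u a b = G (x # u) a b + fscale (ksgn (fst x) (wdeg u)) (G u (x # a) b)
    + fscale (ksgn (fst x) (wdeg u) * ksgn (fst x) (wdeg a)) (G u a (x # b))" for u a b
  have "ush (x # w) (\<lambda>u v. ush v (\<lambda>a b. G u a b)) = ush w (\<lambda>u v. ush v (\<lambda>a b. G' u a b))"
    by (simp add: G'_def ush_add ush_scale[symmetric] free.scale_right_distrib add_ac)
  also have "\<dots> = ush w (\<lambda>c b. ush c (\<lambda>u a. G' u a b))"
    by (rule Cons.IH)
  also have "\<dots> = ush (x # w) (\<lambda>c b. ush c (\<lambda>u a. G u a b))"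
    by (auto simp: G'_def ush_add ush_scale[symmetric] ksgn_add_right add_ac wdeg_shuffles
        intro!: ush_cong)
  finally show ?case .
qed simp

text \<open>Graded cocommutativity, again exact on words: exchanging the two parts turns the sign of
  an unshuffle into that of the opposite one.\<close>

lemma ush_commute: "ush w G = ush w (\<lambda>u v. fscale (ksgn (wdeg u) (wdeg v)) (G v u))"
proof (induction w arbitrary: G)
  case (Cons x w)
  have [simp]: "ksgn (fst x) i * (ksgn (fst x) i * c) = (c::'b)" for i c
    by (simp flip: mult.assoc)
  show ?case
    by (simp, subst Cons.IH)
      (auto intro!: ush_cong simp: ksgn_add_left ksgn_add_right free.scale_right_distrib
        ksgn_commute mult_ac add_ac)
qed simp

lemma set_nat_split: "A = (if 0 \<in> A then insert 0 (Suc ` (Suc -` A)) else Suc ` (Suc -` A))"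
proof (rule Set.set_eqI)
  fix i show "i \<in> A \<longleftrightarrow> i \<in> (if 0 \<in> A then insert 0 (Suc ` (Suc -` A)) else Suc ` (Suc -` A))"
    by (cases i) auto
qed

text \<open>Splits position sets by whether the first letter is selected, matching the recursion of
  \<open>ush\<close>.\<close>

lemma Pow_lessThan_Suc_shift:
  "Pow {..<Suc n} = (\<lambda>A. insert 0 (Suc ` A)) ` Pow {..<n} \<union> (`) Suc ` Pow {..<n}"
proof (rule Set.set_eqI)
  fix A
  note vim = set_nat_split[of A]
  have sub: "Suc -` A \<in> Pow {..<n} \<longleftrightarrow> A \<subseteq> {..<Suc n}"
  proof
    assume *: "Suc -` A \<in> Pow {..<n}"
    show "A \<subseteq> {..<Suc n}"
    proof
      fix i assume "i \<in> A" then show "i \<in> {..<Suc n}" using * by (cases i) auto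
    qed
  qed auto
  show "A \<in> Pow {..<Suc n} \<longleftrightarrow> A \<in> (\<lambda>A. insert 0 (Suc ` A)) ` Pow {..<n} \<union> (`) Suc ` Pow {..<n}"
  proof
    assume "A \<in> Pow {..<Suc n}"
    then have "Suc -` A \<in> Pow {..<n}" using sub by simp
    then show "A \<in> (\<lambda>A. insert 0 (Suc ` A)) ` Pow {..<n} \<union> (`) Suc ` Pow {..<n}"
      using vim by (metis UnI1 UnI2 image_eqI)
  next
    assume "A \<in> (\<lambda>A. insert 0 (Suc ` A)) ` Pow {..<n} \<union> (`) Suc ` Pow {..<n}"
    then show "A \<in> Pow {..<Suc n}"
      by (elim UnE imageE) (auto simp: subset_iff)
  qed
qed

text \<open>\<open>ksgn\<close> is multiplicative in the degree, so passing the selected letters one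
  by one costs the sign of their total degree.\<close>

lemma ksgn_wdeg_nths:
  assumes "B \<subseteq> {..<length w}"
  shows "(\<Prod>i\<in>B. ksgn (fst (w ! i)) k) = (ksgn k (wdeg (nths w B)) :: 'k::field_char_0)"
  using assms
proof (induction w arbitrary: B)
  case (Cons x w)
  have B: "Suc -` B \<subseteq> {..<length w}" and fin: "finite B"
    using Cons.prems finite_subset by auto
  have "(\<Prod>i\<in>Suc ` (Suc -` B). ksgn (fst ((x # w) ! i)) k) = (\<Prod>i\<in>Suc -` B. ksgn (fst (w ! i)) k :: 'k)"
    by (subst prod.reindex) auto
  also have "\<dots> = ksgn k (wdeg (nths w (Suc -` B)))"
    by (rule Cons.IH[OF B])
  finally have *: "(\<Prod>i\<in>Suc ` (Suc -` B). ksgn (fst ((x # w) ! i)) k) = (ksgn k (wdeg (nths w (Suc -` B))) :: 'k)" .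
  have fs: "finite (Suc ` (Suc -` B))" using B finite_subset by blast
  show ?case
  proof (cases "0 \<in> B")
    case True
    then have "B = insert 0 (Suc ` (Suc -` B))"
      using set_nat_split[of B] by simp
    then have "(\<Prod>i\<in>B. ksgn (fst ((x # w) ! i)) k) = (\<Prod>i\<in>insert 0 (Suc ` (Suc -` B)). ksgn (fst ((x # w) ! i)) k :: 'k)"
      by simp
    also have "\<dots> = ksgn (fst x) k * ksgn k (wdeg (nths w (Suc -` B)))"
      using fs * by (subst prod.insert) auto
    finally show ?thesis using True
      by (simp add: nths_Cons ksgn_add_right ksgn_commute vimage_def)
  next
    case False
    then have "B = Suc ` (Suc -` B)"
      using set_nat_split[of B] by simp
    then show ?thesis using * False by (simp add: nths_Cons vimage_def)
  qed
qed auto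

text \<open>A selected first letter has nothing in front of it and adds no inversion; an unselected
  one is inverted with every selected letter.\<close>

lemma shuffle_sgn_shift:
  assumes "B \<subseteq> {..<length w}"
  shows "shuffle_sgn (x # w) (insert 0 (Suc ` B)) = shuffle_sgn w B"
    and "shuffle_sgn (x # w) (Suc ` B) = (ksgn (fst x) (wdeg (nths w B)) * shuffle_sgn w B :: 'k::field_char_0)"
proof -
  have fin: "finite B" using assms finite_subset by blast
  have 1: "{..<Suc i} - insert 0 (Suc ` B) = Suc ` ({..<i} - B)" for i
    using less_Suc_eq_0_disj by auto
  have 2: "{..<Suc i} - Suc ` B = insert 0 (Suc ` ({..<i} - B))" for i
    using less_Suc_eq_0_disj by auto
  show "shuffle_sgn (x # w) (insert 0 (Suc ` B)) = shuffle_sgn w B"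
    unfolding shuffle_sgn_def using fin
    by (subst prod.insert) (auto simp: prod.reindex 1)
  have "shuffle_sgn (x # w) (Suc ` B) =
      (\<Prod>i\<in>B. ksgn (fst (w ! i)) (fst x) * (\<Prod>j\<in>{..<i} - B. ksgn (fst (w ! i)) (fst (w ! j))) :: 'k)"
    unfolding shuffle_sgn_def by (auto simp: prod.reindex 2)
  also have "\<dots> = ksgn (fst x) (wdeg (nths w B)) * shuffle_sgn w B"
    by (simp add: prod.distrib ksgn_wdeg_nths[OF assms] shuffle_sgn_def)
  finally show "shuffle_sgn (x # w) (Suc ` B) = (ksgn (fst x) (wdeg (nths w B)) * shuffle_sgn w B :: 'k)" .
qed

text \<open>Links the recursive form, suited to induction, with the sums over position sets by which
  \<open>coprod\<close> is defined.\<close>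

lemma ush_sum:
  "ush w G = (\<Sum>A\<in>Pow {..<length w}. fscale (shuffle_sgn w A) (G (nths w A) (nths w (- A))))"
proof (induction w arbitrary: G)
  case Nil
  then show ?case by (simp add: shuffle_sgn_def)
next
  case (Cons x w)
  let ?f = "\<lambda>A. fscale (shuffle_sgn (x # w) A) (G (nths (x # w) A) (nths (x # w) (- A)))"
  have "(\<Sum>A\<in>Pow {..<length (x # w)}. ?f A) =
      (\<Sum>A\<in>(\<lambda>A. insert 0 (Suc ` A)) ` Pow {..<length w}. ?f A) + (\<Sum>A\<in>(`) Suc ` Pow {..<length w}. ?f A)"
    unfolding list.size Pow_lessThan_Suc_shift add_0_right add_Suc_right
    by (rule sum.union_disjoint) auto
  also have "\<dots> = (\<Sum>A\<in>Pow {..<length w}. ?f (insert 0 (Suc ` A))) + (\<Sum>A\<in>Pow {..<length w}. ?f (Suc ` A))"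
  proof (intro arg_cong2[where f="(+)"] sum.reindex[unfolded o_def])
    show "inj_on (\<lambda>A. insert 0 (Suc ` A)) (Pow {..<length w})"
    proof (rule inj_onI)
      fix A B assume "insert 0 (Suc ` A) = insert 0 (Suc ` B)"
      then have "{j. Suc j \<in> insert 0 (Suc ` A)} = {j. Suc j \<in> insert 0 (Suc ` B)}" by simp
      then show "A = B" by auto
    qed
    show "inj_on ((`) Suc) (Pow {..<length w})"
      by (rule inj_onI) (simp add: inj_image_eq_iff)
  qed
  also have "\<dots> = (\<Sum>A\<in>Pow {..<length w}. fscale (shuffle_sgn w A) (G (x # nths w A) (nths w (- A)))
      + fscale (shuffle_sgn w A) (fscale (ksgn (fst x) (wdeg (nths w A))) (G (nths w A) (x # nths w (- A)))))"
    unfolding sum.distrib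
  proof (intro arg_cong2[where f="(+)"] sum.cong refl)
    fix A assume A: "A \<in> Pow {..<length w}"
    have e1: "{j. Suc j \<in> Suc ` A} = A" "{j. Suc j \<notin> Suc ` A} = - A" by auto
    show "?f (insert 0 (Suc ` A)) = fscale (shuffle_sgn w A) (G (x # nths w A) (nths w (- A)))"
      using A by (simp add: shuffle_sgn_shift nths_Cons e1)
    show "?f (Suc ` A) = fscale (shuffle_sgn w A) (fscale (ksgn (fst x) (wdeg (nths w A))) (G (nths w A) (x # nths w (- A))))"
      using A by (simp add: shuffle_sgn_shift nths_Cons e1 mult_ac)
  qed
  also have "\<dots> = ush (x # w) G"
    by (simp add: Cons.IH free.scale_right_distrib)
  finally show ?case by simp
qed

text \<open>The range of cardinalities in \<open>coprod\<close> leaves out the empty and the full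
  set of positions, that is, the unshuffles with an empty part.\<close>

lemma coprod_gen:
  "coprod (gen w :: _ \<Rightarrow>\<^sub>0 'k::field_char_0) = ush w (\<lambda>u v. if u = [] \<or> v = [] then 0 else gen (u, v))"
proof -
  let ?f = "\<lambda>A. fscale (shuffle_sgn w A) (gen (nths w A, nths w (- A))) :: _ \<Rightarrow>\<^sub>0 'k"
  let ?g = "\<lambda>A. fscale (shuffle_sgn w A) (if nths w A = [] \<or> nths w (- A) = [] then 0 else gen (nths w A, nths w (- A))) :: _ \<Rightarrow>\<^sub>0 'k"
  have len: "length (nths w A) = card A" "length (nths w (- A)) = length w - card A"
    if "A \<subseteq> {..<length w}" for A
  proof -
    have "{i. i < length w \<and> i \<in> A} = A" "{i. i < length w \<and> i \<in> - A} = {..<length w} - A" using that by auto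
    then show "length (nths w A) = card A" "length (nths w (- A)) = length w - card A"
      using that by (auto simp: length_nths card_Diff_subset finite_subset)
  qed
  have "coprod (gen w) = (\<Sum>p = 1..<length w. \<Sum>A | A \<subseteq> {..<length w} \<and> card A = p. ?f A)"
    by (simp add: coprod_def)
  also have "\<dots> = (\<Sum>A\<in>(\<Union>p\<in>{1..<length w}. {A. A \<subseteq> {..<length w} \<and> card A = p}). ?f A)"
    by (rule sum.UNION_disjoint[symmetric]) (auto intro: finite_subset[of _ "Pow {..<length w}"])
  also have "\<dots> = (\<Sum>A\<in>(\<Union>p\<in>{1..<length w}. {A. A \<subseteq> {..<length w} \<and> card A = p}). ?g A)"
  proof (intro sum.cong refl)
    fix A assume "A \<in> (\<Union>p\<in>{1..<length w}. {A. A \<subseteq> {..<length w} \<and> card A = p})"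
    then have "A \<subseteq> {..<length w}" "1 \<le> card A" "card A < length w" by auto
    then have "length (nths w A) \<noteq> 0" "length (nths w (- A)) \<noteq> 0" using len[of A] by linarith+
    then show "?f A = ?g A" by simp
  qed
  also have "\<dots> = (\<Sum>A\<in>Pow {..<length w}. ?g A)"
  proof (rule sum.mono_neutral_left)
    show "\<forall>A\<in>Pow {..<length w} - (\<Union>p\<in>{1..<length w}. {A. A \<subseteq> {..<length w} \<and> card A = p}). ?g A = 0"
    proof
      fix A assume A: "A \<in> Pow {..<length w} - (\<Union>p\<in>{1..<length w}. {A. A \<subseteq> {..<length w} \<and> card A = p})"
      then have "A \<subseteq> {..<length w}" "card A = 0 \<or> card A \<ge> length w" by auto
      then have "nths w A = [] \<or> nths w (- A) = []" using len[of A] by (metis diff_is_0_eq length_0_conv)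
      then show "?g A = 0" by auto
    qed
  qed auto
  finally show ?thesis by (simp add: ush_sum)
qed

section \<open>Descent of functions on words to the symmetric quotient\<close>

section \<open>The relations of the symmetric coalgebra\<close>

text \<open>Contexts around a letter and parts of an unshuffle may be empty, while
  \<open>words\<close> excludes the empty word.\<close>

definition words0 :: "('k, 'v) gspace \<Rightarrow> 'v word set" where
  "words0 V = {w. \<forall>(i, x) \<in> set w. x \<in> carrier (V i)}"

lemma words0_simps [simp]:
  "[] \<in> words0 V"
  "(i, x) # w \<in> words0 V \<longleftrightarrow> x \<in> carrier (V i) \<and> w \<in> words0 V"
  "u @ w \<in> words0 V \<longleftrightarrow> u \<in> words0 V \<and> w \<in> words0 V"
  by (auto simp: words0_def)

lemma words_iff: "w \<in> words V \<longleftrightarrow> w \<noteq> [] \<and> w \<in> words0 V"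
  by (auto simp: words_def words0_def)

lemma words0_shuffles: "w \<in> words0 V \<Longrightarrow> w \<in> shuffles u v \<Longrightarrow> u \<in> words0 V \<and> v \<in> words0 V"
  by (auto simp: words0_def dest: set_shuffles)

lemma subspace_sym_rel [simp]: "free.subspace (sym_rel V)"
  by (simp add: sym_rel_def)

lemma subspace_tens_rel [simp]: "free.subspace (tens_rel V)"
  by (simp add: tens_rel_def)

lemma subspace_sym_free [simp]: "free.subspace (sym_free V)"
  by (simp add: sym_free_def)

lemma gen_sym_free: "w \<in> words V \<Longrightarrow> gen w \<in> sym_free V"
  by (auto simp: sym_free_def intro: free.span_base)

lemma cong_trans:
  assumes "free.subspace S" "p - q \<in> S" "q - r \<in> S"
  shows "p - r \<in> S"
  using free.subspace_add[OF assms] by simp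

lemma cong_sym:
  assumes "free.subspace S" "p - q \<in> S"
  shows "q - p \<in> S"
  using free.subspace_neg[OF assms] by simp

lemma cong_in:
  assumes "free.subspace S" "p - q \<in> S" "q \<in> S"
  shows "p \<in> S"
  using free.subspace_add[OF assms] by simp

lemma cong_add:
  assumes "free.subspace S" "p - q \<in> S" "p' - q' \<in> S"
  shows "(p + p') - (q + q') \<in> S"
  using free.subspace_add[OF assms] by (simp add: algebra_simps)

lemma cong_diff:
  assumes "free.subspace S" "p - q \<in> S" "p' - q' \<in> S"
  shows "(p - p') - (q - q') \<in> S"
  using free.subspace_diff[OF assms] by (simp add: algebra_simps)

lemma sym_rel_add:
  assumes "u \<in> words0 V" "v \<in> words0 V" "x \<in> carrier (V i)" "y \<in> carrier (V i)"
  shows "gen (u @ (i, x \<oplus>\<^bsub>V i\<^esub> y) # v) - gen (u @ (i, x) # v) - gen (u @ (i, y) # v) \<in> sym_rel V"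
  unfolding sym_rel_def
  by (rule free.span_base, intro UnI1, rule CollectI, intro exI conjI, rule refl)
    (use assms in \<open>auto simp: words_iff\<close>)

lemma sym_rel_smult:
  assumes "u \<in> words0 V" "v \<in> words0 V" "x \<in> carrier (V i)"
  shows "gen (u @ (i, c \<odot>\<^bsub>V i\<^esub> x) # v) - fscale c (gen (u @ (i, x) # v)) \<in> sym_rel V"
  unfolding sym_rel_def
  by (rule free.span_base, rule UnI1, rule UnI2, rule CollectI, intro exI conjI, rule refl)
    (use assms in \<open>auto simp: words_iff\<close>)

lemma sym_rel_swap:
  assumes "u \<in> words0 V" "v \<in> words0 V" "x \<in> carrier (V i)" "y \<in> carrier (V j)"
  shows "gen (u @ (i, x) # (j, y) # v) - fscale (ksgn i j) (gen (u @ (j, y) # (i, x) # v)) \<in> sym_rel V"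
  unfolding sym_rel_def
  by (rule free.span_base, rule UnI2, rule CollectI, intro exI conjI, rule refl)
    (use assms in \<open>auto simp: words_iff\<close>)

text \<open>Expresses that a function on words induces a map from the symmetric quotient to the
  quotient by \<open>S\<close>. On the level of words the three families of relations can be checked
  separately.\<close>

definition sym_compat ::
    "('k::field_char_0, 'v) gspace \<Rightarrow> ('c \<Rightarrow>\<^sub>0 'k) set \<Rightarrow> ('v word \<Rightarrow> ('c \<Rightarrow>\<^sub>0 'k)) \<Rightarrow> bool" where
  "sym_compat V S G \<longleftrightarrow> (\<forall>p \<in> sym_rel V. lin_ext G p \<in> S)"

lemma sym_compatI:
  assumes S: "free.subspace S"
    and add: "\<And>u v i x y. u \<in> words0 V \<Longrightarrow> v \<in> words0 V \<Longrightarrow> x \<in> carrier (V i) \<Longrightarrow> y \<in> carrier (V i) \<Longrightarrow>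
      G (u @ (i, x \<oplus>\<^bsub>V i\<^esub> y) # v) - G (u @ (i, x) # v) - G (u @ (i, y) # v) \<in> S"
    and smult: "\<And>u v i x c. u \<in> words0 V \<Longrightarrow> v \<in> words0 V \<Longrightarrow> x \<in> carrier (V i) \<Longrightarrow>
      G (u @ (i, c \<odot>\<^bsub>V i\<^esub> x) # v) - fscale c (G (u @ (i, x) # v)) \<in> S"
    and swap: "\<And>u v i x j y. u \<in> words0 V \<Longrightarrow> v \<in> words0 V \<Longrightarrow> x \<in> carrier (V i) \<Longrightarrow> y \<in> carrier (V j) \<Longrightarrow>
      G (u @ (i, x) # (j, y) # v) - fscale (ksgn i j) (G (u @ (j, y) # (i, x) # v)) \<in> S"
  shows "sym_compat V S G"
  unfolding sym_compat_def
proof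
  fix p assume "p \<in> sym_rel V"
  then show "lin_ext G p \<in> S"
    unfolding sym_rel_def
  proof (rule flin_span[OF flin_lin_ext S, rotated])
    fix p
    assume "p \<in> {gen (u @ (i, x \<oplus>\<^bsub>V i\<^esub> y) # v) - gen (u @ (i, x) # v) - gen (u @ (i, y) # v) | u v i x y.
        u @ (i, x) # v \<in> words V \<and> y \<in> carrier (V i)} \<union>
     {gen (u @ (i, c \<odot>\<^bsub>V i\<^esub> x) # v) - fscale c (gen (u @ (i, x) # v)) | u v i x c.
        u @ (i, x) # v \<in> words V} \<union>
     {gen (u @ (i, x) # (j, y) # v) - fscale (ksgn i j) (gen (u @ (j, y) # (i, x) # v)) | u v i x j y.
        u @ (i, x) # (j, y) # v \<in> words V}"
    then show "lin_ext G p \<in> S"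
    proof (elim UnE CollectE exE conjE)
    qed (auto simp: flin_simps words_iff add smult swap)
  qed
qed

lemma sym_compat_add:
  assumes "sym_compat V S G" "u \<in> words0 V" "v \<in> words0 V" "x \<in> carrier (V i)" "y \<in> carrier (V i)"
  shows "G (u @ (i, x \<oplus>\<^bsub>V i\<^esub> y) # v) - G (u @ (i, x) # v) - G (u @ (i, y) # v) \<in> S"
  using assms(1)[unfolded sym_compat_def, rule_format, OF sym_rel_add[OF assms(2-5)]]
  by (simp add: flin_simps)

lemma sym_compat_smult:
  assumes "sym_compat V S G" "u \<in> words0 V" "v \<in> words0 V" "x \<in> carrier (V i)"
  shows "G (u @ (i, c \<odot>\<^bsub>V i\<^esub> x) # v) - fscale c (G (u @ (i, x) # v)) \<in> S"
  using assms(1)[unfolded sym_compat_def, rule_format, OF sym_rel_smult[OF assms(2-4)]]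
  by (simp add: flin_simps)

lemma sym_compat_swap:
  assumes "sym_compat V S G" "u \<in> words0 V" "v \<in> words0 V" "x \<in> carrier (V i)" "y \<in> carrier (V j)"
  shows "G (u @ (i, x) # (j, y) # v) - fscale (ksgn i j) (G (u @ (j, y) # (i, x) # v)) \<in> S"
  using assms(1)[unfolded sym_compat_def, rule_format, OF sym_rel_swap[OF assms(2-5)]]
  by (simp add: flin_simps)

lemma sym_compatD: "sym_compat V S G \<Longrightarrow> p \<in> sym_rel V \<Longrightarrow> lin_ext G p \<in> S"
  by (simp add: sym_compat_def)

lemma flin_sym_compat:
  assumes "flin h" "sym_compat V S (\<lambda>w. h (gen w))" "p \<in> sym_rel V"
  shows "h p \<in> S"
  using sym_compatD[OF assms(2,3)] by (subst flin_eq_lin_ext[OF assms(1)])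

text \<open>Each relation compares words with the same letter degrees up to order, so a coefficient
  depending only on these is constant along it. Instances are signs in the total degree and
  functions of the length.\<close>

lemma sym_compat_scale_fun:
  assumes S: "free.subspace S" and G: "sym_compat V S G"
    and c: "\<And>u v i x y. c (u @ (i, x) # v) = c (u @ (i, y) # v)"
      "\<And>u v a b. c (u @ a # b # v) = c (u @ b # a # v)"
  shows "sym_compat V S (\<lambda>w. fscale (c w) (G w))"
proof (rule sym_compatI[OF S])
  fix u v i x y
  assume "u \<in> words0 V" "v \<in> words0 V" "x \<in> carrier (V i)" "y \<in> carrier (V i)"
  then show "fscale (c (u @ (i, x \<oplus>\<^bsub>V i\<^esub> y) # v)) (G (u @ (i, x \<oplus>\<^bsub>V i\<^esub> y) # v)) -
       fscale (c (u @ (i, x) # v)) (G (u @ (i, x) # v)) - fscale (c (u @ (i, y) # v)) (G (u @ (i, y) # v)) \<in> S"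
    using free.subspace_scale[OF S sym_compat_add[OF G]]
    by (simp add: c(1)[of _ _ "x \<oplus>\<^bsub>V i\<^esub> y" _ x] c(1)[of _ _ y _ x] free.scale_right_diff_distrib)
next
  fix u v i x d
  assume "u \<in> words0 V" "v \<in> words0 V" "x \<in> carrier (V i)"
  then show "fscale (c (u @ (i, d \<odot>\<^bsub>V i\<^esub> x) # v)) (G (u @ (i, d \<odot>\<^bsub>V i\<^esub> x) # v)) -
       fscale d (fscale (c (u @ (i, x) # v)) (G (u @ (i, x) # v))) \<in> S"
    using free.subspace_scale[OF S sym_compat_smult[OF G], of u v x i "c (u @ (i, x) # v)" d]
    by (simp add: c(1)[of _ _ "d \<odot>\<^bsub>V i\<^esub> x" _ x] free.scale_right_diff_distrib mult_ac)
next
  fix u v i x j y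
  assume "u \<in> words0 V" "v \<in> words0 V" "x \<in> carrier (V i)" "y \<in> carrier (V j)"
  then show "fscale (c (u @ (i, x) # (j, y) # v)) (G (u @ (i, x) # (j, y) # v)) -
       fscale (ksgn i j) (fscale (c (u @ (j, y) # (i, x) # v)) (G (u @ (j, y) # (i, x) # v))) \<in> S"
    using free.subspace_scale[OF S sym_compat_swap[OF G], of u v x i y j "c (u @ (i, x) # (j, y) # v)"]
    by (simp add: c(2)[of _ "(j, y)"] free.scale_right_diff_distrib mult_ac)
qed

lemma sym_compat_append:
  assumes "a \<in> words0 V" "b \<in> words0 V"
  shows "sym_compat V (sym_rel V) (\<lambda>w. gen (a @ w @ b))"
proof (rule sym_compatI)
  fix u v i x y
  assume "u \<in> words0 V" "v \<in> words0 V" "x \<in> carrier (V i)" "y \<in> carrier (V i)"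
  then show "gen (a @ (u @ (i, x \<oplus>\<^bsub>V i\<^esub> y) # v) @ b) - gen (a @ (u @ (i, x) # v) @ b) -
      gen (a @ (u @ (i, y) # v) @ b) \<in> sym_rel V"
    using sym_rel_add[of "a @ u" V "v @ b" x i y] assms by simp
next
  fix u v i x d
  assume "u \<in> words0 V" "v \<in> words0 V" "x \<in> carrier (V i)"
  then show "gen (a @ (u @ (i, d \<odot>\<^bsub>V i\<^esub> x) # v) @ b) - fscale d (gen (a @ (u @ (i, x) # v) @ b)) \<in> sym_rel V"
    using sym_rel_smult[of "a @ u" V "v @ b" x i d] assms by simp
next
  fix u v i x j y
  assume "u \<in> words0 V" "v \<in> words0 V" "x \<in> carrier (V i)" "y \<in> carrier (V j)"
  then show "gen (a @ (u @ (i, x) # (j, y) # v) @ b) -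
      fscale (ksgn i j) (gen (a @ (u @ (j, y) # (i, x) # v) @ b)) \<in> sym_rel V"
    using sym_rel_swap[of "a @ u" V "v @ b" x i y j] assms by simp
qed simp

lemma sym_compat_append_right:
  "a \<in> words0 V \<Longrightarrow> sym_compat V (sym_rel V) (\<lambda>w. gen (a @ w))"
  using sym_compat_append[of a V "[]"] by simp

lemma sym_compat_append_left:
  "b \<in> words0 V \<Longrightarrow> sym_compat V (sym_rel V) (\<lambda>w. gen (w @ b))"
  using sym_compat_append[of "[]" V b] by simp

lemma sym_compat_Cons:
  "x \<in> carrier (V i) \<Longrightarrow> sym_compat V (sym_rel V) (\<lambda>w. gen ((i, x) # w))"
  using sym_compat_append_right[of "[(i, x)]" V] by simp

lemma sym_compat_gen: "sym_compat V (sym_rel V) gen"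
  using sym_compat_append_right[of "[]" V] by simp

text \<open>The letters of a relation either fall into the same part, where the compatibility of
  \<open>G\<close> in that argument applies, or they are separated, and then the two orders
  cancel.\<close>

lemma sym_compat_ush:
  fixes G :: "'v word \<Rightarrow> 'v word \<Rightarrow> ('c \<Rightarrow>\<^sub>0 'k::field_char_0)"
  assumes S: "free.subspace S"
    and L: "\<And>v. v \<in> words0 V \<Longrightarrow> sym_compat V S (\<lambda>u. G u v)"
    and R: "\<And>u. u \<in> words0 V \<Longrightarrow> sym_compat V S (G u)"
  shows "sym_compat V S (\<lambda>w. ush w G)"
proof (rule sym_compatI[OF S])
  note sub = free.subspace_add[OF S] free.subspace_diff[OF S] free.subspace_scale[OF S]
  \<comment> \<open>Collects the terms in which the letter \<open>z\<close> between the two contexts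
    goes left and goes right.\<close>
  define K where "K z u v u' v' = fscale (ksgn (wdeg v) (fst z + wdeg u')) (G (u @ z # u') (v @ v'))
    + fscale (ksgn (fst z) (wdeg u') * ksgn (wdeg v) (wdeg u')) (G (u @ u') (v @ z # v'))"
    for z u v u' v'
  have K: "ush (a @ z # b) G = ush a (\<lambda>u v. ush b (K z u v))" for a z b
    by (simp add: ush_append K_def[abs_def])
  {
    fix a b i x y
    assume *: "a \<in> words0 V" "b \<in> words0 V" "x \<in> carrier (V i)" "y \<in> carrier (V i)"
    show "ush (a @ (i, x \<oplus>\<^bsub>V i\<^esub> y) # b) G - ush (a @ (i, x) # b) G - ush (a @ (i, y) # b) G \<in> S"
      unfolding K ush_diff[symmetric]
    proof (intro ush_in[OF S])
      fix u v u' v' assume "a \<in> shuffles u v" "b \<in> shuffles u' v'"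
      then have **: "u \<in> words0 V" "v \<in> words0 V" "u' \<in> words0 V" "v' \<in> words0 V"
        using * by (auto dest: words0_shuffles)
      have "fscale (ksgn (wdeg v) (i + wdeg u')) (G (u @ (i, x \<oplus>\<^bsub>V i\<^esub> y) # u') (v @ v')
          - G (u @ (i, x) # u') (v @ v') - G (u @ (i, y) # u') (v @ v')) +
        fscale (ksgn i (wdeg u') * ksgn (wdeg v) (wdeg u')) (G (u @ u') (v @ (i, x \<oplus>\<^bsub>V i\<^esub> y) # v')
          - G (u @ u') (v @ (i, x) # v') - G (u @ u') (v @ (i, y) # v')) \<in> S"
        using * ** by (intro sub sym_compat_add[OF L] sym_compat_add[OF R]) auto
      then show "K (i, x \<oplus>\<^bsub>V i\<^esub> y) u v u' v' - K (i, x) u v u' v' - K (i, y) u v u' v' \<in> S"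
        by (simp add: K_def algebra_simps free.scale_right_diff_distrib free.scale_right_distrib
            del: free.scale_scale)
    qed
  next
    fix a b i x c
    assume *: "a \<in> words0 V" "b \<in> words0 V" "x \<in> carrier (V i)"
    show "ush (a @ (i, c \<odot>\<^bsub>V i\<^esub> x) # b) G - fscale c (ush (a @ (i, x) # b) G) \<in> S"
      unfolding K ush_diff[symmetric] ush_scale[symmetric]
    proof (intro ush_in[OF S])
      fix u v u' v' assume "a \<in> shuffles u v" "b \<in> shuffles u' v'"
      then have **: "u \<in> words0 V" "v \<in> words0 V" "u' \<in> words0 V" "v' \<in> words0 V"
        using * by (auto dest: words0_shuffles)
      have "fscale (ksgn (wdeg v) (i + wdeg u')) (G (u @ (i, c \<odot>\<^bsub>V i\<^esub> x) # u') (v @ v')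
          - fscale c (G (u @ (i, x) # u') (v @ v'))) +
        fscale (ksgn i (wdeg u') * ksgn (wdeg v) (wdeg u')) (G (u @ u') (v @ (i, c \<odot>\<^bsub>V i\<^esub> x) # v')
          - fscale c (G (u @ u') (v @ (i, x) # v'))) \<in> S"
        using * ** by (intro sub sym_compat_smult[OF L] sym_compat_smult[OF R]) auto
      then show "K (i, c \<odot>\<^bsub>V i\<^esub> x) u v u' v' - fscale c (K (i, x) u v u' v') \<in> S"
        by (simp add: K_def algebra_simps free.scale_right_diff_distrib free.scale_right_distrib)
    qed
  next
    fix a b i x j y
    assume *: "a \<in> words0 V" "b \<in> words0 V" "x \<in> carrier (V i)" "y \<in> carrier (V j)"
    \<comment> \<open>Two adjacent letters give four terms: both left, separated in two ways, both
      right.\<close>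
    define K2 where "K2 p q u v u' v' =
        fscale (ksgn (wdeg v) (fst p + (fst q + wdeg u'))) (G (u @ p # q # u') (v @ v'))
      + fscale (ksgn (fst p) (fst q + wdeg u') * ksgn (wdeg v) (fst q + wdeg u')) (G (u @ q # u') (v @ p # v'))
      + fscale (ksgn (fst q) (wdeg u') * ksgn (wdeg v) (fst p + wdeg u')) (G (u @ p # u') (v @ q # v'))
      + fscale (ksgn (fst p) (wdeg u') * (ksgn (fst q) (wdeg u') * ksgn (wdeg v) (wdeg u'))) (G (u @ u') (v @ p # q # v'))"
      for p q u v u' v'
    have K2: "ush (a @ p # q # b) G = ush a (\<lambda>u v. ush b (K2 p q u v))" for p q
      by (auto simp add: ush_append K2_def[abs_def] free.scale_right_distrib mult_ac add_ac intro!: ush_cong)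
    show "ush (a @ (i, x) # (j, y) # b) G - fscale (ksgn i j) (ush (a @ (j, y) # (i, x) # b) G) \<in> S"
      unfolding K2 ush_diff[symmetric] ush_scale[symmetric]
    proof (intro ush_in[OF S])
      fix u v u' v' assume "a \<in> shuffles u v" "b \<in> shuffles u' v'"
      then have **: "u \<in> words0 V" "v \<in> words0 V" "u' \<in> words0 V" "v' \<in> words0 V"
        using * by (auto dest: words0_shuffles)
      have kk: "ksgn i j * (ksgn i j * c) = c" "ksgn i j * (ksgn j i * c) = c" for c :: 'k
        by (simp_all add: ksgn_commute[of j i] flip: mult.assoc)
      \<comment> \<open>The separated terms of the two orders agree up to the factor
        \<open>ksgn i j\<close> and drop out; the terms with both letters in one part
        remain.\<close>
      have "K2 (i, x) (j, y) u v u' v' - fscale (ksgn i j) (K2 (j, y) (i, x) u v u' v') =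
        fscale (ksgn (wdeg v) (i + (j + wdeg u'))) (G (u @ (i, x) # (j, y) # u') (v @ v')
          - fscale (ksgn i j) (G (u @ (j, y) # (i, x) # u') (v @ v'))) +
        fscale (ksgn i (wdeg u') * (ksgn j (wdeg u') * ksgn (wdeg v) (wdeg u'))) (G (u @ u') (v @ (i, x) # (j, y) # v')
          - fscale (ksgn i j) (G (u @ u') (v @ (j, y) # (i, x) # v')))"
        by (simp add: K2_def free.scale_right_diff_distrib free.scale_right_distrib ksgn_add_right
            ksgn_commute[of j i] mult_ac kk)
      also have "\<dots> \<in> S"
        using * ** by (intro sub sym_compat_swap[OF L] sym_compat_swap[OF R]) auto
      finally show "K2 (i, x) (j, y) u v u' v' - fscale (ksgn i j) (K2 (j, y) (i, x) u v u' v') \<in> S" .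
    qed
  }
qed

section \<open>The cogenerators as the kernel of the reduced coproduct\<close>

section \<open>The kernel of the reduced coproduct\<close>

text \<open>Each adjacent transposition on the way to the front contributes one factor of the
  sign.\<close>

lemma swap_front:
  assumes "u \<in> words0 V" "v \<in> words0 V" "x \<in> carrier (V i)"
  shows "gen (u @ (i, x) # v) - fscale (ksgn i (wdeg u)) (gen ((i, x) # u @ v)) \<in> sym_rel V"
  using assms(1)
proof (induction u)
  case Nil
  then show ?case by (simp add: free.subspace_0)
next
  case (Cons a u)
  obtain j y where a: "a = (j, y)" by fastforce
  have y: "y \<in> carrier (V j)" "u \<in> words0 V" using Cons.prems by (auto simp: a)
  have "gen ((j, y) # u @ (i, x) # v) - fscale (ksgn i (wdeg u)) (gen ((j, y) # (i, x) # u @ v)) \<in> sym_rel V"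
    using sym_compatD[OF sym_compat_Cons[of y V j, OF y(1)] Cons.IH[OF y(2)]] by (simp add: flin_simps)
  moreover have "fscale (ksgn i (wdeg u)) (gen ((j, y) # (i, x) # u @ v)) -
      fscale (ksgn i (wdeg u) * ksgn j i) (gen ((i, x) # (j, y) # u @ v)) \<in> sym_rel V"
  proof -
    have "fscale (ksgn i (wdeg u)) (gen ((j, y) # (i, x) # u @ v)
        - fscale (ksgn j i) (gen ((i, x) # (j, y) # u @ v))) \<in> sym_rel V"
      using sym_rel_swap[of "[]" V "u @ v" y j x i] y assms by (intro free.subspace_scale) auto
    then show ?thesis by (simp add: free.scale_right_diff_distrib)
  qed
  ultimately have "gen ((j, y) # u @ (i, x) # v) - fscale (ksgn i (wdeg u) * ksgn j i)
      (gen ((i, x) # (j, y) # u @ v)) \<in> sym_rel V"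
    by (rule cong_trans[OF subspace_sym_rel])
  then show ?case
    by (simp add: a ksgn_add_right ksgn_commute[of j i] mult_ac)
qed

text \<open>Multiplying the two parts back together restores the word with the very sign that the
  unshuffle carries, so all 2^n terms contribute equally.\<close>

lemma mult_ush:
  assumes "w \<in> words0 V"
  shows "ush w (\<lambda>u v. gen (u @ v)) - fscale (2 ^ length w) (gen w) \<in> sym_rel V"
  using assms
proof (induction w)
  case Nil
  then show ?case by (simp add: free.subspace_0)
next
  case (Cons a w)
  obtain i x where a: "a = (i, x)" by fastforce
  have x: "x \<in> carrier (V i)" "w \<in> words0 V" using Cons.prems by (auto simp: a)
  have "ush (a # w) (\<lambda>u v. gen (u @ v)) - fscale 2 (ush w (\<lambda>u v. gen (a # u @ v))) \<in> sym_rel V"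
    unfolding ush_scale[symmetric] ush.simps ush_diff[symmetric]
  proof (rule ush_in[OF subspace_sym_rel])
    fix u v assume "w \<in> shuffles u v"
    then have uv: "u \<in> words0 V" "v \<in> words0 V" using x by (auto dest: words0_shuffles)
    have "fscale (ksgn i (wdeg u)) (gen (u @ (i, x) # v) - fscale (ksgn i (wdeg u)) (gen ((i, x) # u @ v))) \<in> sym_rel V"
      by (intro free.subspace_scale subspace_sym_rel swap_front uv x)
    then have "fscale (ksgn i (wdeg u)) (gen (u @ (i, x) # v)) - gen ((i, x) # u @ v) \<in> sym_rel V"
      by (simp add: free.scale_right_diff_distrib)
    moreover have "fscale 2 p = p + p" for p :: "'a word \<Rightarrow>\<^sub>0 'b"
      by (rule poly_mapping_eqI) (simp add: lookup_add)
    ultimately show "gen ((a # u) @ v) + fscale (ksgn (fst a) (wdeg u)) (gen (u @ a # v)) - fscale 2 (gen (a # u @ v)) \<in> sym_rel V"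
      by (simp add: a)
  qed
  moreover have "fscale 2 (ush w (\<lambda>u v. gen (a # u @ v))) - fscale (2 ^ length (a # w)) (gen (a # w)) \<in> sym_rel V"
  proof -
    have "fscale 2 (ush w (\<lambda>u v. gen (a # u @ v)) - fscale (2 ^ length w) (gen (a # w))) \<in> sym_rel V"
    using sym_compatD[OF sym_compat_Cons[of x V i, OF x(1)] Cons.IH[OF x(2)]]
      by (intro free.subspace_scale) (simp_all add: flin_simps ush_linear[OF flin_lin_ext] a)
    then show ?thesis by (simp add: free.scale_right_diff_distrib)
  qed
  ultimately show ?case
    by (rule cong_trans[OF subspace_sym_rel])
qed

definition multip :: "('v word \<times> 'v word \<Rightarrow>\<^sub>0 'k::field_char_0) \<Rightarrow> ('v word \<Rightarrow>\<^sub>0 'k)" where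
  "multip = lin_ext (\<lambda>(u, v). gen (u @ v))"

lemma flin_multip [simp]: "flin multip"
  by (simp add: multip_def)

lemma multip_tens_rel:
  assumes "p \<in> tens_rel V"
  shows "multip p \<in> sym_rel V"
  using assms unfolding tens_rel_def
proof (rule flin_span[OF flin_multip subspace_sym_rel, rotated])
  fix x assume "x \<in> {tens p (gen w) | p w. p \<in> sym_rel V \<and> w \<in> words V} \<union>
                {tens (gen w) p | p w. p \<in> sym_rel V \<and> w \<in> words V}"
  then show "multip x \<in> sym_rel V"
  proof (elim UnE CollectE exE conjE)
    fix p w assume *: "x = tens p (gen w)" "p \<in> sym_rel V" "w \<in> words V"
    have "multip x = lin_ext (\<lambda>u. gen (u @ w)) p"
      unfolding *(1)
      by (rule flin_eqI[OF flin_comp[OF flin_multip flin_tens_left]]) (auto simp: multip_def)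
    then show ?thesis using sym_compatD[OF sym_compat_append_left] * by (auto simp: words_iff)
  next
    fix p w assume *: "x = tens (gen w) p" "p \<in> sym_rel V" "w \<in> words V"
    have "multip x = lin_ext (\<lambda>u. gen (w @ u)) p"
      unfolding *(1)
      by (rule flin_eqI[OF flin_comp[OF flin_multip flin_tens_right]]) (auto simp: multip_def)
    then show ?thesis using sym_compatD[OF sym_compat_append_right] * by (auto simp: words_iff)
  qed
qed

lemma flin_coprod [simp]: "flin coprod" by (simp add: coprod_def)
lemma flin_proj_one [simp]: "flin proj_one" by (simp add: proj_one_def)
lemma flin_tens_map [simp]: "flin (tens_map e f g)" by (simp add: tens_map_def)

text \<open>Of the 2^n terms of the full unshuffle sum the reduced coproduct omits the two with an
  empty part, and each of these is the word itself.\<close>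

lemma multip_coprod:
  fixes V :: "('k::field_char_0, 'v) gspace"
  assumes "w \<in> words V"
  shows "multip (coprod (gen w)) - fscale (2 ^ length w - 2) (gen w) \<in> sym_rel V"
proof -
  obtain a w' where w: "w = a # w'" using assms by (cases w) (auto simp: words_iff)
  have ush_nil: "ush w (\<lambda>u v. if u = [] then gen v else 0) = (gen w :: 'v word \<Rightarrow>\<^sub>0 'k)"
      "ush w (\<lambda>u v. if v = [] then gen u else 0) = (gen w :: 'v word \<Rightarrow>\<^sub>0 'k)" for w :: "'v word"
  proof -
    have "ush w (\<lambda>u v. if v = [] then gen (b @ u) else 0) = (gen (b @ w) :: 'v word \<Rightarrow>\<^sub>0 'k)" for b w :: "'v word"
    proof (induction w arbitrary: b)
      case (Cons x w)
      from Cons.IH[of "b @ [x]"] show ?case by (simp cong: if_cong)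
    qed simp
    from this[of w "[]"] show "ush w (\<lambda>u v. if v = [] then gen u else 0) = (gen w :: 'v word \<Rightarrow>\<^sub>0 'k)" by (simp cong: if_cong)
    have "ush w (\<lambda>u v. if u = [] then gen (b @ v) else 0) = (gen (b @ w) :: 'v word \<Rightarrow>\<^sub>0 'k)" for b w :: "'v word"
    proof (induction w arbitrary: b)
      case (Cons x w)
      have "ush (x # w) (\<lambda>u v. if u = [] then gen (b @ v) else 0) =
          (ush w (\<lambda>u v. if u = [] then gen ((b @ [x]) @ v) else 0) :: 'v word \<Rightarrow>\<^sub>0 'k)"
        unfolding ush.simps by (rule ush_cong) auto
      with Cons.IH[of "b @ [x]"] show ?case by simp
    qed simp
    from this[of w "[]"] show "ush w (\<lambda>u v. if u = [] then gen v else 0) = (gen w :: 'v word \<Rightarrow>\<^sub>0 'k)" by (simp cong: if_cong)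
  qed
  have "multip (coprod (gen w)) = (ush w (\<lambda>u v. if u = [] \<or> v = [] then 0 else gen (u @ v)) :: 'v word \<Rightarrow>\<^sub>0 'k)"
    unfolding coprod_gen ush_linear[OF flin_multip]
    by (rule ush_cong) (auto simp: free2.linear_0[OF flin_multip], simp add: multip_def)
  also have "\<dots> = ush w (\<lambda>u v. gen (u @ v) - (if u = [] then gen v else 0) - (if v = [] then gen u else 0))"
    by (rule ush_cong) (auto simp: w)
  also have "\<dots> = ush w (\<lambda>u v. gen (u @ v)) - fscale 2 (gen w)"
  proof -
    have "fscale 2 p = p + p" for p :: "'v word \<Rightarrow>\<^sub>0 'k"
      by (rule poly_mapping_eqI) (simp add: lookup_add)
    then show ?thesis by (simp add: ush_diff ush_nil)
  qed
  finally show ?thesis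
    using mult_ush[of w V] assms by (simp add: words_iff free.scale_left_diff_distrib)
qed

text \<open>Multiplying the two factors of the coproduct of a word of length \<open>n\<close> gives back the word
  \<open>2\<^sup>n - 2\<close> times.\<close>

lemma coprod_kernel:
  fixes V :: "('k::field_char_0, 'v) gspace"
  assumes p: "p \<in> sym_free V" and c: "coprod p \<in> tens_rel V" and o: "proj_one p \<in> sym_rel V"
  shows "p \<in> sym_rel V"
proof -
  \<comment> \<open>For words of length one the factor is the inverse of zero, which is zero by
    convention; those words are supplied by \<open>proj_one\<close> instead.\<close>
  define W :: "('v word \<Rightarrow>\<^sub>0 'k) \<Rightarrow> ('v word \<Rightarrow>\<^sub>0 'k)"
    where "W = lin_ext (\<lambda>w. fscale (inverse (2 ^ length w - 2)) (gen w))"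
  have W: "q \<in> sym_rel V \<Longrightarrow> W q \<in> sym_rel V" for q
    unfolding W_def
    by (rule sym_compatD[OF sym_compat_scale_fun[OF subspace_sym_rel sym_compat_gen]]) auto
  have flW: "flin W" by (simp add: W_def)
  have fl: "flin (\<lambda>p. W (multip (coprod p)) + proj_one p - p)"
    by (intro flin_diff flin_add flin_id flin_comp[OF flW] flin_comp[OF flin_multip]) simp_all
  have "W (multip (coprod p)) + proj_one p - p \<in> sym_rel V"
    using p unfolding sym_free_def
  proof (rule flin_span[OF fl subspace_sym_rel, rotated], elim imageE)
    fix x :: "'v word \<Rightarrow>\<^sub>0 'k" and w assume x: "x = gen w" and w: "w \<in> words V"
    \<comment> \<open>Characteristic zero enters here: the distinct natural numbers 2^n and 2 stay
      distinct in the field.\<close>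
    have pow: "(2::'k) ^ length w - 2 \<noteq> 0" if "length w \<noteq> 1"
    proof -
      have "length w \<noteq> 0" using w by (simp add: words_iff)
      then have "2 \<le> length w" using that by linarith
      then obtain k where "length w = Suc (Suc k)" by (metis add_2_eq_Suc le_Suc_ex)
      moreover have "of_nat (2 ^ Suc (Suc k)) \<noteq> (of_nat 2 :: 'k)"
        unfolding of_nat_eq_iff using one_less_power[of "2::nat" "Suc k"] by simp
      then have "(2::'k) ^ Suc (Suc k) \<noteq> 2"
        unfolding of_nat_power of_nat_numeral .
      ultimately show ?thesis by (simp only: right_minus_eq not_False_eq_True)
    qed
    have "W (multip (coprod x) - fscale (2 ^ length w - 2) (gen w)) \<in> sym_rel V"
      unfolding x by (rule W[OF multip_coprod[OF w]])
    moreover have "W (fscale (2 ^ length w - 2) (gen w)) + proj_one x = x"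
      using pow by (cases "length w = 1") (auto simp: x W_def flin_simps proj_one_def)
    then have "x - proj_one x = W (fscale (2 ^ length w - 2) (gen w))"
      by (metis add_diff_cancel_right')
    ultimately have "W (multip (coprod x)) - (x - proj_one x) \<in> sym_rel V"
      unfolding free2.linear_diff[OF flW] by (simp only:)
    then show "W (multip (coprod x)) + proj_one x - x \<in> sym_rel V"
      by (simp only: diff_diff_eq2)
  qed
  then have "p - (W (multip (coprod p)) + proj_one p) \<in> sym_rel V"
    by (rule cong_sym[OF subspace_sym_rel])
  moreover have "W (multip (coprod p)) + proj_one p \<in> sym_rel V"
    by (intro free.subspace_add subspace_sym_rel W multip_tens_rel c o)
  ultimately show ?thesis
    by (rule cong_in[OF subspace_sym_rel])
qed

text \<open>Induction on word length for an error term \<open>E\<close>. In the applications the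
  coproduct of \<open>E\<close> on a word involves \<open>E\<close> only on shorter words, and
  \<open>coprod_kernel\<close> does the rest.\<close>

lemma sym_rel_unique:
  assumes "\<And>w. w \<in> words V \<Longrightarrow> E (gen w) \<in> sym_free V'"
    and "\<And>w. w \<in> words V \<Longrightarrow> proj_one (E (gen w)) \<in> sym_rel V'"
    and "\<And>w. w \<in> words V \<Longrightarrow> (\<And>u. u \<in> words V \<Longrightarrow> length u < length w \<Longrightarrow> E (gen u) \<in> sym_rel V') \<Longrightarrow>
      coprod (E (gen w)) \<in> tens_rel V'"
    and "w \<in> words V"
  shows "E (gen w) \<in> sym_rel V'"
  using assms(4)
proof (induction w rule: length_induct)
  case (1 w)
  then show ?case
    using coprod_kernel[OF assms(1) assms(3) assms(2)] by blast
qed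

section \<open>Rigidity of coderivations, coalgebra maps and their composites\<close>

section \<open>Uniqueness of coderivations and coalgebra maps\<close>

lemma sym_map_flin: "sym_map V V' e D \<Longrightarrow> flin D"
  by (simp add: sym_map_def)

lemma sym_map_deg:
  "sym_map V V' e D \<Longrightarrow> w \<in> words V \<Longrightarrow> D (gen w) \<in> free.span (gen ` {u \<in> words V'. wdeg u = wdeg w + e})"
  by (simp add: sym_map_def)

lemma sym_map_rel: "sym_map V V' e D \<Longrightarrow> p \<in> sym_rel V \<Longrightarrow> D p \<in> sym_rel V'"
  by (auto simp: sym_map_def)

lemma sym_map_gen: "sym_map V V' e D \<Longrightarrow> w \<in> words V \<Longrightarrow> D (gen w) \<in> sym_free V'"
  unfolding sym_free_def by (rule subsetD[OF free.span_mono sym_map_deg]) auto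

lemma sym_map_free:
  assumes "sym_map V V' e D" "p \<in> sym_free V"
  shows "D p \<in> sym_free V'"
  using assms(2) unfolding sym_free_def[of V]
  by (rule flin_span[OF sym_map_flin[OF assms(1)] subspace_sym_free, rotated])
    (auto intro: sym_map_gen[OF assms(1)])

lemma sym_map_id: "sym_map V V 0 id"
  by (auto simp: sym_map_def free.linear_id intro: free.span_base)

lemma tens_map_coprod:
  "tens_map e f g (coprod (gen w)) =
    ush w (\<lambda>u v. if u = [] \<or> v = [] then 0 else fscale (ksgn e (wdeg u)) (tens (f (gen u)) (g (gen v))))"
  unfolding coprod_gen ush_linear[OF flin_tens_map]
  by (rule ush_cong) (auto simp: free2.linear_0[OF flin_tens_map], simp add: tens_map_def)

text \<open>With both parts nonempty each is strictly shorter than \<open>w\<close>; this is what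
  makes induction hypotheses on the length applicable.\<close>

lemma reduced_ush_in:
  assumes "free.subspace S" "w \<in> words V"
    and "\<And>u v. u \<in> words V \<Longrightarrow> v \<in> words V \<Longrightarrow> length u < length w \<Longrightarrow> length v < length w \<Longrightarrow> G u v \<in> S"
  shows "ush w (\<lambda>u v. if u = [] \<or> v = [] then 0 else G u v) \<in> S"
proof (rule ush_in[OF assms(1)])
  fix u v assume s: "w \<in> shuffles u v"
  show "(if u = [] \<or> v = [] then 0 else G u v) \<in> S"
  proof (cases "u = [] \<or> v = []")
    case False
    moreover have "length w = length u + length v" using s by (rule length_shuffles)
    ultimately show ?thesis
      using s assms(2) words0_shuffles[of w V u v] by (auto intro!: assms(3) simp: words_iff)
  qed (simp add: free.subspace_0[OF assms(1)])
qed

lemma tens_rel_left: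
  assumes "p \<in> sym_rel V" "q \<in> sym_free V"
  shows "tens p q \<in> tens_rel V"
  using assms(2) unfolding sym_free_def
  by (rule flin_span[OF flin_tens_right subspace_tens_rel, rotated])
    (use assms(1) in \<open>auto simp: tens_rel_def intro!: free.span_base\<close>)

lemma tens_rel_right:
  assumes "p \<in> sym_rel V" "q \<in> sym_free V"
  shows "tens q p \<in> tens_rel V"
  using assms(2) unfolding sym_free_def
  by (rule flin_span[OF flin_tens_left subspace_tens_rel, rotated])
    (use assms(1) in \<open>auto simp: tens_rel_def intro!: free.span_base\<close>)

lemma tens_map_gen [simp]:
  "tens_map e f g (gen (u, v)) = fscale (ksgn e (wdeg u)) (tens (f (gen u)) (g (gen v)))"
  by (simp add: tens_map_def)

lemma tens_map_tens_gen:
  assumes "flin f" "flin g"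
  shows "tens_map e f g (tens (gen a) q) = fscale (ksgn e (wdeg a)) (tens (f (gen a)) (g q))"
  by (rule flin_eqI) (auto intro!: flin_comp[OF flin_tens_map] flin_tens_right flin_fscale flin_comp[OF flin_tens_right] assms)

lemma tens_map_tens:
  assumes "flin f" "flin g" "p \<in> free.span (gen ` {u. wdeg u = d})"
  shows "tens_map e f g (tens p q) = fscale (ksgn e d) (tens (f p) (g q))"
  using assms(3)
  by (rule flin_span_eq[rotated -1])
    (auto intro!: flin_comp[OF flin_tens_map] flin_tens_left flin_fscale flin_comp[OF flin_tens_left]
      simp: assms tens_map_tens_gen)

lemma tens_map_zero_tens:
  assumes "flin f" "flin g"
  shows "tens_map 0 f g (tens p q) = tens (f p) (g q)"
  by (rule flin_eqI)
    (auto intro!: flin_comp[OF flin_tens_map] flin_tens_left flin_fscale flin_comp[OF flin_tens_left]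
      simp: assms tens_map_tens_gen)

lemma tens_map_rel:
  fixes V :: "('k::field_char_0, 'v) gspace"
  assumes f: "sym_map V V' a f" and g: "sym_map V V' b g" and t: "t \<in> tens_rel V"
  shows "tens_map e f g t \<in> tens_rel V'"
  using t unfolding tens_rel_def[of V]
proof (rule flin_span[OF flin_tens_map subspace_tens_rel, rotated])
  note [simp] = sym_map_flin[OF f] sym_map_flin[OF g]
  fix x assume "x \<in> {tens p (gen w) | p w. p \<in> sym_rel V \<and> w \<in> words V} \<union>
                {tens (gen w) p | p w. p \<in> sym_rel V \<and> w \<in> words V}"
  then show "tens_map e f g x \<in> tens_rel V'"
  proof (elim UnE CollectE exE conjE)
    fix p w assume *: "x = tens p (gen w)" "p \<in> sym_rel V" "w \<in> words V"
    \<comment> \<open>\<open>s\<close> multiplies every word by the sign that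
      \<open>tens_map\<close> attaches to it. Relations are homogeneous, so \<open>s\<close>
      preserves them and the sign can be moved into the left factor.\<close>
    define s where "s = lin_ext (\<lambda>a :: 'v word. fscale (ksgn e (wdeg a)) (gen a :: _ \<Rightarrow>\<^sub>0 'k))"
    have s: "flin s" "s p \<in> sym_rel V"
      using sym_compatD[OF sym_compat_scale_fun[OF subspace_sym_rel sym_compat_gen] *(2)]
      by (auto simp: s_def ksgn_add_right mult_ac)
    have "tens_map e f g x = tens (f (s p)) (g (gen w))"
      unfolding *(1)
      by (rule flin_eqI[OF flin_comp[OF flin_tens_map flin_tens_left]
            flin_comp[OF flin_tens_left flin_comp[OF sym_map_flin[OF f] s(1)]]])
        (simp add: tens_map_tens_gen s_def free2.linear_scale[OF sym_map_flin[OF f]] tens_simps)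
    then show ?thesis
      using * s by (auto intro!: tens_rel_left sym_map_rel[OF f] sym_map_gen[OF g])
  next
    fix p w assume *: "x = tens (gen w) p" "p \<in> sym_rel V" "w \<in> words V"
    then show ?thesis
      by (auto simp: tens_map_tens_gen intro!: free.subspace_scale tens_rel_right sym_map_rel[OF g] sym_map_gen[OF f])
  qed
qed

lemma sym_free_extend:
  assumes "flin E" "\<And>w. w \<in> words V \<Longrightarrow> E (gen w) \<in> sym_rel V'" "p \<in> sym_free V"
  shows "E p \<in> sym_rel V'"
  using assms(3) unfolding sym_free_def
  by (rule flin_span[OF assms(1) subspace_sym_rel, rotated]) (use assms(2) in auto)

lemma coderivation_sym_map: "coderivation V e D \<Longrightarrow> sym_map V V e D"
  by (simp add: coderivation_def)

lemma coalgebra_map_sym_map: "coalgebra_map V V' F \<Longrightarrow> sym_map V V' 0 F"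
  by (simp add: coalgebra_map_def)

lemma coderivation_coprod:
  assumes "coderivation V e D" "p \<in> sym_free V"
  shows "coprod (D p) - (tens_map 0 D id (coprod p) + tens_map e id D (coprod p)) \<in> tens_rel V"
  using assms by (simp add: coderivation_def)

lemma coalgebra_map_coprod:
  assumes "coalgebra_map V V' F" "p \<in> sym_free V"
  shows "coprod (F p) - tens_map 0 F F (coprod p) \<in> tens_rel V'"
  using assms by (simp add: coalgebra_map_def)

text \<open>The difference of two coderivations of the same degree is a coderivation, so its
  coproduct on a word is governed by its values on shorter words.\<close>

lemma coderivation_unique:
  assumes D: "coderivation V e D" and D': "coderivation V e D'"
    and c: "\<And>w. w \<in> words V \<Longrightarrow> proj_one (D (gen w)) - proj_one (D' (gen w)) \<in> sym_rel V"
    and p: "p \<in> sym_free V"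
  shows "D p - D' p \<in> sym_rel V"
proof (rule sym_free_extend[OF _ _ p])
  note DD = coderivation_sym_map[OF D] coderivation_sym_map[OF D']
  note fl = sym_map_flin[OF DD(1)] sym_map_flin[OF DD(2)]
  show "flin (\<lambda>p. D p - D' p)" by (intro flin_diff fl)
  fix w assume "w \<in> words V"
  then show "D (gen w) - D' (gen w) \<in> sym_rel V"
  proof (rule sym_rel_unique[rotated -1])
    fix w assume w: "w \<in> words V"
    show "D (gen w) - D' (gen w) \<in> sym_free V"
      by (intro free.subspace_diff subspace_sym_free sym_map_gen[OF DD(1)] sym_map_gen[OF DD(2)] w)
    show "proj_one (D (gen w) - D' (gen w)) \<in> sym_rel V"
      using c[OF w] by (simp add: flin_simps)
    assume IH: "\<And>u. u \<in> words V \<Longrightarrow> length u < length w \<Longrightarrow> D (gen u) - D' (gen u) \<in> sym_rel V"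
    have "coprod (D (gen w) - D' (gen w)) -
       ((tens_map 0 D id (coprod (gen w)) + tens_map e id D (coprod (gen w)))
       - (tens_map 0 D' id (coprod (gen w)) + tens_map e id D' (coprod (gen w)))) \<in> tens_rel V"
      unfolding free2.linear_diff[OF flin_coprod]
      by (intro cong_diff subspace_tens_rel coderivation_coprod[OF D] coderivation_coprod[OF D'] gen_sym_free w)
    moreover have "(tens_map 0 D id (coprod (gen w)) + tens_map e id D (coprod (gen w)))
       - (tens_map 0 D' id (coprod (gen w)) + tens_map e id D' (coprod (gen w))) \<in> tens_rel V"
    proof -
      have "(tens_map 0 D id (coprod (gen w)) + tens_map e id D (coprod (gen w)))
       - (tens_map 0 D' id (coprod (gen w)) + tens_map e id D' (coprod (gen w))) =
       ush w (\<lambda>u v. if u = [] \<or> v = [] then 0 else tens (D (gen u) - D' (gen u)) (gen v)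
          + fscale (ksgn e (wdeg u)) (tens (gen u) (D (gen v) - D' (gen v))))"
        unfolding tens_map_coprod ush_add[symmetric] ush_diff[symmetric]
        by (rule ush_cong) (auto simp: tens_simps free.scale_right_diff_distrib)
      also have "\<dots> \<in> tens_rel V"
        by (rule reduced_ush_in[OF subspace_tens_rel w])
          (auto intro!: free.subspace_add free.subspace_scale tens_rel_left[OF IH] tens_rel_right[OF IH] gen_sym_free)
      finally show ?thesis .
    qed
    ultimately show "coprod (D (gen w) - D' (gen w)) \<in> tens_rel V"
      by (rule cong_in[OF subspace_tens_rel])
  qed
qed

text \<open>\<open>F - G\<close> is not a coalgebra map, but \<open>F\<close> tensor
  \<open>F\<close> minus \<open>G\<close> tensor \<open>G\<close> is \<open>F - G\<close> tensor
  \<open>F\<close> plus \<open>G\<close> tensor \<open>F - G\<close>, and each term contains the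
  error on a shorter word.\<close>

lemma coalgebra_map_unique:
  assumes F: "coalgebra_map V V' F" and G: "coalgebra_map V V' G"
    and c: "\<And>w. w \<in> words V \<Longrightarrow> proj_one (F (gen w)) - proj_one (G (gen w)) \<in> sym_rel V'"
    and p: "p \<in> sym_free V"
  shows "F p - G p \<in> sym_rel V'"
proof (rule sym_free_extend[OF _ _ p])
  note FG = coalgebra_map_sym_map[OF F] coalgebra_map_sym_map[OF G]
  note fl = sym_map_flin[OF FG(1)] sym_map_flin[OF FG(2)]
  show "flin (\<lambda>p. F p - G p)" by (intro flin_diff fl)
  fix w assume "w \<in> words V"
  then show "F (gen w) - G (gen w) \<in> sym_rel V'"
  proof (rule sym_rel_unique[rotated -1])
    fix w assume w: "w \<in> words V"
    show "F (gen w) - G (gen w) \<in> sym_free V'"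
      by (intro free.subspace_diff subspace_sym_free sym_map_gen[OF FG(1)] sym_map_gen[OF FG(2)] w)
    show "proj_one (F (gen w) - G (gen w)) \<in> sym_rel V'"
      using c[OF w] by (simp add: flin_simps)
    assume IH: "\<And>u. u \<in> words V \<Longrightarrow> length u < length w \<Longrightarrow> F (gen u) - G (gen u) \<in> sym_rel V'"
    have "coprod (F (gen w) - G (gen w)) -
       (tens_map 0 F F (coprod (gen w)) - tens_map 0 G G (coprod (gen w))) \<in> tens_rel V'"
      unfolding free2.linear_diff[OF flin_coprod]
      by (intro cong_diff subspace_tens_rel coalgebra_map_coprod[OF F] coalgebra_map_coprod[OF G] gen_sym_free w)
    moreover have "tens_map 0 F F (coprod (gen w)) - tens_map 0 G G (coprod (gen w)) \<in> tens_rel V'"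
    proof -
      have "tens_map 0 F F (coprod (gen w)) - tens_map 0 G G (coprod (gen w)) =
       ush w (\<lambda>u v. if u = [] \<or> v = [] then 0 else tens (F (gen u) - G (gen u)) (F (gen v))
          + tens (G (gen u)) (F (gen v) - G (gen v)))"
        unfolding tens_map_coprod ush_add[symmetric] ush_diff[symmetric]
        by (rule ush_cong) (auto simp: tens_simps)
      also have "\<dots> \<in> tens_rel V'"
        by (rule reduced_ush_in[OF subspace_tens_rel w])
          (auto intro!: free.subspace_add tens_rel_left[OF IH] tens_rel_right[OF IH]
            sym_map_gen[OF FG(1)] sym_map_gen[OF FG(2)])
      finally show ?thesis .
    qed
    ultimately show "coprod (F (gen w) - G (gen w)) \<in> tens_rel V'"
      by (rule cong_in[OF subspace_tens_rel])
  qed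
qed

lemma span_wdeg: "p \<in> free.span (gen ` {u \<in> A. wdeg u = d}) \<Longrightarrow> p \<in> free.span (gen ` {u. wdeg u = d})"
  using free.span_mono[of "gen ` {u \<in> A. wdeg u = d}" "gen ` {u. wdeg u = d}"] by blast

text \<open>One half of the fact that the defect of intertwining is a coderivation along
  \<open>F\<close>; the next lemma treats the other order of composition.\<close>

lemma coprod_coderivation_coalgebra_map:
  assumes F: "coalgebra_map V V' F" and D: "coderivation V e D" and w: "w \<in> words V"
  shows "coprod (F (D (gen w))) - ush w (\<lambda>u v. if u = [] \<or> v = [] then 0 else
      tens (F (D (gen u))) (F (gen v)) + fscale (ksgn e (wdeg u)) (tens (F (gen u)) (F (D (gen v)))))
    \<in> tens_rel V'"
proof -
  note F' = coalgebra_map_sym_map[OF F] and D' = coderivation_sym_map[OF D]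
  note [simp] = sym_map_flin[OF F']
  have 1: "coprod (F (D (gen w))) - tens_map 0 F F (coprod (D (gen w))) \<in> tens_rel V'"
    by (intro coalgebra_map_coprod[OF F] sym_map_gen[OF D'] w)
  have 2: "tens_map 0 F F (coprod (D (gen w))) - tens_map 0 F F (tens_map 0 D id (coprod (gen w)) + tens_map e id D (coprod (gen w))) \<in> tens_rel V'"
    unfolding free2.linear_diff[OF flin_tens_map, symmetric]
    by (intro tens_map_rel[OF F' F'] coderivation_coprod[OF D] gen_sym_free w)
  have 3: "tens_map 0 F F (tens_map 0 D id (coprod (gen w)) + tens_map e id D (coprod (gen w))) =
      ush w (\<lambda>u v. if u = [] \<or> v = [] then 0 else
      tens (F (D (gen u))) (F (gen v)) + fscale (ksgn e (wdeg u)) (tens (F (gen u)) (F (D (gen v)))))"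
    unfolding tens_map_coprod ush_add[symmetric] ush_linear[OF flin_tens_map]
    by (rule ush_cong) (auto simp: flin_simps tens_map_zero_tens)
  show ?thesis using cong_trans[OF subspace_tens_rel 1 2] unfolding 3 .
qed

lemma coprod_coalgebra_map_coderivation:
  assumes F: "coalgebra_map V V' F" and D: "coderivation V' e D" and w: "w \<in> words V"
  shows "coprod (D (F (gen w))) - ush w (\<lambda>u v. if u = [] \<or> v = [] then 0 else
      tens (D (F (gen u))) (F (gen v)) + fscale (ksgn e (wdeg u)) (tens (F (gen u)) (D (F (gen v)))))
    \<in> tens_rel V'"
proof -
  note F' = coalgebra_map_sym_map[OF F] and D' = coderivation_sym_map[OF D]
  note [simp] = sym_map_flin[OF D'] sym_map_flin[OF sym_map_id]
  have 1: "coprod (D (F (gen w))) - (tens_map 0 D id (coprod (F (gen w))) + tens_map e id D (coprod (F (gen w)))) \<in> tens_rel V'"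
    by (intro coderivation_coprod[OF D] sym_map_gen[OF F'] w)
  have 2: "(tens_map 0 D id (coprod (F (gen w))) + tens_map e id D (coprod (F (gen w))))
      - (tens_map 0 D id (tens_map 0 F F (coprod (gen w))) + tens_map e id D (tens_map 0 F F (coprod (gen w)))) \<in> tens_rel V'"
    by (intro cong_add subspace_tens_rel; unfold free2.linear_diff[OF flin_tens_map, symmetric];
        intro tens_map_rel[OF D' sym_map_id] tens_map_rel[OF sym_map_id D'] coalgebra_map_coprod[OF F] gen_sym_free w)
  have 3: "tens_map 0 D id (tens_map 0 F F (coprod (gen w))) + tens_map e id D (tens_map 0 F F (coprod (gen w))) =
      ush w (\<lambda>u v. if u = [] \<or> v = [] then 0 else
      tens (D (F (gen u))) (F (gen v)) + fscale (ksgn e (wdeg u)) (tens (F (gen u)) (D (F (gen v)))))"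
    unfolding tens_map_coprod ush_linear[OF flin_tens_map] ush_add[symmetric]
  proof (rule ush_cong[OF refl])
    fix u v assume "w \<in> shuffles u v"
    then have "u \<noteq> [] \<Longrightarrow> u \<in> words V" using w words0_shuffles[of w V u v] by (auto simp: words_iff)
    \<comment> \<open>\<open>F\<close> preserves degrees, so \<open>D\<close> passes
      \<open>F (gen u)\<close> at the same sign as it passes \<open>u\<close>.\<close>
    then have "u \<noteq> [] \<Longrightarrow> F (gen u) \<in> free.span (gen ` {x. wdeg x = wdeg u})"
      using sym_map_deg[OF F'] span_wdeg by fastforce
    then show "tens_map 0 D id (if u = [] \<or> v = [] then 0 else fscale (ksgn 0 (wdeg u)) (tens (F (gen u)) (F (gen v)))) +
      tens_map e id D (if u = [] \<or> v = [] then 0 else fscale (ksgn 0 (wdeg u)) (tens (F (gen u)) (F (gen v)))) =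
      (if u = [] \<or> v = [] then 0 else
      tens (D (F (gen u))) (F (gen v)) + fscale (ksgn e (wdeg u)) (tens (F (gen u)) (D (F (gen v)))))"
      by (auto simp: flin_simps tens_map_zero_tens tens_map_tens)
  qed
  show ?thesis using cong_trans[OF subspace_tens_rel 1 2] unfolding 3 .
qed

text \<open>Both composites satisfy the same Leibniz rule along \<open>F\<close>, hence so does
  their difference, which vanishes once its component does.\<close>

lemma intertwine_unique:
  assumes F: "coalgebra_map V V' F" and D: "coderivation V e D" and D': "coderivation V' e D'"
    and c: "\<And>w. w \<in> words V \<Longrightarrow> proj_one (F (D (gen w))) - proj_one (D' (F (gen w))) \<in> sym_rel V'"
    and p: "p \<in> sym_free V"
  shows "F (D p) - D' (F p) \<in> sym_rel V'"
proof (rule sym_free_extend[OF _ _ p])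
  note sm = coalgebra_map_sym_map[OF F] coderivation_sym_map[OF D] coderivation_sym_map[OF D']
  note fl = sm[THEN sym_map_flin]
  show "flin (\<lambda>p. F (D p) - D' (F p))" by (intro flin_diff flin_comp[OF fl(1) fl(2)] flin_comp[OF fl(3) fl(1)])
  fix w assume "w \<in> words V"
  then show "F (D (gen w)) - D' (F (gen w)) \<in> sym_rel V'"
  proof (rule sym_rel_unique[rotated -1])
    fix w assume w: "w \<in> words V"
    show "F (D (gen w)) - D' (F (gen w)) \<in> sym_free V'"
      by (intro free.subspace_diff subspace_sym_free sym_map_free[OF sm(1)] sym_map_free[OF sm(2)]
          sym_map_free[OF sm(3)] gen_sym_free w)
    show "proj_one (F (D (gen w)) - D' (F (gen w))) \<in> sym_rel V'"
      using c[OF w] by (simp add: flin_simps)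
    assume IH: "\<And>u. u \<in> words V \<Longrightarrow> length u < length w \<Longrightarrow> F (D (gen u)) - D' (F (gen u)) \<in> sym_rel V'"
    have "coprod (F (D (gen w)) - D' (F (gen w))) -
       (ush w (\<lambda>u v. if u = [] \<or> v = [] then 0 else
      tens (F (D (gen u))) (F (gen v)) + fscale (ksgn e (wdeg u)) (tens (F (gen u)) (F (D (gen v)))))
      - ush w (\<lambda>u v. if u = [] \<or> v = [] then 0 else
      tens (D' (F (gen u))) (F (gen v)) + fscale (ksgn e (wdeg u)) (tens (F (gen u)) (D' (F (gen v)))))) \<in> tens_rel V'"
      unfolding free2.linear_diff[OF flin_coprod]
      by (intro cong_diff subspace_tens_rel coprod_coderivation_coalgebra_map[OF F D]
          coprod_coalgebra_map_coderivation[OF F D'] w)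
    moreover have "ush w (\<lambda>u v. if u = [] \<or> v = [] then 0 else
      tens (F (D (gen u))) (F (gen v)) + fscale (ksgn e (wdeg u)) (tens (F (gen u)) (F (D (gen v)))))
      - ush w (\<lambda>u v. if u = [] \<or> v = [] then 0 else
      tens (D' (F (gen u))) (F (gen v)) + fscale (ksgn e (wdeg u)) (tens (F (gen u)) (D' (F (gen v))))) \<in> tens_rel V'"
      (is "?l \<in> _")
    proof -
      have "?l = ush w (\<lambda>u v. if u = [] \<or> v = [] then 0 else
          tens (F (D (gen u)) - D' (F (gen u))) (F (gen v))
          + fscale (ksgn e (wdeg u)) (tens (F (gen u)) (F (D (gen v)) - D' (F (gen v)))))"
        unfolding ush_diff[symmetric]
        by (rule ush_cong) (auto simp: tens_simps free.scale_right_diff_distrib)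
      also have "\<dots> \<in> tens_rel V'"
        by (rule reduced_ush_in[OF subspace_tens_rel w])
          (auto intro!: free.subspace_add free.subspace_scale tens_rel_left[OF IH] tens_rel_right[OF IH]
            sym_map_gen[OF sm(1)])
      finally show ?thesis .
    qed
    ultimately show "coprod (F (D (gen w)) - D' (F (gen w))) \<in> tens_rel V'"
      by (rule cong_in[OF subspace_tens_rel])
  qed
qed

text \<open>In odd degree the mixed terms in the coproduct of the square cancel, so the square of a
  coderivation is again a coderivation.\<close>

lemma square_zero_unique:
  assumes D: "coderivation V e D" and e: "odd e"
    and c: "\<And>w. w \<in> words V \<Longrightarrow> proj_one (D (D (gen w))) \<in> sym_rel V"
    and p: "p \<in> sym_free V"
  shows "D (D p) \<in> sym_rel V"
proof (rule sym_free_extend[OF _ _ p])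
  note sm = coderivation_sym_map[OF D]
  note fl = sm[THEN sym_map_flin]
  note [simp] = fl sym_map_flin[OF sym_map_id]
  show "flin (\<lambda>p. D (D p))" by (rule flin_comp[OF fl fl])
  fix w assume "w \<in> words V"
  then show "D (D (gen w)) \<in> sym_rel V"
  proof (rule sym_rel_unique[rotated -1])
    fix w assume w: "w \<in> words V"
    show "D (D (gen w)) \<in> sym_free V"
      by (intro sym_map_free[OF sm] gen_sym_free w)
    show "proj_one (D (D (gen w))) \<in> sym_rel V"
      by (rule c[OF w])
    assume IH: "\<And>u. u \<in> words V \<Longrightarrow> length u < length w \<Longrightarrow> D (D (gen u)) \<in> sym_rel V"
    have 1: "coprod (D (D (gen w))) - (tens_map 0 D id (coprod (D (gen w))) + tens_map e id D (coprod (D (gen w)))) \<in> tens_rel V"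
      by (intro coderivation_coprod[OF D] sym_map_gen[OF sm] w)
    have 2: "(tens_map 0 D id (coprod (D (gen w))) + tens_map e id D (coprod (D (gen w)))) -
        (tens_map 0 D id (tens_map 0 D id (coprod (gen w)) + tens_map e id D (coprod (gen w)))
        + tens_map e id D (tens_map 0 D id (coprod (gen w)) + tens_map e id D (coprod (gen w)))) \<in> tens_rel V"
      by (intro cong_add subspace_tens_rel; unfold free2.linear_diff[OF flin_tens_map, symmetric];
        intro tens_map_rel[OF sm sym_map_id] tens_map_rel[OF sym_map_id sm] coderivation_coprod[OF D] gen_sym_free w)
    have 3: "tens_map 0 D id (tens_map 0 D id (coprod (gen w)) + tens_map e id D (coprod (gen w)))
        + tens_map e id D (tens_map 0 D id (coprod (gen w)) + tens_map e id D (coprod (gen w))) =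
        ush w (\<lambda>u v. if u = [] \<or> v = [] then 0 else
          tens (D (D (gen u))) (gen v) + tens (gen u) (D (D (gen v))))"
      unfolding tens_map_coprod ush_linear[OF flin_tens_map] ush_add[symmetric]
    proof (rule ush_cong[OF refl])
      fix u v assume "w \<in> shuffles u v"
      then have "u \<noteq> [] \<Longrightarrow> u \<in> words V" using w words0_shuffles[of w V u v] by (auto simp: words_iff)
      then have d: "u \<noteq> [] \<Longrightarrow> D (gen u) \<in> free.span (gen ` {x. wdeg x = wdeg u + e})"
        using sym_map_deg[OF sm] span_wdeg by fastforce
      have g: "gen u \<in> free.span (gen ` {x. wdeg x = wdeg u})"
        by (rule free.span_base) auto
      \<comment> \<open>Passing \<open>D (gen u)\<close> instead of \<open>u\<close> adds the odd
        number \<open>e\<close> to the degree; the sign flips, and the two mixed terms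
        cancel.\<close>
      have s: "ksgn e (wdeg u + e) = (- ksgn e (wdeg u) :: 'b)"
        using e by (auto simp: ksgn_def)
      show "tens_map 0 D id ((if u = [] \<or> v = [] then 0 else fscale (ksgn 0 (wdeg u)) (tens (D (gen u)) (id (gen v))))
          + (if u = [] \<or> v = [] then 0 else fscale (ksgn e (wdeg u)) (tens (id (gen u)) (D (gen v))))) +
        tens_map e id D ((if u = [] \<or> v = [] then 0 else fscale (ksgn 0 (wdeg u)) (tens (D (gen u)) (id (gen v))))
          + (if u = [] \<or> v = [] then 0 else fscale (ksgn e (wdeg u)) (tens (id (gen u)) (D (gen v))))) =
        (if u = [] \<or> v = [] then 0 else
          tens (D (D (gen u))) (gen v) + tens (gen u) (D (D (gen v))))"
        by (auto simp: flin_simps tens_map_zero_tens tens_map_tens_gen tens_map_tens[OF _ _ d] s)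
    qed
    have 4: "ush w (\<lambda>u v. if u = [] \<or> v = [] then 0 else
          tens (D (D (gen u))) (gen v) + tens (gen u) (D (D (gen v)))) \<in> tens_rel V"
      by (rule reduced_ush_in[OF subspace_tens_rel w])
          (auto intro!: free.subspace_add tens_rel_left[OF IH] tens_rel_right[OF IH] gen_sym_free)
    show "coprod (D (D (gen w))) \<in> tens_rel V"
      using cong_in[OF subspace_tens_rel cong_trans[OF subspace_tens_rel 1 2[unfolded 3]] 4] .
  qed
qed

section \<open>Explicit coderivations and coalgebra maps with prescribed components\<close>

section \<open>Coderivations and coalgebra maps with given components\<close>

text \<open>The counterpart of \<open>skew_maps\<close> after suspension: symmetric instead of skew,
  and of one degree \<open>e\<close> for all word lengths.\<close>

definition sym_maps ::
    "('k::field_char_0, 'v) gspace \<Rightarrow> ('k, 'w) gspace \<Rightarrow> int \<Rightarrow> ('v word \<Rightarrow> 'w) \<Rightarrow> bool" where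
  "sym_maps V W e \<phi> \<longleftrightarrow>
     (\<forall>w \<in> words V. \<phi> w \<in> carrier (W (wdeg w + e))) \<and>
     (\<forall>u v i x y. u \<in> words0 V \<longrightarrow> v \<in> words0 V \<longrightarrow> x \<in> carrier (V i) \<longrightarrow> y \<in> carrier (V i) \<longrightarrow>
        \<phi> (u @ (i, x \<oplus>\<^bsub>V i\<^esub> y) # v) =
          \<phi> (u @ (i, x) # v) \<oplus>\<^bsub>W (wdeg u + (i + wdeg v) + e)\<^esub> \<phi> (u @ (i, y) # v)) \<and>
     (\<forall>u v i x c. u \<in> words0 V \<longrightarrow> v \<in> words0 V \<longrightarrow> x \<in> carrier (V i) \<longrightarrow>
        \<phi> (u @ (i, c \<odot>\<^bsub>V i\<^esub> x) # v) = c \<odot>\<^bsub>W (wdeg u + (i + wdeg v) + e)\<^esub> \<phi> (u @ (i, x) # v)) \<and>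
     (\<forall>u v i x j y. u \<in> words0 V \<longrightarrow> v \<in> words0 V \<longrightarrow> x \<in> carrier (V i) \<longrightarrow> y \<in> carrier (V j) \<longrightarrow>
        \<phi> (u @ (i, x) # (j, y) # v) =
          ksgn i j \<odot>\<^bsub>W (wdeg u + (i + (j + wdeg v)) + e)\<^esub> \<phi> (u @ (j, y) # (i, x) # v))"

lemma sym_maps_closed: "sym_maps V W e \<phi> \<Longrightarrow> w \<in> words V \<Longrightarrow> \<phi> w \<in> carrier (W (wdeg w + e))"
  by (simp add: sym_maps_def)

lemma sym_maps_add:
  assumes "sym_maps V W e \<phi>" "u \<in> words0 V" "v \<in> words0 V" "x \<in> carrier (V i)" "y \<in> carrier (V i)"
  shows "\<phi> (u @ (i, x \<oplus>\<^bsub>V i\<^esub> y) # v) =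
    \<phi> (u @ (i, x) # v) \<oplus>\<^bsub>W (wdeg u + (i + wdeg v) + e)\<^esub> \<phi> (u @ (i, y) # v)"
  using assms unfolding sym_maps_def by blast

lemma sym_maps_smult:
  assumes "sym_maps V W e \<phi>" "u \<in> words0 V" "v \<in> words0 V" "x \<in> carrier (V i)"
  shows "\<phi> (u @ (i, c \<odot>\<^bsub>V i\<^esub> x) # v) = c \<odot>\<^bsub>W (wdeg u + (i + wdeg v) + e)\<^esub> \<phi> (u @ (i, x) # v)"
  using assms unfolding sym_maps_def by blast

lemma sym_maps_swap:
  assumes "sym_maps V W e \<phi>" "u \<in> words0 V" "v \<in> words0 V" "x \<in> carrier (V i)" "y \<in> carrier (V j)"
  shows "\<phi> (u @ (i, x) # (j, y) # v) =
    ksgn i j \<odot>\<^bsub>W (wdeg u + (i + (j + wdeg v)) + e)\<^esub> \<phi> (u @ (j, y) # (i, x) # v)"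
  using assms unfolding sym_maps_def by blast

lemma sym_compat_letter:
  assumes "sym_maps V W e \<phi>" "a \<in> words0 W" "b \<in> words0 W"
  shows "sym_compat V (sym_rel W) (\<lambda>u. gen (a @ (wdeg u + e, \<phi> u) # b))"
proof (rule sym_compatI)
  fix u v i x y
  assume *: "u \<in> words0 V" "v \<in> words0 V" "x \<in> carrier (V i)" "y \<in> carrier (V i)"
  then have "\<phi> (u @ (i, x) # v) \<in> carrier (W (wdeg u + (i + wdeg v) + e))"
    "\<phi> (u @ (i, y) # v) \<in> carrier (W (wdeg u + (i + wdeg v) + e))"
    using sym_maps_closed[OF assms(1), of "u @ (i, x) # v"] sym_maps_closed[OF assms(1), of "u @ (i, y) # v"]
    by (auto simp: words_iff)
  then show "gen (a @ (wdeg (u @ (i, x \<oplus>\<^bsub>V i\<^esub> y) # v) + e, \<phi> (u @ (i, x \<oplus>\<^bsub>V i\<^esub> y) # v)) # b) -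
       gen (a @ (wdeg (u @ (i, x) # v) + e, \<phi> (u @ (i, x) # v)) # b) -
       gen (a @ (wdeg (u @ (i, y) # v) + e, \<phi> (u @ (i, y) # v)) # b) \<in> sym_rel W"
    unfolding sym_maps_add[OF assms(1) *] using sym_rel_add[OF assms(2,3)] by simp
next
  fix u v i x c
  assume *: "u \<in> words0 V" "v \<in> words0 V" "x \<in> carrier (V i)"
  then have "\<phi> (u @ (i, x) # v) \<in> carrier (W (wdeg u + (i + wdeg v) + e))"
    using sym_maps_closed[OF assms(1), of "u @ (i, x) # v"]
    by (auto simp: words_iff)
  then show "gen (a @ (wdeg (u @ (i, c \<odot>\<^bsub>V i\<^esub> x) # v) + e, \<phi> (u @ (i, c \<odot>\<^bsub>V i\<^esub> x) # v)) # b) -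
       fscale c (gen (a @ (wdeg (u @ (i, x) # v) + e, \<phi> (u @ (i, x) # v)) # b)) \<in> sym_rel W"
    unfolding sym_maps_smult[OF assms(1) *] using sym_rel_smult[OF assms(2,3)] by simp
next
  fix u v i x j y
  assume *: "u \<in> words0 V" "v \<in> words0 V" "x \<in> carrier (V i)" "y \<in> carrier (V j)"
  then have "\<phi> (u @ (j, y) # (i, x) # v) \<in> carrier (W (wdeg u + (i + (j + wdeg v)) + e))"
    using sym_maps_closed[OF assms(1), of "u @ (j, y) # (i, x) # v"]
    by (auto simp: words_iff algebra_simps)
  moreover have "wdeg (u @ (j, y) # (i, x) # v) + e = wdeg u + (i + (j + wdeg v)) + e"
    "wdeg (u @ (i, x) # (j, y) # v) + e = wdeg u + (i + (j + wdeg v)) + e"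
    by simp_all
  ultimately show "gen (a @ (wdeg (u @ (i, x) # (j, y) # v) + e, \<phi> (u @ (i, x) # (j, y) # v)) # b) -
       fscale (ksgn i j) (gen (a @ (wdeg (u @ (j, y) # (i, x) # v) + e, \<phi> (u @ (j, y) # (i, x) # v)) # b)) \<in> sym_rel W"
    unfolding sym_maps_swap[OF assms(1) *] by (simp only: sym_rel_smult[OF assms(2,3)])
qed simp

lemma sym_compat_if:
  assumes "free.subspace S" "sym_compat V S G"
  shows "sym_compat V S (\<lambda>w. if w = [] then z else G w)"
  by (rule sym_compatI[OF assms(1)])
    (auto intro: sym_compat_add[OF assms(2)] sym_compat_smult[OF assms(2)] sym_compat_swap[OF assms(2)])

lemma sym_compat_zero: "free.subspace S \<Longrightarrow> sym_compat V S (\<lambda>w. 0)"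
  by (rule sym_compatI) (auto simp: free.subspace_0)

lemma sym_compat_comp:
  assumes "sym_compat V S G" "flin h" "\<And>p. p \<in> S \<Longrightarrow> h p \<in> S'"
  shows "sym_compat V S' (\<lambda>w. h (G w))"
  using assms by (simp add: sym_compat_def lin_ext_comp[symmetric])

text \<open>No relation mixes words of different lengths, so truncations may be tested; this gives
  an induction on length for recursively defined functions.\<close>

lemma sym_compat_by_length:
  assumes S: "free.subspace S" and G: "\<And>n. sym_compat V S (\<lambda>w. if length w \<le> n then G w else 0)"
  shows "sym_compat V S G"
proof (rule sym_compatI[OF S])
  fix u v i x y
  assume "u \<in> words0 V" "v \<in> words0 V" "x \<in> carrier (V i)" "y \<in> carrier (V i)"
  from sym_compat_add[OF G[of "length u + length v + 1"] this]
  show "G (u @ (i, x \<oplus>\<^bsub>V i\<^esub> y) # v) - G (u @ (i, x) # v) - G (u @ (i, y) # v) \<in> S" by simp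
next
  fix u v i x c
  assume "u \<in> words0 V" "v \<in> words0 V" "x \<in> carrier (V i)"
  from sym_compat_smult[OF G[of "length u + length v + 1"] this]
  show "G (u @ (i, c \<odot>\<^bsub>V i\<^esub> x) # v) - fscale c (G (u @ (i, x) # v)) \<in> S" by simp
next
  fix u v i x j y
  assume "u \<in> words0 V" "v \<in> words0 V" "x \<in> carrier (V i)" "y \<in> carrier (V j)"
  from sym_compat_swap[OF G[of "length u + length v + 2"] this]
  show "G (u @ (i, x) # (j, y) # v) - fscale (ksgn i j) (G (u @ (j, y) # (i, x) # v)) \<in> S" by simp
qed

text \<open>Only the unshuffle moving every letter to the left has an empty right part, and its sign
  is trivial.\<close>

lemma ush_right_nil: "ush w (\<lambda>u v. if v = [] then H u else 0) = H w"
proof (induction w arbitrary: H)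
  case (Cons x w)
  from Cons.IH[of "\<lambda>u. H (x # u)"] show ?case by simp
qed simp

text \<open>Cocommutativity applied to the first two parts of an unshuffle into three.\<close>

lemma ush_exchange:
  "ush w (\<lambda>u v. ush v (\<lambda>a b. fscale (ksgn (wdeg u) (wdeg a)) (G a u b))) = ush w (\<lambda>a c. ush c (\<lambda>u b. G a u b))"
proof -
  have "ush w (\<lambda>a c. ush c (\<lambda>u b. G a u b)) = ush w (\<lambda>x b. ush x (\<lambda>a u. G a u b))"
    by (rule ush_assoc)
  also have "\<dots> = ush w (\<lambda>x b. ush x (\<lambda>a u. fscale (ksgn (wdeg a) (wdeg u)) (G u a b)))"
    by (rule ush_cong[OF refl], rule ush_commute)
  also have "\<dots> = ush w (\<lambda>u v. ush v (\<lambda>a b. fscale (ksgn (wdeg u) (wdeg a)) (G a u b)))"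
    by (rule ush_assoc[symmetric])
  finally show ?thesis by simp
qed

text \<open>The coderivation with components \<phi> of degree \<open>e\<close>, in closed form. The
  block is always placed in front, so no sign besides that of the unshuffle occurs.\<close>

definition cod :: "int \<Rightarrow> ('v word \<Rightarrow> 'v) \<Rightarrow> ('v word \<Rightarrow>\<^sub>0 'k::field_char_0) \<Rightarrow> ('v word \<Rightarrow>\<^sub>0 'k)" where
  "cod e \<phi> = lin_ext (\<lambda>w. ush w (\<lambda>u v. if u = [] then 0 else gen ((wdeg u + e, \<phi> u) # v)))"

text \<open>The component alone, with values in words of length one. Algebra and morphism conditions
  are in the end equations between such expressions.\<close>

definition com :: "int \<Rightarrow> ('v word \<Rightarrow> 'w) \<Rightarrow> ('v word \<Rightarrow>\<^sub>0 'k::field_char_0) \<Rightarrow> ('w word \<Rightarrow>\<^sub>0 'k)" where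
  "com e \<phi> = lin_ext (\<lambda>w. if w = [] then 0 else gen [(wdeg w + e, \<phi> w)])"

lemma flin_cod [simp]: "flin (cod e \<phi>)" by (simp add: cod_def)
lemma flin_com [simp]: "flin (com e \<phi>)" by (simp add: com_def)

lemma cod_gen: "cod e \<phi> (gen w) = ush w (\<lambda>u v. if u = [] then 0 else gen ((wdeg u + e, \<phi> u) # v))"
  by (simp add: cod_def)

lemma com_gen: "com e \<phi> (gen w) = (if w = [] then 0 else gen [(wdeg w + e, \<phi> w)])"
  by (simp add: com_def)

lemma proj_one_gen: "proj_one (gen w) = (if length w = 1 then gen w else 0)"
  by (simp add: proj_one_def)

lemma proj_one_cod: "proj_one (cod e \<phi> p) = com e \<phi> p"
proof (rule flin_eqI[OF flin_comp[OF flin_proj_one flin_cod] flin_com])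
  fix w
  have "proj_one (cod e \<phi> (gen w)) =
      ush w (\<lambda>u v. if v = [] then if u = [] then 0 else gen [(wdeg u + e, \<phi> u)] else 0)"
    unfolding cod_gen ush_linear[OF flin_proj_one]
    by (rule ush_cong) (auto simp: proj_one_gen free2.linear_0[OF flin_proj_one])
  then show "proj_one (cod e \<phi> (gen w)) = com e \<phi> (gen w)"
    by (simp add: ush_right_nil com_gen)
qed

lemma com_rel:
  assumes "sym_maps V W e \<phi>" "p \<in> sym_rel V"
  shows "com e \<phi> p \<in> sym_rel W"
  unfolding com_def
  by (rule sym_compatD[OF sym_compat_if assms(2)]) (use sym_compat_letter[OF assms(1), of "[]" "[]"] in simp_all)

lemma sym_map_cod:
  assumes \<phi>: "sym_maps V V e \<phi>"
  shows "sym_map V V e (cod e \<phi>)"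
  unfolding sym_map_def
proof (intro conjI ballI)
  fix w assume w: "w \<in> words V"
  show "cod e \<phi> (gen w) \<in> free.span (gen ` {u \<in> words V. wdeg u = wdeg w + e})"
    unfolding cod_gen
  proof (rule ush_in[OF free.subspace_span])
    fix u v assume s: "w \<in> shuffles u v"
    have "(wdeg u + e, \<phi> u) # v \<in> words V" if "u \<noteq> []"
      using that w words0_shuffles[OF _ s, of V] sym_maps_closed[OF \<phi>, of u] by (auto simp: words_iff)
    then show "(if u = [] then 0 else gen ((wdeg u + e, \<phi> u) # v))
        \<in> free.span (gen ` {u \<in> words V. wdeg u = wdeg w + e})"
      using wdeg_shuffles[OF s] by (auto simp: free.span_zero intro!: free.span_base)
  qed
next
  have "sym_compat V (sym_rel V) (\<lambda>w. ush w (\<lambda>u v. if u = [] then 0 else gen ((wdeg u + e, \<phi> u) # v)))"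
  proof (rule sym_compat_ush[OF subspace_sym_rel])
    fix v assume "v \<in> words0 V"
    then show "sym_compat V (sym_rel V) (\<lambda>u. if u = [] then 0 else gen ((wdeg u + e, \<phi> u) # v))"
      using sym_compat_letter[OF \<phi>, of "[]" v] by (intro sym_compat_if) simp_all
  next
    fix u assume "u \<in> words0 V"
    then show "sym_compat V (sym_rel V) (\<lambda>v. if u = [] then 0 else gen ((wdeg u + e, \<phi> u) # v))"
      using sym_maps_closed[OF \<phi>, of u]
      by (cases "u = []") (auto simp: sym_compat_zero words_iff intro: sym_compat_Cons)
  qed
  then show "cod e \<phi> ` sym_rel V \<subseteq> sym_rel V"
    by (auto simp: cod_def dest: sym_compatD)
qed simp

text \<open>The letter made from the block \<open>u\<close> lands in the left or the right factor.
  The first case regroups by coassociativity; in the second the block is exchanged with the left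
  part, which leaves the sign of \<open>e\<close> against that part.\<close>

lemma coprod_cod:
  fixes \<phi> :: "'v word \<Rightarrow> 'v" and p :: "'v word \<Rightarrow>\<^sub>0 'k::field_char_0"
  shows "coprod (cod e \<phi> p) = tens_map 0 (cod e \<phi>) id (coprod p) + tens_map e id (cod e \<phi>) (coprod p)"
proof (rule flin_eqI[OF flin_comp[OF flin_coprod flin_cod]
      flin_add[OF flin_comp[OF flin_tens_map flin_coprod] flin_comp[OF flin_tens_map flin_coprod]]])
  fix w :: "'v word"
  let ?g = "\<lambda>x. gen x :: 'v word \<times> 'v word \<Rightarrow>\<^sub>0 'k"
  let ?R = "\<lambda>a b. if a = [] \<or> b = [] then 0 else gen (a, b) :: 'v word \<times> 'v word \<Rightarrow>\<^sub>0 'k"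
  have "coprod (cod e \<phi> (gen w) :: 'v word \<Rightarrow>\<^sub>0 'k) =
      ush w (\<lambda>u v. if u = [] then 0 else coprod (gen ((wdeg u + e, \<phi> u) # v)))"
    unfolding cod_gen ush_linear[OF flin_coprod]
    by (rule ush_cong) (auto simp: free2.linear_0[OF flin_coprod])
  also have "\<dots> =
      ush w (\<lambda>u v. ush v (\<lambda>a b. if u = [] \<or> b = [] then 0 else ?g ((wdeg u + e, \<phi> u) # a, b))) +
      ush w (\<lambda>u v. ush v (\<lambda>a b. fscale (ksgn (wdeg u) (wdeg a))
        (if u = [] \<or> a = [] then 0 else fscale (ksgn e (wdeg a)) (?g (a, (wdeg u + e, \<phi> u) # b)))))"
    unfolding ush_add[symmetric] coprod_gen
  proof (rule ush_cong[OF refl])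
    fix u v :: "'v word"
    show "(if u = [] then 0 else ush ((wdeg u + e, \<phi> u) # v) ?R) =
        ush v (\<lambda>a b. (if u = [] \<or> b = [] then 0 else ?g ((wdeg u + e, \<phi> u) # a, b)) +
          fscale (ksgn (wdeg u) (wdeg a))
        (if u = [] \<or> a = [] then 0 else fscale (ksgn e (wdeg a)) (?g (a, (wdeg u + e, \<phi> u) # b))))"
    proof (cases "u = []")
      case False
      then show ?thesis
        by simp (rule ush_cong, auto simp: ksgn_add_left)
    qed simp
  qed
  also have "ush w (\<lambda>u v. ush v (\<lambda>a b. if u = [] \<or> b = [] then 0 else ?g ((wdeg u + e, \<phi> u) # a, b))) =
      ush w (\<lambda>c b. ush c (\<lambda>u a. if u = [] \<or> b = [] then 0 else ?g ((wdeg u + e, \<phi> u) # a, b)))"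
    by (rule ush_assoc)
  also have "\<dots> = tens_map 0 (cod e \<phi>) id (coprod (gen w))"
    unfolding tens_map_coprod
  proof (rule ush_cong[OF refl])
    fix c b :: "'v word"
    have "tens (cod e \<phi> (gen c)) (gen b :: 'v word \<Rightarrow>\<^sub>0 'k) = ush c (\<lambda>u a. if u = [] then 0 else ?g ((wdeg u + e, \<phi> u) # a, b))"
      unfolding cod_gen ush_linear[OF flin_tens_left] by (rule ush_cong) auto
    then show "ush c (\<lambda>u a. if u = [] \<or> b = [] then 0 else ?g ((wdeg u + e, \<phi> u) # a, b)) =
       (if c = [] \<or> b = [] then 0 else fscale (ksgn 0 (wdeg c)) (tens (cod e \<phi> (gen c)) (id (gen b :: 'v word \<Rightarrow>\<^sub>0 'k))))"
      by auto
  qed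
  also have "ush w (\<lambda>u v. ush v (\<lambda>a b. fscale (ksgn (wdeg u) (wdeg a))
        (if u = [] \<or> a = [] then 0 else fscale (ksgn e (wdeg a)) (?g (a, (wdeg u + e, \<phi> u) # b))))) =
      ush w (\<lambda>a c. ush c (\<lambda>u b. if u = [] \<or> a = [] then 0 else fscale (ksgn e (wdeg a)) (?g (a, (wdeg u + e, \<phi> u) # b))))"
    by (rule ush_exchange)
  also have "\<dots> = tens_map e id (cod e \<phi>) (coprod (gen w))"
    unfolding tens_map_coprod
  proof (rule ush_cong[OF refl])
    fix a c :: "'v word"
    have "fscale (ksgn e (wdeg a)) (tens (gen a :: 'v word \<Rightarrow>\<^sub>0 'k) (cod e \<phi> (gen c))) =
        ush c (\<lambda>u b. if u = [] then 0 else fscale (ksgn e (wdeg a)) (?g (a, (wdeg u + e, \<phi> u) # b)))"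
      unfolding cod_gen ush_linear[OF flin_tens_right] ush_scale[symmetric] by (rule ush_cong) auto
    then show "ush c (\<lambda>u b. if u = [] \<or> a = [] then 0 else fscale (ksgn e (wdeg a)) (?g (a, (wdeg u + e, \<phi> u) # b))) =
       (if a = [] \<or> c = [] then 0 else fscale (ksgn e (wdeg a)) (tens (id (gen a :: 'v word \<Rightarrow>\<^sub>0 'k)) (cod e \<phi> (gen c))))"
      by auto
  qed
  finally show "coprod (cod e \<phi> (gen w) :: 'v word \<Rightarrow>\<^sub>0 'k) =
    tens_map 0 (cod e \<phi>) id (coprod (gen w)) + tens_map e id (cod e \<phi>) (coprod (gen w))" .
qed

lemma coderivation_cod: "sym_maps V V e \<phi> \<Longrightarrow> coderivation V e (cod e \<phi>)"
  by (simp add: coderivation_def sym_map_cod coprod_cod free.subspace_0)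

abbreviation consl :: "'a \<Rightarrow> ('a list \<Rightarrow>\<^sub>0 'k::field) \<Rightarrow> ('a list \<Rightarrow>\<^sub>0 'k)" where
  "consl y \<equiv> lin_ext (\<lambda>x. gen (y # x))"

text \<open>The sum over all unordered partitions of a word into blocks, obtained by singling out one block:
  each partition is produced once for every block, with weight the relative length of the block.\<close>

function cmorg :: "('v word \<Rightarrow> 'w) \<Rightarrow> 'v word \<Rightarrow> ('w word \<Rightarrow>\<^sub>0 'k::field_char_0)" where
  "cmorg \<phi> w = (if w = [] then gen [] else fscale (inverse (of_nat (length w)))
     (ush w (\<lambda>u v. if u = [] then 0 else fscale (of_nat (length u)) (consl (wdeg u, \<phi> u) (cmorg \<phi> v)))))"
  by pat_completeness auto
termination
  by (relation "measure (\<lambda>(\<phi>, w). length w)") (auto dest: length_shuffles)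

declare cmorg.simps [simp del]

lemma cmorg_Nil [simp]: "cmorg \<phi> [] = gen []"
  by (subst cmorg.simps) simp

lemma cmorg_rec:
  "w \<noteq> [] \<Longrightarrow> cmorg \<phi> w = fscale (inverse (of_nat (length w)))
     (ush w (\<lambda>u v. if u = [] then 0 else fscale (of_nat (length u)) (consl (wdeg u, \<phi> u) (cmorg \<phi> v))))"
  by (subst cmorg.simps) simp

text \<open>One induction for all that is needed about the words occurring in \<open>cmorg\<close>:
  degree, emptiness, and membership of the letters. \<open>A\<close> and \<open>P\<close> are
  trivial in the first two uses.\<close>

lemma cmorg_span:
  fixes \<phi> :: "'v word \<Rightarrow> 'w"
  assumes P: "\<And>u. u \<noteq> [] \<Longrightarrow> set u \<subseteq> A \<Longrightarrow> P (wdeg u, \<phi> u)" and "set w \<subseteq> A"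
  shows "(cmorg \<phi> w :: 'w word \<Rightarrow>\<^sub>0 'k::field_char_0) \<in>
    free.span (gen ` {u. (\<forall>x\<in>set u. P x) \<and> wdeg u = wdeg w \<and> (u = [] \<longleftrightarrow> w = [])})"
  using assms(2)
proof (induction w rule: length_induct)
  case (1 w)
  let ?S = "\<lambda>w. free.span ((gen :: _ \<Rightarrow> 'w word \<Rightarrow>\<^sub>0 'k) ` {u. (\<forall>x\<in>set u. P x) \<and> wdeg u = wdeg w \<and> (u = [] \<longleftrightarrow> w = [])})"
  show ?case
  proof (cases "w = []")
    case True
    then show ?thesis by (auto intro!: free.span_base)
  next
    case False
    have "fscale (inverse (of_nat (length w)))
     (ush w (\<lambda>u v. if u = [] then 0 else fscale (of_nat (length u)) (consl (wdeg u, \<phi> u) (cmorg \<phi> v)))) \<in> ?S w"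
    proof (intro free.span_scale ush_in[OF free.subspace_span])
      fix u v assume s: "w \<in> shuffles u v"
      show "(if u = [] then 0 else fscale (of_nat (length u)) (consl (wdeg u, \<phi> u) (cmorg \<phi> v))) \<in> ?S w"
      proof (cases "u = []")
        case u: False
        have "length v < length w" "set v \<subseteq> A" "set u \<subseteq> A"
          using length_shuffles[OF s] set_shuffles[OF s] u 1(2) by auto
        then have "cmorg \<phi> v \<in> ?S v" using 1(1) by blast
        then have "consl (wdeg u, \<phi> u) (cmorg \<phi> v) \<in> ?S w"
          by (rule flin_span[OF flin_lin_ext free.subspace_span, rotated])
            (use P[OF u \<open>set u \<subseteq> A\<close>] wdeg_shuffles[OF s] False in \<open>auto intro!: free.span_base\<close>)
        then show ?thesis using u by (simp add: free.span_scale)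
      qed (simp add: free.span_zero)
    qed
    then show ?thesis by (simp add: cmorg_rec[OF False])
  qed
qed

lemma cmorg_deg: "cmorg \<phi> w \<in> free.span (gen ` {u. wdeg u = wdeg w})"
  by (rule subsetD[OF free.span_mono cmorg_span[of UNIV "\<lambda>x. True"]]) auto

lemma cmorg_nonempty: "cmorg \<phi> w \<in> free.span (gen ` {u. u = [] \<longleftrightarrow> w = []})"
  by (rule subsetD[OF free.span_mono cmorg_span[of UNIV "\<lambda>x. True"]]) auto

lemma cmorg_words0:
  assumes "sym_maps V W 0 \<phi>" "w \<in> words0 V"
  shows "cmorg \<phi> w \<in> free.span (gen ` {u \<in> words0 W. wdeg u = wdeg w \<and> (u = [] \<longleftrightarrow> w = [])})"
proof (rule subsetD[OF free.span_mono cmorg_span[where A = "{(i, x). x \<in> carrier (V i)}" and P = "\<lambda>(i, x). x \<in> carrier (W i)"]])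
  show "set w \<subseteq> {(i, x). x \<in> carrier (V i)}" using assms(2) by (auto simp: words0_def)
  fix u :: "'a word" assume "u \<noteq> []" "set u \<subseteq> {(i, x). x \<in> carrier (V i)}"
  then have "u \<in> words V" by (auto simp: words_def)
  from sym_maps_closed[OF assms(1) this]
  show "case (wdeg u, \<phi> u) of (i, x) \<Rightarrow> x \<in> carrier (W i)" by simp
qed (auto simp: words0_def)

lemma sym_compat_span:
  assumes S: "free.subspace S" and "\<And>x. x \<in> A \<Longrightarrow> sym_compat V S (\<lambda>u. c u x)" and q: "q \<in> free.span (gen ` A)"
  shows "sym_compat V S (\<lambda>u. lin_ext (c u) q)"
  unfolding sym_compat_def
proof
  fix p assume p: "p \<in> sym_rel V"
  have "flin (\<lambda>q. lin_ext (\<lambda>u. lin_ext (c u) q) p)"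
    by (rule flinI) (simp_all add: flin_simps lin_ext_add_fun lin_ext_scale_fun)
  from this S _ q show "lin_ext (\<lambda>u. lin_ext (c u) q) p \<in> S"
    by (rule flin_span) (use assms(2) p in \<open>auto simp: sym_compat_def\<close>)
qed

lemma consl_rel:
  "x \<in> carrier (V i) \<Longrightarrow> p \<in> sym_rel V \<Longrightarrow> consl (i, x) p \<in> sym_rel V"
  using sym_compatD[OF sym_compat_Cons] .

text \<open>Induction on a length bound: the recursion splits off a nonempty block, so the rest of
  the word satisfies the smaller bound.\<close>

lemma sym_compat_cmorg:
  fixes V :: "('k::field_char_0, 'v) gspace"
  assumes \<phi>: "sym_maps V W 0 \<phi>"
  shows "sym_compat V (sym_rel W) (cmorg \<phi>)"
proof (rule sym_compat_by_length[OF subspace_sym_rel])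
  fix n
  show "sym_compat V (sym_rel W) (\<lambda>w. if length w \<le> n then cmorg \<phi> w else 0)"
  proof (induction n)
    case 0
    have eq: "(\<lambda>w. if length w \<le> 0 then cmorg \<phi> w else 0) = (\<lambda>w. if w = [] then gen [] else (0 :: _ \<Rightarrow>\<^sub>0 'k))"
      by auto
    show ?case
      unfolding eq by (intro sym_compat_if sym_compat_zero subspace_sym_rel)
  next
    case (Suc n)
    \<comment> \<open>Truncating \<open>cmorg\<close> inside the recursion changes nothing, as
      \<open>v\<close> is shorter than \<open>w\<close> for nonempty \<open>u\<close>, and it makes
      the induction hypothesis apply to \<open>G u\<close>.\<close>
    define G where "G u v = (if u = [] then 0 else fscale (of_nat (length u))
      (consl (wdeg u, \<phi> u) (if length v \<le> n then cmorg \<phi> v else (0 :: _ \<Rightarrow>\<^sub>0 'k))))" for u v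
    have eq: "(\<lambda>w. if length w \<le> Suc n then cmorg \<phi> w else 0) =
      (\<lambda>w. if w = [] then gen [] else fscale (if length w \<le> Suc n then inverse (of_nat (length w)) else 0) (ush w G))"
    proof
      fix w :: "'v word"
      have "ush w (\<lambda>u v. if u = [] then 0 else fscale (of_nat (length u)) (consl (wdeg u, \<phi> u) (cmorg \<phi> v))) = ush w G"
        if w: "length w \<le> Suc n"
      proof (rule ush_cong[OF refl])
        fix u v assume "w \<in> shuffles u v"
        then have "u \<noteq> [] \<Longrightarrow> length v \<le> n" using w length_shuffles[of w u v] by (cases u) auto
        then show "(if u = [] then 0 else fscale (of_nat (length u)) (consl (wdeg u, \<phi> u) (cmorg \<phi> v))) = G u v"
          by (simp add: G_def)
      qed
      then show "(if length w \<le> Suc n then cmorg \<phi> w else 0) =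
        (if w = [] then gen [] else fscale (if length w \<le> Suc n then inverse (of_nat (length w)) else 0) (ush w G))"
        by (simp add: cmorg_rec)
    qed
    show ?case
      unfolding eq
    proof (intro sym_compat_if sym_compat_scale_fun sym_compat_ush subspace_sym_rel)
      fix v assume v: "v \<in> words0 V"
      define q where "q = (if length v \<le> n then cmorg \<phi> v else (0 :: _ \<Rightarrow>\<^sub>0 'k))"
      have "(cmorg \<phi> v :: _ \<Rightarrow>\<^sub>0 'k) \<in> free.span (gen ` words0 W)"
        by (rule subsetD[OF free.span_mono cmorg_words0[OF \<phi> v]]) auto
      then have "q \<in> free.span (gen ` words0 W)"
        by (simp add: q_def free.span_zero)
      then have "sym_compat V (sym_rel W) (\<lambda>u. consl (wdeg u, \<phi> u) q)"
        using sym_compat_letter[OF \<phi>, of "[]"] by (intro sym_compat_span[of _ "words0 W"]) auto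
      then show "sym_compat V (sym_rel W) (\<lambda>u. G u v)"
        unfolding G_def q_def[symmetric]
        by (intro sym_compat_if sym_compat_scale_fun subspace_sym_rel) auto
    next
      fix u assume u: "u \<in> words0 V"
      show "sym_compat V (sym_rel W) (G u)"
      proof (cases "u = []")
        case True
        then show ?thesis by (simp add: G_def[abs_def] sym_compat_zero)
      next
        case False
        then have "\<phi> u \<in> carrier (W (wdeg u))" using sym_maps_closed[OF \<phi>, of u] u by (simp add: words_iff)
        then show ?thesis
          using False unfolding G_def
          by (simp, intro sym_compat_comp[OF Suc.IH, where h = "\<lambda>p. fscale c (h p)" for c h] flin_fscale flin_lin_ext
              free.subspace_scale subspace_sym_rel consl_rel)
      qed
    qed auto
  qed
qed

definition cmor :: "('v word \<Rightarrow> 'w) \<Rightarrow> ('v word \<Rightarrow>\<^sub>0 'k::field_char_0) \<Rightarrow> ('w word \<Rightarrow>\<^sub>0 'k)" where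
  "cmor \<phi> = lin_ext (cmorg \<phi>)"

lemma flin_cmor [simp]: "flin (cmor \<phi>)" by (simp add: cmor_def)

lemma cmor_gen [simp]: "cmor \<phi> (gen w) = cmorg \<phi> w" by (simp add: cmor_def)

lemma sym_map_cmor:
  assumes \<phi>: "sym_maps V W 0 \<phi>"
  shows "sym_map V W 0 (cmor \<phi>)"
  unfolding sym_map_def
proof (intro conjI ballI)
  fix w assume "w \<in> words V"
  then show "cmor \<phi> (gen w) \<in> free.span (gen ` {u \<in> words W. wdeg u = wdeg w + 0})"
    unfolding cmor_gen
    by (intro subsetD[OF free.span_mono cmorg_words0[OF \<phi>, of w]]) (auto simp: words_iff)
next
  show "cmor \<phi> ` sym_rel V \<subseteq> sym_rel W"
    using sym_compat_cmorg[OF \<phi>] by (auto simp: cmor_def sym_compat_def)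
qed simp

text \<open>The unreduced coproduct, with empty words allowed. On it \<open>cmorg\<close> is
  comultiplicative without case distinctions; truncation recovers the reduced coproduct.\<close>

definition fcop :: "('v word \<Rightarrow>\<^sub>0 'k::field_char_0) \<Rightarrow> ('v word \<times> 'v word \<Rightarrow>\<^sub>0 'k)" where
  "fcop = lin_ext (\<lambda>w. ush w (\<lambda>a b. gen (a, b)))"

text \<open>A new first letter stays in the left factor or passes the left factor to reach the right
  one.\<close>

lemma fcop_consl:
  "fcop (consl y p) = lin_ext (\<lambda>(a, b). gen (y # a, b)) (fcop p)
    + lin_ext (\<lambda>(a, b). fscale (ksgn (fst y) (wdeg a)) (gen (a, y # b))) (fcop p)"
  unfolding fcop_def
  by (rule flin_eqI[OF flin_comp[OF flin_lin_ext flin_lin_ext] flin_add[OF flin_comp[OF flin_lin_ext flin_lin_ext]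
        flin_comp[OF flin_lin_ext flin_lin_ext]]])
    (simp add: ush_linear[OF flin_lin_ext] ush_add)

lemma consl_tens_left: "lin_ext (\<lambda>(a, b). gen (y # a, b)) (tens p q) = tens (consl y p) q"
proof (rule flin_eqI[OF flin_comp[OF flin_lin_ext flin_tens_left] flin_comp[OF flin_tens_left flin_lin_ext]])
  fix a
  show "lin_ext (\<lambda>(a, b). gen (y # a, b)) (tens (gen a) q) = tens (consl y (gen a)) q"
    by (rule flin_eqI[OF flin_comp[OF flin_lin_ext flin_tens_right] flin_tens_right]) simp
qed

lemma consl_tens_right:
  fixes p :: "'v word \<Rightarrow>\<^sub>0 'k::field_char_0" and q :: "'b list \<Rightarrow>\<^sub>0 'k"
  assumes "p \<in> free.span (gen ` {u. wdeg u = d})"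
  shows "lin_ext (\<lambda>(a, b). fscale (ksgn i (wdeg a)) (gen (a, y # b))) (tens p q) =
    fscale (ksgn i d) (tens p (consl y q))"
  using assms
proof (rule flin_span_eq[OF flin_comp[OF flin_lin_ext flin_tens_left] flin_fscale[OF flin_tens_left], rotated])
  fix x :: "'v word \<Rightarrow>\<^sub>0 'k" assume "x \<in> gen ` {u. wdeg u = d}"
  then obtain a where a: "x = gen a" "wdeg a = d" by auto
  show "lin_ext (\<lambda>(a, b). fscale (ksgn i (wdeg a)) (gen (a, y # b))) (tens x q) =
    fscale (ksgn i d) (tens x (consl y q))"
    unfolding a
    by (rule flin_eqI[OF flin_comp[OF flin_lin_ext flin_tens_right] flin_fscale[OF flin_comp[OF flin_tens_right flin_lin_ext]]])
      (simp add: a)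
qed

text \<open>The recursion describes \<open>cmorg\<close> multiplied by the length, so the claim is
  proved after multiplication by \<open>length w\<close>. A block goes to the left or the right
  factor; the resulting weights are the lengths of the two parts of \<open>w\<close>, which add up
  to \<open>length w\<close>.\<close>

lemma fcop_cmorg:
  fixes \<phi> :: "'v word \<Rightarrow> 'w"
  shows "fcop (cmorg \<phi> w :: _ \<Rightarrow>\<^sub>0 'k::field_char_0) = ush w (\<lambda>u v. tens (cmorg \<phi> u) (cmorg \<phi> v))"
proof (induction w rule: length_induct)
  case (1 w)
  let ?F = "cmorg \<phi> :: _ \<Rightarrow> _ \<Rightarrow>\<^sub>0 'k"
  let ?c = "\<lambda>u. consl (wdeg u, \<phi> u) :: ('w word \<Rightarrow>\<^sub>0 'k) \<Rightarrow> _"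
  show ?case
  proof (cases "w = []")
    case True
    then show ?thesis by (simp add: fcop_def)
  next
    case False
    have rec: "fscale (of_nat (length c)) (?F c) = ush c (\<lambda>u a. if u = [] then 0 else fscale (of_nat (length u)) (?c u (?F a)))"
      for c by (cases "c = []") (simp_all add: cmorg_rec)
    have "fscale (of_nat (length w)) (fcop (?F w)) =
        ush w (\<lambda>u v. if u = [] then 0 else fscale (of_nat (length u)) (fcop (?c u (?F v))))"
      unfolding free2.linear_scale[OF flin_lin_ext[folded fcop_def], symmetric, of _ "\<lambda>w. ush w (\<lambda>a b. gen (a, b))", folded fcop_def]
        rec ush_linear[OF flin_lin_ext, of "\<lambda>w. ush w (\<lambda>a b. gen (a, b))", folded fcop_def]
      by (rule ush_cong) (auto simp: fcop_def flin_simps)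
    also have "\<dots> = ush w (\<lambda>u v. ush v (\<lambda>a b. if u = [] then 0 else fscale (of_nat (length u)) (tens (?c u (?F a)) (?F b))))
      + ush w (\<lambda>u v. ush v (\<lambda>a b. fscale (ksgn (wdeg u) (wdeg a))
          (if u = [] then 0 else fscale (of_nat (length u)) (tens (?F a) (?c u (?F b))))))"
      unfolding ush_add[symmetric]
    proof (rule ush_cong[OF refl])
      fix u v assume s: "w \<in> shuffles u v"
      show "(if u = [] then 0 else fscale (of_nat (length u)) (fcop (?c u (?F v)))) =
        ush v (\<lambda>a b. (if u = [] then 0 else fscale (of_nat (length u)) (tens (?c u (?F a)) (?F b)))
          + fscale (ksgn (wdeg u) (wdeg a))
          (if u = [] then 0 else fscale (of_nat (length u)) (tens (?F a) (?c u (?F b)))))"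
      proof (cases "u = []")
        case u: False
        then have "length v < length w" using length_shuffles[OF s] by simp
        then have IH: "fcop (?F v) = ush v (\<lambda>a b. tens (?F a) (?F b))" using 1 by blast
        show ?thesis
          using u
          by (simp add: fcop_consl IH ush_linear[OF flin_lin_ext] consl_tens_left consl_tens_right[OF cmorg_deg]
              ush_add ush_scale[symmetric] free.scale_right_distrib mult_ac)
      qed simp
    qed
    also have "\<dots> = ush w (\<lambda>c b. ush c (\<lambda>u a. if u = [] then 0 else fscale (of_nat (length u)) (tens (?c u (?F a)) (?F b))))
      + ush w (\<lambda>a c. ush c (\<lambda>u b. if u = [] then 0 else fscale (of_nat (length u)) (tens (?F a) (?c u (?F b)))))"
      unfolding ush_assoc[of w] ush_exchange by (simp only: ush_assoc)
    also have "\<dots> = ush w (\<lambda>c b. tens (fscale (of_nat (length c)) (?F c)) (?F b))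
       + ush w (\<lambda>a c. tens (?F a) (fscale (of_nat (length c)) (?F c)))"
      unfolding rec ush_linear[OF flin_tens_left] ush_linear[OF flin_tens_right]
      by (intro arg_cong2[where f = "(+)"] ush_cong refl) (auto simp: tens_simps)
    also have "\<dots> = fscale (of_nat (length w)) (ush w (\<lambda>u v. tens (?F u) (?F v)))"
      unfolding ush_add[symmetric] ush_scale[symmetric]
      by (rule ush_cong) (auto simp: tens_simps free.scale_left_distrib dest: length_shuffles)
    finally show ?thesis using False by simp
  qed
qed

lemma coprod_fcop: "coprod p = lin_ext (\<lambda>(a, b). if a = [] \<or> b = [] then 0 else gen (a, b)) (fcop p)"
  unfolding fcop_def
  by (rule flin_eqI[OF flin_coprod flin_comp[OF flin_lin_ext flin_lin_ext]])
    (simp add: coprod_gen ush_linear[OF flin_lin_ext])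

text \<open>Meant for values of \<open>cmorg\<close>, which is empty exactly on the empty word:
  discarding empty factors before or after applying it is the same.\<close>

lemma trunc_tens:
  fixes p :: "'a list \<Rightarrow>\<^sub>0 'k::field" and q :: "'b list \<Rightarrow>\<^sub>0 'k"
  assumes "p \<in> free.span (gen ` {x. x = [] \<longleftrightarrow> u = []})" "q \<in> free.span (gen ` {x. x = [] \<longleftrightarrow> v = []})"
  shows "lin_ext (\<lambda>(a, b). if a = [] \<or> b = [] then 0 else gen (a, b)) (tens p q)
    = (if u = [] \<or> v = [] then 0 else tens p q)"
  using assms(1)
proof (rule flin_span_eq[rotated -1])
  show "flin (\<lambda>p. lin_ext (\<lambda>(a, b). if a = [] \<or> b = [] then 0 else gen (a, b)) (tens p q))"
    by (rule flin_comp[OF flin_lin_ext flin_tens_left])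
  show "flin (\<lambda>p. if u = [] \<or> v = [] then 0 else tens p q)"
    by (rule flinI) (auto simp: tens_simps)
  fix x :: "'a list \<Rightarrow>\<^sub>0 'k" assume "x \<in> gen ` {x. x = [] \<longleftrightarrow> u = []}"
  then obtain a where a: "x = gen a" "a = [] \<longleftrightarrow> u = []" by auto
  from assms(2)
  show "lin_ext (\<lambda>(a, b). if a = [] \<or> b = [] then 0 else gen (a, b)) (tens x q)
    = (if u = [] \<or> v = [] then 0 else tens x q)"
  proof (rule flin_span_eq[rotated -1])
    show "flin (\<lambda>q. lin_ext (\<lambda>(a, b). if a = [] \<or> b = [] then 0 else gen (a, b)) (tens x q))"
      by (rule flin_comp[OF flin_lin_ext flin_tens_right])
    show "flin (\<lambda>q. if u = [] \<or> v = [] then 0 else tens x q)"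
      by (rule flinI) (auto simp: tens_simps)
  qed (auto simp: a)
qed

lemma coprod_cmor: "coprod (cmor \<phi> p) = tens_map 0 (cmor \<phi>) (cmor \<phi>) (coprod p)"
proof (rule flin_eqI[OF flin_comp[OF flin_coprod flin_cmor] flin_comp[OF flin_tens_map flin_coprod]])
  fix w
  show "coprod (cmor \<phi> (gen w)) = tens_map 0 (cmor \<phi>) (cmor \<phi>) (coprod (gen w))"
    unfolding tens_map_coprod cmor_gen coprod_fcop[of "cmorg \<phi> w"] fcop_cmorg ush_linear[OF flin_lin_ext]
    by (rule ush_cong) (auto simp: trunc_tens[OF cmorg_nonempty cmorg_nonempty])
qed

lemma coalgebra_map_cmor: "sym_maps V W 0 \<phi> \<Longrightarrow> coalgebra_map V W (cmor \<phi>)"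
  by (simp add: coalgebra_map_def sym_map_cmor coprod_cmor free.subspace_0)

lemma proj_one_consl:
  assumes "q \<in> free.span (gen ` {x. x = [] \<longleftrightarrow> v = []})"
  shows "proj_one (consl y q) = (if v = [] then consl y q else 0)"
  using assms
proof (rule flin_span_eq[rotated -1])
  show "flin (\<lambda>q. proj_one (consl y q))" by (rule flin_comp) simp_all
  show "flin (\<lambda>q. if v = [] then consl y q else 0)" by (rule flinI) (auto simp: flin_simps)
qed (auto simp: proj_one_gen)

text \<open>Only the partition into a single block gives a word of length one, and the block length
  cancels against the normalising factor.\<close>

lemma proj_one_cmor:
  fixes \<phi> :: "'v word \<Rightarrow> 'w" and p :: "'v word \<Rightarrow>\<^sub>0 'k::field_char_0"
  shows "proj_one (cmor \<phi> p) = com 0 \<phi> p"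
proof (rule flin_eqI[OF flin_comp[OF flin_proj_one flin_cmor] flin_com])
  fix w :: "'v word"
  show "proj_one (cmor \<phi> (gen w :: _ \<Rightarrow>\<^sub>0 'k)) = com 0 \<phi> (gen w)"
  proof (cases "w = []")
    case True
    then show ?thesis by (simp add: com_gen proj_one_gen)
  next
    case False
    have "ush w (\<lambda>u v. proj_one (if u = [] then 0 else fscale (of_nat (length u)) (consl (wdeg u, \<phi> u) (cmorg \<phi> v)))) =
        ush w (\<lambda>u v. if v = [] then (if u = [] then 0 else fscale (of_nat (length u)) (gen [(wdeg u, \<phi> u)])) else 0 :: _ \<Rightarrow>\<^sub>0 'k)"
      by (rule ush_cong) (auto simp: flin_simps proj_one_consl[OF cmorg_nonempty] proj_one_gen)
    also have "\<dots> = fscale (of_nat (length w)) (gen [(wdeg w, \<phi> w)])"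
      by (simp add: ush_right_nil False)
    finally have eq: "ush w (\<lambda>u v. proj_one (if u = [] then 0 else fscale (of_nat (length u)) (consl (wdeg u, \<phi> u) (cmorg \<phi> v)))) =
        (fscale (of_nat (length w)) (gen [(wdeg w, \<phi> w)]) :: _ \<Rightarrow>\<^sub>0 'k)" .
    show ?thesis
      unfolding cmor_gen cmorg_rec[OF False] free2.linear_scale[OF flin_proj_one] ush_linear[OF flin_proj_one] eq
      using False by (simp add: com_gen)
  qed
qed

section \<open>Coalgebra maps induced by linear maps of degree zero\<close>

section \<open>Letterwise maps\<close>

definition wmap :: "(int \<Rightarrow> 'v \<Rightarrow> 'w) \<Rightarrow> 'v word \<Rightarrow> 'w word" where
  "wmap g w = map (\<lambda>(i, x). (i, g i x)) w"

lemma wmap_simps [simp]: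
  "wmap g [] = []" "wmap g (x # w) = (fst x, g (fst x) (snd x)) # wmap g w" "wmap g (u @ v) = wmap g u @ wmap g v"
  "wmap g w = [] \<longleftrightarrow> w = []" "length (wmap g w) = length w"
  by (auto simp: wmap_def split: prod.splits)

lemma wdeg_wmap [simp]: "wdeg (wmap g w) = wdeg w"
  by (induction w) auto

lemma ush_wmap: "ush (wmap g w) G = ush w (\<lambda>u v. G (wmap g u) (wmap g v))"
  by (induction w arbitrary: G) auto

text \<open>The lift used for strict maps. It agrees with \<open>cmor\<close> of the strict
  components only modulo relations, but involves no partition sums.\<close>

definition smap :: "(int \<Rightarrow> 'v \<Rightarrow> 'w) \<Rightarrow> ('v word \<Rightarrow>\<^sub>0 'k::field_char_0) \<Rightarrow> ('w word \<Rightarrow>\<^sub>0 'k)" where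
  "smap g = lin_ext (\<lambda>w. gen (wmap g w))"

lemma flin_smap [simp]: "flin (smap g)" by (simp add: smap_def)

lemma smap_gen [simp]: "smap g (gen w) = gen (wmap g w)" by (simp add: smap_def)

definition glin :: "('k::field_char_0, 'v) gspace \<Rightarrow> ('k, 'w) gspace \<Rightarrow> (int \<Rightarrow> 'v \<Rightarrow> 'w) \<Rightarrow> bool" where
  "glin V W g \<longleftrightarrow> (\<forall>i. \<forall>x \<in> carrier (V i). g i x \<in> carrier (W i) \<and>
     (\<forall>y \<in> carrier (V i). g i (x \<oplus>\<^bsub>V i\<^esub> y) = g i x \<oplus>\<^bsub>W i\<^esub> g i y) \<and>
     (\<forall>c. g i (c \<odot>\<^bsub>V i\<^esub> x) = c \<odot>\<^bsub>W i\<^esub> g i x))"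

lemma glinD:
  assumes "glin V W g" "x \<in> carrier (V i)"
  shows "g i x \<in> carrier (W i)" "y \<in> carrier (V i) \<Longrightarrow> g i (x \<oplus>\<^bsub>V i\<^esub> y) = g i x \<oplus>\<^bsub>W i\<^esub> g i y"
    "g i (c \<odot>\<^bsub>V i\<^esub> x) = c \<odot>\<^bsub>W i\<^esub> g i x"
  using assms by (auto simp: glin_def)

lemma wmap_words0: "glin V W g \<Longrightarrow> w \<in> words0 V \<Longrightarrow> wmap g w \<in> words0 W"
  by (induction w) (auto simp: glin_def)

lemma wmap_words: "glin V W g \<Longrightarrow> w \<in> words V \<Longrightarrow> wmap g w \<in> words W"
  by (simp add: words_iff wmap_words0)

lemma sym_map_smap:
  assumes g: "glin V W g"
  shows "sym_map V W 0 (smap g)"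
  unfolding sym_map_def
proof (intro conjI ballI)
  fix w assume "w \<in> words V"
  then show "smap g (gen w) \<in> free.span (gen ` {u \<in> words W. wdeg u = wdeg w + 0})"
    by (auto intro!: free.span_base wmap_words[OF g])
next
  have "sym_compat V (sym_rel W) (\<lambda>w. gen (wmap g w))"
  proof (rule sym_compatI)
    fix u v i x y
    assume "u \<in> words0 V" "v \<in> words0 V" "x \<in> carrier (V i)" "y \<in> carrier (V i)"
    then show "gen (wmap g (u @ (i, x \<oplus>\<^bsub>V i\<^esub> y) # v)) - gen (wmap g (u @ (i, x) # v)) -
       gen (wmap g (u @ (i, y) # v)) \<in> sym_rel W"
      using sym_rel_add[of "wmap g u" W "wmap g v" "g i x" i "g i y"] by (simp add: wmap_words0[OF g] glinD[OF g])
  next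
    fix u v i x c
    assume "u \<in> words0 V" "v \<in> words0 V" "x \<in> carrier (V i)"
    then show "gen (wmap g (u @ (i, c \<odot>\<^bsub>V i\<^esub> x) # v)) - fscale c (gen (wmap g (u @ (i, x) # v))) \<in> sym_rel W"
      using sym_rel_smult[of "wmap g u" W "wmap g v" "g i x" i c] by (simp add: wmap_words0[OF g] glinD[OF g])
  next
    fix u v i x j y
    assume "u \<in> words0 V" "v \<in> words0 V" "x \<in> carrier (V i)" "y \<in> carrier (V j)"
    then show "gen (wmap g (u @ (i, x) # (j, y) # v)) -
       fscale (ksgn i j) (gen (wmap g (u @ (j, y) # (i, x) # v))) \<in> sym_rel W"
      using sym_rel_swap[of "wmap g u" W "wmap g v" "g i x" i "g j y" j] by (simp add: wmap_words0[OF g] glinD[OF g])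
  qed simp
  then show "smap g ` sym_rel V \<subseteq> sym_rel W"
    by (auto simp: smap_def sym_compat_def)
qed simp

lemma coprod_smap: "coprod (smap g p) = tens_map 0 (smap g) (smap g) (coprod p)"
proof (rule flin_eqI[OF flin_comp[OF flin_coprod flin_smap] flin_comp[OF flin_tens_map flin_coprod]])
  fix w
  show "coprod (smap g (gen w)) = tens_map 0 (smap g) (smap g) (coprod (gen w))"
    unfolding smap_gen coprod_gen ush_wmap ush_linear[OF flin_tens_map]
    by (rule ush_cong) (auto simp: flin_simps)
qed

lemma coalgebra_map_smap: "glin V W g \<Longrightarrow> coalgebra_map V W (smap g)"
  by (simp add: coalgebra_map_def sym_map_smap coprod_smap free.subspace_0)

lemma smap_cod:
  assumes "\<And>u. u \<in> words V \<Longrightarrow> g (wdeg u + e) (\<phi> u) = \<phi>' (wmap g u)" "w \<in> words0 V"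
  shows "smap g (cod e \<phi> (gen w)) = cod e \<phi>' (gen (wmap g w))"
  unfolding cod_gen ush_linear[OF flin_smap] ush_wmap
  by (rule ush_cong) (use assms in \<open>auto simp: flin_simps words_iff dest: words0_shuffles\<close>)

lemma smap_consl: "smap g (consl y p) = consl (fst y, g (fst y) (snd y)) (smap g p)"
  by (rule flin_eqI[OF flin_comp[OF flin_smap flin_lin_ext] flin_comp[OF flin_lin_ext flin_smap]]) simp

text \<open>Naturality for \<open>g\<close> on the target and \<open>g'\<close> on the source, exact
  because the same partitions occur on both sides. With \<open>g'\<close> the identity it gives the
  projections of a pair, with both maps nontrivial the commuting square.\<close>

lemma smap_cmorg:
  assumes "\<And>u. u \<in> words V \<Longrightarrow> g (wdeg u) (\<phi> u) = \<phi>' (wmap g' u)" "w \<in> words0 V"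
  shows "smap g (cmorg \<phi> w :: _ \<Rightarrow>\<^sub>0 'k::field_char_0) = cmorg \<phi>' (wmap g' w)"
  using assms(2)
proof (induction w rule: length_induct)
  case (1 w)
  show ?case
  proof (cases "w = []")
    case False
    have "ush w (\<lambda>u v. smap g (if u = [] then 0 else fscale (of_nat (length u)) (consl (wdeg u, \<phi> u) (cmorg \<phi> v :: _ \<Rightarrow>\<^sub>0 'k)))) =
      ush w (\<lambda>u v. if u = [] then 0 else fscale (of_nat (length u)) (consl (wdeg u, \<phi>' (wmap g' u)) (cmorg \<phi>' (wmap g' v))))"
    proof (rule ush_cong[OF refl])
      fix u v assume s: "w \<in> shuffles u v"
      show "smap g (if u = [] then 0 else fscale (of_nat (length u)) (consl (wdeg u, \<phi> u) (cmorg \<phi> v :: _ \<Rightarrow>\<^sub>0 'k))) =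
        (if u = [] then 0 else fscale (of_nat (length u)) (consl (wdeg u, \<phi>' (wmap g' u)) (cmorg \<phi>' (wmap g' v))))"
      proof (cases "u = []")
        case u: False
        then have "length v < length w" "u \<in> words V" "v \<in> words0 V"
          using length_shuffles[OF s] words0_shuffles[OF 1(2) s] by (auto simp: words_iff)
        then show ?thesis using 1(1) u by (simp add: free2.linear_scale[OF flin_smap] smap_consl assms(1))
      qed (simp add: flin_simps)
    qed
    then show ?thesis
      using False by (simp add: cmorg_rec free2.linear_scale[OF flin_smap] ush_linear[OF flin_smap] ush_wmap cong: if_cong)
  qed simp
qed

section \<open>Module arithmetic, and the faithfulness of single letters in the quotient\<close>

section \<open>Graded vector spaces\<close>

lemma graded_module: "graded_space V \<Longrightarrow> module (cring_class_ops :: 'k::field_char_0 ring) (V i :: ('k, 'v) module)"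
  by (simp add: graded_space_def)

text \<open>Translates the module laws over \<open>cring_class_ops\<close> once into field
  arithmetic, so that later arguments do not meet the ring record.\<close>

lemma
  fixes V :: "('k::field_char_0, 'v) gspace"
  assumes "graded_space V"
  shows gs_zero: "\<zero>\<^bsub>V i\<^esub> \<in> carrier (V i)"
    and gs_add: "x \<in> carrier (V i) \<Longrightarrow> y \<in> carrier (V i) \<Longrightarrow> x \<oplus>\<^bsub>V i\<^esub> y \<in> carrier (V i)"
    and gs_smult: "x \<in> carrier (V i) \<Longrightarrow> c \<odot>\<^bsub>V i\<^esub> x \<in> carrier (V i)"
    and gs_add_zero: "x \<in> carrier (V i) \<Longrightarrow> x \<oplus>\<^bsub>V i\<^esub> \<zero>\<^bsub>V i\<^esub> = x"
    and gs_zero_add: "x \<in> carrier (V i) \<Longrightarrow> \<zero>\<^bsub>V i\<^esub> \<oplus>\<^bsub>V i\<^esub> x = x"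
    and gs_smult_zero: "c \<odot>\<^bsub>V i\<^esub> \<zero>\<^bsub>V i\<^esub> = \<zero>\<^bsub>V i\<^esub>"
    and gs_zero_smult: "x \<in> carrier (V i) \<Longrightarrow> 0 \<odot>\<^bsub>V i\<^esub> x = \<zero>\<^bsub>V i\<^esub>"
    and gs_one_smult: "x \<in> carrier (V i) \<Longrightarrow> 1 \<odot>\<^bsub>V i\<^esub> x = x"
    and gs_smult_smult: "x \<in> carrier (V i) \<Longrightarrow> a \<odot>\<^bsub>V i\<^esub> (b \<odot>\<^bsub>V i\<^esub> x) = (a * b) \<odot>\<^bsub>V i\<^esub> x"
    and gs_smult_add: "x \<in> carrier (V i) \<Longrightarrow> y \<in> carrier (V i) \<Longrightarrow>
      c \<odot>\<^bsub>V i\<^esub> (x \<oplus>\<^bsub>V i\<^esub> y) = c \<odot>\<^bsub>V i\<^esub> x \<oplus>\<^bsub>V i\<^esub> c \<odot>\<^bsub>V i\<^esub> y"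
    and gs_add_smult: "x \<in> carrier (V i) \<Longrightarrow> (a + b) \<odot>\<^bsub>V i\<^esub> x = a \<odot>\<^bsub>V i\<^esub> x \<oplus>\<^bsub>V i\<^esub> b \<odot>\<^bsub>V i\<^esub> x"
    and gs_neg: "x \<in> carrier (V i) \<Longrightarrow> (- 1) \<odot>\<^bsub>V i\<^esub> x = \<ominus>\<^bsub>V i\<^esub> x"
proof -
  interpret module "cring_class_ops :: 'k ring" "V i" by (rule graded_module[OF assms])
  note [simp] = cring_class_ops_def
  show "\<zero>\<^bsub>V i\<^esub> \<in> carrier (V i)" by simp
  show "x \<in> carrier (V i) \<Longrightarrow> y \<in> carrier (V i) \<Longrightarrow> x \<oplus>\<^bsub>V i\<^esub> y \<in> carrier (V i)" by simp
  show "x \<in> carrier (V i) \<Longrightarrow> x \<oplus>\<^bsub>V i\<^esub> \<zero>\<^bsub>V i\<^esub> = x" by simp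
  show "x \<in> carrier (V i) \<Longrightarrow> \<zero>\<^bsub>V i\<^esub> \<oplus>\<^bsub>V i\<^esub> x = x" by simp
  show "x \<in> carrier (V i) \<Longrightarrow> c \<odot>\<^bsub>V i\<^esub> x \<in> carrier (V i)"
    using smult_closed[of c x] by simp
  show "c \<odot>\<^bsub>V i\<^esub> \<zero>\<^bsub>V i\<^esub> = \<zero>\<^bsub>V i\<^esub>" using smult_r_null[of c] by simp
  show "x \<in> carrier (V i) \<Longrightarrow> 0 \<odot>\<^bsub>V i\<^esub> x = \<zero>\<^bsub>V i\<^esub>" using smult_l_null[of x] by simp
  show "x \<in> carrier (V i) \<Longrightarrow> 1 \<odot>\<^bsub>V i\<^esub> x = x" using smult_one[of x] by simp
  show "x \<in> carrier (V i) \<Longrightarrow> a \<odot>\<^bsub>V i\<^esub> (b \<odot>\<^bsub>V i\<^esub> x) = (a * b) \<odot>\<^bsub>V i\<^esub> x"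
    using smult_assoc1[of a b x] by simp
  show "x \<in> carrier (V i) \<Longrightarrow> y \<in> carrier (V i) \<Longrightarrow>
      c \<odot>\<^bsub>V i\<^esub> (x \<oplus>\<^bsub>V i\<^esub> y) = c \<odot>\<^bsub>V i\<^esub> x \<oplus>\<^bsub>V i\<^esub> c \<odot>\<^bsub>V i\<^esub> y"
    using smult_r_distr[of c x y] by simp
  show "x \<in> carrier (V i) \<Longrightarrow> (a + b) \<odot>\<^bsub>V i\<^esub> x = a \<odot>\<^bsub>V i\<^esub> x \<oplus>\<^bsub>V i\<^esub> b \<odot>\<^bsub>V i\<^esub> x"
    using smult_l_distr[of a b x] by simp
  show "x \<in> carrier (V i) \<Longrightarrow> (- 1) \<odot>\<^bsub>V i\<^esub> x = \<ominus>\<^bsub>V i\<^esub> x"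
    using smult_l_minus[of 1 x] smult_one[of x] uminus_class[of "1 :: 'k"] by simp
qed

lemma graded_susp [simp]: "graded_space V \<Longrightarrow> graded_space (susp V)"
  by (simp add: graded_space_def susp_def)

lemma gen_zero_rel:
  assumes V: "graded_space V" "a \<in> words0 V" "b \<in> words0 V"
  shows "gen (a @ (i, \<zero>\<^bsub>V i\<^esub>) # b) \<in> sym_rel V"
  using sym_rel_smult[OF assms(2,3) gs_zero[OF V(1), of i], of 0]
  by (simp add: gs_smult_zero[OF V(1)])

text \<open>Words of length one form a faithful copy of the graded space in the quotient. The map
  \<open>ev\<close> reads off the length-one part of degree \<open>i\<close> as an element of
  \<open>V i\<close>; it kills the linearity relations by linearity and the swaps because they have
  at least two letters.\<close>

lemma letter_zero:
  fixes V :: "('k::field_char_0, 'v) gspace"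
  assumes V: "graded_space V" and x: "x \<in> carrier (V i)" and r: "gen [(i, x)] \<in> sym_rel V"
  shows "x = \<zero>\<^bsub>V i\<^esub>"
proof -
  interpret module "cring_class_ops :: 'k ring" "V i" by (rule graded_module[OF V])
  \<comment> \<open>Letters outside the carrier go to zero, so every summand below lies in the
    module.\<close>
  define co where "co w = (if fst (hd w) = i \<and> snd (hd w) \<in> carrier (V i) \<and> length w = 1
    then snd (hd w) else \<zero>\<^bsub>V i\<^esub>)" for w :: "'v word"
  define ev where "ev p = (\<Oplus>\<^bsub>V i\<^esub>w\<in>Poly_Mapping.keys p. Poly_Mapping.lookup p w \<odot>\<^bsub>V i\<^esub> co w)"
    for p :: "'v word \<Rightarrow>\<^sub>0 'k"
  have co: "co w \<in> carrier (V i)" for w by (simp add: co_def)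
  have sc: "c \<odot>\<^bsub>V i\<^esub> co w \<in> carrier (V i)" for c w by (rule gs_smult[OF V co])
  have sup: "ev p = (\<Oplus>\<^bsub>V i\<^esub>w\<in>S. Poly_Mapping.lookup p w \<odot>\<^bsub>V i\<^esub> co w)"
    if "finite S" "Poly_Mapping.keys p \<subseteq> S" for p S
    unfolding ev_def
    by (rule add.finprod_mono_neutral_cong_left)
      (use that in \<open>auto simp: in_keys_iff gs_zero_smult[OF V co] sc\<close>)
  have add: "ev (p + q) = ev p \<oplus>\<^bsub>V i\<^esub> ev q" for p q
  proof -
    define S where "S = Poly_Mapping.keys p \<union> Poly_Mapping.keys q"
    have S: "finite S" "Poly_Mapping.keys p \<subseteq> S" "Poly_Mapping.keys q \<subseteq> S"
        "Poly_Mapping.keys (p + q) \<subseteq> S"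
      using Poly_Mapping.keys_add[of p q] by (auto simp: S_def)
    show ?thesis
      unfolding sup[OF S(1,2)] sup[OF S(1,3)] sup[OF S(1,4)] lookup_add gs_add_smult[OF V co]
      by (rule finsum_addf) (auto simp: sc)
  qed
  have scale: "ev (fscale c p) = c \<odot>\<^bsub>V i\<^esub> ev p" for c p
  proof -
    have "Poly_Mapping.keys (fscale c p) \<subseteq> Poly_Mapping.keys p" by (auto simp: in_keys_iff)
    then have "ev (fscale c p) = (\<Oplus>\<^bsub>V i\<^esub>w\<in>Poly_Mapping.keys p. (c * Poly_Mapping.lookup p w) \<odot>\<^bsub>V i\<^esub> co w)"
      using sup[of "Poly_Mapping.keys p" "fscale c p"] by simp
    also have "\<dots> = c \<odot>\<^bsub>V i\<^esub> ev p"
      unfolding ev_def gs_smult_smult[OF V co, symmetric]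
      by (rule finsum_smult_ldistr[symmetric]) (auto simp: sc carrier_class)
    finally show ?thesis .
  qed
  have gen: "ev (gen w) = co w" for w
    by (simp add: ev_def gs_one_smult[OF V co] co)
  have closed: "ev p \<in> carrier (V i)" for p
    unfolding ev_def by (rule finsum_closed) (auto simp: sc)
  have diff: "ev (p - q) = ev p \<oplus>\<^bsub>V i\<^esub> \<ominus>\<^bsub>V i\<^esub> ev q" for p q
  proof -
    have "p - q = p + fscale (- 1) q" by simp
    then show ?thesis by (simp only: add scale gs_neg[OF V closed])
  qed
  have m0 [simp]: "\<ominus>\<^bsub>V i\<^esub> \<zero>\<^bsub>V i\<^esub> = \<zero>\<^bsub>V i\<^esub>"
    using r_neg[OF zero_closed] l_zero[OF a_inv_closed[OF zero_closed]] by simp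
  have sub: "free.subspace {p. ev p = \<zero>\<^bsub>V i\<^esub>}"
    unfolding free.subspace_def
    by (auto simp: add scale gs_smult_zero[OF V]) (simp add: ev_def)
  have "sym_rel V \<subseteq> {p. ev p = \<zero>\<^bsub>V i\<^esub>}"
    unfolding sym_rel_def
  proof (rule free.span_minimal[OF _ sub], rule subsetI, elim UnE CollectE exE conjE)
    fix p :: "'v word \<Rightarrow>\<^sub>0 'k" and u v j y z
    assume *: "p = gen (u @ (j, y \<oplus>\<^bsub>V j\<^esub> z) # v) - gen (u @ (j, y) # v) - gen (u @ (j, z) # v)"
      "u @ (j, y) # v \<in> words V" "z \<in> carrier (V j)"
    then have y: "y \<in> carrier (V j)" by (simp add: words_iff)
    show "p \<in> {p. ev p = \<zero>\<^bsub>V i\<^esub>}"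
    proof (cases "u = [] \<and> v = [] \<and> j = i")
      case True
      then have "ev p = (y \<oplus>\<^bsub>V i\<^esub> z) \<oplus>\<^bsub>V i\<^esub> \<ominus>\<^bsub>V i\<^esub> y \<oplus>\<^bsub>V i\<^esub> \<ominus>\<^bsub>V i\<^esub> z"
        using * y by (auto simp: diff gen co_def)
      also have "\<dots> = \<zero>\<^bsub>V i\<^esub>"
      proof -
        have yz: "y \<in> carrier (V i)" "z \<in> carrier (V i)" using True y *(3) by auto
        then have "(y \<oplus>\<^bsub>V i\<^esub> z) \<oplus>\<^bsub>V i\<^esub> \<ominus>\<^bsub>V i\<^esub> y \<oplus>\<^bsub>V i\<^esub> \<ominus>\<^bsub>V i\<^esub> z = (y \<oplus>\<^bsub>V i\<^esub> z) \<oplus>\<^bsub>V i\<^esub> (\<ominus>\<^bsub>V i\<^esub> y \<oplus>\<^bsub>V i\<^esub> \<ominus>\<^bsub>V i\<^esub> z)"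
          by (intro a_assoc) auto
        then show ?thesis using yz by (simp only: minus_add[symmetric] r_neg a_closed)
      qed
      finally show ?thesis by simp
    next
      case False
      then have "co (u @ (j, a) # v) = \<zero>\<^bsub>V i\<^esub>" for a by (cases u) (auto simp: co_def)
      then show ?thesis using * by (simp add: diff gen)
    qed
  next
    fix p :: "'v word \<Rightarrow>\<^sub>0 'k" and u v j y c
    assume *: "p = gen (u @ (j, c \<odot>\<^bsub>V j\<^esub> y) # v) - fscale c (gen (u @ (j, y) # v))"
      "u @ (j, y) # v \<in> words V"
    then have y: "y \<in> carrier (V j)" by (simp add: words_iff)
    show "p \<in> {p. ev p = \<zero>\<^bsub>V i\<^esub>}"
    proof (cases "u = [] \<and> v = [] \<and> j = i")
      case True
      then show ?thesis
        using * y gs_smult[OF V y, of c] by (auto simp: diff gen scale co_def r_neg)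
    next
      case False
      then have "co (u @ (j, a) # v) = \<zero>\<^bsub>V i\<^esub>" for a by (cases u) (auto simp: co_def)
      then show ?thesis using * by (simp add: diff gen scale gs_smult_zero[OF V])
    qed
  next
    fix p :: "'v word \<Rightarrow>\<^sub>0 'k" and u v j y k z
    assume *: "p = gen (u @ (j, y) # (k, z) # v) - fscale (ksgn j k) (gen (u @ (k, z) # (j, y) # v))"
    have "co (u @ a # b # v) = \<zero>\<^bsub>V i\<^esub>" for a b by (simp add: co_def)
    then show "p \<in> {p. ev p = \<zero>\<^bsub>V i\<^esub>}" using * by (simp add: diff gen scale gs_smult_zero[OF V])
  qed
  then have "ev (gen [(i, x)]) = \<zero>\<^bsub>V i\<^esub>" using r by auto
  then show ?thesis using x by (simp add: gen co_def)
qed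

text \<open>Turns congruences of letters back into equations in the space; this is how identities of
  brackets are extracted from coalgebra identities.\<close>

lemma letter_eq:
  fixes V :: "('k::field_char_0, 'v) gspace"
  assumes V: "graded_space V" and x: "x \<in> carrier (V i)" and y: "y \<in> carrier (V i)"
    and r: "gen [(i, x)] - gen [(i, y)] \<in> sym_rel V"
  shows "x = y"
proof -
  interpret module "cring_class_ops :: 'k ring" "V i" by (rule graded_module[OF V])
  have "gen [(i, x \<oplus>\<^bsub>V i\<^esub> (- 1) \<odot>\<^bsub>V i\<^esub> y)] - gen [(i, x)] - gen [(i, (- 1) \<odot>\<^bsub>V i\<^esub> y)] \<in> sym_rel V"
    using sym_rel_add[of "[]" V "[]" x i "(- 1) \<odot>\<^bsub>V i\<^esub> y"] x y gs_smult[OF V y] by simp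
  moreover have "gen [(i, (- 1) \<odot>\<^bsub>V i\<^esub> y)] - fscale (- 1) (gen [(i, y)]) \<in> sym_rel V"
    using sym_rel_smult[of "[]" V "[]" y i "-1"] y by simp
  ultimately have "gen [(i, x \<oplus>\<^bsub>V i\<^esub> (- 1) \<odot>\<^bsub>V i\<^esub> y)] - gen [(i, x)] - gen [(i, (- 1) \<odot>\<^bsub>V i\<^esub> y)]
      + (gen [(i, (- 1) \<odot>\<^bsub>V i\<^esub> y)] - fscale (- 1) (gen [(i, y)])) + (gen [(i, x)] - gen [(i, y)]) \<in> sym_rel V"
    using r by (intro free.subspace_add subspace_sym_rel)
  then have "gen [(i, x \<oplus>\<^bsub>V i\<^esub> (- 1) \<odot>\<^bsub>V i\<^esub> y)] \<in> sym_rel V" by simp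
  then have "x \<oplus>\<^bsub>V i\<^esub> (- 1) \<odot>\<^bsub>V i\<^esub> y = \<zero>\<^bsub>V i\<^esub>"
    by (rule letter_zero[OF V gs_add[OF V x gs_smult[OF V y]]])
  then show ?thesis
    using x y by (simp add: gs_neg[OF V y]) (metis a_inv_closed minus_equality minus_minus)
qed

section \<open>Decalage: skew maps become symmetric maps of the suspension\<close>

section \<open>Shifted components\<close>

text \<open>Precomposition with the desuspensions, the sign (-1)^(k(k-1)/2) included. The outer
  suspension only relabels degrees and leaves elements unchanged.\<close>

definition shift_map :: "('k::field_char_0, 'w) gspace \<Rightarrow> (nat \<Rightarrow> int) \<Rightarrow> ('v word \<Rightarrow> 'w) \<Rightarrow> 'v word \<Rightarrow> 'w" where
  "shift_map W e f w = desusp_sgn w \<odot>\<^bsub>W (wdeg (desusp w) + e (length w))\<^esub> f (desusp w)"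

lemma desusp_simps [simp]:
  "desusp [] = []" "desusp ((i, x) # w) = (i - 1, x) # desusp w" "desusp (u @ v) = desusp u @ desusp v"
  "desusp w = [] \<longleftrightarrow> w = []" "length (desusp w) = length w"
  by (auto simp: desusp_def)

lemma wdeg_desusp: "wdeg (desusp w) = wdeg w - int (length w)"
  by (induction w) auto

lemma desusp_words0: "desusp w \<in> words0 V \<longleftrightarrow> w \<in> words0 (susp V)"
  by (induction w) (auto simp: susp_def)

lemma desusp_words: "desusp w \<in> words V \<longleftrightarrow> w \<in> words (susp V)"
  by (simp add: words_iff desusp_words0)

lemma desusp_sgn_cong:
  assumes "map fst w = map fst w'"
  shows "desusp_sgn w = desusp_sgn w'"
proof -
  have len: "length w = length w'" using assms by (metis length_map)
  have "fst (w ! j) = fst (w' ! j)" if "j < length w'" for j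
    using that assms len by (metis nth_map)
  then show ?thesis by (simp add: desusp_sgn_def len)
qed

text \<open>The weights of adjacent positions differ by one, so a transposition changes the weighted
  sum of degrees by \<open>i - j\<close>.\<close>

lemma desusp_sgn_swap:
  "desusp_sgn (u @ (i, x) # (j, y) # v) =
    ((if even (i + j) then 1 else - 1) * desusp_sgn (u @ (j, y) # (i, x) # v) :: 'k::field_char_0)"
proof -
  define S where "S w = (\<Sum>j<length w. int (length w - 1 - j) * fst (w ! j))" for w :: "'a word"
  have rec: "S (a # w) = int (length w) * fst a + S w" for a w
    by (simp add: S_def sum.lessThan_Suc_shift del: sum.lessThan_Suc)
  have "S (u @ (i, x) # (j, y) # v) = S (u @ (j, y) # (i, x) # v) + i - j"
    by (induction u) (auto simp: rec algebra_simps)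
  moreover define N where "N = int (length (u @ (i, x) # (j, y) # v) * (length (u @ (i, x) # (j, y) # v) - 1) div 2)"
  ultimately have "even (N + S (u @ (i, x) # (j, y) # v)) \<longleftrightarrow> (even (i + j) \<longleftrightarrow> even (N + S (u @ (j, y) # (i, x) # v)))"
    by auto
  moreover have "desusp_sgn w = (if even (int (length w * (length w - 1) div 2) + S w) then 1 else - 1 :: 'k)" for w :: "'a word"
    by (simp only: desusp_sgn_def S_def)
  moreover have "length (u @ (j, y) # (i, x) # v) = length (u @ (i, x) # (j, y) # v)" by simp
  ultimately show ?thesis
    by (simp only: N_def[symmetric] split: if_splits) auto
qed

lemma desusp_sgn_self: "desusp_sgn w * desusp_sgn w = 1"
  by (simp add: desusp_sgn_def)

lemma skew_maps_closed: "skew_maps V W e f \<Longrightarrow> w \<in> words V \<Longrightarrow> f w \<in> carrier (W (wdeg w + e (length w)))"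
  by (simp add: skew_maps_def)

lemma skew_maps_add:
  assumes "skew_maps V W e f" "u @ (i, x) # v \<in> words V" "y \<in> carrier (V i)"
  shows "f (u @ (i, x \<oplus>\<^bsub>V i\<^esub> y) # v) =
    f (u @ (i, x) # v) \<oplus>\<^bsub>W (wdeg (u @ (i, x) # v) + e (length (u @ (i, x) # v)))\<^esub> f (u @ (i, y) # v)"
  using assms unfolding skew_maps_def Let_def by blast

lemma skew_maps_smult:
  assumes "skew_maps V W e f" "u @ (i, x) # v \<in> words V"
  shows "f (u @ (i, c \<odot>\<^bsub>V i\<^esub> x) # v) =
    c \<odot>\<^bsub>W (wdeg (u @ (i, x) # v) + e (length (u @ (i, x) # v)))\<^esub> f (u @ (i, x) # v)"
  using assms unfolding skew_maps_def Let_def by blast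

lemma skew_maps_swap:
  assumes "skew_maps V W e f" "u @ (i, x) # (j, y) # v \<in> words V"
  shows "f (u @ (i, x) # (j, y) # v) = (- ksgn i j)
    \<odot>\<^bsub>W (wdeg (u @ (i, x) # (j, y) # v) + e (length (u @ (i, x) # (j, y) # v)))\<^esub> f (u @ (j, y) # (i, x) # v)"
  using assms unfolding skew_maps_def Let_def by blast

text \<open>Length-dependent degrees become one degree \<open>c\<close>: - 1 for brackets, 0 for
  morphisms, 1 for an auxiliary map used in the equation for r.\<close>

lemma sym_maps_shift:
  fixes W :: "('k::field_char_0, 'w) gspace"
  assumes W: "graded_space W" and f: "skew_maps V W e f" and e: "\<And>k. e k = int k + c - 1"
  shows "sym_maps (susp V) (susp W) c (shift_map W e f)"
proof -
  have deg: "wdeg (desusp w) + e (length w) = wdeg w + c - 1" for w :: "'b word"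
    by (simp add: wdeg_desusp e)
  have sw: "susp W i = W (i - 1)" for i by (simp add: susp_def)
  have sh: "shift_map W e f w = desusp_sgn w \<odot>\<^bsub>W (wdeg w + c - 1)\<^esub> f (desusp w)" for w
    by (simp only: shift_map_def deg)
  have cl: "f (desusp w) \<in> carrier (W (wdeg w + c - 1))" if "w \<in> words (susp V)" for w
    using skew_maps_closed[OF f, of "desusp w"] that deg[of w] by (simp add: desusp_words)
  show ?thesis
    unfolding sym_maps_def sw
  proof (intro conjI ballI allI impI)
    fix w assume "w \<in> words (susp V)"
    then show "shift_map W e f w \<in> carrier (W (wdeg w + c - 1))"
      unfolding sh by (intro gs_smult[OF W] cl)
  next
    fix u v i x y
    assume *: "u \<in> words0 (susp V)" "v \<in> words0 (susp V)" "x \<in> carrier (susp V i)" "y \<in> carrier (susp V i)"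
    let ?w = "\<lambda>x. u @ (i, x) # v" and ?M = "W (wdeg u + (i + wdeg v) + c - 1)"
    have w: "?w x \<in> words (susp V)" "?w y \<in> words (susp V)" using * by (auto simp: words_iff)
    have "f (desusp u @ (i - 1, x \<oplus>\<^bsub>V (i - 1)\<^esub> y) # desusp v) =
        f (desusp (?w x)) \<oplus>\<^bsub>W (wdeg (desusp (?w x)) + e (length (?w x)))\<^esub> f (desusp (?w y))"
      using skew_maps_add[OF f, of "desusp u" "i - 1" x "desusp v" y] w(1)[folded desusp_words] *(4)
      by (simp add: susp_def)
    then have "f (desusp (?w (x \<oplus>\<^bsub>susp V i\<^esub> y))) = f (desusp (?w x)) \<oplus>\<^bsub>?M\<^esub> f (desusp (?w y))"
      unfolding deg by (simp add: susp_def)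
    moreover have "desusp_sgn (?w (x \<oplus>\<^bsub>susp V i\<^esub> y)) = (desusp_sgn (?w x) :: 'k)"
      "desusp_sgn (?w y) = (desusp_sgn (?w x) :: 'k)"
      by (rule desusp_sgn_cong, simp)+
    ultimately show "shift_map W e f (?w (x \<oplus>\<^bsub>susp V i\<^esub> y)) =
        shift_map W e f (?w x) \<oplus>\<^bsub>?M\<^esub> shift_map W e f (?w y)"
      using cl[OF w(1)] cl[OF w(2)] by (simp add: sh gs_smult_add[OF W])
  next
    fix u v i x a
    assume *: "u \<in> words0 (susp V)" "v \<in> words0 (susp V)" "x \<in> carrier (susp V i)"
    let ?w = "\<lambda>x. u @ (i, x) # v" and ?M = "W (wdeg u + (i + wdeg v) + c - 1)"
    have w: "?w x \<in> words (susp V)" using * by (auto simp: words_iff)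
    have "f (desusp u @ (i - 1, a \<odot>\<^bsub>V (i - 1)\<^esub> x) # desusp v) =
        a \<odot>\<^bsub>W (wdeg (desusp (?w x)) + e (length (?w x)))\<^esub> f (desusp (?w x))"
      using skew_maps_smult[OF f, of "desusp u" "i - 1" x "desusp v" a] w[folded desusp_words]
      by simp
    then have "f (desusp (?w (a \<odot>\<^bsub>susp V i\<^esub> x))) = a \<odot>\<^bsub>?M\<^esub> f (desusp (?w x))"
      unfolding deg by (simp add: susp_def)
    moreover have "desusp_sgn (?w (a \<odot>\<^bsub>susp V i\<^esub> x)) = (desusp_sgn (?w x) :: 'k)"
      by (rule desusp_sgn_cong) simp
    ultimately show "shift_map W e f (?w (a \<odot>\<^bsub>susp V i\<^esub> x)) = a \<odot>\<^bsub>?M\<^esub> shift_map W e f (?w x)"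
      using cl[OF w(1)] by (simp add: sh gs_smult_smult[OF W] mult.commute)
  next
    fix u v i x j y
    assume *: "u \<in> words0 (susp V)" "v \<in> words0 (susp V)" "x \<in> carrier (susp V i)" "y \<in> carrier (susp V j)"
    let ?w = "u @ (i, x) # (j, y) # v" and ?w' = "u @ (j, y) # (i, x) # v"
      and ?M = "W (wdeg u + (i + (j + wdeg v)) + c - 1)"
    have w: "?w \<in> words (susp V)" "?w' \<in> words (susp V)" using * by (auto simp: words_iff)
    have eq: "wdeg ?w' + c - 1 = wdeg u + (i + (j + wdeg v)) + c - 1" "wdeg ?w + c - 1 = wdeg u + (i + (j + wdeg v)) + c - 1" by simp_all
    have "f (desusp ?w) =
        (- ksgn (i - 1) (j - 1)) \<odot>\<^bsub>W (wdeg (desusp ?w) + e (length ?w))\<^esub> f (desusp ?w')"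
      using skew_maps_swap[OF f, of "desusp u" "i - 1" x "j - 1" y "desusp v"] w(1)[folded desusp_words]
      by simp
    then have "f (desusp ?w) = (- ksgn (i - 1) (j - 1)) \<odot>\<^bsub>?M\<^esub> f (desusp ?w')"
      unfolding deg eq .
    \<comment> \<open>The decalage sign: (i-1)(j-1) + 1 + i + j is congruent to ij modulo 2.\<close>
    moreover have K: "- ksgn (i - 1) (j - 1) * (if even (i + j) then 1 else - 1) = (ksgn i j :: 'k)"
      by (auto simp: ksgn_def)
    have "desusp_sgn ?w = (if even (i + j) then 1 else - 1) * (desusp_sgn ?w' :: 'k)"
      by (rule desusp_sgn_swap)
    then have "desusp_sgn ?w * - ksgn (i - 1) (j - 1) = ksgn i j * (desusp_sgn ?w' :: 'k)"
      unfolding K[symmetric] by (simp only: mult_ac)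
    ultimately show "shift_map W e f ?w = ksgn i j \<odot>\<^bsub>?M\<^esub> shift_map W e f ?w'"
      using cl[OF w(2)] unfolding sh eq by (simp only: gs_smult_smult[OF W])
  qed
qed

section \<open>Algebras and morphisms in terms of the canonical lifts\<close>

section \<open>Explicit codifferentials and morphisms\<close>

abbreviation sus :: "('k, 'v) linf \<Rightarrow> ('k, 'v) gspace" where
  "sus L \<equiv> susp (space L)"

definition lbr :: "('k::field_char_0, 'v) linf \<Rightarrow> 'v word \<Rightarrow> 'v" where
  "lbr L = shift_map (space L) bracket_deg (bracket L)"

definition lmo :: "('k::field_char_0, 'w) linf \<Rightarrow> ('v word \<Rightarrow> 'w) \<Rightarrow> 'v word \<Rightarrow> 'w" where
  "lmo L' f = shift_map (space L') morphism_deg f"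

abbreviation codiff :: "('k::field_char_0, 'v) linf \<Rightarrow> ('v word \<Rightarrow>\<^sub>0 'k) \<Rightarrow> ('v word \<Rightarrow>\<^sub>0 'k)" where
  "codiff L \<equiv> cod (- 1) (lbr L)"

abbreviation linf_pre :: "('k::field_char_0, 'v) linf \<Rightarrow> bool" where
  "linf_pre L \<equiv> graded_space (space L) \<and> skew_maps (space L) (space L) bracket_deg (bracket L)"

lemma has_components_iff:
  fixes V' :: "('k::field_char_0, 'w) gspace"
  assumes "\<And>k. e k = int k + c - 1"
  shows "has_components V V' e f D \<longleftrightarrow>
    (\<forall>w \<in> words (susp V). proj_one (D (gen w)) - com c (shift_map V' e f) (gen w) \<in> sym_rel (susp V'))"
  unfolding has_components_def Let_def
proof (rule ball_cong[OF refl])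
  fix w assume "w \<in> words (susp V)"
  then have "com c (shift_map V' e f) (gen w) = (gen [(wdeg w + c, shift_map V' e f w)] :: _ \<Rightarrow>\<^sub>0 'k)"
    by (simp add: com_gen words_iff)
  moreover have "wdeg (desusp w) + e (length w) + 1 = wdeg w + c"
    by (simp add: wdeg_desusp assms)
  ultimately show "(proj_one (D (gen w)) - gen [(wdeg (desusp w) + e (length w) + 1,
        desusp_sgn w \<odot>\<^bsub>V' (wdeg (desusp w) + e (length w))\<^esub> f (desusp w))] \<in> sym_rel (susp V')) =
      (proj_one (D (gen w)) - com c (shift_map V' e f) (gen w) \<in> sym_rel (susp V'))"
    by (simp only: shift_map_def)
qed

lemma lbr_sym: "linf_pre L \<Longrightarrow> sym_maps (sus L) (sus L) (- 1) (lbr L)"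
  unfolding lbr_def by (rule sym_maps_shift) auto

lemma lmo_sym:
  "graded_space (space L') \<Longrightarrow> skew_maps (space L) (space L') morphism_deg f \<Longrightarrow> sym_maps (sus L) (sus L') 0 (lmo L' f)"
  unfolding lmo_def by (rule sym_maps_shift) auto

lemma proj_one_rel:
  fixes V :: "('k::field_char_0, 'v) gspace"
  assumes "p \<in> sym_rel V"
  shows "proj_one p \<in> sym_rel V"
proof (rule flin_sym_compat[OF flin_proj_one _ assms])
  have "(\<lambda>w. proj_one (gen w) :: 'v word \<Rightarrow>\<^sub>0 'k) = (\<lambda>w. fscale (if length w = 1 then 1 else 0) (gen w))"
    by (auto simp: proj_one_gen)
  then show "sym_compat V (sym_rel V) (\<lambda>w. proj_one (gen w))"
    by (auto intro!: sym_compat_scale_fun sym_compat_gen)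
qed

lemma linf_codiff_cod: "linf_pre L \<Longrightarrow> linf_codiff L (codiff L)"
  unfolding linf_codiff_def
  by (subst has_components_iff[where c = "- 1"])
    (auto simp: proj_one_cod lbr_def[symmetric] free.subspace_0 intro!: coderivation_cod lbr_sym)

lemma linf_codiff_unique:
  assumes "linf_pre L" "linf_codiff L D" "p \<in> sym_free (sus L)"
  shows "D p - codiff L p \<in> sym_rel (sus L)"
proof (rule coderivation_unique[OF _ coderivation_cod[OF lbr_sym[OF assms(1)]] _ assms(3)])
  have "has_components (space L) (space L) bracket_deg (bracket L) D"
    using assms(2) by (simp add: linf_codiff_def)
  then show "\<And>w. w \<in> words (sus L) \<Longrightarrow> proj_one (D (gen w)) - proj_one (codiff L (gen w)) \<in> sym_rel (sus L)"
    by (subst (asm) has_components_iff[where c = "- 1"]) (auto simp: proj_one_cod lbr_def)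
qed (use assms(2) in \<open>simp add: linf_codiff_def\<close>)

lemma codiff_sym_map: "linf_pre L \<Longrightarrow> sym_map (sus L) (sus L) (- 1) (codiff L)"
  by (rule sym_map_cod[OF lbr_sym])

lemma linf_algebra_pre: "linf_algebra L \<Longrightarrow> linf_pre L"
  by (simp add: linf_algebra_def)

text \<open>The given codifferential agrees with the canonical one modulo relations, and the
  canonical one preserves relations, so square zero transfers.\<close>

lemma linf_algebra_square:
  assumes L: "linf_algebra L" and p: "p \<in> sym_free (sus L)"
  shows "codiff L (codiff L p) \<in> sym_rel (sus L)"
proof -
  note pre = linf_algebra_pre[OF L]
  obtain D where D: "linf_codiff L D" "\<And>p. p \<in> sym_free (sus L) \<Longrightarrow> D (D p) \<in> sym_rel (sus L)"
    using L by (auto simp: linf_algebra_def)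
  have DS: "sym_map (sus L) (sus L) (- 1) D" using D(1) by (simp add: linf_codiff_def coderivation_def)
  have "codiff L (codiff L p) - codiff L (D p) \<in> sym_rel (sus L)"
    unfolding free2.linear_diff[OF flin_cod, symmetric]
    by (rule sym_map_rel[OF codiff_sym_map[OF pre] cong_sym[OF subspace_sym_rel linf_codiff_unique[OF pre D(1) p]]])
  moreover have "codiff L (D p) - D (D p) \<in> sym_rel (sus L)"
    by (rule cong_sym[OF subspace_sym_rel linf_codiff_unique[OF pre D(1) sym_map_free[OF DS p]]])
  ultimately have "codiff L (codiff L p) - D (D p) \<in> sym_rel (sus L)"
    by (rule cong_trans[OF subspace_sym_rel])
  then show ?thesis by (rule cong_in[OF subspace_sym_rel _ D(2)[OF p]])
qed

text \<open>The generalised Jacobi identity on the entries of \<open>w\<close>, in suspended form.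
  With the converse below it is the working characterisation of an algebra.\<close>

lemma linf_algebra_jacobi:
  assumes "linf_algebra L" "w \<in> words (sus L)"
  shows "com (- 1) (lbr L) (codiff L (gen w)) \<in> sym_rel (sus L)"
  using proj_one_rel[OF linf_algebra_square[OF assms(1) gen_sym_free[OF assms(2)]]] by (simp add: proj_one_cod)

lemma linf_algebraI:
  assumes pre: "linf_pre L"
    and j: "\<And>w. w \<in> words (sus L) \<Longrightarrow> com (- 1) (lbr L) (codiff L (gen w)) \<in> sym_rel (sus L)"
  shows "linf_algebra L"
  unfolding linf_algebra_def
proof (intro conjI exI ballI)
  show "linf_codiff L (codiff L)" by (rule linf_codiff_cod[OF pre])
  fix p assume "p \<in> sym_free (sus L)"
  then show "codiff L (codiff L p) \<in> sym_rel (sus L)"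
    by (rule square_zero_unique[OF coderivation_cod[OF lbr_sym[OF pre]], rotated -1])
      (simp_all add: proj_one_cod j)
qed (use pre in auto)

lemma linf_coalgebra_map_iff:
  "linf_coalgebra_map L L' f F \<longleftrightarrow> coalgebra_map (sus L) (sus L') F \<and>
    (\<forall>w \<in> words (sus L). proj_one (F (gen w)) - com 0 (lmo L' f) (gen w) \<in> sym_rel (sus L'))"
  unfolding linf_coalgebra_map_def lmo_def by (subst has_components_iff[where c = 0]) auto

lemma linf_coalgebra_map_cmor:
  "graded_space (space L') \<Longrightarrow> skew_maps (space L) (space L') morphism_deg f \<Longrightarrow>
    linf_coalgebra_map L L' f (cmor (lmo L' f))"
  by (simp add: linf_coalgebra_map_iff coalgebra_map_cmor lmo_sym proj_one_cmor[simplified cmor_gen] proj_one_cmor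
      free.subspace_0 del: cmor_gen)

lemma linf_coalgebra_map_unique:
  assumes "linf_coalgebra_map L L' f F" "linf_coalgebra_map L L' f G" "p \<in> sym_free (sus L)"
  shows "F p - G p \<in> sym_rel (sus L')"
proof (rule coalgebra_map_unique[OF _ _ _ assms(3)])
  fix w assume "w \<in> words (sus L)"
  then have 1: "proj_one (F (gen w)) - com 0 (lmo L' f) (gen w) \<in> sym_rel (sus L')"
    and 2: "proj_one (G (gen w)) - com 0 (lmo L' f) (gen w) \<in> sym_rel (sus L')"
    using assms(1,2) by (auto simp: linf_coalgebra_map_iff)
  show "proj_one (F (gen w)) - proj_one (G (gen w)) \<in> sym_rel (sus L')"
    by (rule cong_trans[OF subspace_sym_rel 1 cong_sym[OF subspace_sym_rel 2]])
qed (use assms in \<open>auto simp: linf_coalgebra_map_iff\<close>)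

text \<open>Only the component of the intertwining condition is to be checked, and for any lift
  \<open>F\<close>: strict maps use the letterwise one, general morphisms
  \<open>cmor\<close>.\<close>

lemma linf_morphismI:
  assumes L: "linf_algebra L" and L': "linf_algebra L'"
    and f: "skew_maps (space L) (space L') morphism_deg f" and F: "linf_coalgebra_map L L' f F"
    and c: "\<And>w. w \<in> words (sus L) \<Longrightarrow>
      com 0 (lmo L' f) (codiff L (gen w)) - com (- 1) (lbr L') (F (gen w)) \<in> sym_rel (sus L')"
  shows "linf_morphism L L' f"
  unfolding linf_morphism_def
proof (intro conjI exI ballI)
  note pre = linf_algebra_pre[OF L] linf_algebra_pre[OF L']
  show "linf_coalgebra_map L L' f F" "linf_codiff L (codiff L)" "linf_codiff L' (codiff L')"
    by (rule F, rule linf_codiff_cod[OF pre(1)], rule linf_codiff_cod[OF pre(2)])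
  have cF: "coalgebra_map (sus L) (sus L') F" using F by (simp add: linf_coalgebra_map_iff)
  have flF: "flin F" by (rule sym_map_flin[OF coalgebra_map_sym_map[OF cF]])
  fix p assume "p \<in> sym_free (sus L)"
  then show "F (codiff L p) - codiff L' (F p) \<in> sym_rel (sus L')"
  proof (rule intertwine_unique[OF cF coderivation_cod[OF lbr_sym[OF pre(1)]]
        coderivation_cod[OF lbr_sym[OF pre(2)]], rotated])
    fix w assume w: "w \<in> words (sus L)"
    have "proj_one (F (codiff L (gen w))) - com 0 (lmo L' f) (codiff L (gen w)) \<in> sym_rel (sus L')"
    proof (rule sym_free_extend[where E = "\<lambda>p. proj_one (F p) - com 0 (lmo L' f) p"])
      show "flin (\<lambda>p. proj_one (F p) - com 0 (lmo L' f) p)"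
        by (intro flin_diff flin_com flin_comp[OF flin_proj_one flF])
      show "codiff L (gen w) \<in> sym_free (sus L)"
        by (rule sym_map_gen[OF codiff_sym_map[OF pre(1)] w])
    qed (use F in \<open>simp add: linf_coalgebra_map_iff\<close>)
    then show "proj_one (F (codiff L (gen w))) - proj_one (codiff L' (F (gen w))) \<in> sym_rel (sus L')"
      unfolding proj_one_cod by (rule cong_trans[OF subspace_sym_rel _ c[OF w]])
  qed
qed (use assms in auto)

text \<open>The three lifts in the definition are existentially bound; uniqueness exchanges each of
  them for a chosen one.\<close>

lemma linf_morphism_intertwine:
  assumes f: "linf_morphism L L' f" and G: "linf_coalgebra_map L L' f G" and p: "p \<in> sym_free (sus L)"
  shows "G (codiff L p) - codiff L' (G p) \<in> sym_rel (sus L')"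
proof -
  obtain F D D' where F: "linf_coalgebra_map L L' f F" and D: "linf_codiff L D" and D': "linf_codiff L' D'"
    and eq: "\<And>p. p \<in> sym_free (sus L) \<Longrightarrow> F (D p) - D' (F p) \<in> sym_rel (sus L')"
    and LL: "linf_algebra L" "linf_algebra L'"
    using f by (auto simp: linf_morphism_def)
  note pre = LL[THEN linf_algebra_pre]
  have DS: "sym_map (sus L) (sus L) (- 1) D" using D(1) by (simp add: linf_codiff_def coderivation_def)
  have FS: "sym_map (sus L) (sus L') 0 F" using F by (simp add: linf_coalgebra_map_iff coalgebra_map_def)
  have GS: "sym_map (sus L) (sus L') 0 G" using G by (simp add: linf_coalgebra_map_iff coalgebra_map_def)
  note S = subspace_sym_rel
  have 1: "G (codiff L p) - G (D p) \<in> sym_rel (sus L')"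
    unfolding free2.linear_diff[OF sym_map_flin[OF GS], symmetric]
    by (rule sym_map_rel[OF GS cong_sym[OF S linf_codiff_unique[OF pre(1) D p]]])
  have 2: "G (D p) - F (D p) \<in> sym_rel (sus L')"
    by (intro linf_coalgebra_map_unique[OF G F] sym_map_free[OF DS p])
  have 3: "D' (F p) - codiff L' (F p) \<in> sym_rel (sus L')"
    by (intro linf_codiff_unique[OF pre(2) D'] sym_map_free[OF FS p])
  have 4: "codiff L' (F p) - codiff L' (G p) \<in> sym_rel (sus L')"
    unfolding free2.linear_diff[OF flin_cod, symmetric]
    by (intro sym_map_rel[OF codiff_sym_map[OF pre(2)]] linf_coalgebra_map_unique[OF F G p])
  show ?thesis
    by (rule cong_trans[OF S 1 cong_trans[OF S 2 cong_trans[OF S eq[OF p] cong_trans[OF S 3 4]]]])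
qed

lemma linf_morphism_component:
  assumes f: "linf_morphism L L' f" and w: "w \<in> words (sus L)"
  shows "com 0 (lmo L' f) (codiff L (gen w)) - com (- 1) (lbr L') (cmorg (lmo L' f) w) \<in> sym_rel (sus L')"
proof -
  have "graded_space (space L')" "skew_maps (space L) (space L') morphism_deg f"
    using f by (auto simp: linf_morphism_def linf_algebra_def)
  from proj_one_rel[OF linf_morphism_intertwine[OF f linf_coalgebra_map_cmor[OF this] gen_sym_free[OF w]]]
  show ?thesis by (simp add: free2.linear_diff[OF flin_proj_one] proj_one_cod proj_one_cmor)
qed

section \<open>Strict morphisms as linear maps preserving all brackets\<close>

section \<open>Strict morphisms\<close>

text \<open>Ties a function on words to the degreewise linear map of its linear part: statements
  speak of \<open>f\<close>, computations use \<open>g\<close>.\<close>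

definition strict_rep :: "('k::field_char_0, 'v) linf \<Rightarrow> ('k, 'w) linf \<Rightarrow> (int \<Rightarrow> 'v \<Rightarrow> 'w) \<Rightarrow> ('v word \<Rightarrow> 'w) \<Rightarrow> bool" where
  "strict_rep L L' g f \<longleftrightarrow> glin (space L) (space L') g \<and>
     (\<forall>i. \<forall>x \<in> carrier (space L i). f [(i, x)] = g i x) \<and> linf_strict L L' f"

definition bracket_hom :: "('k::field_char_0, 'v) linf \<Rightarrow> ('k, 'w) linf \<Rightarrow> (int \<Rightarrow> 'v \<Rightarrow> 'w) \<Rightarrow> bool" where
  "bracket_hom L L' g \<longleftrightarrow> (\<forall>w \<in> words (space L).
     g (wdeg w + bracket_deg (length w)) (bracket L w) = bracket L' (wmap g w))"

abbreviation gsus :: "(int \<Rightarrow> 'v \<Rightarrow> 'w) \<Rightarrow> int \<Rightarrow> 'v \<Rightarrow> 'w" where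
  "gsus g \<equiv> \<lambda>i. g (i - 1)"

lemma glin_gsus: "glin V W g \<Longrightarrow> glin (susp V) (susp W) (gsus g)"
  by (simp add: glin_def susp_def)

lemma glin_zero:
  assumes "glin V W g" "graded_space V" "graded_space W"
  shows "g i \<zero>\<^bsub>V i\<^esub> = \<zero>\<^bsub>W i\<^esub>"
  using glinD(3)[OF assms(1) gs_zero[OF assms(2), of i], of 0] glinD(1)[OF assms(1) gs_zero[OF assms(2), of i]]
  by (simp add: gs_smult_zero[OF assms(2)] gs_zero_smult[OF assms(3)])

lemma words_cases:
  assumes "w \<in> words V"
  obtains i x where "w = [(i, x)]" "x \<in> carrier (V i)" | "length w \<ge> 2"
proof -
  obtain i x w' where w: "w = (i, x) # w'" using assms by (cases w) (auto simp: words_iff)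
  show ?thesis using that assms by (cases w') (auto simp: w words_iff)
qed

text \<open>A swap involves two letters, where such maps vanish, so skew-symmetry is automatic. The
  degree function stays general to cover strict morphisms, differentials of abelian algebras and a
  map raising degrees by one.\<close>

lemma skew_maps_linear:
  fixes V :: "('k::field_char_0, 'v) gspace" and W :: "('k, 'w) gspace"
  assumes V: "graded_space V" and W: "graded_space W" and g: "glin V (\<lambda>i. W (i + e 1)) g"
    and f1: "\<And>i x. x \<in> carrier (V i) \<Longrightarrow> f [(i, x)] = g i x"
    and f2: "\<And>w. w \<in> words V \<Longrightarrow> length w \<ge> 2 \<Longrightarrow> f w = \<zero>\<^bsub>W (wdeg w + e (length w))\<^esub>"
  shows "skew_maps V W e f"
proof -
  note gD = glinD[OF g, unfolded One_nat_def]
  define N where "N u i v = wdeg u + (i + wdeg v) + e (length u + Suc (length v))" for u v :: "'v word" and i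
  have deg: "wdeg (u @ (i, x) # v) + e (length (u @ (i, x) # v)) = N u i v" for u i x v
    by (simp add: N_def)
  have z: "f (u @ (i, x) # v) = \<zero>\<^bsub>W (N u i v)\<^esub>"
    if "u @ (i, x) # v \<in> words V" "\<not> (u = [] \<and> v = [])" for u i x v
  proof -
    have "length (u @ (i, x) # v) \<ge> 2" using that(2) by (cases u; cases v) auto
    from f2[OF that(1) this] show ?thesis unfolding deg .
  qed
  show ?thesis
    unfolding skew_maps_def Let_def
  proof (intro conjI ballI allI impI; (elim conjE)?)
    fix w assume w: "w \<in> words V"
    then show "f w \<in> carrier (W (wdeg w + e (length w)))"
      by (cases rule: words_cases) (auto simp: f1 gD f2[OF w] gs_zero[OF W])
  next
    fix u v i x y
    assume *: "u @ (i, x) # v \<in> words V" "y \<in> carrier (V i)"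
    then have x: "x \<in> carrier (V i)" and uv: "u \<in> words0 V" "v \<in> words0 V"
      by (auto simp: words_iff)
    show "f (u @ (i, x \<oplus>\<^bsub>V i\<^esub> y) # v) = f (u @ (i, x) # v)
      \<oplus>\<^bsub>W (wdeg (u @ (i, x) # v) + e (length (u @ (i, x) # v)))\<^esub> f (u @ (i, y) # v)"
      unfolding deg
    proof (cases "u = [] \<and> v = []")
      case True
      then show "f (u @ (i, x \<oplus>\<^bsub>V i\<^esub> y) # v) = f (u @ (i, x) # v) \<oplus>\<^bsub>W (N u i v)\<^esub> f (u @ (i, y) # v)"
        using x *(2) by (simp add: f1 gs_add[OF V] gD N_def)
    next
      case False
      then show "f (u @ (i, x \<oplus>\<^bsub>V i\<^esub> y) # v) = f (u @ (i, x) # v) \<oplus>\<^bsub>W (N u i v)\<^esub> f (u @ (i, y) # v)"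
        using x *(2) uv
        by (simp add: z[OF _ False] words_iff gs_add[OF V] gs_zero_add[OF W gs_zero[OF W]])
    qed
  next
    fix u v i x c
    assume *: "u @ (i, x) # v \<in> words V"
    then have x: "x \<in> carrier (V i)" and uv: "u \<in> words0 V" "v \<in> words0 V"
      by (auto simp: words_iff)
    show "f (u @ (i, c \<odot>\<^bsub>V i\<^esub> x) # v) =
      c \<odot>\<^bsub>W (wdeg (u @ (i, x) # v) + e (length (u @ (i, x) # v)))\<^esub> f (u @ (i, x) # v)"
      unfolding deg
    proof (cases "u = [] \<and> v = []")
      case True
      then show "f (u @ (i, c \<odot>\<^bsub>V i\<^esub> x) # v) = c \<odot>\<^bsub>W (N u i v)\<^esub> f (u @ (i, x) # v)"
        using x by (simp add: f1 gs_smult[OF V] gD N_def)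
    next
      case False
      then show "f (u @ (i, c \<odot>\<^bsub>V i\<^esub> x) # v) = c \<odot>\<^bsub>W (N u i v)\<^esub> f (u @ (i, x) # v)"
        using x uv by (simp add: z[OF _ False] words_iff gs_smult[OF V] gs_smult_zero[OF W])
    qed
  next
    fix u v i x j y
    assume *: "u @ (i, x) # (j, y) # v \<in> words V"
    then have **: "u @ (j, y) # (i, x) # v \<in> words V" by (auto simp: words_iff)
    have eq: "wdeg (u @ (j, y) # (i, x) # v) + e (length (u @ (j, y) # (i, x) # v)) =
      wdeg (u @ (i, x) # (j, y) # v) + e (length (u @ (i, x) # (j, y) # v))" by simp
    have "f (u @ (i, x) # (j, y) # v) = \<zero>\<^bsub>W (wdeg (u @ (i, x) # (j, y) # v)
        + e (length (u @ (i, x) # (j, y) # v)))\<^esub>"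
      by (rule f2[OF *]) simp
    moreover have "f (u @ (j, y) # (i, x) # v) = \<zero>\<^bsub>W (wdeg (u @ (i, x) # (j, y) # v)
        + e (length (u @ (i, x) # (j, y) # v)))\<^esub>"
      by (rule f2[OF **, unfolded eq]) simp
    ultimately show "f (u @ (i, x) # (j, y) # v) = (- ksgn i j) \<odot>\<^bsub>W (wdeg (u @ (i, x) # (j, y) # v)
        + e (length (u @ (i, x) # (j, y) # v)))\<^esub> f (u @ (j, y) # (i, x) # v)"
      by (simp only: gs_smult_zero[OF W])
  qed
qed

lemma strict_skew:
  fixes L :: "('k::field_char_0, 'v) linf" and L' :: "('k, 'w) linf"
  assumes V: "graded_space (space L)" and W: "graded_space (space L')" and f: "strict_rep L L' g f"
  shows "skew_maps (space L) (space L') morphism_deg f"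
  by (rule skew_maps_linear[OF V W, where g = g]) (use f in \<open>simp_all add: strict_rep_def linf_strict_def\<close>)

lemma desusp_wmap: "desusp (wmap (gsus g) w) = wmap g (desusp w)"
  by (induction w) auto

lemma wdeg_nonempty_letter: "desusp_sgn [(i, x)] = 1"
  by (simp add: desusp_sgn_def)

text \<open>On longer words the prescribed component is the zero letter, which vanishes only modulo
  relations, whereas \<open>smap\<close> has no component there at all.\<close>

lemma strict_coalgebra_map:
  fixes L :: "('k::field_char_0, 'v) linf" and L' :: "('k, 'w) linf"
  assumes W: "graded_space (space L')" and f: "strict_rep L L' g f"
  shows "linf_coalgebra_map L L' f (smap (gsus g))"
  unfolding linf_coalgebra_map_iff
proof (intro conjI ballI)
  have g: "glin (space L) (space L') g" and f1: "\<And>i x. x \<in> carrier (space L i) \<Longrightarrow> f [(i, x)] = g i x"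
    and f2: "\<And>w. w \<in> words (space L) \<Longrightarrow> length w \<ge> 2 \<Longrightarrow> f w = \<zero>\<^bsub>space L' (wdeg w + morphism_deg (length w))\<^esub>"
    using f by (auto simp: strict_rep_def linf_strict_def)
  show "coalgebra_map (sus L) (sus L') (smap (gsus g))"
    by (rule coalgebra_map_smap[OF glin_gsus[OF g]])
  fix w assume w: "w \<in> words (sus L)"
  then show "proj_one (smap (gsus g) (gen w)) - com 0 (lmo L' f) (gen w) \<in> sym_rel (sus L')"
  proof (cases rule: words_cases)
    case (1 i x)
    then have x: "x \<in> carrier (space L (i - 1))" by (simp add: susp_def)
    have "lmo L' f w = g (i - 1) x"
      using x glinD(1)[OF g x] by (simp add: 1 lmo_def shift_map_def wdeg_nonempty_letter f1 gs_one_smult[OF W])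
    then show ?thesis by (simp add: 1 proj_one_gen com_gen free.subspace_0)
  next
    case 2
    have d: "wdeg (desusp w) + morphism_deg (length w) = wdeg w - 1" by (simp add: wdeg_desusp)
    have "f (desusp w) = \<zero>\<^bsub>space L' (wdeg w - 1)\<^esub>"
      using f2[of "desusp w"] w 2 by (simp add: desusp_words wdeg_desusp)
    then have "lmo L' f w = \<zero>\<^bsub>sus L' (wdeg w)\<^esub>"
      unfolding lmo_def shift_map_def d by (simp add: gs_smult_zero[OF W] susp_def)
    then have "com 0 (lmo L' f) (gen w) = (gen [(wdeg w, \<zero>\<^bsub>sus L' (wdeg w)\<^esub>)] :: _ \<Rightarrow>\<^sub>0 'k)"
      using 2 by (auto simp: com_gen)
    moreover have "gen [(wdeg w, \<zero>\<^bsub>sus L' (wdeg w)\<^esub>)] \<in> sym_rel (sus L')"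
      using gen_zero_rel[OF graded_susp[OF W], of "[]" "[]"] by simp
    moreover have "proj_one (smap (gsus g) (gen w)) = (0 :: _ \<Rightarrow>\<^sub>0 'k)" using 2 by (simp add: proj_one_gen)
    ultimately show ?thesis using free.subspace_neg[OF subspace_sym_rel] by simp
  qed
qed

lemma strict_lbr:
  fixes L :: "('k::field_char_0, 'v) linf" and L' :: "('k, 'w) linf"
  assumes pre: "linf_pre L" and g: "glin (space L) (space L') g" and h: "bracket_hom L L' g" and w: "w \<in> words (sus L)"
  shows "gsus g (wdeg w + - 1) (lbr L w) = lbr L' (wmap (gsus g) w)"
proof -
  have d: "wdeg (desusp w) + bracket_deg (length w) = wdeg w - 2" by (simp add: wdeg_desusp)
  have dw: "desusp w \<in> words (space L)" using w by (simp add: desusp_words)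
  have "bracket L (desusp w) \<in> carrier (space L (wdeg w - 2))"
    using skew_maps_closed[OF conjunct2[OF pre] dw] d by simp
  moreover have "g (wdeg w - 2) (bracket L (desusp w)) = bracket L' (wmap g (desusp w))"
    using h[unfolded bracket_hom_def, rule_format, OF dw] unfolding desusp_simps d .
  moreover have "desusp_sgn (wmap (gsus g) w) = (desusp_sgn w :: 'k)"
    by (rule desusp_sgn_cong) (auto simp: wmap_def)
  ultimately show ?thesis
    by (simp add: lbr_def shift_map_def desusp_wmap glinD[OF g] wdeg_desusp)
qed

text \<open>The letterwise lift intertwines the codifferentials exactly; only the zero letters among
  the components call for a congruence.\<close>

lemma strict_morphism:
  assumes L: "linf_algebra L" and L': "linf_algebra L'" and f: "strict_rep L L' g f" and h: "bracket_hom L L' g"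
  shows "linf_morphism L L' f"
proof (rule linf_morphismI[OF L L'])
  note pre = linf_algebra_pre[OF L] linf_algebra_pre[OF L']
  show "skew_maps (space L) (space L') morphism_deg f" using strict_skew f pre by blast
  show F: "linf_coalgebra_map L L' f (smap (gsus g))" using strict_coalgebra_map f pre by blast
  have g: "glin (space L) (space L') g" using f by (simp add: strict_rep_def)
  fix w assume w: "w \<in> words (sus L)"
  have "proj_one (smap (gsus g) (codiff L (gen w))) - com 0 (lmo L' f) (codiff L (gen w)) \<in> sym_rel (sus L')"
  proof (rule sym_free_extend[where E = "\<lambda>p. proj_one (smap (gsus g) p) - com 0 (lmo L' f) p"])
    show "flin (\<lambda>p. proj_one (smap (gsus g) p) - com 0 (lmo L' f) p)"
      by (intro flin_diff flin_com flin_comp[OF flin_proj_one flin_smap])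
    show "codiff L (gen w) \<in> sym_free (sus L)"
      by (rule sym_map_gen[OF codiff_sym_map[OF pre(1)] w])
  qed (use F in \<open>simp add: linf_coalgebra_map_iff\<close>)
  then have "com 0 (lmo L' f) (codiff L (gen w)) - proj_one (smap (gsus g) (codiff L (gen w))) \<in> sym_rel (sus L')"
    by (rule cong_sym[OF subspace_sym_rel])
  moreover have "smap (gsus g) (codiff L (gen w)) = codiff L' (gen (wmap (gsus g) w))"
    by (rule smap_cod[where V = "sus L"]) (use strict_lbr[OF pre(1) g h] w in \<open>auto simp: words_iff\<close>)
  ultimately show "com 0 (lmo L' f) (codiff L (gen w)) - com (- 1) (lbr L') (smap (gsus g) (gen w)) \<in> sym_rel (sus L')"
    by (simp add: proj_one_cod)
qed

lemma proj_one_smap: "proj_one (smap g p) = smap g (proj_one p)"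
  by (rule flin_eqI[OF flin_comp[OF flin_proj_one flin_smap] flin_comp[OF flin_smap flin_proj_one]])
    (simp add: proj_one_gen flin_simps)

lemma skew_maps_glin:
  assumes V: "graded_space V" and f: "skew_maps V W morphism_deg f"
  shows "glin V W (\<lambda>i x. f [(i, x)])"
  unfolding glin_def
proof (intro allI ballI conjI)
  fix i x assume x: "x \<in> carrier (V i)"
  then have w: "[] @ (i, x) # [] \<in> words V" by (simp add: words_iff)
  show "f [(i, x)] \<in> carrier (W i)" using skew_maps_closed[OF f w] by simp
  show "f [(i, x \<oplus>\<^bsub>V i\<^esub> y)] = f [(i, x)] \<oplus>\<^bsub>W i\<^esub> f [(i, y)]" if "y \<in> carrier (V i)" for y
    using skew_maps_add[OF f w that] by simp
  show "f [(i, c \<odot>\<^bsub>V i\<^esub> x)] = c \<odot>\<^bsub>W i\<^esub> f [(i, x)]" for c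
    using skew_maps_smult[OF f w] by simp
qed

text \<open>The converse, needed because \<open>f\<close> is known only as an L-infinity morphism:
  intertwining by the letterwise lift, projected to letters, is an equation of brackets by
  \<open>letter_eq\<close>.\<close>

lemma strict_morphismD:
  fixes L :: "('k::field_char_0, 'v) linf" and L' :: "('k, 'w) linf"
  assumes f: "linf_morphism L L' f" and s: "linf_strict L L' f"
  defines "g \<equiv> \<lambda>i x. f [(i, x)]"
  shows "strict_rep L L' g f" "bracket_hom L L' g"
proof -
  have L: "linf_algebra L" and L': "linf_algebra L'" and sk: "skew_maps (space L) (space L') morphism_deg f"
    using f by (auto simp: linf_morphism_def)
  note pre = L[THEN linf_algebra_pre] L'[THEN linf_algebra_pre]
  have gr: "graded_space (space L)" "graded_space (space L')" using pre by auto
  have g: "glin (space L) (space L') g" unfolding g_def by (rule skew_maps_glin[OF gr(1) sk])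
  show rep: "strict_rep L L' g f" using g s by (simp add: strict_rep_def g_def)
  note S = strict_coalgebra_map[OF gr(2) rep]
  show "bracket_hom L L' g"
    unfolding bracket_hom_def
  proof
    fix w' assume w': "w' \<in> words (space L)"
    define w where "w = map (\<lambda>(i, x). (i + 1, x)) w'"
    have dw: "desusp w = w'" unfolding w_def by (induction w') auto
    then have w: "w \<in> words (sus L)" using w' by (simp add: desusp_words[symmetric])
    have "smap (gsus g) (codiff L (gen w)) - codiff L' (smap (gsus g) (gen w)) \<in> sym_rel (sus L')"
      by (rule linf_morphism_intertwine[OF f S gen_sym_free[OF w]])
    from proj_one_rel[OF this]
    have r: "gen [(wdeg w - 1, gsus g (wdeg w - 1) (lbr L w))] - gen [(wdeg w - 1, lbr L' (wmap (gsus g) w))] \<in> sym_rel (sus L')"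
      using w by (simp add: free2.linear_diff[OF flin_proj_one] proj_one_smap proj_one_cod com_gen words_iff)
    have ww: "wmap (gsus g) w \<in> words (sus L')" by (rule wmap_words[OF glin_gsus[OF g] w])
    have c: "lbr L w \<in> carrier (sus L (wdeg w - 1))" "lbr L' (wmap (gsus g) w) \<in> carrier (sus L' (wdeg w - 1))"
      using sym_maps_closed[OF lbr_sym[OF pre(1)] w] sym_maps_closed[OF lbr_sym[OF pre(2)] ww] by simp_all
    from c(1) have "gsus g (wdeg w - 1) (lbr L w) \<in> carrier (sus L' (wdeg w - 1))"
      using glinD(1)[OF g] by (simp add: susp_def)
    from letter_eq[OF graded_susp[OF gr(2)] this c(2) r]
    have eq: "gsus g (wdeg w - 1) (lbr L w) = lbr L' (wmap (gsus g) w)" .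
    have sg: "desusp_sgn (wmap (gsus g) w) = (desusp_sgn w :: 'k)"
      by (rule desusp_sgn_cong) (auto simp: wmap_def)
    have d': "wdeg w' + bracket_deg (length w') = wdeg w - 2"
      unfolding dw[symmetric] by (simp add: wdeg_desusp)
    have d'': "wdeg w' + bracket_deg (length w) = wdeg w - 2"
      unfolding dw[symmetric] by (simp add: wdeg_desusp)
    have cl: "bracket L w' \<in> carrier (space L (wdeg w - 2))"
      using skew_maps_closed[OF conjunct2[OF pre(1)] w'] unfolding d' .
    have wl: "wmap g w' \<in> words (space L')" by (rule wmap_words[OF g w'])
    have cl': "bracket L' (wmap g w') \<in> carrier (space L' (wdeg w - 2))"
      using skew_maps_closed[OF conjunct2[OF pre(2)] wl] unfolding wdeg_wmap wmap_simps d' .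
    have "desusp_sgn w \<odot>\<^bsub>space L' (wdeg w - 2)\<^esub> g (wdeg w - 2) (bracket L w') =
        desusp_sgn w \<odot>\<^bsub>space L' (wdeg w - 2)\<^esub> bracket L' (wmap g w')"
      using eq unfolding lbr_def shift_map_def desusp_wmap dw sg wdeg_wmap wmap_simps d''
      by (simp add: glinD(3)[OF g cl])
    \<comment> \<open>The sign is removed by multiplying with it again, its square being
      one.\<close>
    then have "desusp_sgn w \<odot>\<^bsub>space L' (wdeg w - 2)\<^esub> (desusp_sgn w \<odot>\<^bsub>space L' (wdeg w - 2)\<^esub> g (wdeg w - 2) (bracket L w')) =
        desusp_sgn w \<odot>\<^bsub>space L' (wdeg w - 2)\<^esub> (desusp_sgn w \<odot>\<^bsub>space L' (wdeg w - 2)\<^esub> bracket L' (wmap g w'))"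
      by simp
    then have "g (wdeg w - 2) (bracket L w') = bracket L' (wmap g w')"
      using glinD(1)[OF g cl] cl' by (simp add: gs_smult_smult[OF gr(2)] desusp_sgn_self gs_one_smult[OF gr(2)])
    then show "g (wdeg w' + bracket_deg (length w')) (bracket L w') = bracket L' (wmap g w')"
      unfolding d' .
  qed
qed

section \<open>Products of L-infinity algebras and pairs of morphisms\<close>

section \<open>Products\<close>

definition prod_space :: "('k, 'v) gspace \<Rightarrow> ('k, 'w) gspace \<Rightarrow> ('k, 'v \<times> 'w) gspace" where
  "prod_space V W = (\<lambda>i. module_prod (V i) (W i))"

lemma space_linf_prod [simp]: "space (linf_prod A B) = prod_space (space A) (space B)"
  by (simp add: linf_prod_def prod_space_def)

lemma susp_prod_space: "susp (prod_space V W) = prod_space (susp V) (susp W)"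
  by (simp add: susp_def prod_space_def)

lemma prod_space_simps [simp]:
  "carrier (prod_space V W i) = carrier (V i) \<times> carrier (W i)"
  "\<zero>\<^bsub>prod_space V W i\<^esub> = (\<zero>\<^bsub>V i\<^esub>, \<zero>\<^bsub>W i\<^esub>)"
  "(x, y) \<oplus>\<^bsub>prod_space V W i\<^esub> (x', y') = (x \<oplus>\<^bsub>V i\<^esub> x', y \<oplus>\<^bsub>W i\<^esub> y')"
  "c \<odot>\<^bsub>prod_space V W i\<^esub> (x, y) = (c \<odot>\<^bsub>V i\<^esub> x, c \<odot>\<^bsub>W i\<^esub> y)"
  by (simp_all add: prod_space_def module_prod_def)

lemma graded_prod_space:
  fixes V :: "('k::field_char_0, 'v) gspace" and W :: "('k, 'w) gspace"
  assumes V: "graded_space V" and W: "graded_space W"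
  shows "graded_space (prod_space V W)"
  unfolding graded_space_def
proof
  fix i
  interpret V: module "cring_class_ops :: 'k ring" "V i" by (rule graded_module[OF V])
  interpret W: module "cring_class_ops :: 'k ring" "W i" by (rule graded_module[OF W])
  show "module (cring_class_ops :: 'k ring) (prod_space V W i)"
  proof (rule moduleI)
    show "abelian_group (prod_space V W i)"
    proof (rule abelian_groupI)
      fix x assume "x \<in> carrier (prod_space V W i)"
      then show "\<exists>y\<in>carrier (prod_space V W i). y \<oplus>\<^bsub>prod_space V W i\<^esub> x = \<zero>\<^bsub>prod_space V W i\<^esub>"
        by (auto intro!: bexI[of _ "(\<ominus>\<^bsub>V i\<^esub> fst x, \<ominus>\<^bsub>W i\<^esub> snd x)"] simp: V.l_neg W.l_neg)
    qed (auto simp: V.a_ac W.a_ac)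
  qed (auto simp: cring_class plus_class times_class one_class V.smult_closed carrier_class
      gs_smult[OF V] gs_smult[OF W] gs_add_smult[OF V] gs_add_smult[OF W] gs_smult_add[OF V] gs_smult_add[OF W]
      gs_smult_smult[OF V] gs_smult_smult[OF W] gs_one_smult[OF V] gs_one_smult[OF W])
qed

lemma glin_fst: "glin (prod_space V W) V (\<lambda>i. fst)"
  by (auto simp: glin_def)

lemma glin_snd: "glin (prod_space V W) W (\<lambda>i. snd)"
  by (auto simp: glin_def)

lemma glin_inl: "graded_space W \<Longrightarrow> glin V (prod_space V W) (\<lambda>i x. (x, \<zero>\<^bsub>W i\<^esub>))"
  by (auto simp: glin_def gs_zero gs_add_zero gs_smult_zero)

lemma glin_inr: "graded_space V \<Longrightarrow> glin W (prod_space V W) (\<lambda>i x. (\<zero>\<^bsub>V i\<^esub>, x))"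
  by (auto simp: glin_def gs_zero gs_add_zero gs_smult_zero)

abbreviation letters :: "('k::field_char_0, 'v) gspace \<Rightarrow> ('v word \<Rightarrow>\<^sub>0 'k) set" where
  "letters V \<equiv> free.span (gen ` {[(i, x)] | i x. x \<in> carrier (V i)})"

text \<open>By additivity a letter is congruent to the sum of its two components. This fails for
  longer words, hence the restriction to \<open>letters\<close>.\<close>

lemma prod_rel:
  fixes V :: "('k::field_char_0, 'v) gspace" and W :: "('k, 'w) gspace"
  assumes V: "graded_space V" and W: "graded_space W" and p: "p \<in> letters (prod_space V W)"
    and 1: "smap (\<lambda>i. fst) p \<in> sym_rel V" and 2: "smap (\<lambda>i. snd) p \<in> sym_rel W"
  shows "p \<in> sym_rel (prod_space V W)"
proof -
  let ?P = "prod_space V W"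
  let ?h = "\<lambda>p. smap (\<lambda>i x. (x, \<zero>\<^bsub>W i\<^esub>)) (smap (\<lambda>i. fst) p) + smap (\<lambda>i x. (\<zero>\<^bsub>V i\<^esub>, x)) (smap (\<lambda>i. snd) p)"
  have "flin (\<lambda>p. p - ?h p)"
    by (intro flin_diff flin_add flin_id flin_comp[OF flin_smap flin_smap])
  from this subspace_sym_rel _ p have "p - ?h p \<in> sym_rel ?P"
  proof (rule flin_span)
    fix z :: "('v \<times> 'w) word \<Rightarrow>\<^sub>0 'k" assume "z \<in> gen ` {[(i, x)] | i x. x \<in> carrier (?P i)}"
    then obtain i x y where z: "z = gen [(i, (x, y))]" "x \<in> carrier (V i)" "y \<in> carrier (W i)" by auto
    show "z - ?h z \<in> sym_rel ?P"
      using sym_rel_add[of "[]" ?P "[]" "(x, \<zero>\<^bsub>W i\<^esub>)" i "(\<zero>\<^bsub>V i\<^esub>, y)"] z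
      by (simp add: gs_zero[OF V] gs_zero[OF W] gs_add_zero[OF V] gs_zero_add[OF W] diff_diff_add)
  qed
  moreover have "?h p \<in> sym_rel ?P"
    by (intro free.subspace_add subspace_sym_rel sym_map_rel[OF sym_map_smap[OF glin_inl[OF W]] 1]
        sym_map_rel[OF sym_map_smap[OF glin_inr[OF V]] 2])
  ultimately show ?thesis by (rule cong_in[OF subspace_sym_rel])
qed

lemma com_letters:
  assumes "sym_maps V W e \<phi>" "p \<in> sym_free V"
  shows "com e \<phi> p \<in> letters W"
  using assms(2) unfolding sym_free_def
  by (rule flin_span[OF flin_com free.subspace_span, rotated])
    (use sym_maps_closed[OF assms(1)] in \<open>auto simp: com_gen free.span_zero words_iff intro!: free.span_base\<close>)

lemma smap_com_eq:
  assumes "\<And>u. u \<in> words V \<Longrightarrow> g (wdeg u + e) (\<phi> u) = \<phi>' (wmap g' u)" "p \<in> sym_free V"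
  shows "smap g (com e \<phi> p) = com e \<phi>' (smap g' p)"
  using assms(2) unfolding sym_free_def
  by (rule flin_span_eq[OF flin_comp[OF flin_smap flin_com] flin_comp[OF flin_com flin_smap], rotated])
    (auto simp: com_gen flin_simps assms(1) words_iff)

lemma wmap_ident [simp]: "wmap (\<lambda>i x. x) w = w"
  by (induction w) auto

lemma smap_ident [simp]: "smap (\<lambda>i x. x) p = p"
  by (rule flin_eqI[OF flin_smap flin_id]) simp

lemma smap_cod_eq:
  assumes "\<And>u. u \<in> words V \<Longrightarrow> g (wdeg u + e) (\<phi> u) = \<phi>' (wmap g u)" "p \<in> sym_free V"
  shows "smap g (cod e \<phi> p) = cod e \<phi>' (smap g p)"
  using assms(2) unfolding sym_free_def
  by (rule flin_span_eq[OF flin_comp[OF flin_smap flin_cod] flin_comp[OF flin_cod flin_smap], rotated])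
    (use smap_cod[of V g e \<phi> \<phi>', OF assms(1)] in \<open>auto simp: words_iff\<close>)

lemma skew_maps_pair:
  assumes f: "skew_maps V A e f" and g: "skew_maps V B e g"
  shows "skew_maps V (prod_space A B) e (mor_pair f g)"
  unfolding skew_maps_def Let_def mor_pair_def
proof (intro conjI ballI allI impI; (elim conjE)?)
  fix w assume "w \<in> words V"
  then show "(f w, g w) \<in> carrier (prod_space A B (wdeg w + e (length w)))"
    by (simp add: skew_maps_closed[OF f] skew_maps_closed[OF g])
qed (simp_all only: prod_space_simps skew_maps_add[OF f] skew_maps_add[OF g] skew_maps_smult[OF f] skew_maps_smult[OF g]
   skew_maps_swap[OF f] skew_maps_swap[OF g])

lemma skew_maps_wmap:
  assumes f: "skew_maps A B e f" and h: "glin V A h"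
  shows "skew_maps V B e (\<lambda>w. f (wmap h w))"
  unfolding skew_maps_def Let_def
proof (intro conjI ballI allI impI; (elim conjE)?)
  fix w assume "w \<in> words V"
  then show "f (wmap h w) \<in> carrier (B (wdeg w + e (length w)))"
    using skew_maps_closed[OF f wmap_words[OF h]] by simp
next
  fix u v i x y assume *: "u @ (i, x) # v \<in> words V" "y \<in> carrier (V i)"
  then have "x \<in> carrier (V i)" by (simp add: words_iff)
  with * show "f (wmap h (u @ (i, x \<oplus>\<^bsub>V i\<^esub> y) # v)) = f (wmap h (u @ (i, x) # v))
      \<oplus>\<^bsub>B (wdeg (u @ (i, x) # v) + e (length (u @ (i, x) # v)))\<^esub> f (wmap h (u @ (i, y) # v))"
    using skew_maps_add[OF f, of "wmap h u" i "h i x" "wmap h v" "h i y"] wmap_words[OF h *(1)]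
    by (simp add: glinD[OF h])
next
  fix u v i x c assume *: "u @ (i, x) # v \<in> words V"
  then have "x \<in> carrier (V i)" by (simp add: words_iff)
  then show "f (wmap h (u @ (i, c \<odot>\<^bsub>V i\<^esub> x) # v)) =
      c \<odot>\<^bsub>B (wdeg (u @ (i, x) # v) + e (length (u @ (i, x) # v)))\<^esub> f (wmap h (u @ (i, x) # v))"
    using skew_maps_smult[OF f, of "wmap h u" i "h i x" "wmap h v" c] wmap_words[OF h *(1)]
    by (simp add: glinD[OF h])
next
  fix u v i x j y assume *: "u @ (i, x) # (j, y) # v \<in> words V"
  have "wmap h u @ (i, h i x) # (j, h j y) # wmap h v \<in> words A"
    using wmap_words[OF h *] by simp
  from skew_maps_swap[OF f this]
  show "f (wmap h (u @ (i, x) # (j, y) # v)) = (- ksgn i j)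
      \<odot>\<^bsub>B (wdeg (u @ (i, x) # (j, y) # v) + e (length (u @ (i, x) # (j, y) # v)))\<^esub> f (wmap h (u @ (j, y) # (i, x) # v))"
    by simp
qed

lemma mor_sum_eq: "mor_sum f g = mor_pair (\<lambda>w. f (wmap (\<lambda>i. fst) w)) (\<lambda>w. g (wmap (\<lambda>i. snd) w))"
proof
  fix w :: "('a \<times> 'b) word"
  have "map (\<lambda>(i, x, y). (i, x)) w = wmap (\<lambda>i. fst) w" "map (\<lambda>(i, x, y). (i, y)) w = wmap (\<lambda>i. snd) w"
    by (auto simp: wmap_def)
  then show "mor_sum f g w = mor_pair (\<lambda>w. f (wmap (\<lambda>i. fst) w)) (\<lambda>w. g (wmap (\<lambda>i. snd) w)) w"
    by (simp add: mor_sum_def mor_pair_def)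
qed

lemma lbr_prod:
  fixes A :: "('k::field_char_0, 'v) linf" and B :: "('k, 'w) linf"
  shows "lbr (linf_prod A B) w = (lbr A (wmap (\<lambda>i. fst) w), lbr B (wmap (\<lambda>i. snd) w))"
proof -
  have s: "desusp_sgn (wmap (\<lambda>i. fst) w) = (desusp_sgn w :: 'k)" "desusp_sgn (wmap (\<lambda>i. snd) w) = (desusp_sgn w :: 'k)"
    by (rule desusp_sgn_cong, auto simp: wmap_def)+
  have b: "bracket (linf_prod A B) = mor_sum (bracket A) (bracket B)" by (simp add: linf_prod_def)
  show ?thesis
    unfolding lbr_def shift_map_def b mor_sum_eq mor_pair_def space_linf_prod prod_space_simps s
    by (simp add: desusp_wmap[of "\<lambda>i. fst"] desusp_wmap[of "\<lambda>i. snd"])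
qed

lemma lmo_pair: "lmo (linf_prod A B) (mor_pair f g) w = (lmo A f w, lmo B g w)"
  unfolding lmo_def shift_map_def mor_pair_def space_linf_prod prod_space_simps ..

text \<open>The projections are letterwise maps commuting with \<open>cod\<close> and
  \<open>com\<close>, so the Jacobi identity can be tested in each factor.\<close>

lemma linf_algebra_prod:
  fixes A :: "('k::field_char_0, 'v) linf" and B :: "('k, 'w) linf"
  assumes A: "linf_algebra A" and B: "linf_algebra B"
  shows "linf_algebra (linf_prod A B)"
proof (rule linf_algebraI)
  note gr = conjunct1[OF linf_algebra_pre[OF A]] conjunct1[OF linf_algebra_pre[OF B]]
  note sk = conjunct2[OF linf_algebra_pre[OF A]] conjunct2[OF linf_algebra_pre[OF B]]
  have b: "bracket (linf_prod A B) = mor_sum (bracket A) (bracket B)" by (simp add: linf_prod_def)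
  show pre: "linf_pre (linf_prod A B)"
    unfolding b mor_sum_eq space_linf_prod
    by (intro conjI graded_prod_space gr skew_maps_pair skew_maps_wmap[OF sk(1) glin_fst] skew_maps_wmap[OF sk(2) glin_snd])
  fix w assume w: "w \<in> words (sus (linf_prod A B))"
  let ?p = "com (- 1) (lbr (linf_prod A B)) (codiff (linf_prod A B) (gen w)) :: _ \<Rightarrow>\<^sub>0 'k"
  have c: "codiff (linf_prod A B) (gen w) \<in> sym_free (sus (linf_prod A B))"
    by (rule sym_map_gen[OF codiff_sym_map[OF pre] w])
  have w0: "w \<in> words (prod_space (sus A) (sus B))" using w by (simp add: susp_prod_space)
  have "smap (\<lambda>i. fst) ?p = com (- 1) (lbr A) (codiff A (gen (wmap (\<lambda>i. fst) w)))"
    by (simp add: smap_com_eq[OF _ c, of _ _ _ "lbr A" "\<lambda>i. fst"] smap_cod_eq[OF _ gen_sym_free[OF w], of _ _ _ "lbr A"] lbr_prod)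
  moreover have "smap (\<lambda>i. snd) ?p = com (- 1) (lbr B) (codiff B (gen (wmap (\<lambda>i. snd) w)))"
    by (simp add: smap_com_eq[OF _ c, of _ _ _ "lbr B" "\<lambda>i. snd"] smap_cod_eq[OF _ gen_sym_free[OF w], of _ _ _ "lbr B"] lbr_prod)
  ultimately show "?p \<in> sym_rel (sus (linf_prod A B))"
    using com_letters[OF lbr_sym[OF pre] c] linf_algebra_jacobi[OF A wmap_words[OF glin_fst w0]]
      linf_algebra_jacobi[OF B wmap_words[OF glin_snd w0]]
    unfolding space_linf_prod susp_prod_space
    by (intro prod_rel graded_susp gr) simp_all
qed

text \<open>By naturality of \<open>cmorg\<close> along the projections, the two coordinates of the
  component equation are those of \<open>q\<close> and \<open>r\<close>.\<close>

lemma linf_morphism_pair: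
  fixes A :: "('k::field_char_0, 'v) linf" and B :: "('k, 'w) linf"
  assumes q: "linf_morphism L A q" and r: "linf_morphism L B r"
  shows "linf_morphism L (linf_prod A B) (mor_pair q r)"
proof -
  have alg: "linf_algebra L" "linf_algebra A" "linf_algebra B"
    and sk: "skew_maps (space L) (space A) morphism_deg q" "skew_maps (space L) (space B) morphism_deg r"
    using q r by (auto simp: linf_morphism_def)
  have P: "linf_algebra (linf_prod A B)" by (rule linf_algebra_prod[OF alg(2,3)])
  note pre = alg[THEN linf_algebra_pre] linf_algebra_pre[OF P]
  have gP: "graded_space (space (linf_prod A B))" using pre(4) by simp
  have gAB: "graded_space (space A)" "graded_space (space B)" using pre by simp_all
  have skp: "skew_maps (space L) (space (linf_prod A B)) morphism_deg (mor_pair q r)"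
    unfolding space_linf_prod by (rule skew_maps_pair[OF sk])
  note F = linf_coalgebra_map_cmor[OF gP skp]
  show ?thesis
  proof (rule linf_morphismI[OF alg(1) P skp F])
    fix w assume w: "w \<in> words (sus L)"
    let ?m = "lmo (linf_prod A B) (mor_pair q r)"
    have c: "codiff L (gen w) \<in> sym_free (sus L)"
      by (rule sym_map_gen[OF codiff_sym_map[OF pre(1)] w])
    have d: "cmor ?m (gen w) \<in> sym_free (sus (linf_prod A B))"
      by (rule sym_map_gen[OF sym_map_cmor[OF lmo_sym[OF gP skp]] w])
    have w0: "w \<in> words0 (sus L)" using w by (simp add: words_iff)
    have f: "smap (\<lambda>i. fst) (cmorg ?m w) = (cmorg (lmo A q) w :: _ \<Rightarrow>\<^sub>0 'k)"
      using smap_cmorg[OF _ w0, of "\<lambda>i. fst" ?m "lmo A q" "\<lambda>i x. x"] by (simp add: lmo_pair)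
    have s: "smap (\<lambda>i. snd) (cmorg ?m w) = (cmorg (lmo B r) w :: _ \<Rightarrow>\<^sub>0 'k)"
      using smap_cmorg[OF _ w0, of "\<lambda>i. snd" ?m "lmo B r" "\<lambda>i x. x"] by (simp add: lmo_pair)
    let ?p = "com 0 ?m (codiff L (gen w)) - com (- 1) (lbr (linf_prod A B)) (cmor ?m (gen w)) :: _ \<Rightarrow>\<^sub>0 'k"
    have "smap (\<lambda>i. fst) ?p = com 0 (lmo A q) (codiff L (gen w)) - com (- 1) (lbr A) (cmorg (lmo A q) w)"
      unfolding free2.linear_diff[OF flin_smap]
      using smap_com_eq[OF _ c, of "\<lambda>i. fst" 0 ?m "lmo A q" "\<lambda>i x. x"]
        smap_com_eq[OF _ d, of "\<lambda>i. fst" "- 1" "lbr (linf_prod A B)" "lbr A" "\<lambda>i. fst"]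
      by (simp add: lmo_pair lbr_prod f)
    moreover have "smap (\<lambda>i. snd) ?p = com 0 (lmo B r) (codiff L (gen w)) - com (- 1) (lbr B) (cmorg (lmo B r) w)"
      unfolding free2.linear_diff[OF flin_smap]
      using smap_com_eq[OF _ c, of "\<lambda>i. snd" 0 ?m "lmo B r" "\<lambda>i x. x"]
        smap_com_eq[OF _ d, of "\<lambda>i. snd" "- 1" "lbr (linf_prod A B)" "lbr B" "\<lambda>i. snd"]
      by (simp add: lmo_pair lbr_prod s)
    moreover have "?p \<in> letters (sus (linf_prod A B))"
      by (intro free.span_diff com_letters[OF lmo_sym[OF gP skp] c] com_letters[OF lbr_sym[OF pre(4)] d])
    ultimately show "?p \<in> sym_rel (sus (linf_prod A B))"
      using linf_morphism_component[OF q w] linf_morphism_component[OF r w]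
      unfolding space_linf_prod susp_prod_space
      by (intro prod_rel graded_susp gAB) simp_all
  qed
qed

section \<open>Quotients of L-infinity algebras by ideals\<close>

section \<open>Quotients\<close>

text \<open>The last condition says that the degreewise kernel of \<open>p\<close> is an ideal for
  all brackets; by multilinearity one argument at a time is enough.\<close>

definition linf_quot :: "('k::field_char_0, 'v) linf \<Rightarrow> ('k, 'w) gspace \<Rightarrow> (int \<Rightarrow> 'v \<Rightarrow> 'w) \<Rightarrow> bool" where
  "linf_quot L W p \<longleftrightarrow> linf_algebra L \<and> graded_space W \<and> glin (space L) W p \<and>
     (\<forall>i. p i ` carrier (space L i) = carrier (W i)) \<and>
     (\<forall>u v i x. u @ (i, x) # v \<in> words (space L) \<longrightarrow> p i x = \<zero>\<^bsub>W i\<^esub> \<longrightarrow>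
        p (wdeg u + (i + wdeg v) + bracket_deg (length u + length v + 1)) (bracket L (u @ (i, x) # v)) =
          \<zero>\<^bsub>W (wdeg u + (i + wdeg v) + bracket_deg (length u + length v + 1))\<^esub>)"

abbreviation quot_alg :: "('k::field_char_0, 'v) linf \<Rightarrow> ('k, 'w) gspace \<Rightarrow> (int \<Rightarrow> 'v \<Rightarrow> 'w) \<Rightarrow> ('k, 'w) linf" where
  "quot_alg L W p \<equiv> \<lparr>space = W, bracket = induced (space L) p p bracket_deg (bracket L)\<rparr>"

lemma glin_diff_zero:
  fixes V :: "('k::field_char_0, 'v) gspace" and W :: "('k, 'w) gspace"
  assumes V: "graded_space V" and W: "graded_space W" and g: "glin V W g"
    and x: "x \<in> carrier (V i)" and y: "y \<in> carrier (V i)" and eq: "g i x = g i y"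
  obtains z where "z \<in> carrier (V i)" "g i z = \<zero>\<^bsub>W i\<^esub>" "x = y \<oplus>\<^bsub>V i\<^esub> z"
proof -
  interpret V: module "cring_class_ops :: 'k ring" "V i" by (rule graded_module[OF V])
  interpret W: module "cring_class_ops :: 'k ring" "W i" by (rule graded_module[OF W])
  define z where "z = x \<oplus>\<^bsub>V i\<^esub> (- 1) \<odot>\<^bsub>V i\<^esub> y"
  have my: "(- 1) \<odot>\<^bsub>V i\<^esub> y \<in> carrier (V i)" by (rule gs_smult[OF V y])
  have z: "z \<in> carrier (V i)" using x my by (simp add: z_def)
  have "g i z = g i y \<oplus>\<^bsub>W i\<^esub> \<ominus>\<^bsub>W i\<^esub> g i y"
    unfolding z_def using x y my by (simp add: glinD[OF g] eq gs_neg[OF W])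
  then have "g i z = \<zero>\<^bsub>W i\<^esub>" using glinD(1)[OF g y] by (simp add: W.r_neg)
  moreover have "x = y \<oplus>\<^bsub>V i\<^esub> z"
    unfolding z_def gs_neg[OF V y] using x y by (simp add: V.a_lcomm V.r_neg)
  ultimately show ?thesis using that z by blast
qed

text \<open>Arguments are exchanged from left to right, the prefix \<open>a\<close> holding those
  already treated. Each exchange alters the bracket by one that has an entry in the kernel.\<close>

lemma quot_bracket_cong:
  fixes L :: "('k::field_char_0, 'v) linf"
  assumes Q: "linf_quot L W p"
    and "a @ w \<in> words (space L)" "a @ w' \<in> words (space L)" "wmap p w = wmap p w'"
  shows "p (wdeg (a @ w) + bracket_deg (length (a @ w))) (bracket L (a @ w)) =
    p (wdeg (a @ w) + bracket_deg (length (a @ w))) (bracket L (a @ w'))"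
  using assms(2-4)
proof (induction w arbitrary: a w')
  case Nil
  then have "w' = []" by (metis wmap_simps(1,4))
  then show ?case by simp
next
  case (Cons b w)
  have L: "linf_algebra L" and W: "graded_space W" and p: "glin (space L) W p"
    using Q by (auto simp: linf_quot_def)
  note pre = linf_algebra_pre[OF L]
  obtain i x where b: "b = (i, x)" by fastforce
  obtain x' w1 where w': "w' = (i, x') # w1" "p i x = p i x'" "wmap p w = wmap p w1"
    using Cons.prems(3) by (cases w') (auto simp: b)
  have in0: "a \<in> words0 (space L)" "x \<in> carrier (space L i)" "x' \<in> carrier (space L i)"
    "w \<in> words0 (space L)" "w1 \<in> words0 (space L)"
    using Cons.prems by (auto simp: b w' words_iff)
  obtain z where z: "z \<in> carrier (space L i)" "p i z = \<zero>\<^bsub>W i\<^esub>" "x = x' \<oplus>\<^bsub>space L i\<^esub> z"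
    using glin_diff_zero[OF _ W p in0(2,3) w'(2)] pre by blast
  let ?N = "wdeg (a @ (i, x') # w) + bracket_deg (length (a @ (i, x') # w))"
  have wx': "a @ (i, x') # w \<in> words (space L)" "a @ (i, z) # w \<in> words (space L)"
    using in0 z by (auto simp: words_iff)
  have cl: "bracket L (a @ (i, x') # w) \<in> carrier (space L ?N)" "bracket L (a @ (i, z) # w) \<in> carrier (space L ?N)"
    using skew_maps_closed[OF conjunct2[OF pre] wx'(1)] skew_maps_closed[OF conjunct2[OF pre] wx'(2)] by simp_all
  have "p ?N (bracket L (a @ (i, z) # w)) = \<zero>\<^bsub>W ?N\<^esub>"
    using Q wx'(2) z(2) by (simp add: linf_quot_def)
  moreover have "bracket L (a @ (i, x) # w) = bracket L (a @ (i, x') # w) \<oplus>\<^bsub>space L ?N\<^esub> bracket L (a @ (i, z) # w)"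
    unfolding z(3) by (rule skew_maps_add[OF conjunct2[OF pre] wx'(1) z(1)])
  ultimately have 1: "p ?N (bracket L (a @ (i, x) # w)) = p ?N (bracket L (a @ (i, x') # w))"
    using cl glinD(1)[OF p cl(1)] by (simp only: glinD(2)[OF p] gs_add_zero[OF W])
  have "p (wdeg ((a @ [(i, x')]) @ w) + bracket_deg (length ((a @ [(i, x')]) @ w))) (bracket L ((a @ [(i, x')]) @ w)) =
      p (wdeg ((a @ [(i, x')]) @ w) + bracket_deg (length ((a @ [(i, x')]) @ w))) (bracket L ((a @ [(i, x')]) @ w1))"
    by (rule Cons.IH) (use in0 w'(3) in \<open>auto simp: words_iff\<close>)
  with 1 show ?case by (simp add: b w')
qed

text \<open>The choice of preimages built into \<open>induced\<close>, isolated as a letterwise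
  map.\<close>

definition sect :: "('k, 'v) gspace \<Rightarrow> (int \<Rightarrow> 'v \<Rightarrow> 'w) \<Rightarrow> 'w word \<Rightarrow> 'v word" where
  "sect V p = wmap (\<lambda>i. inv_into (carrier (V i)) (p i))"

lemma sect_props:
  assumes "\<And>i. p i ` carrier (V i) = carrier (W i)" "w \<in> words0 W"
  shows "sect V p w \<in> words0 V" "wmap p (sect V p w) = w"
proof -
  have "x \<in> carrier (W i) \<Longrightarrow> inv_into (carrier (V i)) (p i) x \<in> carrier (V i)"
    "x \<in> carrier (W i) \<Longrightarrow> p i (inv_into (carrier (V i)) (p i) x) = x" for i x
    using assms(1)[of i] by (metis inv_into_into, metis f_inv_into_f)
  then show "sect V p w \<in> words0 V" "wmap p (sect V p w) = w"
    using assms(2) by (induction w) (auto simp: sect_def)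
qed

lemma induced_eq: "induced V p p' e f w = p' (wdeg w + e (length w)) (f (sect V p w))"
  by (simp add: induced_def sect_def wmap_def)

text \<open>Equivalently, the value of \<open>induced\<close> on chosen preimages does not depend on
  the choice.\<close>

lemma quot_bracket_hom:
  assumes Q: "linf_quot L W p"
  shows "bracket_hom L (quot_alg L W p) p"
  unfolding bracket_hom_def
proof
  fix w assume w: "w \<in> words (space L)"
  have p: "glin (space L) W p" and s: "\<And>i. p i ` carrier (space L i) = carrier (W i)"
    using Q by (auto simp: linf_quot_def)
  have "wmap p w \<in> words0 W" using w wmap_words[OF p] by (auto simp: words_iff)
  note sp = sect_props[of p "space L" W, OF s this]
  have "sect (space L) p (wmap p w) \<in> words (space L)"
    using sp(1) w by (auto simp: words_iff sect_def)
  then show "p (wdeg w + bracket_deg (length w)) (bracket L w) = bracket (quot_alg L W p) (wmap p w)"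
    using quot_bracket_cong[OF Q, of "[]" w "sect (space L) p (wmap p w)"] w sp(2) by (simp add: induced_eq)
qed

lemma sect_surj:
  assumes Q: "linf_quot L W p" and w: "w \<in> words W"
  obtains w0 where "w0 \<in> words (space L)" "wmap p w0 = w"
proof -
  have "\<And>i. p i ` carrier (space L i) = carrier (W i)" using Q by (auto simp: linf_quot_def)
  from sect_props[of p "space L" W, OF this] w show ?thesis
    by (intro that[of "sect (space L) p w"]) (auto simp: words_iff sect_def)
qed

lemma quot_bracket:
  assumes "linf_quot L W p" "w \<in> words (space L)"
  shows "bracket (quot_alg L W p) (wmap p w) = p (wdeg w + bracket_deg (length w)) (bracket L w)"
  using quot_bracket_hom[OF assms(1)] assms(2) by (simp only: bracket_hom_def)

lemma quot_pre:
  assumes Q: "linf_quot L W p"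
  shows "linf_pre (quot_alg L W p)"
proof -
  have L: "linf_algebra L" and W: "graded_space W" and p: "glin (space L) W p"
    and s: "\<And>i. p i ` carrier (space L i) = carrier (W i)"
    using Q by (auto simp: linf_quot_def)
  note sk = conjunct2[OF linf_algebra_pre[OF L]] and gL = conjunct1[OF linf_algebra_pre[OF L]]
  note qb = quot_bracket[OF Q]
  have lift: "\<exists>x0 \<in> carrier (space L i). p i x0 = x" if "x \<in> carrier (W i)" for i x
    using s[of i] that by (metis imageE)
  have lift0: "\<exists>w0 \<in> words0 (space L). wmap p w0 = w" if "w \<in> words0 W" for w
    using sect_props[of p "space L" W w, OF s that] by blast
  have "skew_maps W W bracket_deg (bracket (quot_alg L W p))"
    unfolding skew_maps_def Let_def
  proof (intro conjI ballI allI impI; (elim conjE)?)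
    fix w assume "w \<in> words W"
    then obtain w0 where w0: "w0 \<in> words (space L)" "wmap p w0 = w" by (rule sect_surj[OF Q])
    from glinD(1)[OF p skew_maps_closed[OF sk w0(1)]]
    show "bracket (quot_alg L W p) w \<in> carrier (W (wdeg w + bracket_deg (length w)))"
      using qb[OF w0(1)] by (simp add: w0(2)[symmetric])
  next
    fix u v i x y assume *: "u @ (i, x) # v \<in> words W" "y \<in> carrier (W i)"
    obtain u0 v0 x0 y0 where l: "u0 \<in> words0 (space L)" "wmap p u0 = u" "v0 \<in> words0 (space L)" "wmap p v0 = v"
      "x0 \<in> carrier (space L i)" "p i x0 = x" "y0 \<in> carrier (space L i)" "p i y0 = y"
      using lift0[of u] lift0[of v] lift[of x i] lift[of y i] * by (auto simp: words_iff)
    let ?N = "wdeg (u @ (i, x) # v) + bracket_deg (length (u @ (i, x) # v))"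
    have N: "wdeg (u0 @ (i, a) # v0) + bracket_deg (length (u0 @ (i, a) # v0)) = ?N" for a
      by (simp add: l(2,4)[symmetric])
    have w: "u0 @ (i, x0) # v0 \<in> words (space L)" "u0 @ (i, y0) # v0 \<in> words (space L)"
      "u0 @ (i, x0 \<oplus>\<^bsub>space L i\<^esub> y0) # v0 \<in> words (space L)"
      using l gs_add[OF gL] by (auto simp: words_iff)
    have "wmap p (u0 @ (i, x0) # v0) = u @ (i, x) # v" "wmap p (u0 @ (i, y0) # v0) = u @ (i, y) # v"
      "wmap p (u0 @ (i, x0 \<oplus>\<^bsub>space L i\<^esub> y0) # v0) = u @ (i, x \<oplus>\<^bsub>W i\<^esub> y) # v"
      using l by (simp_all add: glinD[OF p])
    then show "bracket (quot_alg L W p) (u @ (i, x \<oplus>\<^bsub>W i\<^esub> y) # v) =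
      bracket (quot_alg L W p) (u @ (i, x) # v) \<oplus>\<^bsub>W ?N\<^esub> bracket (quot_alg L W p) (u @ (i, y) # v)"
      using qb[OF w(1)] qb[OF w(2)] qb[OF w(3)] skew_maps_closed[OF sk w(1)] skew_maps_closed[OF sk w(2)]
        skew_maps_add[OF sk w(1) l(7)]
      unfolding N by (simp add: glinD(2)[OF p])
  next
    fix u v i x c assume *: "u @ (i, x) # v \<in> words W"
    obtain u0 v0 x0 where l: "u0 \<in> words0 (space L)" "wmap p u0 = u" "v0 \<in> words0 (space L)" "wmap p v0 = v"
      "x0 \<in> carrier (space L i)" "p i x0 = x"
      using lift0[of u] lift0[of v] lift[of x i] * by (auto simp: words_iff)
    let ?N = "wdeg (u @ (i, x) # v) + bracket_deg (length (u @ (i, x) # v))"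
    have N: "wdeg (u0 @ (i, a) # v0) + bracket_deg (length (u0 @ (i, a) # v0)) = ?N" for a
      by (simp add: l(2,4)[symmetric])
    have w: "u0 @ (i, x0) # v0 \<in> words (space L)"
      "u0 @ (i, c \<odot>\<^bsub>space L i\<^esub> x0) # v0 \<in> words (space L)"
      using l gs_smult[OF gL] by (auto simp: words_iff)
    have "wmap p (u0 @ (i, x0) # v0) = u @ (i, x) # v"
      "wmap p (u0 @ (i, c \<odot>\<^bsub>space L i\<^esub> x0) # v0) = u @ (i, c \<odot>\<^bsub>W i\<^esub> x) # v"
      using l by (simp_all add: glinD[OF p])
    then show "bracket (quot_alg L W p) (u @ (i, c \<odot>\<^bsub>W i\<^esub> x) # v) = c \<odot>\<^bsub>W ?N\<^esub> bracket (quot_alg L W p) (u @ (i, x) # v)"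
      using qb[OF w(1)] qb[OF w(2)] skew_maps_closed[OF sk w(1)] skew_maps_smult[OF sk w(1)]
      unfolding N by (simp add: glinD(3)[OF p])
  next
    fix u v i x j y assume *: "u @ (i, x) # (j, y) # v \<in> words W"
    obtain u0 v0 x0 y0 where l: "u0 \<in> words0 (space L)" "wmap p u0 = u" "v0 \<in> words0 (space L)" "wmap p v0 = v"
      "x0 \<in> carrier (space L i)" "p i x0 = x" "y0 \<in> carrier (space L j)" "p j y0 = y"
      using lift0[of u] lift0[of v] lift[of x i] lift[of y j] * by (auto simp: words_iff)
    let ?N = "wdeg (u @ (i, x) # (j, y) # v) + bracket_deg (length (u @ (i, x) # (j, y) # v))"
    have N: "wdeg (u0 @ (i, x0) # (j, y0) # v0) + bracket_deg (length (u0 @ (i, x0) # (j, y0) # v0)) = ?N"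
      "wdeg (u0 @ (j, y0) # (i, x0) # v0) + bracket_deg (length (u0 @ (j, y0) # (i, x0) # v0)) = ?N"
      by (simp_all add: l(2,4)[symmetric])
    have w: "u0 @ (i, x0) # (j, y0) # v0 \<in> words (space L)" "u0 @ (j, y0) # (i, x0) # v0 \<in> words (space L)"
      using l by (auto simp: words_iff)
    have e: "wmap p (u0 @ (i, x0) # (j, y0) # v0) = u @ (i, x) # (j, y) # v"
      "wmap p (u0 @ (j, y0) # (i, x0) # v0) = u @ (j, y) # (i, x) # v"
      using l by simp_all
    note q1 = qb[OF w(1), unfolded N e] and q2 = qb[OF w(2), unfolded N e]
    show "bracket (quot_alg L W p) (u @ (i, x) # (j, y) # v) = (- ksgn i j) \<odot>\<^bsub>W ?N\<^esub> bracket (quot_alg L W p) (u @ (j, y) # (i, x) # v)"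
      unfolding q1 q2 skew_maps_swap[OF sk w(1), unfolded N]
      by (rule glinD(3)[OF p skew_maps_closed[OF sk w(2), unfolded N]])
  qed
  then show ?thesis using W by simp
qed

text \<open>Every word lifts letter by letter, and the Jacobi expression of the lift maps to that of
  the word.\<close>

lemma quot_linf_algebra:
  assumes Q: "linf_quot L W p"
  shows "linf_algebra (quot_alg L W p)"
proof (rule linf_algebraI[OF quot_pre[OF Q]])
  let ?M = "quot_alg L W p"
  have L: "linf_algebra L" and p: "glin (space L) (space ?M) p"
    using Q by (auto simp: linf_quot_def)
  note pre = linf_algebra_pre[OF L]
  fix w assume "w \<in> words (sus ?M)"
  then have "desusp w \<in> words W" by (simp add: desusp_words)
  then obtain w0 where w0: "w0 \<in> words (space L)" "wmap p w0 = desusp w" by (rule sect_surj[OF Q])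
  define w1 where "w1 = map (\<lambda>(i, x). (i + 1, x)) w0"
  have d1: "desusp w1 = w0" unfolding w1_def by (induction w0) auto
  have inj: "u = v" if "desusp u = desusp v" for u v :: "'c word"
    using that by (induction u arbitrary: v) (auto simp: desusp_def)
  have w1: "w1 \<in> words (sus L)" using w0(1) by (simp add: desusp_words[symmetric] d1)
  have e: "wmap (gsus p) w1 = w" by (rule inj) (simp only: desusp_wmap d1 w0(2))
  note sl = strict_lbr[OF pre p quot_bracket_hom[OF Q]]
  have c: "codiff L (gen w1) \<in> sym_free (sus L)" by (rule sym_map_gen[OF codiff_sym_map[OF pre] w1])
  have "smap (gsus p) (com (- 1) (lbr L) (codiff L (gen w1))) = com (- 1) (lbr ?M) (smap (gsus p) (codiff L (gen w1)))"
    by (rule smap_com_eq[where V = "sus L" and g = "gsus p" and e = "- 1" and \<phi> = "lbr L" and \<phi>' = "lbr ?M" and g' = "gsus p", OF sl c])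
  also have "smap (gsus p) (codiff L (gen w1)) = codiff ?M (gen w)"
    using smap_cod_eq[where V = "sus L" and g = "gsus p" and e = "- 1" and \<phi> = "lbr L" and \<phi>' = "lbr ?M", OF sl gen_sym_free[OF w1]] by (simp add: e)
  finally have "com (- 1) (lbr ?M) (codiff ?M (gen w)) = smap (gsus p) (com (- 1) (lbr L) (codiff L (gen w1)))" ..
  then show "com (- 1) (lbr ?M) (codiff ?M (gen w)) \<in> sym_rel (sus ?M)"
    using sym_map_rel[OF sym_map_smap[OF glin_gsus[OF p]] linf_algebra_jacobi[OF L w1]] by simp
qed

lemma wmap_wmap: "wmap g (wmap h w) = wmap (\<lambda>i x. g i (h i x)) w"
  by (induction w) auto

lemma wmap_cong: "(\<And>i x. x \<in> carrier (V i) \<Longrightarrow> g i x = h i x) \<Longrightarrow> w \<in> words0 V \<Longrightarrow> wmap g w = wmap h w"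
  by (induction w) auto

definition quot_lin :: "('k, 'v) gspace \<Rightarrow> (int \<Rightarrow> 'v \<Rightarrow> 'a) \<Rightarrow> (int \<Rightarrow> 'w \<Rightarrow> 'b) \<Rightarrow> (int \<Rightarrow> 'v \<Rightarrow> 'w) \<Rightarrow> int \<Rightarrow> 'a \<Rightarrow> 'b" where
  "quot_lin V p p' g i y = p' i (g i (inv_into (carrier (V i)) (p i) y))"

text \<open>The condition on kernels makes the induced linear map independent of preimages; its
  algebraic properties are then read off on lifts.\<close>

lemma quot_strict:
  assumes Q: "linf_quot L W p" and Q': "linf_quot L' W' p'"
    and f: "strict_rep L L' g f" and h: "bracket_hom L L' g"
    and k: "\<And>i x. x \<in> carrier (space L i) \<Longrightarrow> p i x = \<zero>\<^bsub>W i\<^esub> \<Longrightarrow> p' i (g i x) = \<zero>\<^bsub>W' i\<^esub>"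
  shows "\<And>i x. x \<in> carrier (space L i) \<Longrightarrow> quot_lin (space L) p p' g i (p i x) = p' i (g i x)" (is "PROP ?P")
    and "strict_rep (quot_alg L W p) (quot_alg L' W' p') (quot_lin (space L) p p' g)
      (induced (space L) p p' morphism_deg f)" (is ?R)
    and "bracket_hom (quot_alg L W p) (quot_alg L' W' p') (quot_lin (space L) p p' g)" (is ?B)
proof -
  let ?g = "quot_lin (space L) p p' g"
  have L: "linf_algebra L" "linf_algebra L'" and W: "graded_space W" "graded_space W'"
    and p: "glin (space L) W p" and p': "glin (space L') W' p'"
    and s: "\<And>i. p i ` carrier (space L i) = carrier (W i)"
    using Q Q' by (auto simp: linf_quot_def)
  have gL: "graded_space (space L)" "graded_space (space L')" and sk: "skew_maps (space L) (space L) bracket_deg (bracket L)"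
    using L by (auto simp: linf_algebra_def)
  have g: "glin (space L) (space L') g" and f1: "\<And>i x. x \<in> carrier (space L i) \<Longrightarrow> f [(i, x)] = g i x"
    and f2: "\<And>w. w \<in> words (space L) \<Longrightarrow> length w \<ge> 2 \<Longrightarrow> f w = \<zero>\<^bsub>space L' (wdeg w + morphism_deg (length w))\<^esub>"
    using f by (auto simp: strict_rep_def linf_strict_def)
  have gp: "glin (space L) W' (\<lambda>i x. p' i (g i x))"
    using g p' unfolding glin_def by auto
  show P: "?g i (p i x) = p' i (g i x)" if x: "x \<in> carrier (space L i)" for i x
  proof -
    define y where "y = inv_into (carrier (space L i)) (p i) (p i x)"
    have y: "y \<in> carrier (space L i)" "p i y = p i x"
      using x unfolding y_def by (auto intro: inv_into_into f_inv_into_f)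
    obtain z where z: "z \<in> carrier (space L i)" "p i z = \<zero>\<^bsub>W i\<^esub>" "y = x \<oplus>\<^bsub>space L i\<^esub> z"
      by (rule glin_diff_zero[OF gL(1) W(1) p y(1) x y(2)])
    have "p' i (g i y) = p' i (g i x)"
      using glinD(2)[OF gp x z(1)] k[OF z(1,2)] glinD(1)[OF gp x] by (simp add: z(3) gs_add_zero[OF W(2)])
    then show ?thesis by (simp add: quot_lin_def y_def)
  qed
  have lift: "\<exists>x0 \<in> carrier (space L i). p i x0 = x" if "x \<in> carrier (W i)" for i x
    using s[of i] that by (metis imageE)
  have gg: "glin W W' ?g"
    unfolding glin_def
  proof (intro allI ballI conjI)
    fix i x assume "x \<in> carrier (W i)"
    then obtain x0 where x0: "x0 \<in> carrier (space L i)" "p i x0 = x" using lift by blast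
    show "?g i x \<in> carrier (W' i)" using P[OF x0(1)] glinD(1)[OF gp x0(1)] x0(2) by simp
    show "?g i (c \<odot>\<^bsub>W i\<^esub> x) = c \<odot>\<^bsub>W' i\<^esub> ?g i x" for c
      using P[OF gs_smult[OF gL(1) x0(1)], of c] P[OF x0(1)] x0 by (simp add: glinD[OF p] glinD(3)[OF gp])
    show "?g i (x \<oplus>\<^bsub>W i\<^esub> y) = ?g i x \<oplus>\<^bsub>W' i\<^esub> ?g i y" if y: "y \<in> carrier (W i)" for y
    proof -
      obtain y0 where y0: "y0 \<in> carrier (space L i)" "p i y0 = y" using lift[OF y] by blast
      show ?thesis
        using P[OF gs_add[OF gL(1) x0(1) y0(1)]] P[OF x0(1)] P[OF y0(1)] x0 y0 by (simp add: glinD[OF p] glinD(2)[OF gp])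
    qed
  qed
  show ?R
    unfolding strict_rep_def linf_strict_def
  proof (intro conjI allI ballI impI)
    show "glin (space (quot_alg L W p)) (space (quot_alg L' W' p')) ?g" using gg by simp
    fix i x assume "x \<in> carrier (space (quot_alg L W p) i)"
    then have "inv_into (carrier (space L i)) (p i) x \<in> carrier (space L i)"
      using s[of i] by (auto intro: inv_into_into)
    then show "induced (space L) p p' morphism_deg f [(i, x)] = ?g i x"
      by (simp add: induced_eq sect_def f1 quot_lin_def)
  next
    fix w assume w: "w \<in> words (space (quot_alg L W p))" "2 \<le> length w"
    have "sect (space L) p w \<in> words (space L)"
      using sect_props(1)[of p "space L" W w, OF s] w by (auto simp: words_iff sect_def)
    from f2[OF this] w(2) show "induced (space L) p p' morphism_deg f w =
        \<zero>\<^bsub>space (quot_alg L' W' p') (wdeg w + morphism_deg (length w))\<^esub>"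
      by (simp add: induced_eq sect_def glin_zero[OF p' gL(2) W(2)])
  qed
  show ?B
    unfolding bracket_hom_def
  proof
    fix w assume "w \<in> words (space (quot_alg L W p))"
    then have "w \<in> words W" by simp
    then obtain w0 where w0: "w0 \<in> words (space L)" "wmap p w0 = w" by (rule sect_surj[OF Q])
    let ?N = "wdeg w + bracket_deg (length w)"
    have N: "wdeg w0 + bracket_deg (length w0) = ?N" by (simp add: w0(2)[symmetric])
    have c: "bracket L w0 \<in> carrier (space L ?N)" using skew_maps_closed[OF sk w0(1)] unfolding N .
    have wg: "wmap g w0 \<in> words (space L')" by (rule wmap_words[OF g w0(1)])
    have "?g ?N (bracket (quot_alg L W p) w) = p' ?N (g ?N (bracket L w0))"
      using quot_bracket[OF Q w0(1)] P[OF c] unfolding N w0(2) by simp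
    also have "g ?N (bracket L w0) = bracket L' (wmap g w0)"
      using h w0(1) N unfolding bracket_hom_def by metis
    also have "p' ?N (bracket L' (wmap g w0)) = bracket (quot_alg L' W' p') (wmap p' (wmap g w0))"
      using quot_bracket[OF Q' wg] N by simp
    also have "wmap p' (wmap g w0) = wmap ?g w"
      unfolding w0(2)[symmetric] wmap_wmap
      by (rule wmap_cong[of "space L"]) (use P w0(1) in \<open>auto simp: words_iff\<close>)
    finally show "?g ?N (bracket (quot_alg L W p) w) = bracket (quot_alg L' W' p') (wmap ?g w)" .
  qed
qed

lemma skew_maps_zero:
  assumes V: "graded_space V" and W: "graded_space W" and f: "skew_maps V W e f"
    and w: "u \<in> words0 V" "v \<in> words0 V"
  shows "f (u @ (i, \<zero>\<^bsub>V i\<^esub>) # v) = \<zero>\<^bsub>W (wdeg (u @ (i, \<zero>\<^bsub>V i\<^esub>) # v) + e (length (u @ (i, \<zero>\<^bsub>V i\<^esub>) # v)))\<^esub>"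
proof -
  have "u @ (i, \<zero>\<^bsub>V i\<^esub>) # v \<in> words V" using w gs_zero[OF V] by (simp add: words_iff)
  from skew_maps_smult[OF f this, of 0] gs_zero_smult[OF W skew_maps_closed[OF f this]]
  show ?thesis by (simp only: gs_smult_zero[OF V])
qed

lemma graded_submodule:
  fixes V :: "('k::field_char_0, 'v) gspace"
  assumes V: "graded_space V" and H: "H \<subseteq> carrier (V i)" "\<zero>\<^bsub>V i\<^esub> \<in> H"
    "\<And>x y. x \<in> H \<Longrightarrow> y \<in> H \<Longrightarrow> x \<oplus>\<^bsub>V i\<^esub> y \<in> H" "\<And>c x. x \<in> H \<Longrightarrow> c \<odot>\<^bsub>V i\<^esub> x \<in> H"
  shows "submodule H (cring_class_ops :: 'k ring) (V i)"
proof -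
  interpret V: module "cring_class_ops :: 'k ring" "V i" by (rule graded_module[OF V])
  show ?thesis
  proof (rule V.submoduleI)
    fix x assume "x \<in> H"
    then show "\<ominus>\<^bsub>V i\<^esub> x \<in> H" using H(1) H(4)[of x "-1"] gs_neg[OF V, of x i] by auto
  qed (use H in auto)
qed

lemma submodule_module:
  fixes M :: "('k::field_char_0, 'v) module"
  shows "submodule H (cring_class_ops :: 'k ring) M \<Longrightarrow> module (cring_class_ops :: 'k ring) M \<Longrightarrow>
    module (cring_class_ops :: 'k ring) (M\<lparr>carrier := H\<rparr>)"
  by (rule submodule.submodule_is_module)

lemma zero_submodule: "graded_space V \<Longrightarrow> submodule {\<zero>\<^bsub>V i\<^esub>} (cring_class_ops :: 'k::field_char_0 ring) (V i :: ('k, 'v) module)"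
  by (rule graded_submodule) (auto simp: gs_zero gs_add_zero gs_smult_zero)

section \<open>Quotient modules in the form of cosets\<close>

context
  fixes M :: "('k::field_char_0, 'v) module" and B :: "'v set"
  assumes M: "module (cring_class_ops :: 'k ring) M" and B: "submodule B (cring_class_ops :: 'k ring) M"
begin

interpretation M: module "cring_class_ops :: 'k ring" M by (rule M)

lemma quot_abelian_subgroup: "abelian_subgroup B M"
  using B M.abelian_group_axioms
  by (intro abelian_subgroupI3 additive_subgroup.intro submodule.axioms(1)[of B "cring_class_ops :: 'k ring"])

interpretation B: abelian_subgroup B M by (rule quot_abelian_subgroup)

text \<open>Pointwise scaling by zero collapses a coset to a single element; adding \<open>B\<close>
  again, as \<open>module_quot\<close> does, repairs this and is harmless for the other
  scalars.\<close>

lemma quot_smult_coset: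
  assumes x: "x \<in> carrier M"
  shows "c \<odot>\<^bsub>module_quot M B\<^esub> (B +>\<^bsub>M\<^esub> x) = B +>\<^bsub>M\<^esub> (c \<odot>\<^bsub>M\<^esub> x)"
proof -
  have cl: "c \<odot>\<^bsub>M\<^esub> y \<in> carrier M" if "y \<in> carrier M" for y using M.smult_closed[of c y] that by (simp add: carrier_class)
  have Bc: "b \<in> B \<Longrightarrow> c \<odot>\<^bsub>M\<^esub> b \<in> B" for b
    using submodule.smult_closed[OF B, of c b] by (simp add: carrier_class)
  have dist: "c \<odot>\<^bsub>M\<^esub> (b \<oplus>\<^bsub>M\<^esub> x) = c \<odot>\<^bsub>M\<^esub> b \<oplus>\<^bsub>M\<^esub> c \<odot>\<^bsub>M\<^esub> x" if "b \<in> B" for b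
    using M.smult_r_distr[of c b x] that x B.a_subset by (auto simp: carrier_class)
  show ?thesis
  proof (rule Set.set_eqI, rule iffI)
    fix y assume "y \<in> c \<odot>\<^bsub>module_quot M B\<^esub> (B +>\<^bsub>M\<^esub> x)"
    then obtain b b' where b: "b \<in> B" "b' \<in> B" "y = b \<oplus>\<^bsub>M\<^esub> c \<odot>\<^bsub>M\<^esub> (b' \<oplus>\<^bsub>M\<^esub> x)"
      by (auto simp: module_quot_def set_add_def' a_r_coset_def')
    then have "y = (b \<oplus>\<^bsub>M\<^esub> c \<odot>\<^bsub>M\<^esub> b') \<oplus>\<^bsub>M\<^esub> c \<odot>\<^bsub>M\<^esub> x"
      using B.a_subset cl[OF x] Bc by (auto simp: dist M.a_assoc subset_iff)
    moreover have "b \<oplus>\<^bsub>M\<^esub> c \<odot>\<^bsub>M\<^esub> b' \<in> B" using b Bc by (auto intro: B.a_closed)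
    ultimately show "y \<in> B +>\<^bsub>M\<^esub> (c \<odot>\<^bsub>M\<^esub> x)" by (auto simp: a_r_coset_def')
  next
    fix y assume "y \<in> B +>\<^bsub>M\<^esub> (c \<odot>\<^bsub>M\<^esub> x)"
    then obtain b where b: "b \<in> B" "y = b \<oplus>\<^bsub>M\<^esub> c \<odot>\<^bsub>M\<^esub> x" by (auto simp: a_r_coset_def')
    have "x = \<zero>\<^bsub>M\<^esub> \<oplus>\<^bsub>M\<^esub> x" using x by simp
    then have "x \<in> B +>\<^bsub>M\<^esub> x" using B.zero_closed by (auto simp: a_r_coset_def')
    then show "y \<in> c \<odot>\<^bsub>module_quot M B\<^esub> (B +>\<^bsub>M\<^esub> x)"
      using b by (auto simp: module_quot_def set_add_def')
  qed
qed

lemma quot_add_coset: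
  "x \<in> carrier M \<Longrightarrow> y \<in> carrier M \<Longrightarrow>
    (B +>\<^bsub>M\<^esub> x) \<oplus>\<^bsub>module_quot M B\<^esub> (B +>\<^bsub>M\<^esub> y) = B +>\<^bsub>M\<^esub> (x \<oplus>\<^bsub>M\<^esub> y)"
  by (simp add: module_quot_def B.a_rcos_sum)

lemma quot_carrier: "carrier (module_quot M B) = (\<lambda>x. B +>\<^bsub>M\<^esub> x) ` carrier M"
  by (auto simp: module_quot_def A_RCOSETS_def')

lemma quot_zero: "\<zero>\<^bsub>module_quot M B\<^esub> = B"
  by (simp add: module_quot_def)

lemma coset_eq_zero: "x \<in> carrier M \<Longrightarrow> B +>\<^bsub>M\<^esub> x = B \<longleftrightarrow> x \<in> B"
  using B.a_rcos_self[of x] B.a_rcos_const[of x] by auto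

lemma module_quot_module: "module (cring_class_ops :: 'k ring) (module_quot M B)"
proof (rule moduleI)
  have z: "\<zero>\<^bsub>module_quot M B\<^esub> = B +>\<^bsub>M\<^esub> \<zero>\<^bsub>M\<^esub>"
    using coset_eq_zero[of "\<zero>\<^bsub>M\<^esub>"] B.zero_closed by (simp add: quot_zero)
  show "abelian_group (module_quot M B)"
  proof (rule abelian_groupI)
    fix x assume "x \<in> carrier (module_quot M B)"
    then obtain x0 where x0: "x0 \<in> carrier M" "x = B +>\<^bsub>M\<^esub> x0" by (auto simp: quot_carrier)
    show "\<zero>\<^bsub>module_quot M B\<^esub> \<oplus>\<^bsub>module_quot M B\<^esub> x = x"
      using x0 by (simp add: z quot_add_coset)
    have "(B +>\<^bsub>M\<^esub> (\<ominus>\<^bsub>M\<^esub> x0)) \<oplus>\<^bsub>module_quot M B\<^esub> x = \<zero>\<^bsub>module_quot M B\<^esub>"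
      using x0 by (simp add: z quot_add_coset M.l_neg)
    then show "\<exists>y\<in>carrier (module_quot M B). y \<oplus>\<^bsub>module_quot M B\<^esub> x = \<zero>\<^bsub>module_quot M B\<^esub>"
      using x0 by (auto simp: quot_carrier)
  next
    show "\<zero>\<^bsub>module_quot M B\<^esub> \<in> carrier (module_quot M B)"
      unfolding z by (simp add: quot_carrier)
  qed (auto simp: quot_carrier quot_add_coset M.a_ac)
  have cl: "c \<odot>\<^bsub>M\<^esub> y \<in> carrier M" if "y \<in> carrier M" for c y using M.smult_closed[of c y] that by (simp add: carrier_class)
  note q = quot_carrier quot_smult_coset quot_add_coset cl
  show "cring (cring_class_ops :: 'k ring)" by (rule cring_class)
  fix a b :: 'k and x y
  show "a \<odot>\<^bsub>module_quot M B\<^esub> x \<in> carrier (module_quot M B)" if "x \<in> carrier (module_quot M B)"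
    using that by (auto simp: q)
  show "(a \<oplus>\<^bsub>cring_class_ops\<^esub> b) \<odot>\<^bsub>module_quot M B\<^esub> x = a \<odot>\<^bsub>module_quot M B\<^esub> x \<oplus>\<^bsub>module_quot M B\<^esub> b \<odot>\<^bsub>module_quot M B\<^esub> x"
    if "x \<in> carrier (module_quot M B)"
    using that M.smult_l_distr[of a b] by (auto simp: q carrier_class)
  show "a \<odot>\<^bsub>module_quot M B\<^esub> (x \<oplus>\<^bsub>module_quot M B\<^esub> y) = a \<odot>\<^bsub>module_quot M B\<^esub> x \<oplus>\<^bsub>module_quot M B\<^esub> a \<odot>\<^bsub>module_quot M B\<^esub> y"
    if "x \<in> carrier (module_quot M B)" "y \<in> carrier (module_quot M B)"
    using that M.smult_r_distr[of a] by (auto simp: q carrier_class)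
  show "(a \<otimes>\<^bsub>cring_class_ops\<^esub> b) \<odot>\<^bsub>module_quot M B\<^esub> x = a \<odot>\<^bsub>module_quot M B\<^esub> (b \<odot>\<^bsub>module_quot M B\<^esub> x)"
    if "x \<in> carrier (module_quot M B)"
    using that M.smult_assoc1[of a b] by (auto simp: q carrier_class)
  show "\<one>\<^bsub>cring_class_ops\<^esub> \<odot>\<^bsub>module_quot M B\<^esub> x = x" if "x \<in> carrier (module_quot M B)"
    using that M.smult_one by (auto simp: q)
qed

end

section \<open>The differential, and brackets with elements of degree zero\<close>

section \<open>The differential\<close>

text \<open>Nonnegative grading is the only bound on degrees assumed, so the arguments are uniform
  in n; the upper bound is treated in \<open>lie_n_truncations\<close>.\<close>

locale trunc =
  fixes L :: "('k::field_char_0, 'v) linf" and m :: int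
  assumes L: "linf_algebra L" and m: "0 \<le> m"
    and neg: "\<And>i. i < 0 \<Longrightarrow> carrier (space L i) = {\<zero>\<^bsub>space L i\<^esub>}"
begin

abbreviation d :: "int \<Rightarrow> 'v \<Rightarrow> 'v" where "d i x \<equiv> bracket L [(i, x)]"

lemma gL: "graded_space (space L)" and sk: "skew_maps (space L) (space L) bracket_deg (bracket L)"
  using L by (auto simp: linf_algebra_def)

lemma single_word: "x \<in> carrier (space L i) \<Longrightarrow> [] @ (i, x) # [] \<in> words (space L)"
  by (simp add: words_iff)

lemma d_closed: "x \<in> carrier (space L i) \<Longrightarrow> d i x \<in> carrier (space L (i - 1))"
  using skew_maps_closed[OF sk single_word] by simp

lemma d_add: "x \<in> carrier (space L i) \<Longrightarrow> y \<in> carrier (space L i) \<Longrightarrow>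
    d i (x \<oplus>\<^bsub>space L i\<^esub> y) = d i x \<oplus>\<^bsub>space L (i - 1)\<^esub> d i y"
  using skew_maps_add[OF sk single_word] by simp

lemma d_smult: "x \<in> carrier (space L i) \<Longrightarrow> d i (c \<odot>\<^bsub>space L i\<^esub> x) = c \<odot>\<^bsub>space L (i - 1)\<^esub> d i x"
  using skew_maps_smult[OF sk single_word] by simp

lemma d_zero: "d i \<zero>\<^bsub>space L i\<^esub> = \<zero>\<^bsub>space L (i - 1)\<^esub>"
  using skew_maps_zero[OF gL gL sk, of "[]" "[]"] by simp

lemma lbr_single: "x \<in> carrier (space L (i - 1)) \<Longrightarrow> lbr L [(i, x)] = d (i - 1) x"
  using gs_one_smult[OF gL d_closed[of x "i - 1"]]
  by (simp add: lbr_def shift_map_def wdeg_nonempty_letter)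

text \<open>The Jacobi identity on a single letter.\<close>

lemma d_d:
  assumes x: "x \<in> carrier (space L i)"
  shows "d (i - 1) (d i x) = \<zero>\<^bsub>space L (i - 1 - 1)\<^esub>"
proof -
  have "[(i + 1, x)] \<in> words (sus L)" using x by (simp add: words_iff susp_def)
  from linf_algebra_jacobi[OF L this] have "gen [(i - 1, d (i - 1) (d i x))] \<in> sym_rel (sus L)"
    using x d_closed[OF x] by (simp add: cod_gen com_gen lbr_single)
  from letter_zero[OF graded_susp[OF gL] _ this] show ?thesis
    using d_closed[OF d_closed[OF x]] by (simp add: susp_def)
qed

text \<open>The Jacobi identity on two letters, one of degree zero, whose differential vanishes
  since nothing lives in degree - 1. The sign is kept only as a factor of square one, which suffices
  for statements about subspaces.\<close>

lemma leibniz: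
  assumes x: "x \<in> carrier (space L 0)" and z: "z \<in> carrier (space L j)"
  shows "\<exists>c. c * c = 1 \<and>
    bracket L [(j - 1, d j z), (0, x)] = c \<odot>\<^bsub>space L (j - 1)\<^esub> d j (bracket L [(0, x), (j, z)])"
proof -
  let ?a = "(1, x)" and ?b = "(j + 1, z)"
  have w: "[?a, ?b] \<in> words (sus L)" using x z by (simp add: words_iff susp_def)
  have dx: "d 0 x = \<zero>\<^bsub>space L (- 1)\<^esub>" using d_closed[OF x] neg[of "- 1"] by simp
  have l1: "lbr L [?a] = \<zero>\<^bsub>space L (- 1)\<^esub>" "lbr L [?b] = d j z"
    using x z dx by (simp_all add: lbr_single)
  define s1 where "s1 = (desusp_sgn [?a, ?b] :: 'k)"
  define s2 where "s2 = (desusp_sgn [(j, d j z), (1, x)] :: 'k)"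
  define k where "k = (ksgn 1 (j + 1) :: 'k)"
  define B where "B = bracket L [(j - 1, d j z), (0, x)]"
  define E where "E = bracket L [(0, x), (j, z)]"
  have sq: "s1 * s1 = 1" "s2 * s2 = 1" "k * k = 1" by (simp_all add: s1_def s2_def k_def desusp_sgn_self)
  have wE: "[(0, x), (j, z)] \<in> words (space L)" and wB: "[(j - 1, d j z), (0, x)] \<in> words (space L)"
    using x z d_closed[OF z] by (auto simp: words_iff)
  have E: "E \<in> carrier (space L j)" and B: "B \<in> carrier (space L (j - 1))"
    using skew_maps_closed[OF sk wE] skew_maps_closed[OF sk wB] by (simp_all add: E_def B_def)
  have lw: "lbr L [?a, ?b] = s1 \<odot>\<^bsub>space L j\<^esub> E"
    by (simp add: lbr_def shift_map_def s1_def E_def)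
  have lB: "lbr L [(j, d j z), ?a] = s2 \<odot>\<^bsub>space L (j - 1)\<^esub> B"
    by (simp add: lbr_def shift_map_def s2_def B_def)
  have l0: "lbr L [(0, \<zero>\<^bsub>space L (- 1)\<^esub>), ?b] = \<zero>\<^bsub>space L (j - 1)\<^esub>"
    using skew_maps_zero[OF gL gL sk, of "[]" "[(j, z)]" "- 1"] z
    by (simp add: lbr_def shift_map_def gs_smult_zero[OF gL])
  have lE: "lbr L [(j + 1, s1 \<odot>\<^bsub>space L j\<^esub> E)] = s1 \<odot>\<^bsub>space L (j - 1)\<^esub> d j E"
    using E by (simp add: lbr_single gs_smult[OF gL] d_smult)
  \<comment> \<open>The terms are d of the bracket, the bracket with d z, and the bracket with d x,
    which is a zero letter.\<close>
  have "com (- 1) (lbr L) (codiff L (gen [?a, ?b])) =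
      gen [(j, s1 \<odot>\<^bsub>space L (j - 1)\<^esub> d j E)] + fscale k (gen [(j, s2 \<odot>\<^bsub>space L (j - 1)\<^esub> B)])
        + (gen [(j, \<zero>\<^bsub>space L (j - 1)\<^esub>)] :: _ \<Rightarrow>\<^sub>0 'k)"
    by (simp add: cod_gen flin_simps com_gen l1 lw lE lB l0 k_def)
  with linf_algebra_jacobi[OF L w]
  have "gen [(j, s1 \<odot>\<^bsub>space L (j - 1)\<^esub> d j E)] + fscale k (gen [(j, s2 \<odot>\<^bsub>space L (j - 1)\<^esub> B)])
        + (gen [(j, \<zero>\<^bsub>space L (j - 1)\<^esub>)] :: _ \<Rightarrow>\<^sub>0 'k) \<in> sym_rel (sus L)" by simp
  moreover have "(gen [(j, \<zero>\<^bsub>space L (j - 1)\<^esub>)] :: _ \<Rightarrow>\<^sub>0 'k) \<in> sym_rel (sus L)"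
    using gen_zero_rel[OF graded_susp[OF gL], of "[]" "[]" j] by (simp add: susp_def)
  ultimately have "gen [(j, s1 \<odot>\<^bsub>space L (j - 1)\<^esub> d j E)] + fscale k (gen [(j, s2 \<odot>\<^bsub>space L (j - 1)\<^esub> B)]) \<in> sym_rel (sus L)"
    using free.subspace_diff[OF subspace_sym_rel] by fastforce
  moreover have "gen [(j, (- k) \<odot>\<^bsub>space L (j - 1)\<^esub> (s2 \<odot>\<^bsub>space L (j - 1)\<^esub> B))] -
      fscale (- k) (gen [(j, s2 \<odot>\<^bsub>space L (j - 1)\<^esub> B)]) \<in> sym_rel (sus L)"
    using sym_rel_smult[of "[]" "sus L" "[]" "s2 \<odot>\<^bsub>space L (j - 1)\<^esub> B" j "- k"] B
    by (simp add: susp_def gs_smult[OF gL])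
  ultimately have "gen [(j, s1 \<odot>\<^bsub>space L (j - 1)\<^esub> d j E)] - gen [(j, (- k) \<odot>\<^bsub>space L (j - 1)\<^esub> (s2 \<odot>\<^bsub>space L (j - 1)\<^esub> B))] \<in> sym_rel (sus L)"
    using free.subspace_diff[OF subspace_sym_rel] by fastforce
  then have "s1 \<odot>\<^bsub>space L (j - 1)\<^esub> d j E = (- k) \<odot>\<^bsub>space L (j - 1)\<^esub> (s2 \<odot>\<^bsub>space L (j - 1)\<^esub> B)"
    using E B d_closed[OF E] by (intro letter_eq[OF graded_susp[OF gL], of _ j]) (auto simp: susp_def gs_smult[OF gL])
  then have "(- k * s2) \<odot>\<^bsub>space L (j - 1)\<^esub> (s1 \<odot>\<^bsub>space L (j - 1)\<^esub> d j E) =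
      (- k * s2) \<odot>\<^bsub>space L (j - 1)\<^esub> ((- k) \<odot>\<^bsub>space L (j - 1)\<^esub> (s2 \<odot>\<^bsub>space L (j - 1)\<^esub> B))" by simp
  moreover have "- k * s2 * (- k * s2) = 1" "- k * s2 * s1 * (- k * s2 * s1) = 1"
  proof -
    have "- k * s2 * (- k * s2) = (k * k) * (s2 * s2)" "- k * s2 * s1 * (- k * s2 * s1) = (k * k) * (s2 * s2) * (s1 * s1)"
      by (simp_all add: algebra_simps)
    then show "- k * s2 * (- k * s2) = 1" "- k * s2 * s1 * (- k * s2 * s1) = 1" by (simp_all add: sq)
  qed
  ultimately show ?thesis
    using B d_closed[OF E] unfolding B_def[symmetric] E_def[symmetric]
    by (intro exI[of _ "- k * s2 * s1"]) (simp only: gs_smult_smult[OF gL] gs_smult[OF gL] gs_one_smult[OF gL])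
qed

text \<open>Needed for \<open>tau_lt\<close>: in its top degree the kernel of the projection
  consists of the cycles.\<close>

lemma d_bracket_cycle:
  assumes x: "x \<in> carrier (space L 0)" and z: "z \<in> carrier (space L j)" "d j z = \<zero>\<^bsub>space L (j - 1)\<^esub>"
  shows "d j (bracket L [(0, x), (j, z)]) = \<zero>\<^bsub>space L (j - 1)\<^esub>"
proof -
  have wE: "[(0, x), (j, z)] \<in> words (space L)" using x z by (simp add: words_iff)
  have E: "bracket L [(0, x), (j, z)] \<in> carrier (space L j)" using skew_maps_closed[OF sk wE] by simp
  obtain c where c: "c * c = (1 :: 'k)" "bracket L [(j - 1, d j z), (0, x)] = c \<odot>\<^bsub>space L (j - 1)\<^esub> d j (bracket L [(0, x), (j, z)])"
    using leibniz[OF x z(1)] by blast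
  have "c \<odot>\<^bsub>space L (j - 1)\<^esub> d j (bracket L [(0, x), (j, z)]) = \<zero>\<^bsub>space L (j - 1)\<^esub>"
    using skew_maps_zero[OF gL gL sk, of "[]" "[(0, x)]" "j - 1"] x c(2) by (simp add: z(2))
  then have "c \<odot>\<^bsub>space L (j - 1)\<^esub> (c \<odot>\<^bsub>space L (j - 1)\<^esub> d j (bracket L [(0, x), (j, z)])) = \<zero>\<^bsub>space L (j - 1)\<^esub>"
    by (simp add: gs_smult_zero[OF gL])
  then show ?thesis using d_closed[OF E] by (simp add: gs_smult_smult[OF gL] c(1) gs_one_smult[OF gL])
qed

text \<open>Needed for \<open>tau_le\<close>: in its top degree the kernel of the projection
  consists of the boundaries.\<close>

lemma bracket_boundary:
  assumes x: "x \<in> carrier (space L 0)" and z: "z \<in> boundaries L j"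
  shows "bracket L [(j, z), (0, x)] \<in> boundaries L j"
proof -
  obtain y where y: "y \<in> carrier (space L (j + 1))" "z = d (j + 1) y" using z by (auto simp: boundaries_def)
  have wE: "[(0, x), (j + 1, y)] \<in> words (space L)" using x y by (simp add: words_iff)
  have E: "bracket L [(0, x), (j + 1, y)] \<in> carrier (space L (j + 1))" using skew_maps_closed[OF sk wE] by simp
  obtain c where c: "bracket L [(j, z), (0, x)] = (c :: 'k) \<odot>\<^bsub>space L j\<^esub> d (j + 1) (bracket L [(0, x), (j + 1, y)])"
    using leibniz[OF x y(1)] y(2) by auto
  also have "\<dots> = d (j + 1) (c \<odot>\<^bsub>space L (j + 1)\<^esub> bracket L [(0, x), (j + 1, y)])"
    using d_smult[OF E] by simp
  finally show ?thesis using gs_smult[OF gL E] by (auto simp: boundaries_def)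
qed

lemma boundaries_submodule: "submodule (boundaries L j) (cring_class_ops :: 'k ring) (space L j)"
proof (rule graded_submodule[OF gL])
  show "boundaries L j \<subseteq> carrier (space L j)" using d_closed[of _ "j + 1"] by (auto simp: boundaries_def)
  show "\<zero>\<^bsub>space L j\<^esub> \<in> boundaries L j"
    unfolding boundaries_def by (rule image_eqI[of _ _ "\<zero>\<^bsub>space L (j + 1)\<^esub>"]) (auto simp: d_zero gs_zero[OF gL])
  fix x y assume "x \<in> boundaries L j" "y \<in> boundaries L j"
  then obtain x' y' where *: "x' \<in> carrier (space L (j + 1))" "x = d (j + 1) x'" "y' \<in> carrier (space L (j + 1))" "y = d (j + 1) y'"
    by (auto simp: boundaries_def)
  have "x \<oplus>\<^bsub>space L j\<^esub> y = d (j + 1) (x' \<oplus>\<^bsub>space L (j + 1)\<^esub> y')" using d_add[OF *(1,3)] * by simp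
  then show "x \<oplus>\<^bsub>space L j\<^esub> y \<in> boundaries L j" using gs_add[OF gL *(1,3)] by (auto simp: boundaries_def)
next
  fix x c assume "x \<in> boundaries L j"
  then obtain x' where *: "x' \<in> carrier (space L (j + 1))" "x = d (j + 1) x'" by (auto simp: boundaries_def)
  have "c \<odot>\<^bsub>space L j\<^esub> x = d (j + 1) (c \<odot>\<^bsub>space L (j + 1)\<^esub> x')" using d_smult[OF *(1)] * by simp
  then show "c \<odot>\<^bsub>space L j\<^esub> x \<in> boundaries L j" using gs_smult[OF gL *(1)] by (auto simp: boundaries_def)
qed

lemma boundaries_sub: "boundaries L j \<subseteq> carrier (space L j)"
  using d_closed[of _ "j + 1"] by (auto simp: boundaries_def)

text \<open>By degree reasons a bracket of at least two elements can only hit degree \<open>i\<close> with an entry of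
  degree \<open>i\<close> if it is binary and the other entry has degree zero.\<close>

lemma bracket_degree_cases:
  assumes w: "u @ (i, x) # v \<in> words (space L)"
  obtains (zero) "bracket L (u @ (i, x) # v) =
      \<zero>\<^bsub>space L (wdeg u + (i + wdeg v) + bracket_deg (length u + length v + 1))\<^esub>"
  | (single) "u = []" "v = []"
  | (left) y where "u = []" "v = [(0, y)]" "y \<in> carrier (space L 0)"
  | (right) y where "u = [(0, y)]" "v = []" "y \<in> carrier (space L 0)"
  | (above) "wdeg u + (i + wdeg v) + bracket_deg (length u + length v + 1) > i"
proof (cases "\<exists>(j, y) \<in> set (u @ v). j < 0")
  case True
  then obtain j y where jy: "(j, y) \<in> set (u @ v)" "j < 0" by auto
  have "\<exists>a b. u @ (i, x) # v = a @ (j, y) # b"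
  proof (cases "(j, y) \<in> set u")
    case True
    then obtain a b where "u = a @ (j, y) # b" by (meson split_list)
    then have "u @ (i, x) # v = a @ (j, y) # (b @ (i, x) # v)" by simp
    then show ?thesis by blast
  next
    case False
    then have "(j, y) \<in> set v" using jy by simp
    then obtain a b where "v = a @ (j, y) # b" by (meson split_list)
    then have "u @ (i, x) # v = (u @ (i, x) # a) @ (j, y) # b" by simp
    then show ?thesis by blast
  qed
  then obtain a b where ab: "u @ (i, x) # v = a @ (j, y) # b" by blast
  then have "y = \<zero>\<^bsub>space L j\<^esub>" "a \<in> words0 (space L)" "b \<in> words0 (space L)"
    using w neg[OF jy(2)] by (auto simp: words_iff)
  then have "bracket L (u @ (i, x) # v) = \<zero>\<^bsub>space L (wdeg (u @ (i, x) # v) + bracket_deg (length (u @ (i, x) # v)))\<^esub>"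
    unfolding ab using skew_maps_zero[OF gL gL sk] by simp
  then show ?thesis by (intro zero) simp
next
  case False
  have nn: "0 \<le> wdeg t" if "\<forall>(j, y) \<in> set t. \<not> j < 0" for t :: "'v word"
    using that by (induction t) auto
  have wd: "0 \<le> wdeg u" "0 \<le> wdeg v" using False nn[of u] nn[of v] by auto
  show ?thesis
  proof (cases "wdeg u + (i + wdeg v) + bracket_deg (length u + length v + 1) > i")
    case True then show ?thesis by (rule above)
  next
    case le: False
    \<comment> \<open>The degree of the bracket exceeds \<open>i\<close> by the degrees of the other
      entries plus their number minus one; as these degrees are nonnegative, at most one other entry
      remains.\<close>
    have len: "length u + length v \<le> 1" using le wd by auto
    then consider "u = []" "v = []" | a where "u = []" "v = [a]" | a where "u = [a]" "v = []"
      by (cases u; cases v) auto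
    then show ?thesis
    proof cases
      case 1 then show ?thesis by (rule single)
    next
      case (2 a)
      then have "fst a = 0" using le wd by simp
      then show ?thesis using 2 w left[of "snd a"] by (cases a) (auto simp: words_iff)
    next
      case (3 a)
      then have "fst a = 0" using le wd by simp
      then show ?thesis using 3 w right[of "snd a"] by (cases a) (auto simp: words_iff)
    qed
  qed
qed

end

text \<open>In the component of the squared codifferential only d after d on a single letter could
  survive; all other terms pass through a vanishing higher bracket.\<close>

lemma linf_algebra_abelian:
  fixes A :: "('k::field_char_0, 'v) linf"
  assumes A: "graded_space (space A)"
    and g: "glin (space A) (\<lambda>i. space A (i - 1)) (\<lambda>i x. bracket A [(i, x)])"
    and dd: "\<And>i x. x \<in> carrier (space A i) \<Longrightarrow> bracket A [(i - 1, bracket A [(i, x)])] = \<zero>\<^bsub>space A (i - 2)\<^esub>"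
    and z: "\<And>w. w \<in> words (space A) \<Longrightarrow> length w \<ge> 2 \<Longrightarrow> bracket A w = \<zero>\<^bsub>space A (wdeg w + bracket_deg (length w))\<^esub>"
  shows "linf_algebra A"
proof (rule linf_algebraI)
  have "skew_maps (space A) (space A) bracket_deg (bracket A)"
    by (rule skew_maps_linear[OF A A _ _ z]) (use g in \<open>simp_all add: glin_def\<close>)
  then show pre: "linf_pre A" using A by simp
  note sl = lbr_sym[OF pre]
  have l2: "lbr A w = \<zero>\<^bsub>sus A (wdeg w - 1)\<^esub>" if "w \<in> words (sus A)" "length w \<ge> 2" for w
    using z[of "desusp w"] that
    by (simp add: lbr_def shift_map_def desusp_words wdeg_desusp gs_smult_zero[OF A] susp_def)
  have l1: "lbr A [(i, x)] = bracket A [(i - 1, x)]" if "x \<in> carrier (space A (i - 1))" for i x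
    using gs_one_smult[OF A, of "bracket A [(i - 1, x)]" "i - 1 - 1"] glinD(1)[OF g that]
    by (simp add: lbr_def shift_map_def wdeg_nonempty_letter)
  have zr: "gen [(i, \<zero>\<^bsub>sus A i\<^esub>)] \<in> sym_rel (sus A)" for i
    using gen_zero_rel[OF graded_susp[OF A], of "[]" "[]"] by simp
  fix w assume w: "w \<in> words (sus A)"
  show "com (- 1) (lbr A) (codiff A (gen w)) \<in> sym_rel (sus A)"
    unfolding cod_gen ush_linear[OF flin_com]
  proof (rule ush_in[OF subspace_sym_rel])
    fix u v assume s: "w \<in> shuffles u v"
    have uv: "u \<in> words0 (sus A)" "v \<in> words0 (sus A)"
      using words0_shuffles[OF _ s] w by (auto simp: words_iff)
    show "com (- 1) (lbr A) (if u = [] then 0 else gen ((wdeg u + - 1, lbr A u) # v)) \<in> sym_rel (sus A)"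
    proof (cases "u = []")
      case False
      then have u: "u \<in> words (sus A)" using uv by (simp add: words_iff)
      have c: "lbr A u \<in> carrier (sus A (wdeg u - 1))" using sym_maps_closed[OF sl u] by simp
      then have wv: "(wdeg u - 1, lbr A u) # v \<in> words (sus A)" using uv by (simp add: words_iff)
      have "lbr A ((wdeg u - 1, lbr A u) # v) = \<zero>\<^bsub>sus A (wdeg u - 1 + wdeg v - 1)\<^esub>"
      proof (cases "v = []")
        case v: False
        then have "length ((wdeg u - 1, lbr A u) # v) \<ge> 2" by (cases v) auto
        from l2[OF wv this] show ?thesis by simp
      next
        case True
        have "lbr A [(wdeg u - 1, lbr A u)] = bracket A [(wdeg u - 1 - 1, lbr A u)]"
          by (rule l1) (use c in \<open>simp add: susp_def\<close>)
        also have "\<dots> = \<zero>\<^bsub>space A (wdeg u - 1 - 1 - 1)\<^esub>"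
          using u
        proof (cases rule: words_cases)
          case (1 i x)
          then show ?thesis using dd[of x "i - 1"] by (simp add: susp_def l1)
        next
          case 2
          then show ?thesis
            using glin_zero[OF g A, of "wdeg u - 1 - 1"] A l2[OF u 2] by (simp add: susp_def graded_space_def)
        qed
        finally show ?thesis using True by (simp add: susp_def)
      qed
      then show ?thesis using zr[of "wdeg u - 1 + wdeg v - 1"] False by (simp add: com_gen)
    qed (simp add: flin_simps free.subspace_0)
  qed
qed

lemma quot_trivial:
  assumes Q: "linf_quot L W p" and z: "carrier (space L i) = {\<zero>\<^bsub>space L i\<^esub>}"
  shows "carrier (W i) = {\<zero>\<^bsub>W i\<^esub>}"
proof -
  have "linf_algebra L" and W: "graded_space W" "glin (space L) W p" "p i ` carrier (space L i) = carrier (W i)"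
    using Q by (auto simp: linf_quot_def)
  then have "graded_space (space L)" by (simp add: linf_algebra_def)
  from glin_zero[OF W(2) this W(1), of i] W(3) z show ?thesis by auto
qed

section \<open>The two truncations as quotients, the map q and its kernel\<close>

section \<open>Truncations\<close>

context trunc
begin

abbreviation T where "T \<equiv> tau_lt (m + 1) L"
abbreviation Q where "Q \<equiv> tau_le m L"
abbreviation K where "K \<equiv> ker_q m L"
abbreviation pT where "pT \<equiv> p_lt (m + 1) L"
abbreviation pQ where "pQ \<equiv> p_le m L"

lemma T_space: "space T i = (if i < m + 1 then space L i
    else if i = m + 1 then (space L m)\<lparr>carrier := boundaries L m\<rparr>
    else (space L i)\<lparr>carrier := {\<zero>\<^bsub>space L i\<^esub>}\<rparr>)"
  by (simp add: tau_lt_def)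

lemma T_eq: "quot_alg L (space T) pT = T"
  by (simp add: tau_lt_def)

lemma pT_simps:
  "i < m + 1 \<Longrightarrow> pT i x = x" "pT (m + 1) x = d (m + 1) x" "i > m + 1 \<Longrightarrow> pT i x = \<zero>\<^bsub>space T i\<^esub>"
  by (simp_all add: p_lt_def T_space)

lemma graded_T: "graded_space (space T)"
  unfolding graded_space_def
proof
  fix i
  show "module (cring_class_ops :: 'k ring) (space T i)"
    unfolding T_space using graded_module[OF gL] submodule_module[OF boundaries_submodule graded_module[OF gL]]
      submodule_module[OF zero_submodule[OF gL] graded_module[OF gL]] by auto
qed

lemma T_zero: "i < m + 1 \<Longrightarrow> \<zero>\<^bsub>space T i\<^esub> = \<zero>\<^bsub>space L i\<^esub>" "\<zero>\<^bsub>space T (m + 1)\<^esub> = \<zero>\<^bsub>space L m\<^esub>"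
  by (simp_all add: T_space)

lemma glin_pT: "glin (space L) (space T) pT"
  unfolding glin_def
proof (intro allI ballI)
  fix i x assume x: "x \<in> carrier (space L i)"
  consider "i < m + 1" | "i = m + 1" | "i > m + 1" by linarith
  then show "pT i x \<in> carrier (space T i) \<and>
     (\<forall>y\<in>carrier (space L i). pT i (x \<oplus>\<^bsub>space L i\<^esub> y) = pT i x \<oplus>\<^bsub>space T i\<^esub> pT i y) \<and>
     (\<forall>c. pT i (c \<odot>\<^bsub>space L i\<^esub> x) = c \<odot>\<^bsub>space T i\<^esub> pT i x)"
  proof cases
    case 1
    then show ?thesis using x by (simp add: pT_simps T_space)
  next
    case 2
    then show ?thesis using x d_add[of x "m + 1"] d_smult[of x "m + 1"] by (auto simp: pT_simps T_space boundaries_def)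
  next
    case 3
    then show ?thesis
      using gs_zero[OF graded_T, of i] gs_add_zero[OF graded_T gs_zero[OF graded_T, of i]]
      by (simp add: pT_simps(3) gs_smult_zero[OF graded_T])
  qed
qed

text \<open>Skew-symmetry with the scalar left implicit, since only closure under scaling is used
  afterwards.\<close>

lemma swap_zero:
  assumes y: "y \<in> carrier (space L 0)" and x: "x \<in> carrier (space L i)"
  shows "\<exists>c. bracket L [(i, x), (0, y)] = (c :: 'k) \<odot>\<^bsub>space L i\<^esub> bracket L [(0, y), (i, x)]"
    and "\<exists>c. bracket L [(0, y), (i, x)] = (c :: 'k) \<odot>\<^bsub>space L i\<^esub> bracket L [(i, x), (0, y)]"
    and "bracket L [(0, y), (i, x)] \<in> carrier (space L i)"
    and "bracket L [(i, x), (0, y)] \<in> carrier (space L i)"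
proof -
  have w: "[] @ (i, x) # (0, y) # [] \<in> words (space L)" "[] @ (0, y) # (i, x) # [] \<in> words (space L)"
    using x y by (auto simp: words_iff)
  show "\<exists>c. bracket L [(i, x), (0, y)] = (c :: 'k) \<odot>\<^bsub>space L i\<^esub> bracket L [(0, y), (i, x)]"
    using skew_maps_swap[OF sk w(1)] by auto
  show "\<exists>c. bracket L [(0, y), (i, x)] = (c :: 'k) \<odot>\<^bsub>space L i\<^esub> bracket L [(i, x), (0, y)]"
    using skew_maps_swap[OF sk w(2)] by auto
  show "bracket L [(0, y), (i, x)] \<in> carrier (space L i)" "bracket L [(i, x), (0, y)] \<in> carrier (space L i)"
    using skew_maps_closed[OF sk w(1)] skew_maps_closed[OF sk w(2)] by simp_all
qed

text \<open>The kernel of \<open>pT\<close> is zero below degree m + 1, the cycles in degree m + 1,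
  and everything above. For degree reasons only the differential and the binary bracket with a
  degree zero element could leave it; d d = 0 excludes the first, and brackets with degree zero
  preserve cycles.\<close>

lemma T_quot: "linf_quot L (space T) pT"
  unfolding linf_quot_def
proof (intro conjI allI impI)
  fix i
  consider "i < m + 1" | "i = m + 1" | "i > m + 1" by linarith
  then show "pT i ` carrier (space L i) = carrier (space T i)"
    using gs_zero[OF gL, of i] by cases (auto simp: pT_simps T_space boundaries_def image_iff)
next
  fix u v i x
  assume w: "u @ (i, x) # v \<in> words (space L)" and z: "pT i x = \<zero>\<^bsub>space T i\<^esub>"
  let ?N = "wdeg u + (i + wdeg v) + bracket_deg (length u + length v + 1)"
  note pz = glin_zero[OF glin_pT gL graded_T]
  have x: "x \<in> carrier (space L i)" and uv: "u \<in> words0 (space L)" "v \<in> words0 (space L)"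
    using w by (auto simp: words_iff)
  show "pT ?N (bracket L (u @ (i, x) # v)) = \<zero>\<^bsub>space T ?N\<^esub>"
  proof (cases "i < m + 1")
    case True
    then have "x = \<zero>\<^bsub>space L i\<^esub>" using z by (simp add: pT_simps T_space)
    then have "bracket L (u @ (i, x) # v) = \<zero>\<^bsub>space L ?N\<^esub>"
      using skew_maps_zero[OF gL gL sk uv, of i] by simp
    then show ?thesis by (simp only: pz)
  next
    case False
    from w show ?thesis
    proof (cases rule: bracket_degree_cases)
      case zero
      then show ?thesis by (simp only: pz)
    next
      case single
      consider "i = m + 1" | "i = m + 2" | "i > m + 2" using False by linarith
      then show ?thesis
      proof cases
        case 1
        then have "d i x = \<zero>\<^bsub>space L (i - 1)\<^esub>" using z by (simp add: pT_simps T_zero)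
        then show ?thesis using pz[of "i - 1"] by (simp add: single)
      next
        case 2
        then have i: "i - 1 = m + 1" by simp
        have "pT (i - 1) (d i x) = \<zero>\<^bsub>space T (i - 1)\<^esub>"
          using d_d[OF x] unfolding i pT_simps(2) T_zero(2) by simp
        then show ?thesis by (simp add: single)
      next
        case 3
        then show ?thesis by (simp add: single pT_simps)
      qed
    next
      case (left y)
      show ?thesis
      proof (cases "i = m + 1")
        case True
        then have "d i x = \<zero>\<^bsub>space L (i - 1)\<^esub>" using z by (simp add: pT_simps T_zero)
        note cyc = d_bracket_cycle[OF left(3) x this]
        obtain e where e: "bracket L [(i, x), (0, y)] = (e :: 'k) \<odot>\<^bsub>space L i\<^esub> bracket L [(0, y), (i, x)]"
          using swap_zero(1)[OF left(3) x] by blast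
        have "d i (bracket L [(i, x), (0, y)]) = \<zero>\<^bsub>space L (i - 1)\<^esub>"
          unfolding e d_smult[OF swap_zero(3)[OF left(3) x]] cyc by (rule gs_smult_zero[OF gL])
        then show ?thesis using True by (simp add: left pT_simps T_zero)
      next
        case i: False
        then show ?thesis using False by (simp add: left pT_simps)
      qed
    next
      case (right y)
      show ?thesis
      proof (cases "i = m + 1")
        case True
        then have "d i x = \<zero>\<^bsub>space L (i - 1)\<^esub>" using z by (simp add: pT_simps T_zero)
        from d_bracket_cycle[OF right(3) x this] show ?thesis
          using True by (simp add: right pT_simps T_zero)
      next
        case i: False
        then show ?thesis using False by (simp add: right pT_simps)
      qed
    next
      case above
      then show ?thesis using False by (simp add: pT_simps(3))
    qed
  qed
qed (use L graded_T glin_pT in auto)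

lemma sub_Q: "submodule (tau_le_sub m L i) (cring_class_ops :: 'k ring) (space L i)"
  using zero_submodule[OF gL, of i] boundaries_submodule[of m] module.carrier_is_submodule[OF graded_module[OF gL, of i]]
  by (auto simp: tau_le_sub_def)

lemma Q_space: "space Q i = module_quot (space L i) (tau_le_sub m L i)"
  by (simp add: tau_le_def)

lemma Q_eq: "quot_alg L (space Q) pQ = Q"
  by (simp add: tau_le_def)

lemma graded_Q: "graded_space (space Q)"
  unfolding graded_space_def Q_space using module_quot_module[OF graded_module[OF gL] sub_Q] by blast

lemma pQ_zero_iff: "x \<in> carrier (space L i) \<Longrightarrow> pQ i x = \<zero>\<^bsub>space Q i\<^esub> \<longleftrightarrow> x \<in> tau_le_sub m L i"
  unfolding p_le_def Q_space quot_zero[OF graded_module[OF gL] sub_Q]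
  by (rule coset_eq_zero[OF graded_module[OF gL] sub_Q])

lemma glin_pQ: "glin (space L) (space Q) pQ"
  unfolding glin_def Q_space p_le_def
  by (auto simp: quot_carrier[OF graded_module[OF gL] sub_Q] quot_add_coset[OF graded_module[OF gL] sub_Q]
      quot_smult_coset[OF graded_module[OF gL] sub_Q])

text \<open>Here the kernel is zero below degree m, the boundaries in degree m, and everything
  above; the argument is the one for \<open>T_quot\<close> with boundaries in place of
  cycles.\<close>

lemma Q_quot: "linf_quot L (space Q) pQ"
  unfolding linf_quot_def
proof (intro conjI allI impI)
  fix i
  show "pQ i ` carrier (space L i) = carrier (space Q i)"
    unfolding Q_space quot_carrier[OF graded_module[OF gL] sub_Q] by (simp add: p_le_def)
next
  fix u v i x
  assume w: "u @ (i, x) # v \<in> words (space L)" and z: "pQ i x = \<zero>\<^bsub>space Q i\<^esub>"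
  let ?N = "wdeg u + (i + wdeg v) + bracket_deg (length u + length v + 1)"
  have x: "x \<in> carrier (space L i)" and uv: "u \<in> words0 (space L)" "v \<in> words0 (space L)"
    using w by (auto simp: words_iff)
  have xS: "x \<in> tau_le_sub m L i" using z pQ_zero_iff[OF x] by simp
  have c: "bracket L (u @ (i, x) # v) \<in> carrier (space L ?N)" using skew_maps_closed[OF sk w] by simp
  have zS: "\<zero>\<^bsub>space L j\<^esub> \<in> tau_le_sub m L j" for j
    using subgroup.one_closed[OF submodule.axioms(1)[OF sub_Q[of j]]] by simp
  have "bracket L (u @ (i, x) # v) \<in> tau_le_sub m L ?N"
  proof (cases "i < m")
    case True
    then have "x = \<zero>\<^bsub>space L i\<^esub>" using xS by (simp add: tau_le_sub_def)
    then have "bracket L (u @ (i, x) # v) = \<zero>\<^bsub>space L ?N\<^esub>"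
      using skew_maps_zero[OF gL gL sk uv, of i] by simp
    then show ?thesis by (simp only: zS)
  next
    case False
    have high: "y \<in> carrier (space L j) \<Longrightarrow> j > m \<Longrightarrow> y \<in> tau_le_sub m L j" for y j by (simp add: tau_le_sub_def)
    from w show ?thesis
    proof (cases rule: bracket_degree_cases)
      case zero
      then show ?thesis by (simp only: zS)
    next
      case single
      consider "i = m" | "i = m + 1" | "i > m + 1" using False by linarith
      then show ?thesis
      proof cases
        case 1
        then obtain y where y: "y \<in> carrier (space L (i + 1))" "x = d (i + 1) y"
          using xS by (auto simp: tau_le_sub_def boundaries_def)
        have "d i x = \<zero>\<^bsub>space L (i - 1)\<^esub>" using d_d[OF y(1)] y(2) by simp
        then show ?thesis using zS[of "i - 1"] by (simp add: single)
      next
        case 2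
        then show ?thesis using x by (auto simp: single tau_le_sub_def boundaries_def)
      next
        case 3
        then show ?thesis using c by (intro high) (auto simp: single)
      qed
    next
      case (left y)
      show ?thesis
      proof (cases "i = m")
        case True
        then show ?thesis using bracket_boundary[OF left(3), of x m] xS by (simp add: left tau_le_sub_def)
      next
        case i: False
        then show ?thesis using False c by (intro high) (auto simp: left)
      qed
    next
      case (right y)
      show ?thesis
      proof (cases "i = m")
        case True
        then have b: "bracket L [(i, x), (0, y)] \<in> boundaries L m"
          using bracket_boundary[OF right(3), of x m] xS by (simp add: tau_le_sub_def)
        obtain e where "bracket L [(0, y), (i, x)] = (e :: 'k) \<odot>\<^bsub>space L i\<^esub> bracket L [(i, x), (0, y)]"
          using swap_zero(2)[OF right(3) x] by blast
        then show ?thesis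
          using True submodule.smult_closed[OF boundaries_submodule _ b, of e]
          by (simp add: right tau_le_sub_def carrier_class)
      next
        case i: False
        then show ?thesis using False c by (intro high) (auto simp: right)
      qed
    next
      case above
      then show ?thesis using False c by (intro high) auto
    qed
  qed
  then show "pQ ?N (bracket L (u @ (i, x) # v)) = \<zero>\<^bsub>space Q ?N\<^esub>" using pQ_zero_iff[OF c] by simp
qed (use L graded_Q glin_pQ in auto)

lemma T_algebra: "linf_algebra T"
  using quot_linf_algebra[OF T_quot] unfolding T_eq .

lemma Q_algebra: "linf_algebra Q"
  using quot_linf_algebra[OF Q_quot] unfolding Q_eq .

text \<open>As \<open>pT\<close> is onto, this factorisation determines \<open>q_lin\<close> on all
  of \<open>T\<close> and passes the compatibility with brackets on to it.\<close>

lemma q_pT: "x \<in> carrier (space L i) \<Longrightarrow> q_lin m L i (pT i x) = pQ i x"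
proof (cases "i \<le> m")
  case False
  assume x: "x \<in> carrier (space L i)"
  have "pQ i x = \<zero>\<^bsub>space Q i\<^esub>" using False x by (subst pQ_zero_iff) (auto simp: tau_le_sub_def)
  then show ?thesis using False by (simp add: q_lin_def)
qed (simp add: q_lin_def pT_simps)

lemma glin_q: "glin (space T) (space Q) (q_lin m L)"
  unfolding glin_def
proof (intro allI ballI)
  fix i x assume x: "x \<in> carrier (space T i)"
  show "q_lin m L i x \<in> carrier (space Q i) \<and>
     (\<forall>y\<in>carrier (space T i). q_lin m L i (x \<oplus>\<^bsub>space T i\<^esub> y) = q_lin m L i x \<oplus>\<^bsub>space Q i\<^esub> q_lin m L i y) \<and>
     (\<forall>c. q_lin m L i (c \<odot>\<^bsub>space T i\<^esub> x) = c \<odot>\<^bsub>space Q i\<^esub> q_lin m L i x)"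
  proof (cases "i \<le> m")
    case True
    then show ?thesis using x glinD[OF glin_pQ] by (auto simp: q_lin_def T_space)
  next
    case False
    then show ?thesis
      using gs_zero[OF graded_Q, of i] gs_add_zero[OF graded_Q gs_zero[OF graded_Q, of i]]
      by (simp add: q_lin_def gs_smult_zero[OF graded_Q])
  qed
qed

lemma bracket_hom_q: "bracket_hom T Q (q_lin m L)"
  unfolding bracket_hom_def
proof
  fix w assume "w \<in> words (space T)"
  then obtain w0 where w0: "w0 \<in> words (space L)" "wmap pT w0 = w" by (rule sect_surj[OF T_quot])
  let ?N = "wdeg w + bracket_deg (length w)"
  have N: "wdeg w0 + bracket_deg (length w0) = ?N" by (simp add: w0(2)[symmetric])
  have c: "bracket L w0 \<in> carrier (space L ?N)" using skew_maps_closed[OF sk w0(1)] unfolding N .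
  have e: "wmap (q_lin m L) w = wmap pQ w0"
    unfolding w0(2)[symmetric] wmap_wmap
    by (rule wmap_cong[of "space L"]) (use q_pT w0(1) in \<open>auto simp: words_iff\<close>)
  have a: "bracket T w = pT ?N (bracket L w0)"
    using quot_bracket[OF T_quot w0(1)] unfolding T_eq N w0(2) .
  have b: "bracket Q (wmap pQ w0) = pQ ?N (bracket L w0)"
    using quot_bracket[OF Q_quot w0(1)] unfolding Q_eq N .
  show "q_lin m L ?N (bracket T w) = bracket Q (wmap (q_lin m L) w)"
    unfolding a e b by (rule q_pT[OF c])
qed

lemma strict_rep_q: "strict_rep T Q (q_lin m L) (q_lt m L)"
  using glin_q by (auto simp: strict_rep_def linf_strict_def q_lt_def strict_of_def)

lemma q_morphism: "linf_morphism T Q (q_lt m L)"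
  by (rule strict_morphism[OF T_algebra Q_algebra strict_rep_q bracket_hom_q])

text \<open>An element of degree m + 1 of \<open>T\<close> is some d y, stored as itself inside L_m,
  and the bracket induced along \<open>pT\<close> returns this same d y.\<close>

lemma dT_top:
  assumes x: "x \<in> boundaries L m"
  shows "bracket T [(m + 1, x)] = x"
proof -
  obtain y where y: "y \<in> carrier (space L (m + 1))" "x = d (m + 1) y" using x by (auto simp: boundaries_def)
  then show ?thesis
    using quot_bracket[OF T_quot, of "[(m + 1, y)]"] unfolding T_eq by (simp add: words_iff pT_simps)
qed

lemma K_space: "space K i = (space T i)\<lparr>carrier := {x \<in> carrier (space T i). q_lin m L i x = \<zero>\<^bsub>space Q i\<^esub>}\<rparr>"
  by (simp add: ker_q_def Let_def)

lemma K_simps [simp]: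
  "\<zero>\<^bsub>space K i\<^esub> = \<zero>\<^bsub>space T i\<^esub>" "x \<oplus>\<^bsub>space K i\<^esub> y = x \<oplus>\<^bsub>space T i\<^esub> y" "c \<odot>\<^bsub>space K i\<^esub> x = c \<odot>\<^bsub>space T i\<^esub> x"
  by (simp_all add: K_space)

lemma K_carrier: "carrier (space K i) = (if i = m \<or> i = m + 1 then boundaries L m else {\<zero>\<^bsub>space T i\<^esub>})"
proof -
  consider "i < m" | "i = m" | "i = m + 1" | "i > m + 1" by linarith
  then show ?thesis
  proof cases
    case 1
    have "x \<in> carrier (space L i) \<Longrightarrow> pQ i x = \<zero>\<^bsub>space Q i\<^esub> \<longleftrightarrow> x = \<zero>\<^bsub>space L i\<^esub>" for x
      using pQ_zero_iff[of x i] 1 by (simp add: tau_le_sub_def)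
    then show ?thesis using 1 gs_zero[OF gL, of i] by (auto simp: K_space T_space q_lin_def)
  next
    case 2
    have "x \<in> carrier (space L i) \<Longrightarrow> pQ i x = \<zero>\<^bsub>space Q i\<^esub> \<longleftrightarrow> x \<in> boundaries L m" for x
      using pQ_zero_iff[of x i] 2 by (simp add: tau_le_sub_def)
    then show ?thesis using 2 boundaries_sub[of m] by (auto simp: K_space T_space q_lin_def)
  qed (auto simp: K_space T_space q_lin_def)
qed

lemma K_sub_T: "x \<in> carrier (space K i) \<Longrightarrow> x \<in> carrier (space T i)"
  by (simp add: K_space)

lemma graded_K: "graded_space (space K)"
  unfolding graded_space_def
proof
  fix i
  show "module (cring_class_ops :: 'k ring) (space K i)"
    unfolding K_space
  proof (rule submodule_module[OF graded_submodule[OF graded_T] graded_module[OF graded_T]])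
    show "\<zero>\<^bsub>space T i\<^esub> \<in> {x \<in> carrier (space T i). q_lin m L i x = \<zero>\<^bsub>space Q i\<^esub>}"
      using glin_zero[OF glin_q graded_T graded_Q, of i] gs_zero[OF graded_T] by simp
  qed (auto simp: glinD[OF glin_q] gs_add[OF graded_T] gs_smult[OF graded_T] gs_smult_zero[OF graded_Q]
      gs_add_zero[OF graded_Q gs_zero[OF graded_Q]])
qed

text \<open>Makes the facts about differentials available for \<open>T\<close> itself, where the
  differential of \<open>K\<close> is computed.\<close>

lemma trunc_T: "trunc T m"
proof
  show "linf_algebra T" by (rule T_algebra)
  show "0 \<le> m" by (rule m)
  fix i :: int assume "i < 0"
  then show "carrier (space T i) = {\<zero>\<^bsub>space T i\<^esub>}" using neg[of i] m by (simp add: T_space)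
qed

lemma K_bracket: "bracket K w = (if length w = 1 then bracket T w else \<zero>\<^bsub>space T (wdeg w + bracket_deg (length w))\<^esub>)"
  by (simp add: ker_q_def Let_def)

lemma K_algebra: "linf_algebra K"
proof (rule linf_algebra_abelian[OF graded_K])
  interpret T: trunc T m by (rule trunc_T)
  have cl: "bracket T [(i, x)] \<in> carrier (space K (i - 1))" if x: "x \<in> carrier (space K i)" for i x
  proof -
    have xT: "x \<in> carrier (space T i)" "q_lin m L i x = \<zero>\<^bsub>space Q i\<^esub>" using x by (auto simp: K_space)
    have "[(i, x)] \<in> words (space T)" using xT by (simp add: words_iff)
    then have "q_lin m L (i - 1) (bracket T [(i, x)]) = bracket Q [(i, \<zero>\<^bsub>space Q i\<^esub>)]"
      using bracket_hom_q xT by (force simp: bracket_hom_def)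
    also have "\<dots> = \<zero>\<^bsub>space Q (i - 1)\<^esub>"
      using skew_maps_zero[OF graded_Q graded_Q conjunct2[OF linf_algebra_pre[OF Q_algebra]], of "[]" "[]" i] by simp
    finally show ?thesis using T.d_closed[OF xT(1)] by (simp add: K_space)
  qed
  show "glin (space K) (\<lambda>i. space K (i - 1)) (\<lambda>i x. bracket K [(i, x)])"
    unfolding glin_def using cl K_sub_T T.d_add T.d_smult by (simp add: K_bracket)
  fix i x assume x: "x \<in> carrier (space K i)"
  show "bracket K [(i - 1, bracket K [(i, x)])] = \<zero>\<^bsub>space K (i - 2)\<^esub>"
    using T.d_d[OF K_sub_T[OF x]] by (simp add: K_bracket)
qed (simp add: K_bracket)

end

section \<open>Complements and compatible retractions in one graded piece\<close>

section \<open>Complements\<close>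

definition subsp :: "('k::field_char_0, 'v) module \<Rightarrow> 'v set \<Rightarrow> bool" where
  "subsp M H \<longleftrightarrow> H \<subseteq> carrier M \<and> \<zero>\<^bsub>M\<^esub> \<in> H \<and> (\<forall>x\<in>H. \<forall>y\<in>H. x \<oplus>\<^bsub>M\<^esub> y \<in> H) \<and> (\<forall>c. \<forall>x\<in>H. c \<odot>\<^bsub>M\<^esub> x \<in> H)"

lemma subspD:
  assumes "subsp M H"
  shows "x \<in> H \<Longrightarrow> x \<in> carrier M" "\<zero>\<^bsub>M\<^esub> \<in> H" "x \<in> H \<Longrightarrow> y \<in> H \<Longrightarrow> x \<oplus>\<^bsub>M\<^esub> y \<in> H" "x \<in> H \<Longrightarrow> c \<odot>\<^bsub>M\<^esub> x \<in> H"
  using assms by (auto simp: subsp_def)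

context
  fixes V :: "('k::field_char_0, 'v) gspace" and i :: int
  assumes V: "graded_space V"
begin

interpretation M: module "cring_class_ops :: 'k ring" "V i" by (rule graded_module[OF V])

abbreviation minus1 where "minus1 x \<equiv> (- 1) \<odot>\<^bsub>V i\<^esub> x"

text \<open>Passes from x + y = z + t to x - z = t - y. Negatives are scalar multiples here, so that
  closure of a subspace under scaling covers them.\<close>

lemma cancel4:
  assumes c: "x \<in> carrier (V i)" "y \<in> carrier (V i)" "z \<in> carrier (V i)" "t \<in> carrier (V i)"
    and eq: "x \<oplus>\<^bsub>V i\<^esub> y = z \<oplus>\<^bsub>V i\<^esub> t"
  shows "x \<oplus>\<^bsub>V i\<^esub> minus1 z = t \<oplus>\<^bsub>V i\<^esub> minus1 y"
proof -
  have "x = (z \<oplus>\<^bsub>V i\<^esub> t) \<oplus>\<^bsub>V i\<^esub> \<ominus>\<^bsub>V i\<^esub> y"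
    using c eq by (metis M.a_assoc M.a_inv_closed M.r_neg M.r_zero)
  also have "\<dots> = z \<oplus>\<^bsub>V i\<^esub> (t \<oplus>\<^bsub>V i\<^esub> \<ominus>\<^bsub>V i\<^esub> y)" using c by (simp add: M.a_assoc)
  finally have "x \<oplus>\<^bsub>V i\<^esub> \<ominus>\<^bsub>V i\<^esub> z = \<ominus>\<^bsub>V i\<^esub> z \<oplus>\<^bsub>V i\<^esub> (z \<oplus>\<^bsub>V i\<^esub> (t \<oplus>\<^bsub>V i\<^esub> \<ominus>\<^bsub>V i\<^esub> y))"
    using c by (simp add: M.a_comm)
  also have "\<dots> = t \<oplus>\<^bsub>V i\<^esub> \<ominus>\<^bsub>V i\<^esub> y" using c by (simp add: M.r_neg1)
  finally show ?thesis using c by (simp add: gs_neg[OF V])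
qed

lemma minus1_closed: "x \<in> carrier (V i) \<Longrightarrow> minus1 x \<in> carrier (V i)"
  by (rule gs_smult[OF V])

lemma eq_of_minus1: "x \<in> carrier (V i) \<Longrightarrow> y \<in> carrier (V i) \<Longrightarrow> x \<oplus>\<^bsub>V i\<^esub> minus1 y = \<zero>\<^bsub>V i\<^esub> \<Longrightarrow> x = y"
  unfolding gs_neg[OF V] by (metis M.a_inv_closed M.minus_equality M.minus_minus)

lemma add_swap4:
  "a \<in> carrier (V i) \<Longrightarrow> b \<in> carrier (V i) \<Longrightarrow> c \<in> carrier (V i) \<Longrightarrow> e \<in> carrier (V i) \<Longrightarrow>
    (a \<oplus>\<^bsub>V i\<^esub> b) \<oplus>\<^bsub>V i\<^esub> (c \<oplus>\<^bsub>V i\<^esub> e) = (a \<oplus>\<^bsub>V i\<^esub> c) \<oplus>\<^bsub>V i\<^esub> (b \<oplus>\<^bsub>V i\<^esub> e)"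
  by (simp add: M.a_ac)

definition setsum :: "'v set \<Rightarrow> 'v set \<Rightarrow> 'v set" where
  "setsum A B = {a \<oplus>\<^bsub>V i\<^esub> b | a b. a \<in> A \<and> b \<in> B}"

lemma subsp_setsum:
  assumes A: "subsp (V i) A" and B: "subsp (V i) B"
  shows "subsp (V i) (setsum A B)"
  unfolding subsp_def
proof (intro conjI ballI allI)
  note D = subspD[OF A] subspD[OF B]
  show "setsum A B \<subseteq> carrier (V i)" using D by (auto simp: setsum_def)
  have "\<zero>\<^bsub>V i\<^esub> = \<zero>\<^bsub>V i\<^esub> \<oplus>\<^bsub>V i\<^esub> \<zero>\<^bsub>V i\<^esub>" by simp
  then show "\<zero>\<^bsub>V i\<^esub> \<in> setsum A B" using D unfolding setsum_def by blast
  fix x assume "x \<in> setsum A B"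
  then obtain a b where x: "a \<in> A" "b \<in> B" "x = a \<oplus>\<^bsub>V i\<^esub> b" by (auto simp: setsum_def)
  { fix c
    have "c \<odot>\<^bsub>V i\<^esub> x = c \<odot>\<^bsub>V i\<^esub> a \<oplus>\<^bsub>V i\<^esub> c \<odot>\<^bsub>V i\<^esub> b" using x D by (simp add: gs_smult_add[OF V])
    then show "c \<odot>\<^bsub>V i\<^esub> x \<in> setsum A B" using x D unfolding setsum_def by blast }
  fix y assume "y \<in> setsum A B"
  then obtain a' b' where y: "a' \<in> A" "b' \<in> B" "y = a' \<oplus>\<^bsub>V i\<^esub> b'" by (auto simp: setsum_def)
  have "x \<oplus>\<^bsub>V i\<^esub> y = (a \<oplus>\<^bsub>V i\<^esub> a') \<oplus>\<^bsub>V i\<^esub> (b \<oplus>\<^bsub>V i\<^esub> b')"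
    unfolding x y by (rule add_swap4) (use x y D in auto)
  then show "x \<oplus>\<^bsub>V i\<^esub> y \<in> setsum A B" using x y D unfolding setsum_def by blast
qed

lemma setsum_left:
  assumes A: "subsp (V i) A" and B: "subsp (V i) B" and a: "a \<in> A"
  shows "a \<in> setsum A B"
proof -
  have "a = a \<oplus>\<^bsub>V i\<^esub> \<zero>\<^bsub>V i\<^esub>" using gs_add_zero[OF V subspD(1)[OF A a]] by simp
  then show ?thesis unfolding setsum_def using a subspD(2)[OF B] by blast
qed

lemma setsum_right:
  assumes A: "subsp (V i) A" and B: "subsp (V i) B" and b: "b \<in> B"
  shows "b \<in> setsum A B"
proof -
  have "b = \<zero>\<^bsub>V i\<^esub> \<oplus>\<^bsub>V i\<^esub> b" using gs_zero_add[OF V subspD(1)[OF B b]] by simp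
  then show ?thesis unfolding setsum_def using b subspD(2)[OF A] by blast
qed

text \<open>Zorn's lemma: if \<open>C\<close> is maximal among the subspaces of \<open>N\<close>
  meeting \<open>A\<close> trivially, then a vector of \<open>N\<close> outside A + C could be
  adjoined to \<open>C\<close>.\<close>

lemma complement_exists:
  assumes N: "subsp (V i) N" and A: "subsp (V i) A"
  shows "\<exists>C. subsp (V i) C \<and> C \<subseteq> N \<and> A \<inter> C = {\<zero>\<^bsub>V i\<^esub>} \<and> N \<subseteq> setsum A C"
proof -
  define F where "F = {C. subsp (V i) C \<and> C \<subseteq> N \<and> A \<inter> C = {\<zero>\<^bsub>V i\<^esub>}}"
  have "{\<zero>\<^bsub>V i\<^esub>} \<in> F"
    using subspD(2)[OF A] subspD(2)[OF N] by (auto simp: F_def subsp_def gs_smult_zero[OF V])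
  then have "F \<noteq> {}" by blast
  moreover have "\<Union>\<C> \<in> F" if ne: "\<C> \<noteq> {}" and ch: "subset.chain F \<C>" for \<C>
  proof -
    have sub: "\<And>C. C \<in> \<C> \<Longrightarrow> subsp (V i) C \<and> C \<subseteq> N \<and> A \<inter> C = {\<zero>\<^bsub>V i\<^esub>}"
      using ch by (auto simp: subset.chain_def F_def)
    have "subsp (V i) (\<Union>\<C>)"
      unfolding subsp_def
    proof (intro conjI ballI allI)
      show "\<Union>\<C> \<subseteq> carrier (V i)"
      proof
        fix x assume "x \<in> \<Union>\<C>"
        then obtain X where X: "X \<in> \<C>" "x \<in> X" by (rule UnionE)
        show "x \<in> carrier (V i)" by (rule subspD(1)[OF conjunct1[OF sub[OF X(1)]] X(2)])
      qed
      obtain X0 where X0: "X0 \<in> \<C>" using ne by (meson ex_in_conv)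
      show "\<zero>\<^bsub>V i\<^esub> \<in> \<Union>\<C>" by (rule UnionI[OF X0 subspD(2)[OF conjunct1[OF sub[OF X0]]]])
      show "c \<odot>\<^bsub>V i\<^esub> x \<in> \<Union>\<C>" if x: "x \<in> \<Union>\<C>" for c x
      proof -
        obtain X where X: "X \<in> \<C>" "x \<in> X" using x by (rule UnionE)
        show ?thesis by (rule UnionI[OF X(1) subspD(4)[OF conjunct1[OF sub[OF X(1)]] X(2)]])
      qed
      fix x y assume "x \<in> \<Union>\<C>" "y \<in> \<Union>\<C>"
      then obtain X Y where XY: "X \<in> \<C>" "x \<in> X" "Y \<in> \<C>" "y \<in> Y" by (elim UnionE)
      then have "X \<subseteq> Y \<or> Y \<subseteq> X" using ch unfolding subset.chain_def by blast
      then obtain Z where Z: "Z \<in> \<C>" "x \<in> Z" "y \<in> Z" using XY by (meson subsetD)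
      show "x \<oplus>\<^bsub>V i\<^esub> y \<in> \<Union>\<C>"
        by (rule UnionI[OF Z(1) subspD(3)[OF conjunct1[OF sub[OF Z(1)]] Z(2,3)]])
    qed
    moreover have "\<Union>\<C> \<subseteq> N" using sub by (meson Union_least)
    moreover have "A \<inter> \<Union>\<C> = {\<zero>\<^bsub>V i\<^esub>}"
    proof -
      obtain X0 where "X0 \<in> \<C>" using ne by (meson ex_in_conv)
      then show ?thesis using sub by blast
    qed
    ultimately show ?thesis by (simp add: F_def)
  qed
  ultimately obtain C where C: "C \<in> F" and max: "\<And>X. X \<in> F \<Longrightarrow> C \<subseteq> X \<Longrightarrow> X = C"
    using subset_Zorn_nonempty[of F] by blast
  have sC: "subsp (V i) C" and CN: "C \<subseteq> N" and AC: "A \<inter> C = {\<zero>\<^bsub>V i\<^esub>}" using C by (auto simp: F_def)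
  have "x \<in> setsum A C" if x: "x \<in> N" for x
  proof (rule ccontr)
    assume nx: "x \<notin> setsum A C"
    have xc: "x \<in> carrier (V i)" using subspD(1)[OF N x] .
    define X where "X = range (\<lambda>k. k \<odot>\<^bsub>V i\<^esub> x)"
    have sX: "subsp (V i) X"
      unfolding subsp_def X_def
    proof (intro conjI ballI allI)
      show "range (\<lambda>k. k \<odot>\<^bsub>V i\<^esub> x) \<subseteq> carrier (V i)" using gs_smult[OF V xc] by auto
      show "\<zero>\<^bsub>V i\<^esub> \<in> range (\<lambda>k. k \<odot>\<^bsub>V i\<^esub> x)" using gs_zero_smult[OF V xc] by (metis rangeI)
      fix y assume "y \<in> range (\<lambda>k. k \<odot>\<^bsub>V i\<^esub> x)"
      then obtain k where y: "y = k \<odot>\<^bsub>V i\<^esub> x" by auto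
      show "c \<odot>\<^bsub>V i\<^esub> y \<in> range (\<lambda>k. k \<odot>\<^bsub>V i\<^esub> x)" for c by (simp add: y gs_smult_smult[OF V xc])
      fix z assume "z \<in> range (\<lambda>k. k \<odot>\<^bsub>V i\<^esub> x)"
      then obtain l where z: "z = l \<odot>\<^bsub>V i\<^esub> x" by auto
      show "y \<oplus>\<^bsub>V i\<^esub> z \<in> range (\<lambda>k. k \<odot>\<^bsub>V i\<^esub> x)"
        using gs_add_smult[OF V xc, of k l] by (metis y z rangeI)
    qed
    have "1 \<odot>\<^bsub>V i\<^esub> x \<in> X" unfolding X_def by blast
    then have xX: "x \<in> X" by (simp add: gs_one_smult[OF V xc])
    have XN: "X \<subseteq> N" using subspD(4)[OF N x] by (auto simp: X_def)
    have "A \<inter> setsum C X = {\<zero>\<^bsub>V i\<^esub>}"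
    proof -
      have "y = \<zero>\<^bsub>V i\<^esub>" if y: "y \<in> A" "y \<in> setsum C X" for y
      proof -
        obtain c k where ck: "c \<in> C" "y = c \<oplus>\<^bsub>V i\<^esub> k \<odot>\<^bsub>V i\<^esub> x" using y(2) by (auto simp: setsum_def X_def)
        have cc: "c \<in> carrier (V i)" "y \<in> carrier (V i)" using subspD(1)[OF sC ck(1)] subspD(1)[OF A y(1)] .
        show ?thesis
        proof (cases "k = 0")
          case True
          then have "y = c" using ck cc by (simp add: gs_zero_smult[OF V xc] gs_add_zero[OF V])
          then show ?thesis using AC y ck by blast
        next
          case False
          have "\<zero>\<^bsub>V i\<^esub> \<oplus>\<^bsub>V i\<^esub> y = c \<oplus>\<^bsub>V i\<^esub> k \<odot>\<^bsub>V i\<^esub> x" using ck cc by (simp add: gs_zero_add[OF V])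
          then have "k \<odot>\<^bsub>V i\<^esub> x \<oplus>\<^bsub>V i\<^esub> c = y \<oplus>\<^bsub>V i\<^esub> \<zero>\<^bsub>V i\<^esub>"
            using cc gs_smult[OF V xc, of k] by (simp add: M.a_comm)
          from cancel4[OF gs_smult[OF V xc] cc(1) cc(2) gs_zero[OF V] this]
          have e: "k \<odot>\<^bsub>V i\<^esub> x \<oplus>\<^bsub>V i\<^esub> minus1 y = minus1 c"
            using minus1_closed[OF cc(1)] by (simp add: gs_zero_add[OF V])
          have "k \<odot>\<^bsub>V i\<^esub> x = y \<oplus>\<^bsub>V i\<^esub> minus1 c"
            unfolding e[symmetric] gs_neg[OF V cc(2)]
            using cc gs_smult[OF V xc, of k] M.a_lcomm[of y "k \<odot>\<^bsub>V i\<^esub> x" "\<ominus>\<^bsub>V i\<^esub> y"]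
            by (simp add: M.r_neg del: M.add.m_lcomm)
          \<comment> \<open>Division by the nonzero \<open>k\<close> places \<open>x\<close> in A +
            C, against its choice.\<close>
          then have "inverse k \<odot>\<^bsub>V i\<^esub> (k \<odot>\<^bsub>V i\<^esub> x) = inverse k \<odot>\<^bsub>V i\<^esub> y \<oplus>\<^bsub>V i\<^esub> inverse k \<odot>\<^bsub>V i\<^esub> minus1 c"
            using cc minus1_closed by (simp add: gs_smult_add[OF V])
          then have "x = inverse k \<odot>\<^bsub>V i\<^esub> y \<oplus>\<^bsub>V i\<^esub> inverse k \<odot>\<^bsub>V i\<^esub> minus1 c"
            using False by (simp add: gs_smult_smult[OF V xc] gs_one_smult[OF V xc])
          moreover have "inverse k \<odot>\<^bsub>V i\<^esub> y \<in> A" "inverse k \<odot>\<^bsub>V i\<^esub> minus1 c \<in> C"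
            using subspD(4)[OF A y(1)] subspD(4)[OF sC subspD(4)[OF sC ck(1)]] by auto
          ultimately have "x \<in> setsum A C" unfolding setsum_def by blast
          then show ?thesis using nx by blast
        qed
      qed
      moreover have "\<zero>\<^bsub>V i\<^esub> \<in> A \<inter> setsum C X"
        using subspD(2)[OF A] subspD(2)[OF subsp_setsum[OF sC sX]] by blast
      ultimately show ?thesis by blast
    qed
    moreover have "setsum C X \<subseteq> N"
      using CN XN subspD(3)[OF N] by (auto simp: setsum_def subset_iff)
    ultimately have "setsum C X \<in> F" using subsp_setsum[OF sC sX] by (simp add: F_def)
    then have "setsum C X = C" using setsum_left[OF sC sX] by (intro max) auto
    then have "x \<in> C" using setsum_right[OF sC sX xX] by simp
    then show False using nx setsum_right[OF A sC] by blast
  qed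
  then show ?thesis using sC CN AC by blast
qed

text \<open>The trivial intersection makes the part in \<open>B\<close> of a decomposition unique,
  so choosing it is harmless; outside B + C the value is arbitrary.\<close>

lemma projection_exists:
  assumes B: "subsp (V i) B" and C: "subsp (V i) C" and BC: "B \<inter> C = {\<zero>\<^bsub>V i\<^esub>}"
  shows "\<exists>\<rho>. \<forall>b\<in>B. \<forall>c\<in>C. \<rho> (b \<oplus>\<^bsub>V i\<^esub> c) = b"
proof (intro exI ballI)
  fix b c assume b: "b \<in> B" and c: "c \<in> C"
  show "(SOME b'. b' \<in> B \<and> (\<exists>c'\<in>C. b \<oplus>\<^bsub>V i\<^esub> c = b' \<oplus>\<^bsub>V i\<^esub> c')) = b"
  proof (rule some_equality)
    show "b \<in> B \<and> (\<exists>c'\<in>C. b \<oplus>\<^bsub>V i\<^esub> c = b \<oplus>\<^bsub>V i\<^esub> c')" using b c by blast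
    fix b' assume "b' \<in> B \<and> (\<exists>c'\<in>C. b \<oplus>\<^bsub>V i\<^esub> c = b' \<oplus>\<^bsub>V i\<^esub> c')"
    then obtain c' where b': "b' \<in> B" "c' \<in> C" "b \<oplus>\<^bsub>V i\<^esub> c = b' \<oplus>\<^bsub>V i\<^esub> c'" by blast
    note cl = subspD(1)[OF B b] subspD(1)[OF C c] subspD(1)[OF B b'(1)] subspD(1)[OF C b'(2)]
    have "b \<oplus>\<^bsub>V i\<^esub> minus1 b' = c' \<oplus>\<^bsub>V i\<^esub> minus1 c" by (rule cancel4[OF cl b'(3)])
    moreover have "b \<oplus>\<^bsub>V i\<^esub> minus1 b' \<in> B" "c' \<oplus>\<^bsub>V i\<^esub> minus1 c \<in> C"
      by (rule subspD(3)[OF B b subspD(4)[OF B b'(1)]], rule subspD(3)[OF C b'(2) subspD(4)[OF C c]])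
    ultimately have "b \<oplus>\<^bsub>V i\<^esub> minus1 b' = \<zero>\<^bsub>V i\<^esub>" using BC by auto
    then show "b' = b" using eq_of_minus1 cl by auto
  qed
qed

end

definition retraction :: "('k::field_char_0, 'v) module \<Rightarrow> 'v set \<Rightarrow> ('v \<Rightarrow> 'v) \<Rightarrow> bool" where
  "retraction M B \<rho> \<longleftrightarrow> (\<forall>x\<in>carrier M. \<rho> x \<in> B \<and> (\<forall>y\<in>carrier M. \<rho> (x \<oplus>\<^bsub>M\<^esub> y) = \<rho> x \<oplus>\<^bsub>M\<^esub> \<rho> y) \<and>
     (\<forall>c. \<rho> (c \<odot>\<^bsub>M\<^esub> x) = c \<odot>\<^bsub>M\<^esub> \<rho> x)) \<and> (\<forall>b\<in>B. \<rho> b = b)"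

lemma retraction_of_complement:
  assumes V: "graded_space V" and B: "subsp (V i) B" and C: "subsp (V i) C"
    and span: "carrier (V i) \<subseteq> setsum V i B C" and \<rho>: "\<forall>b\<in>B. \<forall>c\<in>C. \<rho> (b \<oplus>\<^bsub>V i\<^esub> c) = b"
  shows "retraction (V i) B \<rho>"
  unfolding retraction_def
proof (intro conjI ballI allI)
  note D = subspD[OF B] subspD[OF C]
  fix x assume "x \<in> carrier (V i)"
  then obtain b c where x: "b \<in> B" "c \<in> C" "x = b \<oplus>\<^bsub>V i\<^esub> c" using span by (auto simp: setsum_def[OF V])
  show "\<rho> x \<in> B" using x \<rho> by simp
  have "a \<odot>\<^bsub>V i\<^esub> x = a \<odot>\<^bsub>V i\<^esub> b \<oplus>\<^bsub>V i\<^esub> a \<odot>\<^bsub>V i\<^esub> c" for a using x D by (simp add: gs_smult_add[OF V])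
  then show "\<rho> (a \<odot>\<^bsub>V i\<^esub> x) = a \<odot>\<^bsub>V i\<^esub> \<rho> x" for a using x \<rho> D by simp
  fix y assume "y \<in> carrier (V i)"
  then obtain b' c' where y: "b' \<in> B" "c' \<in> C" "y = b' \<oplus>\<^bsub>V i\<^esub> c'" using span by (auto simp: setsum_def[OF V])
  have "x \<oplus>\<^bsub>V i\<^esub> y = (b \<oplus>\<^bsub>V i\<^esub> b') \<oplus>\<^bsub>V i\<^esub> (c \<oplus>\<^bsub>V i\<^esub> c')"
    unfolding x y by (rule add_swap4[OF V]) (use x y D in auto)
  then show "\<rho> (x \<oplus>\<^bsub>V i\<^esub> y) = \<rho> x \<oplus>\<^bsub>V i\<^esub> \<rho> y" using x y \<rho> D by simp
next
  fix b assume b: "b \<in> B"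
  then have "\<rho> (b \<oplus>\<^bsub>V i\<^esub> \<zero>\<^bsub>V i\<^esub>) = b" using \<rho> subspD(2)[OF C] by blast
  then show "\<rho> b = b" using subspD(1)[OF B b] by (simp add: gs_add_zero[OF V])
qed

text \<open>A complement of \<open>B\<close> whose image meets \<open>g B\<close> trivially is the sum of a complement of \<open>B \<inter> ker g\<close> in
  \<open>ker g\<close> and a complement of \<open>B + ker g\<close>.\<close>

lemma compatible_retractions:
  fixes V :: "('k::field_char_0, 'v) gspace" and W :: "('k, 'w) gspace"
  assumes V: "graded_space V" and W: "graded_space W" and g: "glin V W g"
    and B: "subsp (V i) B" and surj: "g i ` carrier (V i) = carrier (W i)"
  shows "\<exists>\<rho> \<rho>'. retraction (V i) B \<rho> \<and> retraction (W i) (g i ` B) \<rho>' \<and>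
    (\<forall>x\<in>carrier (V i). \<rho>' (g i x) = g i (\<rho> x))"
proof -
  define N where "N = {x \<in> carrier (V i). g i x = \<zero>\<^bsub>W i\<^esub>}"
  have img: "subsp (W i) (g i ` H)" if H: "subsp (V i) H" for H
    unfolding subsp_def
  proof (intro conjI ballI allI)
    show "g i ` H \<subseteq> carrier (W i)" using subspD(1)[OF H] glinD(1)[OF g] by auto
    show "\<zero>\<^bsub>W i\<^esub> \<in> g i ` H"
      using subspD(2)[OF H] glin_zero[OF g V W, of i] by (metis imageI)
    fix x assume "x \<in> g i ` H"
    then obtain x0 where x0: "x0 \<in> H" "x = g i x0" by auto
    note xc = subspD(1)[OF H x0(1)]
    show "c \<odot>\<^bsub>W i\<^esub> x \<in> g i ` H" for c
      using subspD(4)[OF H x0(1), of c] glinD(3)[OF g xc, of c] x0 by (metis imageI)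
    fix y assume "y \<in> g i ` H"
    then obtain y0 where y0: "y0 \<in> H" "y = g i y0" by auto
    show "x \<oplus>\<^bsub>W i\<^esub> y \<in> g i ` H"
      using subspD(3)[OF H x0(1) y0(1)] glinD(2)[OF g xc subspD(1)[OF H y0(1)]] x0 y0 by (metis imageI)
  qed
  have N: "subsp (V i) N"
    unfolding subsp_def N_def
    by (auto simp: gs_zero[OF V] gs_add[OF V] gs_smult[OF V] glin_zero[OF g V W] glinD[OF g]
        gs_add_zero[OF W gs_zero[OF W]] gs_smult_zero[OF W])
  have BN: "subsp (V i) (B \<inter> N)" using B N by (auto simp: subsp_def)
  have BpN: "subsp (V i) (setsum V i B N)" by (rule subsp_setsum[OF V B N])
  have full: "subsp (V i) (carrier (V i))"
    by (auto simp: subsp_def gs_zero[OF V] gs_add[OF V] gs_smult[OF V])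
  obtain C1 where C1: "subsp (V i) C1" "C1 \<subseteq> N" "(B \<inter> N) \<inter> C1 = {\<zero>\<^bsub>V i\<^esub>}" "N \<subseteq> setsum V i (B \<inter> N) C1"
    using complement_exists[OF V N BN] by blast
  obtain C2 where C2: "subsp (V i) C2" "setsum V i B N \<inter> C2 = {\<zero>\<^bsub>V i\<^esub>}" "carrier (V i) \<subseteq> setsum V i (setsum V i B N) C2"
    using complement_exists[OF V full BpN] by blast
  define C where "C = setsum V i C1 C2"
  have C: "subsp (V i) C" unfolding C_def by (rule subsp_setsum[OF V C1(1) C2(1)])
  \<comment> \<open>An element of \<open>C\<close> with the same image as an element of
    \<open>B\<close> has its \<open>C2\<close>-part in B + N, hence zero, so it lies in
    \<open>C1\<close> and in ker g. Both intersections, B with C and their images, follow from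
    this.\<close>
  have Cg: "\<exists>c1\<in>C1. c = c1" if c: "c \<in> C" and b: "b \<in> B" and gc: "g i c = g i b" for b c
  proof -
    obtain c1 c2 where cc: "c1 \<in> C1" "c2 \<in> C2" "c = c1 \<oplus>\<^bsub>V i\<^esub> c2" using c by (auto simp: C_def setsum_def[OF V])
    note cl = subspD(1)[OF C1(1) cc(1)] subspD(1)[OF C2(1) cc(2)] subspD(1)[OF B b]
    have "g i c1 = \<zero>\<^bsub>W i\<^esub>" using C1(2) cc(1) by (auto simp: N_def)
    then have "g i c2 = g i b" using gc cl glinD(1)[OF g cl(2)] by (simp add: cc(3) glinD(2)[OF g] gs_zero_add[OF W])
    then obtain z where z: "z \<in> carrier (V i)" "g i z = \<zero>\<^bsub>W i\<^esub>" "c2 = b \<oplus>\<^bsub>V i\<^esub> z"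
      using glin_diff_zero[OF V W g cl(2,3)] by blast
    then have "c2 \<in> setsum V i B N" using b by (auto simp: setsum_def[OF V] N_def)
    then have "c2 = \<zero>\<^bsub>V i\<^esub>" using C2(2) cc(2) by blast
    then show ?thesis using cc cl by (auto simp: gs_add_zero[OF V])
  qed
  have BC: "B \<inter> C = {\<zero>\<^bsub>V i\<^esub>}"
  proof -
    have "b = \<zero>\<^bsub>V i\<^esub>" if "b \<in> B" "b \<in> C" for b
      using Cg[OF that(2,1) refl] C1(2,3) that(1) by blast
    then show ?thesis using subspD(2)[OF B] subspD(2)[OF C] by blast
  qed
  have span: "\<exists>b\<in>B. \<exists>c\<in>C. x = b \<oplus>\<^bsub>V i\<^esub> c" if x: "x \<in> carrier (V i)" for x
  proof -
    obtain b n c2 where 1: "b \<in> B" "n \<in> N" "c2 \<in> C2" "x = (b \<oplus>\<^bsub>V i\<^esub> n) \<oplus>\<^bsub>V i\<^esub> c2"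
      using C2(3) x by (fastforce simp: setsum_def[OF V])
    obtain a c1 where 2: "a \<in> B" "c1 \<in> C1" "n = a \<oplus>\<^bsub>V i\<^esub> c1"
      using C1(4) 1(2) by (fastforce simp: setsum_def[OF V])
    interpret M: module "cring_class_ops :: 'k ring" "V i" by (rule graded_module[OF V])
    note cl = subspD(1)[OF B 1(1)] subspD(1)[OF C2(1) 1(3)] subspD(1)[OF B 2(1)] subspD(1)[OF C1(1) 2(2)]
    have "x = (b \<oplus>\<^bsub>V i\<^esub> a) \<oplus>\<^bsub>V i\<^esub> (c1 \<oplus>\<^bsub>V i\<^esub> c2)" using cl by (simp add: 1(4) 2(3) M.a_assoc)
    moreover have "b \<oplus>\<^bsub>V i\<^esub> a \<in> B" by (rule subspD(3)[OF B 1(1) 2(1)])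
    moreover have "c1 \<oplus>\<^bsub>V i\<^esub> c2 \<in> C" using 2(2) 1(3) by (auto simp: C_def setsum_def[OF V])
    ultimately show ?thesis by blast
  qed
  have gB: "subsp (W i) (g i ` B)" and gC: "subsp (W i) (g i ` C)" using img B C by auto
  have BC': "g i ` B \<inter> g i ` C = {\<zero>\<^bsub>W i\<^esub>}"
  proof -
    have "g i c = \<zero>\<^bsub>W i\<^esub>" if "b \<in> B" "c \<in> C" "g i c = g i b" for b c
      using Cg[OF that(2,1,3)] C1(2) by (auto simp: N_def)
    then have "y = \<zero>\<^bsub>W i\<^esub>" if "y \<in> g i ` B" "y \<in> g i ` C" for y using that by (metis imageE)
    then show ?thesis using subspD(2)[OF gB] subspD(2)[OF gC] by blast
  qed
  obtain \<rho> where \<rho>: "\<forall>b\<in>B. \<forall>c\<in>C. \<rho> (b \<oplus>\<^bsub>V i\<^esub> c) = b" using projection_exists[OF V B C BC] by blast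
  obtain \<rho>' where \<rho>': "\<forall>b\<in>g i ` B. \<forall>c\<in>g i ` C. \<rho>' (b \<oplus>\<^bsub>W i\<^esub> c) = b" using projection_exists[OF W gB gC BC'] by blast
  have comm: "\<rho>' (g i x) = g i (\<rho> x)" if x: "x \<in> carrier (V i)" for x
  proof -
    obtain b c where bc: "b \<in> B" "c \<in> C" "x = b \<oplus>\<^bsub>V i\<^esub> c" using span[OF x] by blast
    then show ?thesis using \<rho> \<rho>' glinD(2)[OF g subspD(1)[OF B bc(1)] subspD(1)[OF C bc(2)]] by simp
  qed
  have "carrier (W i) \<subseteq> setsum W i (g i ` B) (g i ` C)"
  proof
    fix y assume "y \<in> carrier (W i)"
    then obtain x where x: "x \<in> carrier (V i)" "y = g i x" using surj by blast
    obtain b c where bc: "b \<in> B" "c \<in> C" "x = b \<oplus>\<^bsub>V i\<^esub> c" using span[OF x(1)] by blast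
    then show "y \<in> setsum W i (g i ` B) (g i ` C)"
      using glinD(2)[OF g subspD(1)[OF B bc(1)] subspD(1)[OF C bc(2)]] x(2) by (auto simp: setsum_def[OF W])
  qed
  then have "retraction (W i) (g i ` B) \<rho>'" by (rule retraction_of_complement[OF W gB gC _ \<rho>'])
  moreover have "carrier (V i) \<subseteq> setsum V i B C" using span by (fastforce simp: setsum_def[OF V])
  then have "retraction (V i) B \<rho>" by (rule retraction_of_complement[OF V B C _ \<rho>])
  ultimately show ?thesis using comm by blast
qed

section \<open>The retraction extended to a morphism onto the kernel of q\<close>

section \<open>The morphism onto the kernel\<close>

text \<open>Postcomposition with a linear map that shifts degrees by \<open>- c\<close>. It is
  applied to the bracket of \<open>T\<close> with c = - 1, as \<rho> then leads from degree m to
  degree m + 1.\<close>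

lemma skew_maps_post:
  assumes f: "skew_maps V W e f" and e: "\<And>k. e k = e' k + c" and h: "glin (\<lambda>N. W (N + c)) W' h"
  shows "skew_maps V W' e' (\<lambda>w. h (wdeg w + e' (length w)) (f w))"
proof -
  have ea: "x + e k = x + e' k + c" for x k by (simp add: e)
  note cl = skew_maps_closed[OF f, unfolded ea]
  note h' = glinD[OF h]
  show ?thesis
    unfolding skew_maps_def Let_def
  proof (intro conjI ballI allI impI; (elim conjE)?)
    fix w assume w: "w \<in> words V"
    show "h (wdeg w + e' (length w)) (f w) \<in> carrier (W' (wdeg w + e' (length w)))"
      by (rule h'(1)[OF cl[OF w]])
  next
    fix u v i x y
    assume w: "u @ (i, x) # v \<in> words V" and y: "y \<in> carrier (V i)"
    let ?N = "wdeg (u @ (i, x) # v) + e' (length (u @ (i, x) # v))"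
    have N: "wdeg (u @ (i, z) # v) + e' (length (u @ (i, z) # v)) = ?N" for z by simp
    have wy: "u @ (i, y) # v \<in> words V" using w y by (simp add: words_iff)
    show "h (wdeg (u @ (i, x \<oplus>\<^bsub>V i\<^esub> y) # v) + e' (length (u @ (i, x \<oplus>\<^bsub>V i\<^esub> y) # v))) (f (u @ (i, x \<oplus>\<^bsub>V i\<^esub> y) # v)) =
      h ?N (f (u @ (i, x) # v)) \<oplus>\<^bsub>W' ?N\<^esub> h (wdeg (u @ (i, y) # v) + e' (length (u @ (i, y) # v))) (f (u @ (i, y) # v))"
      unfolding N[of "x \<oplus>\<^bsub>V i\<^esub> y"] N[of y] skew_maps_add[OF f w y, unfolded ea]
      by (rule h'(2)[OF cl[OF w] cl[OF wy, unfolded N[of y]]])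
  next
    fix u v i x a
    assume w: "u @ (i, x) # v \<in> words V"
    let ?N = "wdeg (u @ (i, x) # v) + e' (length (u @ (i, x) # v))"
    have N: "wdeg (u @ (i, z) # v) + e' (length (u @ (i, z) # v)) = ?N" for z by simp
    show "h (wdeg (u @ (i, a \<odot>\<^bsub>V i\<^esub> x) # v) + e' (length (u @ (i, a \<odot>\<^bsub>V i\<^esub> x) # v))) (f (u @ (i, a \<odot>\<^bsub>V i\<^esub> x) # v)) =
      a \<odot>\<^bsub>W' ?N\<^esub> h ?N (f (u @ (i, x) # v))"
      unfolding N[of "a \<odot>\<^bsub>V i\<^esub> x"] skew_maps_smult[OF f w, unfolded ea]
      by (rule h'(3)[OF cl[OF w]])
  next
    fix u v i x j y
    assume w: "u @ (i, x) # (j, y) # v \<in> words V"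
    let ?N = "wdeg (u @ (i, x) # (j, y) # v) + e' (length (u @ (i, x) # (j, y) # v))"
    have N: "wdeg (u @ (j, y) # (i, x) # v) + e' (length (u @ (j, y) # (i, x) # v)) = ?N" by simp
    have w': "u @ (j, y) # (i, x) # v \<in> words V" using w by (auto simp: words_iff)
    show "h ?N (f (u @ (i, x) # (j, y) # v)) = (- ksgn i j) \<odot>\<^bsub>W' ?N\<^esub>
      h (wdeg (u @ (j, y) # (i, x) # v) + e' (length (u @ (j, y) # (i, x) # v))) (f (u @ (j, y) # (i, x) # v))"
      unfolding N skew_maps_swap[OF f w, unfolded ea]
      by (rule h'(3)[OF cl[OF w', unfolded N]])
  qed
qed

text \<open>A case distinction on total degree and length is invisible to the conditions, each of
  which compares words sharing both.\<close>

lemma skew_maps_if: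
  assumes f: "skew_maps V W e f" and g: "skew_maps V W e g"
  shows "skew_maps V W e (\<lambda>w. if P (wdeg w) (length w) then f w else g w)"
  unfolding skew_maps_def Let_def
proof (intro conjI ballI allI impI; (elim conjE)?)
  fix u v i x j y
  assume w: "u @ (i, x) # (j, y) # v \<in> words V"
  have N: "wdeg (u @ (j, y) # (i, x) # v) = wdeg (u @ (i, x) # (j, y) # v)"
    "length (u @ (j, y) # (i, x) # v) = length (u @ (i, x) # (j, y) # v)" by simp_all
  show "(if P (wdeg (u @ (i, x) # (j, y) # v)) (length (u @ (i, x) # (j, y) # v))
      then f (u @ (i, x) # (j, y) # v) else g (u @ (i, x) # (j, y) # v)) =
    (- ksgn i j) \<odot>\<^bsub>W (wdeg (u @ (i, x) # (j, y) # v) + e (length (u @ (i, x) # (j, y) # v)))\<^esub>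
      (if P (wdeg (u @ (j, y) # (i, x) # v)) (length (u @ (j, y) # (i, x) # v))
       then f (u @ (j, y) # (i, x) # v) else g (u @ (j, y) # (i, x) # v))"
    unfolding N using skew_maps_swap[OF f w] skew_maps_swap[OF g w] by presburger
next
  fix u v i x y
  assume w: "u @ (i, x) # v \<in> words V" and y: "y \<in> carrier (V i)"
  have N: "wdeg (u @ (i, z) # v) = wdeg (u @ (i, x) # v)" "length (u @ (i, z) # v) = length (u @ (i, x) # v)" for z
    by simp_all
  show "(if P (wdeg (u @ (i, x \<oplus>\<^bsub>V i\<^esub> y) # v)) (length (u @ (i, x \<oplus>\<^bsub>V i\<^esub> y) # v))
      then f (u @ (i, x \<oplus>\<^bsub>V i\<^esub> y) # v) else g (u @ (i, x \<oplus>\<^bsub>V i\<^esub> y) # v)) =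
    (if P (wdeg (u @ (i, x) # v)) (length (u @ (i, x) # v)) then f (u @ (i, x) # v) else g (u @ (i, x) # v))
    \<oplus>\<^bsub>W (wdeg (u @ (i, x) # v) + e (length (u @ (i, x) # v)))\<^esub>
    (if P (wdeg (u @ (i, y) # v)) (length (u @ (i, y) # v)) then f (u @ (i, y) # v) else g (u @ (i, y) # v))"
    unfolding N[of y] N[of "x \<oplus>\<^bsub>V i\<^esub> y"] using skew_maps_add[OF f w y] skew_maps_add[OF g w y] by presburger
next
  fix u v i x a
  assume w: "u @ (i, x) # v \<in> words V"
  have N: "wdeg (u @ (i, z) # v) = wdeg (u @ (i, x) # v)" "length (u @ (i, z) # v) = length (u @ (i, x) # v)" for z
    by simp_all
  show "(if P (wdeg (u @ (i, a \<odot>\<^bsub>V i\<^esub> x) # v)) (length (u @ (i, a \<odot>\<^bsub>V i\<^esub> x) # v))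
      then f (u @ (i, a \<odot>\<^bsub>V i\<^esub> x) # v) else g (u @ (i, a \<odot>\<^bsub>V i\<^esub> x) # v)) =
    a \<odot>\<^bsub>W (wdeg (u @ (i, x) # v) + e (length (u @ (i, x) # v)))\<^esub>
    (if P (wdeg (u @ (i, x) # v)) (length (u @ (i, x) # v)) then f (u @ (i, x) # v) else g (u @ (i, x) # v))"
    unfolding N[of "a \<odot>\<^bsub>V i\<^esub> x"] using skew_maps_smult[OF f w] skew_maps_smult[OF g w] by presburger
qed (use skew_maps_closed[OF f] skew_maps_closed[OF g] in presburger)

lemma trivial_letters:
  fixes W :: "('k::field_char_0, 'w) gspace"
  assumes W: "graded_space W" and z: "carrier (W i) = {\<zero>\<^bsub>W i\<^esub>}"
    and p: "p \<in> free.span (gen ` {[(i, x)] | x. x \<in> carrier (W i)})"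
  shows "p \<in> sym_rel W"
  using p by (rule flin_span[OF flin_id subspace_sym_rel, rotated])
    (use z gen_zero_rel[OF W, of "[]" "[]" i] in auto)

lemma com_deg:
  assumes \<phi>: "sym_maps V W e \<phi>" and p: "p \<in> free.span (gen ` {u \<in> words V. wdeg u = d})"
  shows "com e \<phi> p \<in> free.span (gen ` {[(d + e, x)] | x. x \<in> carrier (W (d + e))})"
  using p by (rule flin_span[OF flin_com free.subspace_span, rotated])
    (use sym_maps_closed[OF \<phi>] in \<open>auto simp: com_gen words_iff intro!: free.span_base\<close>)

text \<open>Applied twice: to the brackets of the abelian target, and to r in the degree where it
  lives on single letters.\<close>

lemma com_proj_one:
  fixes V :: "('k::field_char_0, 'v) gspace" and W :: "('k, 'w) gspace"
  assumes W: "graded_space W" and A: "A \<subseteq> words V"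
    and z: "\<And>u. u \<in> A \<Longrightarrow> length u \<ge> 2 \<Longrightarrow> \<phi> u = \<zero>\<^bsub>W (wdeg u + e)\<^esub>"
    and p: "p \<in> free.span (gen ` A)"
  shows "com e \<phi> p - com e \<phi> (proj_one p) \<in> sym_rel W"
  using p
proof (rule flin_span[OF flin_diff[OF flin_com flin_comp[OF flin_com flin_proj_one]] subspace_sym_rel, rotated])
  fix x :: "'v word \<Rightarrow>\<^sub>0 'k" assume "x \<in> gen ` A"
  then obtain u where u: "u \<in> A" "x = gen u" by blast
  show "com e \<phi> x - com e \<phi> (proj_one x) \<in> sym_rel W"
  proof (cases "length u = 1")
    case True
    then show ?thesis by (simp add: u proj_one_gen free.subspace_0)
  next
    case False
    have ne: "u \<noteq> []" using u A by (auto simp: words_iff)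
    then have "length u \<ge> 2" using False by (cases u; cases "tl u") auto
    then have "\<phi> u = \<zero>\<^bsub>W (wdeg u + e)\<^esub>" by (rule z[OF u(1)])
    then show ?thesis
      using False ne gen_zero_rel[OF W, of "[]" "[]" "wdeg u + e"]
      by (simp add: u proj_one_gen com_gen free2.linear_0[OF flin_com])
  qed
qed

text \<open>Degrees m and m + 1 of the kernel are the same set, so \<rho> serves both. The first
  case includes single letters of degree m + 1: there the differential of \<open>T\<close> returns
  the element itself and \<rho> fixes it.\<close>

definition rmap :: "int \<Rightarrow> ('k::field_char_0, 'v) linf \<Rightarrow> ('v \<Rightarrow> 'v) \<Rightarrow> 'v word \<Rightarrow> 'v" where
  "rmap m L \<rho> w = (if wdeg w + morphism_deg (length w) = m + 1 then \<rho> (bracket (tau_lt (m + 1) L) w)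
     else strict_of (ker_q m L) (\<lambda>i x. if i = m then \<rho> x else \<zero>\<^bsub>space (ker_q m L) i\<^esub>) w)"

context trunc
begin

context
  fixes \<rho> :: "'v \<Rightarrow> 'v"
  assumes ret: "retraction (space L m) (boundaries L m) \<rho>"
begin

abbreviation r where "r \<equiv> rmap m L \<rho>"

lemma \<rho>_simps:
  "x \<in> carrier (space L m) \<Longrightarrow> \<rho> x \<in> boundaries L m"
  "x \<in> carrier (space L m) \<Longrightarrow> y \<in> carrier (space L m) \<Longrightarrow> \<rho> (x \<oplus>\<^bsub>space L m\<^esub> y) = \<rho> x \<oplus>\<^bsub>space L m\<^esub> \<rho> y"
  "x \<in> carrier (space L m) \<Longrightarrow> \<rho> (c \<odot>\<^bsub>space L m\<^esub> x) = c \<odot>\<^bsub>space L m\<^esub> \<rho> x"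
  "b \<in> boundaries L m \<Longrightarrow> \<rho> b = b"
  using ret by (auto simp: retraction_def)

lemma T_m: "space T m = space L m" by (simp add: T_space)

lemma glin_rho: "glin (space T) (space K) (\<lambda>i x. if i = m then \<rho> x else \<zero>\<^bsub>space K i\<^esub>)"
  unfolding glin_def
proof (intro allI ballI)
  fix i x assume x: "x \<in> carrier (space T i)"
  show "(if i = m then \<rho> x else \<zero>\<^bsub>space K i\<^esub>) \<in> carrier (space K i) \<and>
     (\<forall>y\<in>carrier (space T i). (if i = m then \<rho> (x \<oplus>\<^bsub>space T i\<^esub> y) else \<zero>\<^bsub>space K i\<^esub>) =
       (if i = m then \<rho> x else \<zero>\<^bsub>space K i\<^esub>) \<oplus>\<^bsub>space K i\<^esub> (if i = m then \<rho> y else \<zero>\<^bsub>space K i\<^esub>)) \<and>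
     (\<forall>c. (if i = m then \<rho> (c \<odot>\<^bsub>space T i\<^esub> x) else \<zero>\<^bsub>space K i\<^esub>) = c \<odot>\<^bsub>space K i\<^esub> (if i = m then \<rho> x else \<zero>\<^bsub>space K i\<^esub>))"
  proof (cases "i = m")
    case True
    then show ?thesis using x \<rho>_simps by (simp add: T_m K_carrier)
  next
    case False
    then show ?thesis
      using gs_zero[OF graded_K, of i] gs_add_zero[OF graded_K gs_zero[OF graded_K, of i]]
        gs_smult_zero[OF graded_K, where i = i] by simp
  qed
qed

lemma skew_r: "skew_maps (space T) (space K) morphism_deg r"
proof -
  have h: "glin (\<lambda>N. space T (N + - 1)) (space K) (\<lambda>N x. if N = m + 1 then \<rho> x else \<zero>\<^bsub>space K N\<^esub>)"
    unfolding glin_def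
  proof (intro allI ballI)
    fix N x assume x: "x \<in> carrier (space T (N + - 1))"
    show "(if N = m + 1 then \<rho> x else \<zero>\<^bsub>space K N\<^esub>) \<in> carrier (space K N) \<and>
     (\<forall>y\<in>carrier (space T (N + - 1)). (if N = m + 1 then \<rho> (x \<oplus>\<^bsub>space T (N + - 1)\<^esub> y) else \<zero>\<^bsub>space K N\<^esub>) =
       (if N = m + 1 then \<rho> x else \<zero>\<^bsub>space K N\<^esub>) \<oplus>\<^bsub>space K N\<^esub> (if N = m + 1 then \<rho> y else \<zero>\<^bsub>space K N\<^esub>)) \<and>
     (\<forall>c. (if N = m + 1 then \<rho> (c \<odot>\<^bsub>space T (N + - 1)\<^esub> x) else \<zero>\<^bsub>space K N\<^esub>) =
       c \<odot>\<^bsub>space K N\<^esub> (if N = m + 1 then \<rho> x else \<zero>\<^bsub>space K N\<^esub>))"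
    proof (cases "N = m + 1")
      case True
      then show ?thesis using x \<rho>_simps by (simp add: T_m K_carrier) (simp add: T_space)
    next
      case False
      then show ?thesis
        using gs_zero[OF graded_K, of N] gs_add_zero[OF graded_K gs_zero[OF graded_K, of N]]
          gs_smult_zero[OF graded_K, where i = N] by simp
    qed
  qed
  have s1: "skew_maps (space T) (space K) morphism_deg
      (\<lambda>w. if wdeg w + morphism_deg (length w) = m + 1 then \<rho> (bracket T w) else \<zero>\<^bsub>space K (wdeg w + morphism_deg (length w))\<^esub>)"
    by (rule skew_maps_post[OF conjunct2[OF linf_algebra_pre[OF T_algebra]] _ h]) simp
  have s2: "skew_maps (space T) (space K) morphism_deg (strict_of K (\<lambda>i x. if i = m then \<rho> x else \<zero>\<^bsub>space K i\<^esub>))"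
    by (rule strict_skew[OF graded_T graded_K])
      (use glin_rho in \<open>auto simp: strict_rep_def linf_strict_def strict_of_def\<close>)
  have "r = (\<lambda>w. if wdeg w + morphism_deg (length w) = m + 1
      then (if wdeg w + morphism_deg (length w) = m + 1 then \<rho> (bracket T w) else \<zero>\<^bsub>space K (wdeg w + morphism_deg (length w))\<^esub>)
      else strict_of K (\<lambda>i x. if i = m then \<rho> x else \<zero>\<^bsub>space K i\<^esub>) w)"
    by (rule ext) (simp add: rmap_def)
  then show ?thesis using skew_maps_if[OF s1 s2, of "\<lambda>a k. a + morphism_deg k = m + 1"] by simp
qed

lemma m_arith: "1 + m = m + 1" "2 + m = m + 2"
  by simp_all

lemma desusp_mdeg: "wdeg (desusp w) + morphism_deg (length w) = wdeg w - 1"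
  by (simp add: wdeg_desusp)

text \<open>Brackets and morphisms carry the same desuspension sign, which passes through the linear
  map \<rho>. Suspended degree m + 2 means target degree m + 1.\<close>

lemma lmo_r_top:
  assumes w: "w \<in> words (sus T)" and deg: "wdeg w = m + 2"
  shows "lmo K r w = \<rho> (lbr T w)"
proof -
  have b: "wdeg (desusp w) + bracket_deg (length w) = m" using deg by (simp add: wdeg_desusp)
  have dw: "desusp w \<in> words (space T)" using w by (simp add: desusp_words)
  have c: "bracket T (desusp w) \<in> carrier (space L m)"
    using skew_maps_closed[OF conjunct2[OF linf_algebra_pre[OF T_algebra]] dw] b by (simp add: T_m)
  have "r (desusp w) = \<rho> (bracket T (desusp w))"
    using desusp_mdeg[of w] deg by (simp add: rmap_def)
  then have "lmo K r w = desusp_sgn w \<odot>\<^bsub>space K (m + 1)\<^esub> \<rho> (bracket T (desusp w))"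
    unfolding lmo_def shift_map_def desusp_mdeg deg by (simp add: m_arith)
  also have "\<dots> = desusp_sgn w \<odot>\<^bsub>space L m\<^esub> \<rho> (bracket T (desusp w))" by (simp add: T_space)
  also have "\<dots> = \<rho> (lbr T w)"
    unfolding lbr_def shift_map_def b T_m using \<rho>_simps(3)[OF c] by simp
  finally show ?thesis .
qed

lemma lmo_r_single:
  assumes x: "x \<in> carrier (space L m)"
  shows "lmo K r [(m + 1, x)] = \<rho> x"
  using gs_one_smult[OF graded_K, of "\<rho> x" m] \<rho>_simps(1)[OF x]
  by (simp add: lmo_def shift_map_def wdeg_nonempty_letter rmap_def strict_of_def K_carrier)

lemma lmo_r_zero:
  assumes "wdeg w = m + 1" "length w \<ge> 2"
  shows "lmo K r w = \<zero>\<^bsub>sus K (wdeg w + 0)\<^esub>"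
proof -
  have "r (desusp w) = \<zero>\<^bsub>space K (wdeg w - 1)\<^esub>"
    using desusp_mdeg[of w] assms by (simp add: rmap_def strict_of_def)
  then show ?thesis
    unfolding lmo_def shift_map_def desusp_mdeg by (simp add: gs_smult_zero[OF graded_K] susp_def del: K_simps)
qed

lemma lbr_K_zero:
  assumes "length w \<ge> 2"
  shows "lbr K w = \<zero>\<^bsub>sus K (wdeg w + - 1)\<^esub>"
proof -
  have b: "wdeg (desusp w) + bracket_deg (length w) = wdeg w - 2" by (simp add: wdeg_desusp)
  have "bracket K (desusp w) = \<zero>\<^bsub>space T (wdeg (desusp w) + bracket_deg (length w))\<^esub>"
    using assms by (simp add: K_bracket)
  then have "bracket K (desusp w) = \<zero>\<^bsub>space K (wdeg w - 2)\<^esub>" unfolding b K_simps .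
  then show ?thesis
    unfolding lbr_def shift_map_def b by (simp add: gs_smult_zero[OF graded_K] susp_def del: K_simps)
qed

text \<open>For a word of suspended degree D both sides lie in degree D - 2 of the kernel, which is
  nonzero at most for D = m + 2 and D = m + 3.\<close>

lemma r_equation:
  assumes w: "w \<in> words (sus T)"
  shows "com 0 (lmo K r) (codiff T (gen w)) - com (- 1) (lbr K) (cmor (lmo K r) (gen w)) \<in> sym_rel (sus K)"
proof -
  let ?f = "lmo K r"
  let ?X = "com 0 ?f (codiff T (gen w)) :: _ \<Rightarrow>\<^sub>0 'k" and ?Y = "com (- 1) (lbr K) (cmor ?f (gen w)) :: _ \<Rightarrow>\<^sub>0 'k"
  note preT = linf_algebra_pre[OF T_algebra] and preK = linf_algebra_pre[OF K_algebra]
  note gK = graded_susp[OF graded_K]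
  have f: "sym_maps (sus T) (sus K) 0 ?f" by (rule lmo_sym[OF graded_K skew_r])
  note S = subspace_sym_rel
  have c: "codiff T (gen w) \<in> free.span (gen ` {u \<in> words (sus T). wdeg u = wdeg w + - 1})"
    by (rule sym_map_deg[OF codiff_sym_map[OF preT] w])
  have q: "(cmor ?f (gen w) :: _ \<Rightarrow>\<^sub>0 'k) \<in> free.span (gen ` {u \<in> words (sus K). wdeg u = wdeg w + 0})"
    by (rule sym_map_deg[OF sym_map_cmor[OF f] w])
  have p1: "proj_one (cmor ?f (gen w)) = (gen [(wdeg w, ?f w)] :: _ \<Rightarrow>\<^sub>0 'k)"
    using w by (simp add: proj_one_cmor com_gen words_iff del: cmor_gen)
  have Y: "?Y - com (- 1) (lbr K) (gen [(wdeg w, ?f w)]) \<in> sym_rel (sus K)"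
  proof -
    have "?Y - com (- 1) (lbr K) (proj_one (cmor ?f (gen w))) \<in> sym_rel (sus K)"
    proof (rule com_proj_one[OF gK _ _ q])
      fix u :: "'v word" assume "2 \<le> length u"
      then show "lbr K u = \<zero>\<^bsub>sus K (wdeg u + - 1)\<^esub>" by (rule lbr_K_zero)
    qed auto
    then show ?thesis unfolding p1 .
  qed
  have fw: "?f w \<in> carrier (space K (wdeg w - 1))" using sym_maps_closed[OF f w] by (simp add: susp_def)
  have cT: "lbr T w \<in> carrier (space T (wdeg w - 2))"
    using sym_maps_closed[OF lbr_sym[OF preT] w] by (simp add: susp_def)
  consider (low) "wdeg w = m + 2" | (high) "wdeg w = m + 3" | (other) "wdeg w \<noteq> m + 2" "wdeg w \<noteq> m + 3" by blast
  then show ?thesis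
  proof cases
    case low
    \<comment> \<open>Into degree m: the differential of the kernel is the identity on im d, and r
      sees only the letter \<open>lbr T w\<close>, so both sides are \<rho> of that letter.\<close>
    have fl: "?f w = \<rho> (lbr T w)" by (rule lmo_r_top[OF w low])
    have lT: "lbr T w \<in> carrier (space L m)" using cT low T_m by simp
    have "lbr K [(m + 2, y)] = y" if y: "y \<in> boundaries L m" for y
      using dT_top[OF y] gs_one_smult[OF graded_K, of y m] y
      by (simp add: lbr_def shift_map_def wdeg_nonempty_letter K_bracket K_carrier m_arith)
    from this[OF \<rho>_simps(1)[OF lT]] have "lbr K [(m + 2, ?f w)] = ?f w" unfolding fl .
    then have "com (- 1) (lbr K) (gen [(wdeg w, ?f w)]) = (gen [(m + 1, \<rho> (lbr T w))] :: _ \<Rightarrow>\<^sub>0 'k)"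
      by (simp add: com_gen low fl m_arith)
    moreover have "?X - com 0 ?f (proj_one (codiff T (gen w))) \<in> sym_rel (sus K)"
    proof (rule com_proj_one[OF gK _ _ c])
      fix u assume "u \<in> {u \<in> words (sus T). wdeg u = wdeg w + - 1}" "2 \<le> length u"
      then show "?f u = \<zero>\<^bsub>sus K (wdeg u + 0)\<^esub>" using lmo_r_zero[of u] low by simp
    qed auto
    moreover have "com 0 ?f (proj_one (codiff T (gen w))) = (gen [(m + 1, \<rho> (lbr T w))] :: _ \<Rightarrow>\<^sub>0 'k)"
      using w lmo_r_single[OF lT] low by (simp add: proj_one_cod com_gen words_iff m_arith)
    ultimately show ?thesis using cong_trans[OF S _ cong_sym[OF S Y]] by simp
  next
    case high
    \<comment> \<open>Into degree m + 1: the value of r on \<open>w\<close> would have degree m + 2,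
      where the kernel vanishes.\<close>
    have "?f w = \<zero>\<^bsub>sus K (wdeg w)\<^esub>" using fw high by (simp add: K_carrier susp_def)
    then have "gen [(wdeg w, ?f w)] \<in> sym_rel (sus K)" using gen_zero_rel[OF gK, of "[]" "[]" "wdeg w"] by simp
    then have "com (- 1) (lbr K) (gen [(wdeg w, ?f w)]) \<in> sym_rel (sus K)" by (rule com_rel[OF lbr_sym[OF preK]])
    then have Yr: "?Y \<in> sym_rel (sus K)" by (rule cong_in[OF S Y])
    \<comment> \<open>\<rho> regarded as a map from degree m of \<open>T\<close> to degree m + 1 of
      the kernel. Through it the remaining side factors over the Jacobi expression of
      \<open>T\<close>.\<close>
    define g where "g = (\<lambda>i x. if i = m then \<rho> x else \<zero>\<^bsub>space K (i + 1)\<^esub>)"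
    define f2 where "f2 w = (if length w = 1 then g (fst (hd w)) (snd (hd w)) else \<zero>\<^bsub>space K (wdeg w + int (length w))\<^esub>)"
      for w :: "'v word"
    have gg: "glin (space T) (\<lambda>i. space K (i + int 1)) g"
      unfolding glin_def
    proof (intro allI ballI)
      fix i x assume x: "x \<in> carrier (space T i)"
      show "g i x \<in> carrier (space K (i + int 1)) \<and>
        (\<forall>y\<in>carrier (space T i). g i (x \<oplus>\<^bsub>space T i\<^esub> y) = g i x \<oplus>\<^bsub>space K (i + int 1)\<^esub> g i y) \<and>
        (\<forall>c. g i (c \<odot>\<^bsub>space T i\<^esub> x) = c \<odot>\<^bsub>space K (i + int 1)\<^esub> g i x)"
      proof (cases "i = m")
        case True
        then show ?thesis using x \<rho>_simps by (simp add: g_def T_m K_carrier) (simp add: T_space)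
      next
        case False
        then show ?thesis
          using gs_zero[OF graded_K, of "i + 1"] gs_add_zero[OF graded_K gs_zero[OF graded_K, of "i + 1"]]
            gs_smult_zero[OF graded_K, where i = "i + 1"] by (simp add: g_def)
      qed
    qed
    have "skew_maps (space T) (space K) int f2"
      by (rule skew_maps_linear[where e = int and V = "space T" and W = "space K" and g = g, OF graded_T graded_K gg])
        (simp_all add: f2_def)
    then have s2: "sym_maps (sus T) (sus K) 1 (shift_map (space K) int f2)"
      by (rule sym_maps_shift[OF graded_K]) simp
    have "?X = com 1 (shift_map (space K) int f2) (com (- 1) (lbr T) (codiff T (gen w)))"
      using c
    proof (rule flin_span_eq[OF flin_com flin_comp[OF flin_com flin_com], rotated])
      fix z :: "'v word \<Rightarrow>\<^sub>0 'k" assume "z \<in> gen ` {u \<in> words (sus T). wdeg u = wdeg w + - 1}"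
      then obtain u where u: "z = gen u" "u \<in> words (sus T)" "wdeg u = m + 2" using high by auto
      have lT: "lbr T u \<in> carrier (space L m)"
        using sym_maps_closed[OF lbr_sym[OF preT] u(2)] u(3) by (simp add: susp_def T_m)
      have "shift_map (space K) int f2 [(m + 1, lbr T u)] = \<rho> (lbr T u)"
        using gs_one_smult[OF graded_K, of "\<rho> (lbr T u)" "m + 1"] \<rho>_simps(1)[OF lT]
        by (simp add: shift_map_def wdeg_nonempty_letter f2_def g_def K_carrier)
      then show "com 0 ?f z = com 1 (shift_map (space K) int f2) (com (- 1) (lbr T) z)"
        using u lmo_r_top[OF u(2,3)] by (simp add: com_gen words_iff m_arith)
    qed
    also have "\<dots> \<in> sym_rel (sus K)" by (rule com_rel[OF s2 linf_algebra_jacobi[OF T_algebra w]])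
    finally show ?thesis using Yr by (rule free.subspace_diff[OF S])
  next
    case other
    \<comment> \<open>In all other total degrees the equation takes place in a zero space.\<close>
    have z: "carrier (sus K (wdeg w - 1)) = {\<zero>\<^bsub>sus K (wdeg w - 1)\<^esub>}" using other by (simp add: susp_def K_carrier)
    have "?X \<in> sym_rel (sus K)"
      using com_deg[OF f c] by (intro trivial_letters[OF gK z]) simp
    moreover have "?Y \<in> sym_rel (sus K)"
      using com_deg[OF lbr_sym[OF preK] q] by (intro trivial_letters[OF gK z]) simp
    ultimately show ?thesis by (rule free.subspace_diff[OF S])
  qed
qed

lemma r_morphism: "linf_morphism T K r"
  by (rule linf_morphismI[OF T_algebra K_algebra skew_r linf_coalgebra_map_cmor[OF graded_K skew_r] r_equation])

text \<open>In degree m this is the retraction property, in degree m + 1 the same combined with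
  \<open>dT_top\<close>.\<close>

lemma r_K:
  assumes x: "x \<in> carrier (space K i)"
  shows "r [(i, x)] = x"
proof -
  consider "i = m" | "i = m + 1" | "i \<noteq> m" "i \<noteq> m + 1" by blast
  then show ?thesis
  proof cases
    case 1
    then show ?thesis using x \<rho>_simps(4) by (simp add: rmap_def strict_of_def K_carrier)
  next
    case 2
    then show ?thesis using x \<rho>_simps(4) dT_top by (simp add: rmap_def K_carrier)
  next
    case 3
    then show ?thesis using x by (simp add: rmap_def strict_of_def K_carrier)
  qed
qed

text \<open>The linear part of \<open>q_lt\<close> is onto with kernel \<open>K\<close>, and that of
  \<open>r\<close> is the identity on \<open>K\<close>, so it splits the sequence.\<close>

lemma pair_iso: "linf_iso T (linf_prod Q K) (mor_pair (q_lt m L) r)"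
  unfolding linf_iso_def
proof (intro conjI allI)
  show mor: "linf_morphism T (linf_prod Q K) (mor_pair (q_lt m L) r)"
    by (rule linf_morphism_pair[OF q_morphism r_morphism])
  fix i
  let ?h = "\<lambda>i x. mor_pair (q_lt m L) r [(i, x)]"
  have h: "glin (space T) (space (linf_prod Q K)) ?h"
    by (rule skew_maps_glin[OF graded_T]) (use mor in \<open>simp add: linf_morphism_def\<close>)
  have gP: "graded_space (space (linf_prod Q K))" by (simp add: graded_prod_space[OF graded_Q graded_K])
  have hx: "?h i x = (q_lin m L i x, r [(i, x)])" for x
    by (simp add: mor_pair_def q_lt_def strict_of_def)
  have rl: "glin (space T) (space K) (\<lambda>i x. r [(i, x)])" by (rule skew_maps_glin[OF graded_T skew_r])
  have surjq: "\<exists>x\<in>carrier (space T i). q_lin m L i x = a" if "a \<in> carrier (space Q i)" for a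
  proof -
    have "pQ i ` carrier (space L i) = carrier (space Q i)" using Q_quot unfolding linf_quot_def by simp
    then have "a \<in> pQ i ` carrier (space L i)" using that by simp
    then obtain y where y: "y \<in> carrier (space L i)" "pQ i y = a" by blast
    show ?thesis using glinD(1)[OF glin_pT y(1)] q_pT[OF y(1)] y(2) by blast
  qed
  have "inj_on (?h i) (carrier (space T i))"
  proof (rule inj_onI)
    fix x y assume x: "x \<in> carrier (space T i)" and y: "y \<in> carrier (space T i)" and eq: "?h i x = ?h i y"
    obtain z where z: "z \<in> carrier (space T i)" "?h i z = \<zero>\<^bsub>space (linf_prod Q K) i\<^esub>" "x = y \<oplus>\<^bsub>space T i\<^esub> z"
      by (rule glin_diff_zero[OF graded_T gP h x y eq])
    then have "z \<in> carrier (space K i)" "r [(i, z)] = \<zero>\<^bsub>space T i\<^esub>" by (simp_all add: hx K_space)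
    then have "z = \<zero>\<^bsub>space T i\<^esub>" using r_K by simp
    then show "x = y" using y z(3) by (simp add: gs_add_zero[OF graded_T])
  qed
  moreover have "?h i ` carrier (space T i) = carrier (space (linf_prod Q K) i)"
  proof
    show "?h i ` carrier (space T i) \<subseteq> carrier (space (linf_prod Q K) i)" using glinD(1)[OF h] by blast
    show "carrier (space (linf_prod Q K) i) \<subseteq> ?h i ` carrier (space T i)"
    proof
      fix p assume "p \<in> carrier (space (linf_prod Q K) i)"
      then obtain a k where p: "p = (a, k)" "a \<in> carrier (space Q i)" "k \<in> carrier (space K i)" by auto
      obtain x where x: "x \<in> carrier (space T i)" "q_lin m L i x = a" using surjq[OF p(2)] by blast
      have rx: "r [(i, x)] \<in> carrier (space K i)" by (rule glinD(1)[OF rl x(1)])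
      \<comment> \<open>Adding this element of the kernel to \<open>x\<close> keeps the first
        coordinate and moves the second to \<open>k\<close>.\<close>
      define y where "y = k \<oplus>\<^bsub>space T i\<^esub> (- 1) \<odot>\<^bsub>space T i\<^esub> r [(i, x)]"
      have y: "y \<in> carrier (space K i)"
        using gs_add[OF graded_K p(3) gs_smult[OF graded_K rx, of "- 1"]] by (simp add: y_def)
      have yT: "y \<in> carrier (space T i)" "q_lin m L i y = \<zero>\<^bsub>space Q i\<^esub>" using y by (simp_all add: K_space)
      have rT: "r [(i, x)] \<in> carrier (space T i)" and kT: "k \<in> carrier (space T i)" using rx p(3) K_sub_T by auto
      interpret M: module "cring_class_ops :: 'k ring" "space T i" by (rule graded_module[OF graded_T])
      have "q_lin m L i (x \<oplus>\<^bsub>space T i\<^esub> y) = a"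
        using glinD(2)[OF glin_q x(1) yT(1)] x(2) yT(2) p(2) by (simp add: gs_add_zero[OF graded_Q])
      moreover have "r [(i, x \<oplus>\<^bsub>space T i\<^esub> y)] = r [(i, x)] \<oplus>\<^bsub>space T i\<^esub> y"
        using glinD(2)[OF rl x(1) yT(1)] r_K[OF y] by simp
      moreover have "r [(i, x)] \<oplus>\<^bsub>space T i\<^esub> y = k"
        unfolding y_def gs_neg[OF graded_T rT]
        using rT kT M.a_lcomm[of "r [(i, x)]" k "\<ominus>\<^bsub>space T i\<^esub> r [(i, x)]"] by (simp add: M.r_neg del: M.add.m_lcomm)
      ultimately have "?h i (x \<oplus>\<^bsub>space T i\<^esub> y) = p" by (simp only: hx p(1))
      then show "p \<in> ?h i ` carrier (space T i)" using gs_add[OF graded_T x(1) yT(1)] by blast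
    qed
  qed
  ultimately show "bij_betw (\<lambda>x. mor_pair (q_lt m L) r [(i, x)]) (carrier (space T i)) (carrier (space (linf_prod Q K) i))"
    by (simp add: bij_betw_def)
qed

end

lemma boundaries_subsp: "subsp (space L m) (boundaries L m)"
  using boundaries_submodule[of m] boundaries_sub[of m] submodule.smult_closed[OF boundaries_submodule[of m]]
    subgroup.one_closed[OF submodule.axioms(1)[OF boundaries_submodule[of m]]]
    subgroup.m_closed[OF submodule.axioms(1)[OF boundaries_submodule[of m]]]
  by (simp add: subsp_def carrier_class)

text \<open>Vanishing in a degree passes to quotients, subspaces and products. Degree m + 1 of
  \<open>T\<close> sits in L_m, but as a quotient of degree m + 1 of \<open>L\<close> it vanishes
  with the latter.\<close>

lemma lie_n_truncations:
  assumes lie: "lie_n_algebra n L"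
  shows "lie_n_algebra n T" "lie_n_algebra n Q" "lie_n_algebra n K" "lie_n_algebra n (linf_prod Q K)"
proof -
  have n: "carrier (space L i) = {\<zero>\<^bsub>space L i\<^esub>}" if "i < 0 \<or> n \<le> enat (nat i)" for i
    using lie that unfolding lie_n_algebra_def by blast
  have t: "carrier (space T i) = {\<zero>\<^bsub>space T i\<^esub>}" "carrier (space Q i) = {\<zero>\<^bsub>space Q i\<^esub>}"
    if "i < 0 \<or> n \<le> enat (nat i)" for i
    using quot_trivial[OF T_quot n[OF that]] quot_trivial[OF Q_quot n[OF that]] .
  have k: "carrier (space K i) = {\<zero>\<^bsub>space K i\<^esub>}" if h: "i < 0 \<or> n \<le> enat (nat i)" for i
  proof (rule subset_antisym)
    have "carrier (space K i) \<subseteq> carrier (space T i)" by (rule subsetI) (rule K_sub_T)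
    then show "carrier (space K i) \<subseteq> {\<zero>\<^bsub>space K i\<^esub>}" unfolding t(1)[OF h] K_simps .
    show "{\<zero>\<^bsub>space K i\<^esub>} \<subseteq> carrier (space K i)" by (rule insert_subsetI[OF gs_zero[OF graded_K] empty_subsetI])
  qed
  show "lie_n_algebra n T" unfolding lie_n_algebra_def using T_algebra t(1) by blast
  show "lie_n_algebra n Q" unfolding lie_n_algebra_def using Q_algebra t(2) by blast
  show "lie_n_algebra n K" unfolding lie_n_algebra_def using K_algebra k by blast
  show "lie_n_algebra n (linf_prod Q K)"
    unfolding lie_n_algebra_def
  proof (intro conjI allI impI)
    fix i assume i: "i < 0 \<or> n \<le> enat (nat i)"
    show "carrier (space (linf_prod Q K) i) = {\<zero>\<^bsub>space (linf_prod Q K) i\<^esub>}"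
      unfolding space_linf_prod prod_space_simps t(2)[OF i] k[OF i] by blast
  qed (rule linf_algebra_prod[OF Q_algebra K_algebra])
qed

end

section \<open>Naturality in a strict epimorphism, and the commuting square\<close>

section \<open>Naturality\<close>

lemma lmo_natural:
  fixes B :: "('k::field_char_0, 'b) linf" and D :: "('k, 'd) linf"
  assumes sk: "skew_maps (space A) (space B) morphism_deg f" and h: "glin (space B) (space D) h"
    and eq: "\<And>w. w \<in> words (space A) \<Longrightarrow> h (wdeg w + morphism_deg (length w)) (f w) = f' (wmap g w)"
    and u: "u \<in> words (sus A)"
  shows "gsus h (wdeg u) (lmo B f u) = lmo D f' (wmap (gsus g) u)"
proof -
  have d: "wdeg (desusp u) + morphism_deg (length u) = wdeg u - 1" by (simp add: wdeg_desusp)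
  have du: "desusp u \<in> words (space A)" using u by (simp add: desusp_words)
  have c: "f (desusp u) \<in> carrier (space B (wdeg u - 1))"
    using skew_maps_closed[OF sk du] unfolding desusp_simps d .
  have e: "h (wdeg u - 1) (f (desusp u)) = f' (wmap g (desusp u))"
    using eq[OF du] unfolding desusp_simps d .
  have s: "desusp_sgn (wmap (gsus g) u) = (desusp_sgn u :: 'k)"
    by (rule desusp_sgn_cong) (auto simp: wmap_def)
  show ?thesis
    unfolding lmo_def shift_map_def desusp_wmap wdeg_wmap wmap_simps d s glinD(3)[OF h c] e ..
qed

context
  fixes L :: "('k::field_char_0, 'v) linf" and L' :: "('k, 'w) linf" and m :: int
    and f :: "'v word \<Rightarrow> 'w" and g :: "int \<Rightarrow> 'v \<Rightarrow> 'w"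
  assumes tL: "trunc L m" and tL': "trunc L' m"
    and rep: "strict_rep L L' g f" and hom: "bracket_hom L L' g"
    and surj: "\<And>i. g i ` carrier (space L i) = carrier (space L' i)"
begin

interpretation A: trunc L m by (rule tL)
interpretation B: trunc L' m by (rule tL')

lemma gl: "glin (space L) (space L') g"
  using rep by (simp add: strict_rep_def)

lemma g_d: "x \<in> carrier (space L i) \<Longrightarrow> g (i - 1) (A.d i x) = B.d i (g i x)"
  using hom[unfolded bracket_hom_def, rule_format, of "[(i, x)]"] by (simp add: words_iff)

lemma g_zero: "g i \<zero>\<^bsub>space L i\<^esub> = \<zero>\<^bsub>space L' i\<^esub>"
  by (rule glin_zero[OF gl A.gL B.gL])

text \<open>Surjectivity is used one degree higher: every boundary of the target is d' of an image,
  hence the image of a boundary.\<close>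

lemma g_boundaries: "g m ` boundaries L m = boundaries L' m"
proof -
  have "g m ` boundaries L m = (\<lambda>x. g m (A.d (m + 1) x)) ` carrier (space L (m + 1))"
    by (simp add: boundaries_def image_image)
  also have "\<dots> = (\<lambda>x. B.d (m + 1) (g (m + 1) x)) ` carrier (space L (m + 1))"
    by (rule image_cong[OF refl]) (use g_d[of _ "m + 1"] in simp)
  also have "\<dots> = (\<lambda>x. B.d (m + 1) x) ` (g (m + 1) ` carrier (space L (m + 1)))"
    by (simp add: image_image)
  finally show ?thesis by (simp add: surj boundaries_def)
qed

abbreviation gT where "gT \<equiv> quot_lin (space L) A.pT B.pT g"
abbreviation gQ where "gQ \<equiv> quot_lin (space L) A.pQ B.pQ g"

lemma ker_pT:
  assumes x: "x \<in> carrier (space L i)" and z: "A.pT i x = \<zero>\<^bsub>space A.T i\<^esub>"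
  shows "B.pT i (g i x) = \<zero>\<^bsub>space B.T i\<^esub>"
proof -
  consider "i < m + 1" | "i = m + 1" | "i > m + 1" by linarith
  then show ?thesis
  proof cases
    case 1
    then have "x = \<zero>\<^bsub>space L i\<^esub>" using z by (simp add: A.pT_simps A.T_zero)
    then show ?thesis using 1 by (simp add: B.pT_simps B.T_zero g_zero)
  next
    case 2
    then have "A.d (m + 1) x = \<zero>\<^bsub>space L m\<^esub>" using z by (simp add: A.pT_simps A.T_zero)
    then have "B.d (m + 1) (g (m + 1) x) = \<zero>\<^bsub>space L' m\<^esub>" using g_d[OF x] 2 g_zero[of m] by simp
    then show ?thesis using 2 by (simp add: B.pT_simps B.T_zero)
  next
    case 3
    then show ?thesis by (simp add: B.pT_simps)
  qed
qed

lemma ker_pQ: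
  assumes x: "x \<in> carrier (space L i)" and z: "A.pQ i x = \<zero>\<^bsub>space A.Q i\<^esub>"
  shows "B.pQ i (g i x) = \<zero>\<^bsub>space B.Q i\<^esub>"
proof -
  have gx: "g i x \<in> carrier (space L' i)" by (rule glinD(1)[OF gl x])
  have "x \<in> tau_le_sub m L i" using A.pQ_zero_iff[OF x] z by simp
  then have "g i x \<in> tau_le_sub m L' i"
    using gx g_zero[of i] g_boundaries by (auto simp: tau_le_sub_def split: if_splits)
  then show ?thesis using B.pQ_zero_iff[OF gx] by simp
qed

lemma gT_facts:
  "x \<in> carrier (space L i) \<Longrightarrow> gT i (A.pT i x) = B.pT i (g i x)"
  "strict_rep A.T B.T gT (induced (space L) A.pT B.pT morphism_deg f)"
  "bracket_hom A.T B.T gT"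
  by (rule quot_strict[OF A.T_quot B.T_quot rep hom, unfolded A.T_eq B.T_eq]; (rule ker_pT)?; assumption)+

lemma gQ_facts:
  "x \<in> carrier (space L i) \<Longrightarrow> gQ i (A.pQ i x) = B.pQ i (g i x)"
  "strict_rep A.Q B.Q gQ (induced (space L) A.pQ B.pQ morphism_deg f)"
  "bracket_hom A.Q B.Q gQ"
  by (rule quot_strict[OF A.Q_quot B.Q_quot rep hom, unfolded A.Q_eq B.Q_eq]; (rule ker_pQ)?; assumption)+


lemma glin_gT: "glin (space A.T) (space B.T) gT"
  using gT_facts(2) by (simp add: strict_rep_def)

lemma glin_gQ: "glin (space A.Q) (space B.Q) gQ"
  using gQ_facts(2) by (simp add: strict_rep_def)

lemma tau_lt_map_rep: "strict_rep A.T B.T gT (tau_lt_map (m + 1) L L' f)"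
  unfolding tau_lt_map_def by (rule gT_facts(2))

lemma tau_le_map_rep: "strict_rep A.Q B.Q gQ (tau_le_map m L L' f)"
  unfolding tau_le_map_def by (rule gQ_facts(2))

lemma gT_low: "x \<in> carrier (space L i) \<Longrightarrow> i \<le> m \<Longrightarrow> gT i x = g i x"
  using gT_facts(1)[of x i] by (simp add: A.pT_simps B.pT_simps)

text \<open>Degree m + 1 of \<open>T\<close> is stored inside L_m, so the induced map is computed
  there by \<open>g\<close> in degree m rather than in degree m + 1.\<close>

lemma gT_top:
  assumes x: "x \<in> boundaries L m"
  shows "gT (m + 1) x = g m x"
proof -
  obtain y where y: "y \<in> carrier (space L (m + 1))" "x = A.d (m + 1) y" using x by (auto simp: boundaries_def)
  then show ?thesis using gT_facts(1)[OF y(1)] g_d[OF y(1)] by (simp add: A.pT_simps B.pT_simps)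
qed

lemma gQ_q:
  assumes x: "x \<in> carrier (space A.T i)"
  shows "gQ i (q_lin m L i x) = q_lin m L' i (gT i x)"
proof -
  have "A.pT i ` carrier (space L i) = carrier (space A.T i)" using A.T_quot unfolding linf_quot_def by simp
  then have "x \<in> A.pT i ` carrier (space L i)" using x by simp
  then obtain y where y: "y \<in> carrier (space L i)" "x = A.pT i y" by blast
  show ?thesis
    unfolding y(2) A.q_pT[OF y(1)] gQ_facts(1)[OF y(1)] gT_facts(1)[OF y(1)] B.q_pT[OF glinD(1)[OF gl y(1)]] ..
qed

lemma gT_K:
  assumes x: "x \<in> carrier (space A.K i)"
  shows "gT i x \<in> carrier (space B.K i)"
proof -
  have xT: "x \<in> carrier (space A.T i)" "q_lin m L i x = \<zero>\<^bsub>space A.Q i\<^esub>" using x by (simp_all add: A.K_space)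
  then have "q_lin m L' i (gT i x) = \<zero>\<^bsub>space B.Q i\<^esub>"
    using gQ_q[OF xT(1)] glin_zero[OF glin_gQ A.graded_Q B.graded_Q] by simp
  then show ?thesis using glinD(1)[OF glin_gT xT(1)] by (simp add: B.K_space)
qed

lemma glin_gT_K: "glin (space A.K) (space B.K) gT"
  unfolding glin_def
proof (intro allI ballI conjI)
  fix i x assume x: "x \<in> carrier (space A.K i)"
  show "gT i x \<in> carrier (space B.K i)" by (rule gT_K[OF x])
  show "gT i (c \<odot>\<^bsub>space A.K i\<^esub> x) = c \<odot>\<^bsub>space B.K i\<^esub> gT i x" for c
    unfolding A.K_simps B.K_simps by (rule glinD(3)[OF glin_gT A.K_sub_T[OF x]])
  show "gT i (x \<oplus>\<^bsub>space A.K i\<^esub> y) = gT i x \<oplus>\<^bsub>space B.K i\<^esub> gT i y" if y: "y \<in> carrier (space A.K i)" for y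
    unfolding A.K_simps B.K_simps by (rule glinD(2)[OF glin_gT A.K_sub_T[OF x] A.K_sub_T[OF y]])
qed

lemma words_K_T: "w \<in> words (space A.K) \<Longrightarrow> w \<in> words (space A.T)"
  using A.K_sub_T by (auto simp: words_def)

definition gP :: "int \<Rightarrow> 'v set \<times> 'v \<Rightarrow> 'w set \<times> 'w" where
  "gP i z = (gQ i (fst z), gT i (snd z))"

text \<open>The second summand is the truncated map itself: on letters of the kernel its values stay
  in the kernel, so the restriction is a change of source and target only.\<close>

lemma tau_sum_rep:
  "strict_rep (linf_prod A.Q A.K) (linf_prod B.Q B.K) gP
    (mor_sum (tau_le_map m L L' f) (tau_lt_map (m + 1) L L' f))"
  unfolding strict_rep_def linf_strict_def
proof (intro conjI allI ballI impI)
  show "glin (space (linf_prod A.Q A.K)) (space (linf_prod B.Q B.K)) gP"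
    using glin_gQ glin_gT_K unfolding glin_def gP_def space_linf_prod by auto
  fix i x assume "x \<in> carrier (space (linf_prod A.Q A.K) i)"
  then obtain a b where x: "x = (a, b)" "a \<in> carrier (space A.Q i)" "b \<in> carrier (space A.T i)"
    using A.K_sub_T by auto
  then show "mor_sum (tau_le_map m L L' f) (tau_lt_map (m + 1) L L' f) [(i, x)] = gP i x"
    using tau_le_map_rep tau_lt_map_rep by (simp add: mor_sum_def gP_def strict_rep_def)
next
  fix w assume w: "w \<in> words (space (linf_prod A.Q A.K))" "2 \<le> length w"
  then have w': "w \<in> words (prod_space (space A.Q) (space A.K))" by simp
  have 1: "wmap (\<lambda>i. fst) w \<in> words (space A.Q)" by (rule wmap_words[OF glin_fst w'])
  have 2: "wmap (\<lambda>i. snd) w \<in> words (space A.T)" by (rule words_K_T[OF wmap_words[OF glin_snd w']])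
  have "tau_le_map m L L' f (wmap (\<lambda>i. fst) w) = \<zero>\<^bsub>space B.Q (wdeg w + morphism_deg (length w))\<^esub>"
    using tau_le_map_rep 1 w(2) by (simp add: strict_rep_def linf_strict_def)
  moreover have "tau_lt_map (m + 1) L L' f (wmap (\<lambda>i. snd) w) = \<zero>\<^bsub>space B.T (wdeg w + morphism_deg (length w))\<^esub>"
    using tau_lt_map_rep 2 w(2) by (simp add: strict_rep_def linf_strict_def)
  ultimately show "mor_sum (tau_le_map m L L' f) (tau_lt_map (m + 1) L L' f) w =
      \<zero>\<^bsub>space (linf_prod B.Q B.K) (wdeg w + morphism_deg (length w))\<^esub>"
    unfolding mor_sum_eq mor_pair_def space_linf_prod prod_space_simps B.K_simps by simp
qed

lemma bracket_hom_gT_K: "bracket_hom A.K B.K gT"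
  unfolding bracket_hom_def
proof
  fix w assume w: "w \<in> words (space A.K)"
  show "gT (wdeg w + bracket_deg (length w)) (bracket A.K w) = bracket B.K (wmap gT w)"
  proof (cases "length w = 1")
    case True
    then show ?thesis
      using gT_facts(3)[unfolded bracket_hom_def, rule_format, OF words_K_T[OF w]]
      by (simp add: A.K_bracket B.K_bracket)
  next
    case False
    then show ?thesis
      unfolding A.K_bracket B.K_bracket wdeg_wmap wmap_simps
      using glin_zero[OF glin_gT A.graded_T B.graded_T] by simp
  qed
qed

lemma bracket_hom_gP: "bracket_hom (linf_prod A.Q A.K) (linf_prod B.Q B.K) gP"
  unfolding bracket_hom_def
proof
  fix w assume "w \<in> words (space (linf_prod A.Q A.K))"
  then have w: "w \<in> words (prod_space (space A.Q) (space A.K))" by simp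
  have b': "bracket (linf_prod A.Q A.K) = mor_sum (bracket A.Q) (bracket A.K)"
    "bracket (linf_prod B.Q B.K) = mor_sum (bracket B.Q) (bracket B.K)" by (simp_all add: linf_prod_def)
  have p: "wmap (\<lambda>i. fst) (wmap gP w) = wmap gQ (wmap (\<lambda>i. fst) w)" "wmap (\<lambda>i. snd) (wmap gP w) = wmap gT (wmap (\<lambda>i. snd) w)"
    by (simp_all add: wmap_wmap gP_def)
  have 1: "gQ (wdeg w + bracket_deg (length w)) (bracket A.Q (wmap (\<lambda>i. fst) w)) = bracket B.Q (wmap gQ (wmap (\<lambda>i. fst) w))"
    using gQ_facts(3)[unfolded bracket_hom_def, rule_format, OF wmap_words[OF glin_fst w]] by simp
  have 2: "gT (wdeg w + bracket_deg (length w)) (bracket A.K (wmap (\<lambda>i. snd) w)) = bracket B.K (wmap gT (wmap (\<lambda>i. snd) w))"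
    using bracket_hom_gT_K[unfolded bracket_hom_def, rule_format, OF wmap_words[OF glin_snd w]] by simp
  show "gP (wdeg w + bracket_deg (length w)) (bracket (linf_prod A.Q A.K) w) = bracket (linf_prod B.Q B.K) (wmap gP w)"
    unfolding b' mor_sum_eq mor_pair_def p gP_def[of "wdeg w + bracket_deg (length w)"] fst_conv snd_conv 1 2 ..
qed

text \<open>The vertical maps are strict and lifted by \<open>smap\<close>, the horizontal ones by
  \<open>cmor\<close>; naturality of \<open>cmorg\<close> makes the two composites equal already on
  representatives.\<close>

lemma truncated_square:
  assumes ret: "retraction (space L m) (boundaries L m) \<rho>" and ret': "retraction (space L' m) (boundaries L' m) \<rho>'"
    and comm: "\<forall>x\<in>carrier (space L m). \<rho>' (g m x) = g m (\<rho> x)"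
    and n: "lie_n_algebra n L" and n': "lie_n_algebra n L'"
  shows "lie_n_square n A.T (linf_prod A.Q A.K) B.T (linf_prod B.Q B.K)
    (mor_pair (q_lt m L) (rmap m L \<rho>)) (tau_lt_map (m + 1) L L' f)
    (mor_sum (tau_le_map m L L' f) (tau_lt_map (m + 1) L L' f)) (mor_pair (q_lt m L') (rmap m L' \<rho>'))"
proof -
  let ?t = "mor_pair (q_lt m L) (rmap m L \<rho>)" and ?b = "mor_pair (q_lt m L') (rmap m L' \<rho>')"
  let ?l = "tau_lt_map (m + 1) L L' f" and ?s = "mor_sum (tau_le_map m L L' f) (tau_lt_map (m + 1) L L' f)"
  let ?P = "linf_prod A.Q A.K" and ?P' = "linf_prod B.Q B.K"
  have t: "linf_morphism A.T ?P ?t" by (rule linf_morphism_pair[OF A.q_morphism A.r_morphism[OF ret]])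
  have b: "linf_morphism B.T ?P' ?b" by (rule linf_morphism_pair[OF B.q_morphism B.r_morphism[OF ret']])
  have l: "linf_morphism A.T B.T ?l"
    by (rule strict_morphism[OF A.T_algebra B.T_algebra tau_lt_map_rep gT_facts(3)])
  have P: "linf_algebra ?P" "linf_algebra ?P'"
    by (rule linf_algebra_prod[OF A.Q_algebra A.K_algebra], rule linf_algebra_prod[OF B.Q_algebra B.K_algebra])
  have s: "linf_morphism ?P ?P' ?s" by (rule strict_morphism[OF P tau_sum_rep bracket_hom_gP])
  have gr: "graded_space (space ?P)" "graded_space (space ?P')" using P by (simp_all add: linf_algebra_def)
  have skt: "skew_maps (space A.T) (space ?P) morphism_deg ?t" and skb: "skew_maps (space B.T) (space ?P') morphism_deg ?b"
    using t b by (simp_all add: linf_morphism_def)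
  \<comment> \<open>Equality of the components. Those of r agree because the truncated map preserves
    brackets and commutes with the retractions.\<close>
  have nat: "gP (wdeg w + morphism_deg (length w)) (?t w) = ?b (wmap gT w)" if w: "w \<in> words (space A.T)" for w
  proof -
    let ?N = "wdeg w + morphism_deg (length w)"
    have q: "gQ ?N (q_lt m L w) = q_lt m L' (wmap gT w)"
      using w
    proof (cases rule: words_cases)
      case (1 i x)
      then show ?thesis using gQ_q[OF 1(2)] by (simp add: q_lt_def strict_of_def)
    next
      case 2
      then show ?thesis
        using glin_zero[OF glin_gQ A.graded_Q B.graded_Q, of ?N] by (simp add: q_lt_def strict_of_def)
    qed
    have zK: "gT ?N \<zero>\<^bsub>space A.K ?N\<^esub> = \<zero>\<^bsub>space B.K ?N\<^esub>"
      by (rule glin_zero[OF glin_gT_K A.graded_K B.graded_K])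
    have r: "gT ?N (rmap m L \<rho> w) = rmap m L' \<rho>' (wmap gT w)"
    proof (cases "?N = m + 1")
      case True
      have bd: "wdeg w + bracket_deg (length w) = m" using True by simp
      have c: "bracket A.T w \<in> carrier (space L m)"
        using skew_maps_closed[OF conjunct2[OF linf_algebra_pre[OF A.T_algebra]] w] unfolding bd A.T_m[OF ret] .
      have "bracket B.T (wmap gT w) = gT m (bracket A.T w)"
        using gT_facts(3)[unfolded bracket_hom_def, rule_format, OF w] unfolding bd by simp
      also have "\<dots> = g m (bracket A.T w)" by (rule gT_low[OF c order_refl])
      finally have "\<rho>' (bracket B.T (wmap gT w)) = g m (\<rho> (bracket A.T w))" using comm c by simp
      also have "\<dots> = gT (m + 1) (\<rho> (bracket A.T w))" by (rule gT_top[OF A.\<rho>_simps(1)[OF ret c], symmetric])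
      finally have e: "\<rho>' (bracket B.T (wmap gT w)) = gT (m + 1) (\<rho> (bracket A.T w))" .
      have N': "wdeg (wmap gT w) + morphism_deg (length (wmap gT w)) = m + 1" using True by simp
      show ?thesis
        unfolding rmap_def if_P[OF True] if_P[OF N'] e unfolding True ..
    next
      case False
      have N': "wdeg (wmap gT w) + morphism_deg (length (wmap gT w)) \<noteq> m + 1" using False by simp
      show ?thesis
        unfolding rmap_def if_not_P[OF False] if_not_P[OF N']
        using w
      proof (cases rule: words_cases)
        case (1 i x)
        show "gT ?N (strict_of A.K (\<lambda>i x. if i = m then \<rho> x else \<zero>\<^bsub>space A.K i\<^esub>) w) =
          strict_of B.K (\<lambda>i x. if i = m then \<rho>' x else \<zero>\<^bsub>space B.K i\<^esub>) (wmap gT w)"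
        proof (cases "i = m")
          case True
          then have x: "x \<in> carrier (space L m)" using 1(2) A.T_m[OF ret] by simp
          have "\<rho> x \<in> carrier (space L m)" using A.\<rho>_simps(1)[OF ret x] A.boundaries_sub by blast
          then have "gT m (\<rho> x) = \<rho>' (gT m x)" using comm x gT_low x by simp
          then show ?thesis using 1(1) True by (simp add: strict_of_def)
        next
          case i: False
          then show ?thesis using zK 1(1) by (simp add: strict_of_def del: A.K_simps B.K_simps)
        qed
      next
        case 2
        then show "gT ?N (strict_of A.K (\<lambda>i x. if i = m then \<rho> x else \<zero>\<^bsub>space A.K i\<^esub>) w) =
          strict_of B.K (\<lambda>i x. if i = m then \<rho>' x else \<zero>\<^bsub>space B.K i\<^esub>) (wmap gT w)"
          using zK by (simp add: strict_of_def del: A.K_simps B.K_simps)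
      qed
    qed
    show ?thesis by (simp add: gP_def mor_pair_def q r)
  qed
  have glP: "glin (space ?P) (space ?P') gP" using tau_sum_rep by (simp add: strict_rep_def)
  note lie = A.lie_n_truncations[OF n] B.lie_n_truncations[OF n']
  show ?thesis
    unfolding lie_n_square_def lie_n_morphism_def
  proof (intro conjI exI ballI)
    show "linf_coalgebra_map A.T ?P ?t (cmor (lmo ?P ?t))" by (rule linf_coalgebra_map_cmor[OF gr(1) skt])
    show "linf_coalgebra_map B.T ?P' ?b (cmor (lmo ?P' ?b))" by (rule linf_coalgebra_map_cmor[OF gr(2) skb])
    show "linf_coalgebra_map A.T B.T ?l (smap (gsus gT))" by (rule strict_coalgebra_map[OF B.graded_T tau_lt_map_rep])
    show "linf_coalgebra_map ?P ?P' ?s (smap (gsus gP))" by (rule strict_coalgebra_map[OF gr(2) tau_sum_rep])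
    fix p assume p: "p \<in> sym_free (sus A.T)"
    have "smap (gsus gP) (cmor (lmo ?P ?t) p) = cmor (lmo ?P' ?b) (smap (gsus gT) p)"
      using p unfolding sym_free_def
    proof (rule flin_span_eq[OF flin_comp[OF flin_smap flin_cmor] flin_comp[OF flin_cmor flin_smap], rotated])
      fix z :: "'v word \<Rightarrow>\<^sub>0 'k" assume "z \<in> gen ` words (sus A.T)"
      then obtain w where w: "z = gen w" "w \<in> words (sus A.T)" by blast
      have w0: "w \<in> words0 (sus A.T)" using w(2) by (simp add: words_iff)
      have "smap (gsus gP) (cmorg (lmo ?P ?t) w) = (cmorg (lmo ?P' ?b) (wmap (gsus gT) w) :: _ \<Rightarrow>\<^sub>0 'k)"
      proof (rule smap_cmorg)
        show "w \<in> words0 (sus A.T)" by (rule w0)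
        fix u assume u: "u \<in> words (sus A.T)"
        show "gsus gP (wdeg u) (lmo ?P ?t u) = lmo ?P' ?b (wmap (gsus gT) u)"
          by (rule lmo_natural[OF skt glP _ u]) (rule nat)
      qed
      then show "smap (gsus gP) (cmor (lmo ?P ?t) z) = cmor (lmo ?P' ?b) (smap (gsus gT) z)" by (simp add: w(1))
    qed
    then show "smap (gsus gP) (cmor (lmo ?P ?t) p) - cmor (lmo ?P' ?b) (smap (gsus gT) p) \<in> sym_rel (sus ?P')"
      by (simp add: free.subspace_0)
  qed (rule lie t b l s)+
qed

end

theorem proposition7p5:
  fixes n :: enat and m :: nat
    and L :: "('k::field_char_0, 'v) linf" and L' :: "('k, 'w) linf"
    and f :: "'v word \<Rightarrow> 'w"
  assumes "lie_n_algebra n L" and "lie_n_algebra n L'"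
    and "linf_epi L L' f" and "linf_strict L L' f"
  shows "\<exists>r r'.
    lie_n_morphism n (tau_lt (int m + 1) L) (ker_q (int m) L) r \<and>
    lie_n_morphism n (tau_lt (int m + 1) L') (ker_q (int m) L') r' \<and>
    linf_iso (tau_lt (int m + 1) L) (linf_prod (tau_le (int m) L) (ker_q (int m) L))
      (mor_pair (q_lt (int m) L) r) \<and>
    linf_iso (tau_lt (int m + 1) L') (linf_prod (tau_le (int m) L') (ker_q (int m) L'))
      (mor_pair (q_lt (int m) L') r') \<and>
    lie_n_square n
      (tau_lt (int m + 1) L) (linf_prod (tau_le (int m) L) (ker_q (int m) L))
      (tau_lt (int m + 1) L') (linf_prod (tau_le (int m) L') (ker_q (int m) L'))
      (mor_pair (q_lt (int m) L) r)
      (tau_lt_map (int m + 1) L L' f)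
      (mor_sum (tau_le_map (int m) L L' f) (tau_lt_map (int m + 1) L L' f))
      (mor_pair (q_lt (int m) L') r')"
proof -
  have alg: "linf_algebra L" "linf_algebra L'"
    using assms(1,2) unfolding lie_n_algebra_def by blast+
  have neg: "carrier (space L i) = {\<zero>\<^bsub>space L i\<^esub>}" "carrier (space L' i) = {\<zero>\<^bsub>space L' i\<^esub>}" if "i < 0" for i
    using assms(1,2) that unfolding lie_n_algebra_def by blast+
  have mor: "linf_morphism L L' f" and surj: "\<And>i. (\<lambda>x. f [(i, x)]) ` carrier (space L i) = carrier (space L' i)"
    using assms(3) unfolding linf_epi_def by simp_all
  define g where "g = (\<lambda>i x. f [(i, x)])"
  have rep: "strict_rep L L' g f" and hom: "bracket_hom L L' g"
    unfolding g_def by (rule strict_morphismD[OF mor assms(4)])+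
  have gs: "g i ` carrier (space L i) = carrier (space L' i)" for i using surj by (simp add: g_def)
  have tr: "trunc L (int m)" "trunc L' (int m)"
    by (unfold_locales; use alg neg in simp)+
  interpret A: trunc L "int m" by (rule tr(1))
  interpret B: trunc L' "int m" by (rule tr(2))
  have gl: "glin (space L) (space L') g" using rep by (simp add: strict_rep_def)
  \<comment> \<open>The second retraction is chosen for the image of im d under the linear part of
    f, which \<open>g_boundaries\<close> identifies with the boundaries of the target.\<close>
  obtain \<rho> \<rho>' where ret: "retraction (space L (int m)) (boundaries L (int m)) \<rho>"
    and ret': "retraction (space L' (int m)) (g (int m) ` boundaries L (int m)) \<rho>'"
    and comm: "\<forall>x\<in>carrier (space L (int m)). \<rho>' (g (int m) x) = g (int m) (\<rho> x)"
    using compatible_retractions[OF A.gL B.gL gl A.boundaries_subsp gs] by blast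
  have ret'': "retraction (space L' (int m)) (boundaries L' (int m)) \<rho>'"
    using ret' unfolding g_boundaries[OF tr rep hom gs] .
  note lie = A.lie_n_truncations[OF assms(1)] B.lie_n_truncations[OF assms(2)]
  show ?thesis
    unfolding lie_n_morphism_def
    by (intro exI[of _ "rmap (int m) L \<rho>"] exI[of _ "rmap (int m) L' \<rho>'"] conjI lie
        A.r_morphism[OF ret] B.r_morphism[OF ret''] A.pair_iso[OF ret] B.pair_iso[OF ret'']
        truncated_square[OF tr rep hom gs ret ret'' comm assms(1,2)])
qed

end
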